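(* The finite satisfiability problem for $\mathrm{FO}^2(\rightarrow,\downarrow)$ is $\mathrm{NEXPTIME}$-complete. That is, the problem "given a closed formula $\varphi$ of $\mathrm{FO}^2(\rightarrow,\downarrow)$, is there a valued permutation $(\pi,\sigma)$ with $(\pi,\sigma)\models\varphi$?" is decidable in nondeterministic exponential time and is $\mathrm{NEXPTIME}$-hard.
   Context: Fix a countably infinite set $\mathbb{V}$ of propositional letters. For $n\ge 1$, an $n$-permutation is a set $\pi\subseteq[n]\times[n]$ (where $[n]=\{1,\dots,n\}$) such that for every $k\in[n]$ there is exactly one $c$ with $(k,c)\in\pi$ and exactly one $r$ with $(r,k)\in\pi$. A valued permutation is a pair $(\pi,\sigma)$ with $\pi$ an $n$-permutation for some $n\ge1$ and $\sigma:\pi\to 2^{\mathbb{V}}$. Such a pair encodes a finite structure with two linear orders: the element $(r,c)$ is the $r$-th element of the first order and the $c$-th element of the second order, and it satisfies exactly the letters in $\sigma(r,c)$. The logic $\mathrm{FO}^2(\rightarrow,\downarrow)$ is first-order logic using only the two variables $x,y$ (reusable), with atoms $p(a)$, $a\rightarrow b$, $a\downarrow b$ for $a,b\in\{x,y\}$ and $p\in\mathbb{V}$, closed under $\neg,\wedge,\vee,\exists,\forall$ (no equality atom is listed). Semantics over $(\pi,\sigma)$ with an assignment $\mu$ of variables to elements of $\pi$: $p(x)$ holds iff $p\in\sigma(\mu(x))$; $x\rightarrow y$ holds iff $\mu(x)=(r,c)$ and $\mu(y)=(r',c+1)$ for some $r,r',c$; $x\downarrow y$ holds iff $\mu(x)=(r,c)$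 and $\mu(y)=(r+1,c')$ for some $r,c,c'$; quantifiers range over elements of $\pi$, Boolean connectives as usual. A closed formula is satisfiable if some valued permutation satisfies it. *)

theory Defs
  imports Main
begin

section \<open>Valued permutations and the two-variable logic\<close>

definition is_permutation :: "nat \<Rightarrow> (nat \<times> nat) set \<Rightarrow> bool" where
  "is_permutation n \<pi> \<longleftrightarrow>
     \<pi> \<subseteq> {1..n} \<times> {1..n} \<and> (\<forall>k\<in>{1..n}. (\<exists>!c. (k, c) \<in> \<pi>) \<and> (\<exists>!r. (r, k) \<in> \<pi>))"

text \<open>The propositional letters are the natural numbers. A valuation is a total function on
  positions; only its values on the permutation matter, since assignments range over the
  permutation.\<close>

type_synonym letter = nat
type_synonym position = "nat \<times> nat"
type_synonym valuation = "position \<Rightarrow> letter set"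

definition valued_permutation :: "position set \<Rightarrow> valuation \<Rightarrow> bool" where
  "valued_permutation \<pi> \<sigma> \<longleftrightarrow> (\<exists>n\<ge>1. is_permutation n \<pi>)"

datatype var = X | Y

datatype fm =
    Letter letter var
  | Rightarrow var var
  | Downarrow var var
  | Neg fm
  | Conj fm fm
  | Disj fm fm
  | Exists var fm
  | Forall var fm

fun sat :: "position set \<Rightarrow> valuation \<Rightarrow> (var \<Rightarrow> position) \<Rightarrow> fm \<Rightarrow> bool" where
  "sat \<pi> \<sigma> \<mu> (Letter p a) \<longleftrightarrow> p \<in> \<sigma> (\<mu> a)"
| "sat \<pi> \<sigma> \<mu> (Rightarrow a b) \<longleftrightarrow> (\<exists>r r' c. \<mu> a = (r, c) \<and> \<mu> b = (r', c + 1))"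
| "sat \<pi> \<sigma> \<mu> (Downarrow a b) \<longleftrightarrow> (\<exists>r c c'. \<mu> a = (r, c) \<and> \<mu> b = (r + 1, c'))"
| "sat \<pi> \<sigma> \<mu> (Neg \<phi>) \<longleftrightarrow> \<not> sat \<pi> \<sigma> \<mu> \<phi>"
| "sat \<pi> \<sigma> \<mu> (Conj \<phi> \<psi>) \<longleftrightarrow> sat \<pi> \<sigma> \<mu> \<phi> \<and> sat \<pi> \<sigma> \<mu> \<psi>"
| "sat \<pi> \<sigma> \<mu> (Disj \<phi> \<psi>) \<longleftrightarrow> sat \<pi> \<sigma> \<mu> \<phi> \<or> sat \<pi> \<sigma> \<mu> \<psi>"
| "sat \<pi> \<sigma> \<mu> (Exists a \<phi>) \<longleftrightarrow> (\<exists>e\<in>\<pi>. sat \<pi> \<sigma> (\<mu>(a := e)) \<phi>)"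
| "sat \<pi> \<sigma> \<mu> (Forall a \<phi>) \<longleftrightarrow> (\<forall>e\<in>\<pi>. sat \<pi> \<sigma> (\<mu>(a := e)) \<phi>)"

fun free_vars :: "fm \<Rightarrow> var set" where
  "free_vars (Letter p a) = {a}"
| "free_vars (Rightarrow a b) = {a, b}"
| "free_vars (Downarrow a b) = {a, b}"
| "free_vars (Neg \<phi>) = free_vars \<phi>"
| "free_vars (Conj \<phi> \<psi>) = free_vars \<phi> \<union> free_vars \<psi>"
| "free_vars (Disj \<phi> \<psi>) = free_vars \<phi> \<union> free_vars \<psi>"
| "free_vars (Exists a \<phi>) = free_vars \<phi> - {a}"
| "free_vars (Forall a \<phi>) = free_vars \<phi> - {a}"

definition closed_fm :: "fm \<Rightarrow> bool" where
  "closed_fm \<phi> \<longleftrightarrow> free_vars \<phi> = {}"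

text \<open>For a closed formula the choice of the assignment is immaterial, see \<open>models_closed_iff\<close>
  below.\<close>

definition models :: "position set \<Rightarrow> valuation \<Rightarrow> fm \<Rightarrow> bool" where
  "models \<pi> \<sigma> \<phi> \<longleftrightarrow> (\<forall>\<mu>. (\<forall>a. \<mu> a \<in> \<pi>) \<longrightarrow> sat \<pi> \<sigma> \<mu> \<phi>)"

definition satisfiable :: "fm \<Rightarrow> bool" where
  "satisfiable \<phi> \<longleftrightarrow> (\<exists>\<pi> \<sigma>. valued_permutation \<pi> \<sigma> \<and> models \<pi> \<sigma> \<phi>)"

lemma sat_cong_free_vars:
  "(\<And>a. a \<in> free_vars \<phi> \<Longrightarrow> \<mu> a = \<nu> a) \<Longrightarrow> sat \<pi> \<sigma> \<mu> \<phi> \<longleftrightarrow> sat \<pi> \<sigma> \<nu> \<phi>"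
proof (induction \<phi> arbitrary: \<mu> \<nu>)
  case (Neg \<phi>)
  have "sat \<pi> \<sigma> \<mu> \<phi> = sat \<pi> \<sigma> \<nu> \<phi>"
    using Neg.prems by (intro Neg.IH) simp
  then show ?case by simp
next
  case (Conj \<phi> \<psi>)
  have "sat \<pi> \<sigma> \<mu> \<phi> = sat \<pi> \<sigma> \<nu> \<phi>" "sat \<pi> \<sigma> \<mu> \<psi> = sat \<pi> \<sigma> \<nu> \<psi>"
    using Conj.prems by (auto intro!: Conj.IH)
  then show ?case by simp
next
  case (Disj \<phi> \<psi>)
  have "sat \<pi> \<sigma> \<mu> \<phi> = sat \<pi> \<sigma> \<nu> \<phi>" "sat \<pi> \<sigma> \<mu> \<psi> = sat \<pi> \<sigma> \<nu> \<psi>"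
    using Disj.prems by (auto intro!: Disj.IH)
  then show ?case by simp
next
  case (Exists a \<phi>)
  have "sat \<pi> \<sigma> (\<mu>(a := e)) \<phi> = sat \<pi> \<sigma> (\<nu>(a := e)) \<phi>" for e
    using Exists.prems by (auto intro!: Exists.IH)
  then show ?case by simp
next
  case (Forall a \<phi>)
  have "sat \<pi> \<sigma> (\<mu>(a := e)) \<phi> = sat \<pi> \<sigma> (\<nu>(a := e)) \<phi>" for e
    using Forall.prems by (auto intro!: Forall.IH)
  then show ?case by simp
qed auto

lemma models_closed_iff:
  assumes "valued_permutation \<pi> \<sigma>" "closed_fm \<phi>"
  shows "models \<pi> \<sigma> \<phi> \<longleftrightarrow> sat \<pi> \<sigma> \<mu> \<phi>"
proof -
  have eq: "sat \<pi> \<sigma> \<nu> \<phi> = sat \<pi> \<sigma> \<mu> \<phi>" for \<nu>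
    using assms(2) by (intro sat_cong_free_vars) (simp add: closed_fm_def)
  obtain n where "n \<ge> 1" "is_permutation n \<pi>"
    using assms(1) by (auto simp: valued_permutation_def)
  then have "\<exists>c. (1, c) \<in> \<pi>"
    unfolding is_permutation_def by force
  then obtain e where "e \<in> \<pi>" by blast
  show ?thesis
  proof
    assume "models \<pi> \<sigma> \<phi>"
    then have "sat \<pi> \<sigma> (\<lambda>_. e) \<phi>"
      using \<open>e \<in> \<pi>\<close> by (simp add: models_def)
    then show "sat \<pi> \<sigma> \<mu> \<phi>"
      unfolding eq[of "\<lambda>_. e"] .
  next
    assume "sat \<pi> \<sigma> \<mu> \<phi>"
    then show "models \<pi> \<sigma> \<phi>"
      unfolding models_def using eq by blast
  qed
qed

section \<open>Formulas as binary words\<close>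

text \<open>Formulas are written in prefix notation, each constructor having a three-bit tag. The index
  of a letter is written in binary, least significant digit first, each digit preceded by
  \<open>True\<close>, and ended by \<open>False\<close>; hence it takes logarithmic space.\<close>

fun encode_nat :: "nat \<Rightarrow> bool list" where
  "encode_nat n = (if n = 0 then [False] else True # odd n # encode_nat (n div 2))"

declare encode_nat.simps [simp del]

fun encode_var :: "var \<Rightarrow> bool list" where
  "encode_var X = [False]"
| "encode_var Y = [True]"

fun encode :: "fm \<Rightarrow> bool list" where
  "encode (Letter p a)     = [False, False, False] @ encode_nat p @ encode_var a"
| "encode (Rightarrow a b) = [False, False, True] @ encode_var a @ encode_var b"
| "encode (Downarrow a b)  = [False, True, False] @ encode_var a @ encode_var b"
| "encode (Neg \<phi>)          = [False, True, True] @ encode \<phi>"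
| "encode (Conj \<phi> \<psi>)       = [True, False, False] @ encode \<phi> @ encode \<psi>"
| "encode (Disj \<phi> \<psi>)       = [True, False, True] @ encode \<phi> @ encode \<psi>"
| "encode (Exists a \<phi>)     = [True, True, False] @ encode_var a @ encode \<phi>"
| "encode (Forall a \<phi>)     = [True, True, True] @ encode_var a @ encode \<phi>"

lemma encode_nat_prefix_free: "encode_nat m @ xs = encode_nat n @ ys \<Longrightarrow> m = n \<and> xs = ys"
proof (induction m arbitrary: n rule: less_induct)
  case (less m)
  have m: "encode_nat m = (if m = 0 then [False] else True # odd m # encode_nat (m div 2))"
    and n: "encode_nat n = (if n = 0 then [False] else True # odd n # encode_nat (n div 2))"
    by (rule encode_nat.simps)+
  show ?case
  proof (cases "m = 0 \<or> n = 0")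
    case True
    then show ?thesis
      using less.prems unfolding m n by (auto split: if_splits)
  next
    case False
    then have par: "odd m = odd n" and eq: "encode_nat (m div 2) @ xs = encode_nat (n div 2) @ ys"
      using less.prems unfolding m n by simp_all
    have "m div 2 < m"
      using False by simp
    then have half: "m div 2 = n div 2" "xs = ys"
      using less.IH[OF _ eq] by blast+
    then have "m = n"
      using par by presburger
    then show ?thesis using half by simp
  qed
qed

lemma encode_var_prefix_free: "encode_var a @ xs = encode_var b @ ys \<Longrightarrow> a = b \<and> xs = ys"
  by (cases a; cases b) auto

lemma encode_prefix_free: "encode \<phi> @ xs = encode \<psi> @ ys \<Longrightarrow> \<phi> = \<psi> \<and> xs = ys"
proof (induction \<phi> arbitrary: \<psi> xs ys)
  case (Letter p a)
  then show ?case
    by (cases \<psi>) (auto dest!: encode_nat_prefix_free encode_var_prefix_free)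
next
  case (Rightarrow a b)
  then show ?case
    by (cases \<psi>) (auto dest!: encode_var_prefix_free)
next
  case (Downarrow a b)
  then show ?case
    by (cases \<psi>) (auto dest!: encode_var_prefix_free)
next
  case (Neg \<phi>)
  from Neg.prems show ?case
    by (cases \<psi>) (auto dest!: Neg.IH)
next
  case (Conj \<phi>1 \<phi>2)
  from Conj.prems show ?case
    by (cases \<psi>) (auto dest!: Conj.IH)
next
  case (Disj \<phi>1 \<phi>2)
  from Disj.prems show ?case
    by (cases \<psi>) (auto dest!: Disj.IH)
next
  case (Exists a \<phi>)
  from Exists.prems show ?case
    by (cases \<psi>) (auto dest!: encode_var_prefix_free Exists.IH)
next
  case (Forall a \<phi>)
  from Forall.prems show ?case
    by (cases \<psi>) (auto dest!: encode_var_prefix_free Forall.IH)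
qed

lemma inj_encode: "inj encode"
  by (rule injI) (metis encode_prefix_free)

section \<open>Turing machines and nondeterministic exponential time\<close>

text \<open>Multi-tape machines with two-way infinite tapes. States and tape symbols are initial
  segments of the natural numbers; state 0 is initial, symbol 0 is the blank, and symbols 1
  and 2 stand for the input bits. The first tape carries the input, the last one the output
  (they may coincide). A transition \<open>(q, rs, q', ws, ds)\<close> leads from state \<open>q\<close>, reading the
  symbols \<open>rs\<close>, to state \<open>q'\<close>, writing \<open>ws\<close> and moving the heads in directions \<open>ds\<close>.\<close>

datatype dir = Go_Left | Stay | Go_Right

record tm =
  tapes :: nat
  states :: nat
  symbols :: nat
  accepting :: "nat set"
  transitions :: "(nat \<times> nat list \<times> nat \<times> nat list \<times> dir list) set"

definition wf_tm :: "tm \<Rightarrow> bool" where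
  "wf_tm M \<longleftrightarrow> tapes M \<ge> 1 \<and> states M \<ge> 1 \<and> symbols M \<ge> 3 \<and>
     (\<forall>(q, rs, q', ws, ds) \<in> transitions M.
        q < states M \<and> q' < states M \<and>
        length rs = tapes M \<and> length ws = tapes M \<and> length ds = tapes M \<and>
        (\<forall>s \<in> set rs \<union> set ws. s < symbols M))"

definition deterministic :: "tm \<Rightarrow> bool" where
  "deterministic M \<longleftrightarrow>
     (\<forall>q rs act act'. (q, rs, act) \<in> transitions M \<and> (q, rs, act') \<in> transitions M \<longrightarrow> act = act')"

text \<open>A tape is its content together with the position of the head.\<close>

type_synonym tape = "(int \<Rightarrow> nat) \<times> int"
type_synonym config = "nat \<times> tape list"

fun read_tape :: "tape \<Rightarrow> nat" where
  "read_tape (t, i) = t i"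

fun move :: "dir \<Rightarrow> int \<Rightarrow> int" where
  "move Go_Left i = i - 1"
| "move Stay i = i"
| "move Go_Right i = i + 1"

fun act_tape :: "tape \<Rightarrow> nat \<times> dir \<Rightarrow> tape" where
  "act_tape (t, i) (s, d) = (t(i := s), move d i)"

fun step :: "tm \<Rightarrow> config \<Rightarrow> config \<Rightarrow> bool" where
  "step M (q, ts) (q', ts') \<longleftrightarrow>
     (\<exists>ws ds. (q, map read_tape ts, q', ws, ds) \<in> transitions M \<and>
              ts' = map2 act_tape ts (zip ws ds))"

definition halted :: "tm \<Rightarrow> config \<Rightarrow> bool" where
  "halted M C \<longleftrightarrow> (\<nexists>C'. step M C C')"

definition word_content :: "bool list \<Rightarrow> int \<Rightarrow> nat" where
  "word_content w i =
     (if 0 \<le> i \<and> i < int (length w) then (if w ! nat i then 2 else 1) else 0)"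

definition initial :: "tm \<Rightarrow> bool list \<Rightarrow> config" where
  "initial M w = (0, (word_content w, 0) # replicate (tapes M - 1) (\<lambda>_. 0, 0))"

definition accepts :: "tm \<Rightarrow> bool list \<Rightarrow> bool" where
  "accepts M w \<longleftrightarrow> (\<exists>C. (step M)\<^sup>*\<^sup>* (initial M w) C \<and> halted M C \<and> fst C \<in> accepting M)"

text \<open>Every computation, whether accepting or not, takes at most \<open>t\<close> steps.\<close>

definition halts_within :: "tm \<Rightarrow> bool list \<Rightarrow> nat \<Rightarrow> bool" where
  "halts_within M w t \<longleftrightarrow> (\<forall>n C. (step M ^^ n) (initial M w) C \<longrightarrow> n \<le> t)"

type_synonym language = "bool list set"

text \<open>The constant \<open>b\<close> makes this the class usually written with the bound \<open>O(T)\<close>; the additive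
  occurrence takes care of bounds that vanish on short inputs.\<close>

definition NTIME :: "(nat \<Rightarrow> nat) \<Rightarrow> language set" where
  "NTIME T = {L. \<exists>M b. wf_tm M \<and>
     (\<forall>w. halts_within M w (b * T (length w) + b) \<and> (w \<in> L \<longleftrightarrow> accepts M w))}"

definition NEXPTIME :: "language set" where
  "NEXPTIME = (\<Union>k. NTIME (\<lambda>n. 2 ^ (n ^ k)))"

definition polytime_computable :: "(bool list \<Rightarrow> bool list) \<Rightarrow> bool" where
  "polytime_computable f \<longleftrightarrow> (\<exists>M b k. wf_tm M \<and> deterministic M \<and>
     (\<forall>w. \<exists>n \<le> b * length w ^ k + b. \<exists>C. (step M ^^ n) (initial M w) C \<and> halted M C \<and>
        fst (last (snd C)) = word_content (f w)))"

definition polytime_reducible :: "language \<Rightarrow> language \<Rightarrow> bool" where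
  "polytime_reducible L L' \<longleftrightarrow> (\<exists>f. polytime_computable f \<and> (\<forall>w. w \<in> L \<longleftrightarrow> f w \<in> L'))"

definition NEXPTIME_hard :: "language \<Rightarrow> bool" where
  "NEXPTIME_hard L \<longleftrightarrow> (\<forall>L' \<in> NEXPTIME. polytime_reducible L' L)"

definition NEXPTIME_complete :: "language \<Rightarrow> bool" where
  "NEXPTIME_complete L \<longleftrightarrow> L \<in> NEXPTIME \<and> NEXPTIME_hard L"

end

(*
  Hardness: a run of a nondeterministic machine of exponential length is described by a formula
  about the cells (time, position), whose coordinates are binary numbers written in letters.

  Membership: satisfiable formulas need not have models of exponential size. Colour the elements so
  that the neighbours of an element have different labels, a label being a colour together with the
  letters and quantified subformulas that hold. The truth of the formula then depends only on the
  stars (the label of an element and those of its neighbours), on the set of labels, and on which labels occur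
  exactly once. Maximal sequences of elements adjacent in both orders are contracted to
  pieces. The two orders are Euler tours through two graphs whose edges are the pieces; hence
  a structure exists as soon as the multiplicities of the pieces satisfy linear flow equations
  and the graphs are connected. Pieces are shortened by removing loops, multiplicities are made small by
  an argument of Siegel type, and a certificate of exponential size remains.
*)

theory Submission
 imports Defs "Graph_Theory.Euler" Complex_Main
begin

section \<open>Structured programs for Turing machines\<close>

text \<open>Once the pieces are fixed the two orders are independent: each is an Euler tour of its
  own graph, whose vertices are the pairs of labels meeting at a boundary between pieces, with
  \<open>Nl\<close> for the ends. Elements adjacent in both orders would be torn apart by
  independent tours; this is why they are contracted. The labels of neighbours are made different so
  that the relative position of two elements can be read off the star of one and the label of the
  other. A label carried by a neighbour is met at a non-neighbour too only if it occurs twice; so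
  multiplicities matter only as 0, 1 or more, and this is what small solutions must preserve. With N
  pieces, N exponential, multiplicities may reach the order of \<open>N ^ N\<close>: a model may be
  doubly exponential, its description in binary is not. As the machine model is concrete, reduction
  and verifier are obtained in a calculus of polynomial-time functions on binary trees, a tree being
  also what is guessed as certificate. In the hardness part several elements may share a cell, so
  all conditions compare every pair of elements by their coordinates.\<close>

datatype com = Skip | Abort | Wr nat nat | Mv nat dir | Seq com com (infixr ";;" 60)
 | Ite nat "nat set" com com | Whl nat "nat set" com | Alt com com

definition idle :: "nat list => (nat \<times> dir) list" where
 "idle rs = map (%s. (s, Stay)) rs"

text \<open>One machine step as a function of the symbols under the heads: the rest of the program
  together with what each tape does. \<open>Skip\<close> and \<open>Abort\<close> both stop; they
  differ only in that \<open>Skip\<close> becomes the accepting state. Each \<open>Ite\<close>,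
  \<open>Whl\<close> and \<open>Alt\<close> costs one step that leaves the tapes alone.\<close>

fun nxt :: "com => nat list => (com \<times> (nat \<times> dir) list) set" where
 "nxt Skip rs = {}"
| "nxt Abort rs = {}"
| "nxt (Wr j s) rs = {(Skip, (idle rs)[j := (s, Stay)])}"
| "nxt (Mv j d) rs = {(Skip, (idle rs)[j := (rs ! j, d)])}"
| "nxt (c1 ;; c2) rs =
   (if c1 = Skip then {(c2, idle rs)} else (%(c, a). (c ;; c2, a)) ` nxt c1 rs)"
| "nxt (Ite j P c1 c2) rs = {(if rs ! j \<in> P then c1 else c2, idle rs)}"
| "nxt (Whl j P c) rs = {(if rs ! j \<in> P then c ;; Whl j P c else Skip, idle rs)}"
| "nxt (Alt c1 c2) rs = {(c1, idle rs), (c2, idle rs)}"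

text \<open>Programs themselves serve as control states: only finitely many arise from a given one.\<close>

fun derivs :: "com => com set" where
 "derivs Skip = {Skip}"
| "derivs Abort = {Abort}"
| "derivs (Wr j s) = {Wr j s, Skip}"
| "derivs (Mv j d) = {Mv j d, Skip}"
| "derivs (c1 ;; c2) = (%c. c ;; c2) ` derivs c1 \<union> derivs c2"
| "derivs (Ite j P c1 c2) = insert (Ite j P c1 c2) (derivs c1 \<union> derivs c2)"
| "derivs (Whl j P c) = {Whl j P c, Skip} \<union> (%d. d ;; Whl j P c) ` derivs c"
| "derivs (Alt c1 c2) = insert (Alt c1 c2) (derivs c1 \<union> derivs c2)"

lemma finite_derivs: "finite (derivs c)"
 by (induction c) auto

lemma self_derivs: "c \<in> derivs c"
 by (induction c) auto

lemma nxt_derivs: "d \<in> derivs c ==> (d', a) \<in> nxt d rs ==> d' \<in> derivs c"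
proof (induction c arbitrary: d d' a)
 case (Seq c1 c2)
 show ?case
 proof (cases "d \<in> derivs c2")
  case False
  then obtain e where e: "d = e ;; c2" "e \<in> derivs c1" using Seq.prems(1) by auto
  show ?thesis
  proof (cases "e = Skip")
   case True
   then show ?thesis using Seq.prems(2) e by (simp add: self_derivs)
  next
   case False
   then obtain e' where "d' = e' ;; c2" "(e', a) \<in> nxt e rs" using Seq.prems(2) e by auto
   then show ?thesis using Seq.IH(1) e by auto
  qed
 qed (use Seq in auto)
next
 case (Whl j P c)
 from Whl.prems(1) consider "d = Whl j P c" | "d = Skip" | e where "d = e ;; Whl j P c" "e \<in> derivs c"
  by auto
 then show ?case
 proof cases
  case 1
  then show ?thesis using Whl.prems(2) by (simp add: self_derivs split: if_splits)
 next
  case (3 e)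
  then show ?thesis
  proof (cases "e = Skip")
   case False
   then obtain e' where "d' = e' ;; Whl j P c" "(e', a) \<in> nxt e rs" using Whl.prems(2) 3 by auto
   then show ?thesis using Whl.IH 3 by auto
  qed (use Whl.prems(2) 3 in simp)
 qed (use Whl.prems in simp)
next
 case (Ite j P c1 c2)
 from Ite.prems(1) consider "d = Ite j P c1 c2" | "d \<in> derivs c1" | "d \<in> derivs c2" by auto
 then show ?case
  using Ite by cases (auto simp: self_derivs split: if_splits)
next
 case (Alt c1 c2)
 from Alt.prems(1) consider "d = Alt c1 c2" | "d \<in> derivs c1" | "d \<in> derivs c2" by auto
 then show ?case
  using Alt by cases (auto simp: self_derivs)
qed auto

fun wfc :: "nat => com => bool" where
 "wfc k (Wr j s) \<longleftrightarrow> j < k & s < 3"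
| "wfc k (Mv j d) \<longleftrightarrow> j < k"
| "wfc k (c1 ;; c2) \<longleftrightarrow> wfc k c1 & wfc k c2"
| "wfc k (Ite j P c1 c2) \<longleftrightarrow> j < k & wfc k c1 & wfc k c2"
| "wfc k (Whl j P c) \<longleftrightarrow> j < k & wfc k c"
| "wfc k (Alt c1 c2) \<longleftrightarrow> wfc k c1 & wfc k c2"
| "wfc k _ \<longleftrightarrow> True"

fun altfree :: "com => bool" where
 "altfree (c1 ;; c2) \<longleftrightarrow> altfree c1 & altfree c2"
| "altfree (Ite j P c1 c2) \<longleftrightarrow> altfree c1 & altfree c2"
| "altfree (Whl j P c) \<longleftrightarrow> altfree c"
| "altfree (Alt c1 c2) \<longleftrightarrow> False"
| "altfree _ \<longleftrightarrow> True"

lemma wfc_derivs: "wfc k c ==> d \<in> derivs c ==> wfc k d"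
proof -
 have "wfc k c ==> derivs c \<subseteq> Collect (wfc k)" by (induction c) (simp_all add: image_subset_iff, (blast dest: subsetD)+)
 then show "wfc k c ==> d \<in> derivs c ==> wfc k d" by blast
qed

lemma altfree_derivs: "altfree c ==> d \<in> derivs c ==> altfree d"
proof -
 have "altfree c ==> derivs c \<subseteq> Collect altfree" by (induction c) (simp_all add: image_subset_iff, (blast dest: subsetD)+)
 then show "altfree c ==> d \<in> derivs c ==> altfree d" by blast
qed

lemma nxt_altfree: "altfree c ==> x \<in> nxt c rs ==> y \<in> nxt c rs ==> x = y"
proof (induction c arbitrary: x y)
 case (Seq c1 c2)
 then show ?case by (fastforce split: if_splits)
qed auto

lemma nxt_actions:
 assumes "wfc (length rs) c" "set rs \<subseteq> {..<3}" "(c', a) \<in> nxt c rs"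
 shows "length a = length rs & fst ` set a \<subseteq> {..<3}"
 using assms
proof (induction c arbitrary: c' a)
 case (Wr j s)
 then have "set a \<subseteq> insert (s, Stay) (set (idle rs))"
  using set_update_subset_insert by fastforce
 with Wr show ?case by (fastforce simp: idle_def)
next
 case (Mv j d)
 then have "set a \<subseteq> insert (rs ! j, d) (set (idle rs))"
  using set_update_subset_insert by fastforce
 moreover have "rs ! j < 3" using Mv by (auto simp: subset_iff)
 ultimately show ?case using Mv by (fastforce simp: idle_def)
next
 case (Seq c1 c2)
 then show ?case by (fastforce simp: idle_def split: if_splits)
qed (auto simp: idle_def)

text \<open>A run begins in state 0, so the whole program gets the number 0; the remaining control
  states are numbered from 1 by an arbitrary injection.\<close>

definition index :: "com => com => nat" where
 "index c d = (if d = c then 0 else Suc ((SOME f. inj_on f (derivs c)) d))"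

lemma inj_index: "inj_on (index c) (derivs c)"
proof -
 have "\<exists>f::com => nat. inj_on f (derivs c)"
  using finite_imp_inj_to_nat_seg[OF finite_derivs] by blast
 then have "inj_on (SOME f::com => nat. inj_on f (derivs c)) (derivs c)"
  by (rule someI_ex)
 then show ?thesis by (auto simp: index_def inj_on_def)
qed

lemma index_eq_iff: "d \<in> derivs c ==> d' \<in> derivs c ==> index c d = index c d' \<longleftrightarrow> d = d'"
 using inj_index[of c] by (auto simp: inj_on_def)

text \<open>The intersection with \<open>derivs c\<close> matters when \<open>Skip\<close> never
  arises from \<open>c\<close>: its index would then be arbitrary and could be that of another
  state.\<close>

definition machine :: "nat => com => tm" where
 "machine k c = \<lparr>tapes = k, states = Suc (Max (index c ` derivs c)), symbols = 3,
   accepting = index c ` (derivs c \<inter> {Skip}),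
   transitions = {(index c d, rs, index c d', map fst a, map snd a) | d rs d' a.
    d \<in> derivs c & length rs = k & set rs \<subseteq> {..<3} & (d', a) \<in> nxt d rs}\<rparr>"

declare step.simps [simp del]

lemma transitions_machine:
 "(q, rs, q', ws, ds) \<in> transitions (machine k c) \<longleftrightarrow> (\<exists>d d' a. q = index c d & q' = index c d' &
   ws = map fst a & ds = map snd a & d \<in> derivs c & length rs = k & set rs \<subseteq> {..<3} & (d', a) \<in> nxt d rs)"
 by (auto simp: machine_def)

lemma wf_machine:
 assumes "wfc k c" "k \<ge> 1"
 shows "wf_tm (machine k c)"
proof -
 have *: "index c d < Suc (Max (index c ` derivs c))" if "d \<in> derivs c" for d
  using that finite_derivs by (auto simp: less_Suc_eq_le)
 have "q < states (machine k c) & q' < states (machine k c) & length rs = k & length ws = k &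
   length ds = k & (\<forall>s\<in>set rs \<union> set ws. s < 3)"
  if h: "(q, rs, q', ws, ds) \<in> transitions (machine k c)" for q rs q' ws ds
 proof -
  obtain d d' a where 1: "q = index c d" "q' = index c d'" "ws = map fst a" "ds = map snd a"
   "d \<in> derivs c" "length rs = k" "set rs \<subseteq> {..<3}" "(d', a) \<in> nxt d rs"
   using h unfolding transitions_machine by blast
  then have "length a = length rs & fst ` set a \<subseteq> {..<3}"
   using nxt_actions wfc_derivs[OF assms(1)] by blast
  then show ?thesis
   using 1 * nxt_derivs by (auto simp: machine_def)
 qed
 then show ?thesis
  using assms(2) unfolding wf_tm_def by (auto simp: machine_def[of k c, THEN arg_cong[of _ _ tapes]]
   machine_def[of k c, THEN arg_cong[of _ _ symbols]] machine_def[of k c, THEN arg_cong[of _ _ states]])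
qed

lemma deterministic_machine:
 assumes "altfree c"
 shows "deterministic (machine k c)"
 unfolding deterministic_def
proof (intro allI impI, elim conjE)
 fix q rs act act'
 assume *: "(q, rs, act) \<in> transitions (machine k c)" "(q, rs, act') \<in> transitions (machine k c)"
 obtain q1 w1 m1 where act1: "act = (q1, w1, m1)" by (rule prod_cases3)
 obtain q2 w2 m2 where act2: "act' = (q2, w2, m2)" by (rule prod_cases3)
 note act = act1 act2
 obtain d d1 a where 1: "q = index c d" "d \<in> derivs c" "(d1, a) \<in> nxt d rs"
   "q1 = index c d1" "w1 = map fst a" "m1 = map snd a"
  using *(1) unfolding act transitions_machine by blast
 obtain d' d2 b where 2: "q = index c d'" "d' \<in> derivs c" "(d2, b) \<in> nxt d' rs"
   "q2 = index c d2" "w2 = map fst b" "m2 = map snd b"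
  using *(2) unfolding act transitions_machine by blast
 have "d = d'" using 1(1,2) 2(1,2) index_eq_iff by simp
 then have "(d1, a) = (d2, b)"
  using nxt_altfree[OF altfree_derivs[OF assms 1(2)] 1(3)] 2(3) by blast
 then show "act = act'" using 1 2 act by simp
qed

text \<open>\<open>machine\<close> has transitions only for symbols below 3, hence the simulation is
  stated for tapes all of whose cells, visited or not, hold such symbols.\<close>

definition good :: "nat => tape list => bool" where
 "good k ts \<longleftrightarrow> length ts = k & (\<forall>x\<in>set ts. \<forall>j. fst x j < 3)"

definition succs :: "com => tape list => (com \<times> tape list) set" where
 "succs c ts = (%(c', a). (c', map2 act_tape ts a)) ` nxt c (map read_tape ts)"

lemma read_tape_def: "read_tape x = fst x (snd x)"
 by (cases x) simp

lemma act_tape_good: "\<forall>j. fst x j < 3 ==> fst y < (3::nat) ==> fst (act_tape x y) j < 3"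
 by (cases x; cases y) auto

lemma succs_good:
 assumes "good k ts" "wfc k c" "(c', ts') \<in> succs c ts"
 shows "good k ts'"
proof -
 obtain a where a: "(c', a) \<in> nxt c (map read_tape ts)" "ts' = map2 act_tape ts a"
  using assms(3) by (auto simp: succs_def)
 have *: "length a = length ts" "fst ` set a \<subseteq> {..<3}"
  using nxt_actions[OF _ _ a(1)] assms(1,2) by (auto simp: good_def read_tape_def)
 have "\<forall>j. fst x j < 3" if "x \<in> set ts'" for x
 proof -
  obtain p where "p \<in> set (zip ts a)" "x = act_tape (fst p) (snd p)"
   using \<open>x \<in> set ts'\<close> unfolding a(2) by (auto simp del: act_tape.simps simp: split_def)
  then obtain t y where "x = act_tape t y" "t \<in> set ts" "y \<in> set a"
   by (metis prod.collapse set_zip_leftD set_zip_rightD)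
  then show ?thesis
   using assms(1) * by (auto simp: good_def intro!: act_tape_good)
 qed
 then show ?thesis
  using assms(1) * by (auto simp: good_def a(2))
qed

lemma step_machine:
 assumes "good k ts" "wfc k c" "d \<in> derivs c"
 shows "step (machine k c) (index c d, ts) C \<longleftrightarrow> (\<exists>(d', ts')\<in>succs d ts. C = (index c d', ts'))"
proof -
 obtain q ts' where C: "C = (q, ts')" by force
 have rs: "length (map read_tape ts) = k" "set (map read_tape ts) \<subseteq> {..<3}"
  using assms(1) by (auto simp: good_def read_tape_def)
 have "step (machine k c) (index c d, ts) C \<longleftrightarrow>
   (\<exists>d' a. (d', a) \<in> nxt d (map read_tape ts) & q = index c d' & ts' = map2 act_tape ts a)"
  (is "?L \<longleftrightarrow> ?R")
 proof
  assume ?L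
  then obtain ws ds where "(index c d, map read_tape ts, q, ws, ds) \<in> transitions (machine k c)"
    "ts' = map2 act_tape ts (zip ws ds)"
   unfolding C step.simps by blast
  then show ?R
   unfolding transitions_machine using index_eq_iff assms(3) by (fastforce simp: zip_map_fst_snd)
 next
  assume ?R
  then obtain d' a where *: "(d', a) \<in> nxt d (map read_tape ts)" "q = index c d'"
   "ts' = map2 act_tape ts (zip (map fst a) (map snd a))"
   by (auto simp: zip_map_fst_snd)
  then have "(index c d, map read_tape ts, q, map fst a, map snd a) \<in> transitions (machine k c)"
   unfolding transitions_machine using assms(3) rs by blast
  then show ?L
   using *(3) unfolding C step.simps by blast
 qed
 then show ?thesis unfolding C succs_def by (simp add: split_def Bex_def)
qed

text \<open>\<open>E c ts t Q\<close>: every run of \<open>c\<close> from \<open>ts\<close> ends within \<open>t\<close> steps, and \<open>Q\<close> is the set of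
 the tapes left by the runs that end in \<open>Skip\<close>.\<close>

inductive E :: "com => tape list => nat => tape list set => bool" where
 E_Skip: "E Skip ts t {ts}"
| E_step: "c ~= Skip ==> (\<And>x. x \<in> succs c ts ==> E (fst x) (snd x) t (Q x)) ==>
   E c ts (Suc t) (\<Union>x\<in>succs c ts. Q x)"

lemma succs_Skip: "succs Skip ts = {}"
 by (simp add: succs_def)

text \<open>One derivation of \<open>E\<close> serves all uses of machines: the step bound is that
  of \<open>halts_within\<close>, and the description of all accepting final configurations decides
  \<open>accepts\<close> (is \<open>Q\<close> nonempty?) and exhibits the output when
  \<open>Q\<close> is a singleton.\<close>

lemma E_machine:
 assumes "E d ts t Q" "good k ts" "wfc k c" "d \<in> derivs c"
 defines "M \<equiv> machine k c"
 shows "(\<forall>n C. (step M ^^ n) (index c d, ts) C --> n \<le> t) &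
  {C. (step M)\<^sup>*\<^sup>* (index c d, ts) C & halted M C & fst C \<in> accepting M} = Pair (index c Skip) ` Q"
 using assms(1,2,4)
proof (induction rule: E.induct)
 case (E_Skip ts t)
 have no: "\<not> step M (index c Skip, ts) C" for C
  using step_machine[OF E_Skip(1) assms(3) E_Skip(2), of C] by (auto simp: M_def succs_Skip)
 have "n = 0" if "(step M ^^ n) (index c Skip, ts) C" for n C
  using that no by (metis relpowp_E2)
 moreover have "(step M)\<^sup>*\<^sup>* (index c Skip, ts) C \<longleftrightarrow> C = (index c Skip, ts)" for C
  using no by (auto elim: converse_rtranclpE)
 ultimately show ?case
  using no E_Skip(2) by (fastforce simp: halted_def M_def machine_def)
next
 case (E_step d ts t Q)
 note st = step_machine[OF E_step.prems(1) assms(3) E_step.prems(2), folded M_def]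
 have IH: "(\<forall>n C. (step M ^^ n) (index c d', ts') C --> n \<le> t) &
  {C. (step M)\<^sup>*\<^sup>* (index c d', ts') C & halted M C & fst C \<in> accepting M}
   = Pair (index c Skip) ` Q (d', ts')"
  if "(d', ts') \<in> succs d ts" for d' ts'
 proof -
  have "good k ts'"
   using succs_good[OF E_step.prems(1) wfc_derivs[OF assms(3) E_step.prems(2)] that] .
  moreover have "d' \<in> derivs c"
   using that nxt_derivs[OF E_step.prems(2)] by (auto simp: succs_def)
  ultimately show ?thesis using E_step.IH[OF that] by simp
 qed
 have 1: "n \<le> Suc t" if h: "(step M ^^ n) (index c d, ts) C" for n C
 proof (cases n)
  case (Suc n')
  then obtain C' where "step M (index c d, ts) C'" "(step M ^^ n') C' C"
   using h by (metis relpowp_Suc_E2)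
  then obtain d' ts' where "(d', ts') \<in> succs d ts" "(step M ^^ n') (index c d', ts') C"
   using st[of C'] by (auto simp: split_def)
  then show ?thesis using IH Suc by blast
 qed simp
 have "index c d \<notin> accepting M"
  using E_step.hyps(1) E_step.prems(2) index_eq_iff by (auto simp: M_def machine_def)
 then have "{C. (step M)\<^sup>*\<^sup>* (index c d, ts) C & halted M C & fst C \<in> accepting M} =
   (\<Union>(d', ts')\<in>succs d ts. {C. (step M)\<^sup>*\<^sup>* (index c d', ts') C & halted M C & fst C \<in> accepting M})"
  (is "?L = ?R")
 proof (intro equalityI subsetI)
  fix C assume C: "C \<in> ?L"
  then have "(step M)\<^sup>*\<^sup>* (index c d, ts) C" "C ~= (index c d, ts)"
   using \<open>index c d \<notin> accepting M\<close> by auto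
  then obtain C' where "step M (index c d, ts) C'" "(step M)\<^sup>*\<^sup>* C' C"
   by (cases rule: converse_rtranclpE) auto
  moreover obtain d' ts' where "(d', ts') \<in> succs d ts" "C' = (index c d', ts')"
   using st[of C'] calculation(1) by (auto simp: split_def)
  ultimately show "C \<in> ?R" using C by blast
 next
  fix C assume "C \<in> ?R"
  then obtain d' ts' where *: "(d', ts') \<in> succs d ts" "(step M)\<^sup>*\<^sup>* (index c d', ts') C"
    "halted M C" "fst C \<in> accepting M" by auto
  then have "step M (index c d, ts) (index c d', ts')" unfolding st by blast
  then show "C \<in> ?L" using * by (auto intro: converse_rtranclp_into_rtranclp)
 qed
 also have "\<dots> = (\<Union>(d', ts')\<in>succs d ts. Pair (index c Skip) ` Q (d', ts'))"
 proof (rule SUP_cong[OF refl])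
  fix x assume "x \<in> succs d ts"
  then show "(case x of (d', ts') => {C. (step M)\<^sup>*\<^sup>* (index c d', ts') C & halted M C & fst C \<in> accepting M}) =
    (case x of (d', ts') => Pair (index c Skip) ` Q (d', ts'))"
   using IH[of "fst x" "snd x"] unfolding split_def by (simp only: prod.collapse)
 qed
 finally show ?case using 1 unfolding image_UN split_def by simp
qed

lemma E_mono: "E c ts t Q ==> t \<le> t' ==> E c ts t' Q"
proof (induction arbitrary: t' rule: E.induct)
 case (E_step c ts t Q)
 then obtain u where "t' = Suc u" "t \<le> u" by (cases t') auto
 then show ?case using E_step by (auto intro: E.E_step)
qed (rule E_Skip)

lemma E_det:
 assumes "c ~= Skip" "succs c ts = {(c', ts')}" "E c' ts' t Q"
 shows "E c ts (Suc t) Q"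
 using E_step[of c ts t "%_. Q"] assms by auto

lemma map2_idle: "map2 act_tape ts (idle (map read_tape ts)) = ts"
 by (induction ts) (auto simp: idle_def)

lemma map2_idle_update:
 "j < length ts ==> map2 act_tape ts ((idle (map read_tape ts))[j := x]) = ts[j := act_tape (ts ! j) x]"
 using map2_idle[of ts]
 by (auto simp: list_eq_iff_nth_eq nth_list_update idle_def)

lemma E_Wr: "j < length ts ==> E (Wr j s) ts 1 {ts[j := act_tape (ts ! j) (s, Stay)]}"
 unfolding One_nat_def by (rule E_det[OF _ _ E_Skip]) (auto simp: succs_def map2_idle_update)

lemma E_Mv: "j < length ts ==> E (Mv j d) ts 1 {ts[j := act_tape (ts ! j) (read_tape (ts ! j), d)]}"
 unfolding One_nat_def by (rule E_det[OF _ _ E_Skip]) (auto simp: succs_def map2_idle_update)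

lemma E_Seqs:
 "E c1 ts t1 Q1 ==> (\<And>x. x \<in> Q1 ==> E c2 x t2 (Q2 x)) ==> E (c1 ;; c2) ts (Suc (t1 + t2)) (\<Union>x\<in>Q1. Q2 x)"
proof (induction arbitrary: rule: E.induct)
 case (E_Skip ts t)
 then have "E c2 ts (t + t2) (Q2 ts)" by (auto intro: E_mono)
 then show ?case
  by (simp, intro E_det[of "Skip ;; c2" ts]) (auto simp: succs_def map2_idle)
next
 case (E_step c ts t Q)
 have s: "succs (c ;; c2) ts = (%(d, x). (d ;; c2, x)) ` succs c ts"
  using E_step(1) by (force simp: succs_def)
 \<comment> \<open>\<open>Q\<close> is indexed by successors of \<open>c\<close>, the rule by
   successors of \<open>c ;; c2\<close>; the \<open>case\<close> expression strips \<open>c2\<close>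
   again.\<close>
 have "E (c ;; c2) ts (Suc (Suc (t + t2))) (\<Union>y\<in>succs (c ;; c2) ts. \<Union>x\<in>Q (case fst y of d ;; e => d, snd y). Q2 x)"
 proof (rule E.E_step)
  fix y assume "y \<in> succs (c ;; c2) ts"
  then obtain d x where y: "y = (d ;; c2, x)" "(d, x) \<in> succs c ts" by (auto simp: s)
  show "E (fst y) (snd y) (Suc (t + t2)) (\<Union>x\<in>Q (case fst y of d ;; e => d, snd y). Q2 x)"
   using E_step.IH[OF y(2)] E_step.prems y by auto
 qed simp
 moreover have "(\<Union>y\<in>succs (c ;; c2) ts. \<Union>x\<in>Q (case fst y of d ;; e => d, snd y). Q2 x) =
   (\<Union>x\<in>\<Union> (Q ` succs c ts). Q2 x)"
  (is "?L = ?R")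
 proof (intro equalityI subsetI)
  fix z assume "z \<in> ?R"
  then obtain y x where "y \<in> succs c ts" "x \<in> Q y" "z \<in> Q2 x" by blast
  then show "z \<in> ?L" unfolding s by (intro UN_I[of "(fst y ;; c2, snd y)"]) force+
 next
  fix z assume "z \<in> ?L"
  then obtain y x where "y \<in> succs (c ;; c2) ts"
   "x \<in> Q (case fst y of d ;; e => d, snd y)" "z \<in> Q2 x" by blast
  then show "z \<in> ?R" unfolding s by force
 qed
 ultimately show ?case by simp
qed

lemma E_Seq:
 assumes "E c1 ts t1 {ts1}" "E c2 ts1 t2 Q"
 shows "E (c1 ;; c2) ts (Suc (t1 + t2)) Q"
 using E_Seqs[OF assms(1), of c2 t2 "%_. Q"] assms(2) by simp

lemma E_Ite:
 "j < length ts ==> E (if read_tape (ts ! j) \<in> P then c1 else c2) ts t Q ==> E (Ite j P c1 c2) ts (Suc t) Q"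
 by (rule E_det) (auto simp: succs_def map2_idle)

lemma E_Whl:
 "j < length ts ==> E (if read_tape (ts ! j) \<in> P then c ;; Whl j P c else Skip) ts t Q ==>
  E (Whl j P c) ts (Suc t) Q"
 by (rule E_det) (auto simp: succs_def map2_idle)

text \<open>Successors form a set, and the rule for \<open>E\<close> attaches a result to each of
  them; two syntactically equal branches could not be given different results.\<close>

lemma E_Alt:
 assumes "c1 ~= c2" "E c1 ts t Q1" "E c2 ts t Q2"
 shows "E (Alt c1 c2) ts (Suc t) (Q1 \<union> Q2)"
proof -
 have s: "succs (Alt c1 c2) ts = {(c1, ts), (c2, ts)}" by (auto simp: succs_def map2_idle)
 have "E (Alt c1 c2) ts (Suc t) (\<Union>x\<in>succs (Alt c1 c2) ts. if fst x = c1 then Q1 else Q2)"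
  using assms by (intro E_step) (auto simp: s)
 then show ?thesis using assms(1) unfolding s by (simp add: Un_commute)
qed

section \<open>Stacks and trees on tapes\<close>

declare One_nat_def [simp del]

text \<open>A stack grows to the left; its bottom is the cell before position \<open>z\<close>, its top is under the head.\<close>

definition stk :: "int => nat list => tape" where
 "stk z s = (%j. if z - int (length s) \<le> j & j < z then s ! nat (j - (z - int (length s))) else 0,
   z - int (length s))"

lemma read_stk [simp]: "read_tape (stk z (a # s)) = a" "read_tape (stk z []) = 0"
 by (auto simp: stk_def)

lemma push_stk: "act_tape (act_tape (stk z s) (read_tape (stk z s), Go_Left)) (a, Stay) = stk z (a # s)"
proof -
 have "nat (j - (z - (1 + int (length s)))) = Suc (nat (j - (z - int (length s))))"
  if "z - int (length s) \<le> j" for j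
  using that by linarith
 then show ?thesis by (auto simp: stk_def fun_eq_iff nth_Cons')
qed

lemma pop_stk:
 "act_tape (act_tape (stk z (a # s)) (0, Stay)) (read_tape (act_tape (stk z (a # s)) (0, Stay)), Go_Right) = stk z s"
proof -
 have "nat (j - (z - (1 + int (length s)))) = Suc (nat (j - (z - int (length s))))"
  if "z - int (length s) \<le> j" for j
  using that by linarith
 then show ?thesis by (auto simp: stk_def fun_eq_iff nth_Cons')
qed

text \<open>An empty stack leaves no trace on the tape, so moving the head moves its bottom. This is
  how the output gets its proper place.\<close>

lemma shift_stk: "act_tape (stk z []) (read_tape (stk z []), Go_Right) = stk (z + 1) []"
 by (auto simp: stk_def fun_eq_iff)

definition symb :: "bool => nat" where
 "symb b = (if b then 2 else 1)"

lemma word_stk: "(word_content w, 0) = stk (int (length w)) (map symb w)"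
 by (auto simp: stk_def word_content_def fun_eq_iff symb_def)

definition push :: "nat => nat => com" where
 "push j a = Mv j Go_Left ;; Wr j a"

definition pop :: "nat => com" where
 "pop j = Wr j 0 ;; Mv j Go_Right"

lemma E_push: "j < length ts ==> ts ! j = stk z s ==> E (push j a) ts 3 {ts[j := stk z (a # s)]}"
 unfolding push_def
 by (rule E_mono, rule E_Seq[OF E_Mv], simp, rule E_Wr[of j _ a, THEN back_subst[of "%x. E _ _ _ {x}"]])
   (simp_all add: push_stk)

lemma E_pop: "j < length ts ==> ts ! j = stk z (a # s) ==> E (pop j) ts 3 {ts[j := stk z s]}"
 unfolding pop_def
 by (rule E_mono, rule E_Seq[OF E_Wr], simp, rule E_Mv[of j _ Go_Right, THEN back_subst[of "%x. E _ _ _ {x}"]])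
   (simp_all add: pop_stk del: act_tape.simps)

text \<open>Tape 0 carries the input and later serves as scratch, tape 1 is the main stack on which
  trees are stored, tape 2 holds counters and flags, tape 3 is scratch and finally the output. Only
  the tapes that carry a word need a variable bottom.\<close>

definition st :: "int => nat list => nat list => nat list => int => nat list => tape list" where
 "st z a m c y b = [stk z a, stk 0 m, stk 0 c, stk y b]"

lemma st_nth [simp]:
 "length (st z a m c y b) = 4" "st z a m c y b ! 0 = stk z a" "st z a m c y b ! 1 = stk 0 m"
 "st z a m c y b ! 2 = stk 0 c" "st z a m c y b ! 3 = stk y b"
 by (auto simp: st_def One_nat_def)

lemma push_st:
 "E (push 0 x) (st z a m c y b) 3 {st z (x # a) m c y b}"
 "E (push 1 x) (st z a m c y b) 3 {st z a (x # m) c y b}"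
 "E (push 2 x) (st z a m c y b) 3 {st z a m (x # c) y b}"
 "E (push 3 x) (st z a m c y b) 3 {st z a m c y (x # b)}"
 using E_push[of 0 "st z a m c y b" z a x] E_push[of 1 "st z a m c y b" 0 m x]
  E_push[of 2 "st z a m c y b" 0 c x] E_push[of 3 "st z a m c y b" y b x]
 by (simp_all add: st_def One_nat_def)

lemma pop_st:
 "E (pop 0) (st z (x # a) m c y b) 3 {st z a m c y b}"
 "E (pop 1) (st z a (x # m) c y b) 3 {st z a m c y b}"
 "E (pop 2) (st z a m (x # c) y b) 3 {st z a m c y b}"
 "E (pop 3) (st z a m c y (x # b)) 3 {st z a m c y b}"
 using E_pop[of 0 "st z (x # a) m c y b" z x a] E_pop[of 1 "st z a (x # m) c y b" 0 x m]
  E_pop[of 2 "st z a m (x # c) y b" 0 x c] E_pop[of 3 "st z a m c y (x # b)" y x b]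
 by (simp_all add: st_def One_nat_def)

lemma E_If1: "read_tape (ts ! j) \<in> P ==> j < length ts ==> E c1 ts t Q ==> E (Ite j P c1 c2) ts (Suc t) Q"
 by (rule E_Ite) auto

lemma E_If2: "read_tape (ts ! j) \<notin> P ==> j < length ts ==> E c2 ts t Q ==> E (Ite j P c1 c2) ts (Suc t) Q"
 by (rule E_Ite) auto

lemma E_Whl1:
 "read_tape (ts ! j) \<in> P ==> j < length ts ==> E c ts t {ts'} ==> E (Whl j P c) ts' t' Q ==>
  E (Whl j P c) ts (2 + t + t') Q"
 using E_Whl[of j ts P c "Suc (t + t')" Q] E_Seq[of c ts t ts'] by auto

lemma E_Whl2: "read_tape (ts ! j) \<notin> P ==> j < length ts ==> E (Whl j P c) ts 1 {ts}"
 using E_Whl[of j ts P c 0 "{ts}"] E_Skip by (auto simp: One_nat_def)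

datatype tree = Nl | Cn tree tree

text \<open>Preorder with 1 for a leaf and 2 for a node. The code is prefix free
  (\<open>enc_prefix\<close>), so trees lie on the stack without separators.\<close>

fun enc :: "tree => nat list" where
 "enc Nl = [1]"
| "enc (Cn a b) = 2 # enc a @ enc b"

abbreviation sz :: "tree => nat" where
 "sz t \<equiv> length (enc t)"

lemma sz_pos: "1 \<le> sz t"
 by (cases t) (auto simp: One_nat_def)

lemma enc_symbols: "set (enc t) \<subseteq> {1, 2}"
 by (induction t) auto

text \<open>The tape transfers below exist for both scratch tapes 0 and 3; \<open>s2 j\<close> puts the stack \<open>a\<close> in
 question on tape \<open>j\<close>.\<close>

definition s2 :: "nat => int => int => nat list => nat list => nat list => nat list => tape list" where
 "s2 j z y b a m c = (if j = 0 then st z a m c y b else st z b m c y a)"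

lemma s2_simps [simp]: "length (s2 j z y b a m c) = 4" "s2 j z y b a m c ! 1 = stk 0 m"
 "s2 j z y b a m c ! 2 = stk 0 c"
 "j = 0 \<or> j = 3 ==> s2 j z y b a m c ! j = stk (if j = 0 then z else y) a"
 by (auto simp: s2_def)

lemma push_s2:
 "j = 0 \<or> j = 3 ==> E (push j x) (s2 j z y b a m c) 3 {s2 j z y b (x # a) m c}"
 "E (push 1 x) (s2 j z y b a m c) 3 {s2 j z y b a (x # m) c}"
 "E (push 2 x) (s2 j z y b a m c) 3 {s2 j z y b a m (x # c)}"
 by (auto simp: s2_def push_st)

lemma pop_s2:
 "j = 0 \<or> j = 3 ==> E (pop j) (s2 j z y b (x # a) m c) 3 {s2 j z y b a m c}"
 "E (pop 1) (s2 j z y b a (x # m) c) 3 {s2 j z y b a m c}"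
 "E (pop 2) (s2 j z y b a m (x # c)) 3 {s2 j z y b a m c}"
 by (auto simp: s2_def pop_st)

text \<open>Tape 2 counts in unary the subtrees still to be moved: a node adds one to the count, a
  leaf takes one away. The tree arrives reversed.\<close>

definition mvl :: "nat => com" where
 "mvl j = Whl 2 {1} (Ite 1 {2} (pop 1 ;; push j 2 ;; push 2 1) (pop 1 ;; push j 1 ;; pop 2))"

text \<open>Stated with the rest of the loop as a premise: in the node case the hypothesis for the
  left subtree is applied to the loop that still has to move the right one.\<close>

lemma E_mvl:
 assumes "j = 0 \<or> j = 3"
 shows "E (mvl j) (s2 j z y b (rev (enc t) @ a) m c) u Q ==>
  E (mvl j) (s2 j z y b a (enc t @ m) (1 # c)) (u + 20 * sz t) Q"
proof (induction t arbitrary: a m c u)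
 case Nl
 have 1: "E (Ite 1 {2} (pop 1 ;; push j 2 ;; push 2 1) (pop 1 ;; push j 1 ;; pop 2))
   (s2 j z y b a (1 # m) (1 # c)) 12 {s2 j z y b (1 # a) m c}"
  by (rule E_mono, rule E_If2, simp, simp, rule E_Seq[OF pop_s2(2)], rule E_Seq[OF push_s2(1)[OF assms]],
    rule pop_s2(3)) simp
 show ?case
  using Nl unfolding mvl_def by (simp, intro E_mono[OF E_Whl1[OF _ _ 1]]) auto
next
 case (Cn s t)
 have 1: "E (Ite 1 {2} (pop 1 ;; push j 2 ;; push 2 1) (pop 1 ;; push j 1 ;; pop 2))
   (s2 j z y b a (2 # enc s @ enc t @ m) (1 # c)) 12 {s2 j z y b (2 # a) (enc s @ enc t @ m) (1 # 1 # c)}"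
  by (rule E_mono, rule E_If1, simp, simp, rule E_Seq[OF pop_s2(2)], rule E_Seq[OF push_s2(1)[OF assms]],
    rule push_s2(3)) simp
 have 2: "E (mvl j) (s2 j z y b (2 # a) (enc s @ enc t @ m) (1 # 1 # c)) ((u + 20 * sz t) + 20 * sz s) Q"
  using Cn by (intro Cn.IH) simp
 show ?case
  using 2 unfolding mvl_def by (simp, intro E_mono[OF E_Whl1[OF _ _ 1]]) auto
qed

definition mvt :: "nat => com" where
 "mvt j = push 2 1 ;; mvl j"

lemma E_mvt:
 assumes "j = 0 \<or> j = 3"
 shows "E (mvt j) (s2 j z y b a (enc t @ m) []) (25 * sz t) {s2 j z y b (rev (enc t) @ a) m []}"
proof -
 have "E (mvl j) (s2 j z y b (rev (enc t) @ a) m []) 1 {s2 j z y b (rev (enc t) @ a) m []}"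
  unfolding mvl_def by (rule E_Whl2) auto
 note E_mvl[OF assms this]
 then show ?thesis
  unfolding mvt_def using sz_pos[of t] by (intro E_mono[OF E_Seq[OF push_s2(3)]]) auto
qed

definition xfer :: "nat => nat => com" where
 "xfer i j = Whl i {1, 2} (Ite i {2} (pop i ;; push j 2) (pop i ;; push j 1))"

text \<open>\<open>S a m\<close> abstracts the tapes as a function of the stacks on source and
  target, so that one induction covers all pairs of tapes used.\<close>

lemma E_xfer_loop:
 assumes "\<And>x a m. E (pop i) (S (x # a) m) 3 {S a m}" "\<And>x a m. E (push j x) (S a m) 3 {S a (x # m)}"
  and "\<And>x a m. read_tape (S (x # a) m ! i) = x" "\<And>m. read_tape (S [] m ! i) = 0"
   "\<And>a m. length (S a m) = k" "i < k"
  and "set a \<subseteq> {1, 2}"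
 shows "E (xfer i j) (S a m) (12 * length a + 1) {S [] (rev a @ m)}"
 using assms(7)
proof (induction a arbitrary: m)
 case Nil
 show ?case using E_Whl2[of "S [] m" i "{1, 2}"] unfolding xfer_def by (simp add: assms)
next
 case (Cons x a)
 then have "x = 1 \<or> x = 2" by auto
 then consider "x = 1" | "x = 2" by blast
 then have body: "E (Ite i {2} (pop i ;; push j 2) (pop i ;; push j 1)) (S (x # a) m) 8 {S a (x # m)}"
 proof cases
  case 1
  show ?thesis unfolding 1
   by (rule E_mono, rule E_If2, simp add: assms, simp add: assms, rule E_Seq[OF assms(1)], rule assms(2)) simp
 next
  case 2
  show ?thesis unfolding 2
   by (rule E_mono, rule E_If1, simp add: assms, simp add: assms, rule E_Seq[OF assms(1)], rule assms(2)) simp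
 qed
 have "E (xfer i j) (S a (x # m)) (12 * length a + 1) {S [] (rev (x # a) @ m)}"
  using Cons.IH[of "x # m"] Cons.prems by simp
 then show ?case
  using \<open>x = 1 \<or> x = 2\<close> unfolding xfer_def by (intro E_mono[OF E_Whl1[OF _ _ body]]) (auto simp: assms(3,4,5,6))
qed

lemma E_xfer_main: "j = 0 \<or> j = 3 ==> set a \<subseteq> {1, 2} ==>
  E (xfer j 1) (s2 j z y b a m c) (12 * length a + 1) {s2 j z y b [] (rev a @ m) c}"
 by (rule E_xfer_loop[of j "%a m. s2 j z y b a m c" 1 4]) (auto intro: push_s2 pop_s2)

lemma E_xfer30: "set b \<subseteq> {1, 2} ==> E (xfer 3 0) (st z a m c y b) (12 * length b + 1) {st z (rev b @ a) m c y []}"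
 by (rule E_xfer_loop[of 3 "%b a. st z a m c y b" 0 4]) (auto intro: push_st pop_st)

lemma E_xfer03: "set a \<subseteq> {1, 2} ==> E (xfer 0 3) (st z a m c y b) (12 * length a + 1) {st z [] m c y (rev a @ b)}"
 by (rule E_xfer_loop[of 0 "%a b. st z a m c y b" 3 4]) (auto intro: push_st pop_st)

definition clear :: com where
 "clear = Whl 0 {1, 2} (pop 0)"

lemma E_clear: "set a \<subseteq> {1, 2} ==> E clear (st z a m c y b) (5 * length a + 1) {st z [] m c y b}"
proof (induction a)
 case Nil
 show ?case using E_Whl2[of "st z [] m c y b" 0 "{1, 2}"] unfolding clear_def by simp
next
 case (Cons x a)
 then show ?case
  unfolding clear_def by (intro E_mono[OF E_Whl1[OF _ _ pop_st(1)]]) auto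
qed

definition copy :: com where
 "copy = Whl 0 {1, 2} (Ite 0 {2} (pop 0 ;; push 1 2 ;; push 3 2) (pop 0 ;; push 1 1 ;; push 3 1))"

lemma E_copy:
 "set a \<subseteq> {1, 2} ==> E copy (st z a m c y b) (15 * length a + 1) {st z [] (rev a @ m) c y (rev a @ b)}"
proof (induction a arbitrary: m b)
 case Nil
 show ?case using E_Whl2[of "st z [] m c y b" 0 "{1, 2}"] unfolding copy_def by simp
next
 case (Cons x a)
 then have "x = 1 \<or> x = 2" by auto
 then consider "x = 1" | "x = 2" by blast
 then have body: "E (Ite 0 {2} (pop 0 ;; push 1 2 ;; push 3 2) (pop 0 ;; push 1 1 ;; push 3 1))
   (st z (x # a) m c y b) 12 {st z a (x # m) c y (x # b)}"
 proof cases
  case 1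
  show ?thesis unfolding 1
   by (rule E_mono, rule E_If2, simp, simp, rule E_Seq[OF pop_st(1)], rule E_Seq[OF push_st(2)], rule push_st(4)) simp
 next
  case 2
  show ?thesis unfolding 2
   by (rule E_mono, rule E_If1, simp, simp, rule E_Seq[OF pop_st(1)], rule E_Seq[OF push_st(2)], rule push_st(4)) simp
 qed
 have "E copy (st z a (x # m) c y (x # b)) (15 * length a + 1) {st z [] (rev (x # a) @ m) c y (rev (x # a) @ b)}"
  using Cons.IH[of "x # m" "x # b"] Cons.prems by simp
 then show ?case
  using \<open>x = 1 \<or> x = 2\<close> unfolding copy_def by (intro E_mono[OF E_Whl1[OF _ _ body]]) auto
qed

abbreviation ms :: "int => int => nat list => tape list" where
 "ms z y m \<equiv> st z [] m [] y []"

definition drop_op :: com where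
 "drop_op = mvt 0 ;; clear"

definition dup_op :: com where
 "dup_op = mvt 0 ;; copy ;; xfer 3 0 ;; xfer 0 1"

definition swap_op :: com where
 "swap_op = mvt 0 ;; mvt 3 ;; xfer 0 1 ;; xfer 3 1"

lemmas E_mvt0 = E_mvt[of 0, unfolded s2_def, simplified]
lemmas E_mvt3 = E_mvt[of 3, unfolded s2_def, simplified]
lemmas E_xfer01 = E_xfer_main[of 0, unfolded s2_def, simplified]
lemmas E_xfer31 = E_xfer_main[of 3, unfolded s2_def, simplified]

lemma E_drop: "E drop_op (ms z y (enc t @ m)) (40 * sz t) {ms z y m}"
proof -
 have 1: "E (mvt 0) (ms z y (enc t @ m)) (25 * sz t) {st z (rev (enc t)) m [] y []}"
  using E_mvt0[where a = "[]" and b = "[]"] by simp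
 have 2: "E clear (st z (rev (enc t)) m [] y []) (5 * sz t + 1) {ms z y m}"
  using E_clear[of "rev (enc t)"] enc_symbols[of t] by simp
 show ?thesis
  unfolding drop_op_def using sz_pos[of t] by (intro E_mono[OF E_Seq[OF 1 2]]) linarith
qed

lemma E_dup: "E dup_op (ms z y (enc t @ m)) (100 * sz t) {ms z y (enc t @ enc t @ m)}"
proof -
 have 1: "E copy (st z (rev (enc t)) m [] y []) (15 * sz t + 1) {st z [] (enc t @ m) [] y (enc t)}"
  using E_copy[where a = "rev (enc t)" and b = "[]"] enc_symbols[of t] by simp
 have 2: "E (xfer 3 0) (st z [] (enc t @ m) [] y (enc t)) (12 * sz t + 1) {st z (rev (enc t)) (enc t @ m) [] y []}"
  using E_xfer30[where b = "enc t" and a = "[]"] enc_symbols[of t] by simp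
 have 3: "E (xfer 0 1) (st z (rev (enc t)) (enc t @ m) [] y []) (12 * sz t + 1) {ms z y (enc t @ enc t @ m)}"
  using E_xfer01[where a = "rev (enc t)"] enc_symbols[of t] by simp
 show ?thesis
  unfolding dup_op_def using E_mvt0[where a = "[]" and b = "[]"] sz_pos[of t]
  by (intro E_mono[OF E_Seq[OF _ E_Seq[OF 1 E_Seq[OF 2 3]]]]) auto
qed

lemma E_swap: "E swap_op (ms z y (enc s @ enc t @ m)) (100 * (sz s + sz t)) {ms z y (enc t @ enc s @ m)}"
proof -
 have 3: "E (xfer 0 1) (st z (rev (enc s)) m [] y (rev (enc t))) (12 * sz s + 1) {st z [] (enc s @ m) [] y (rev (enc t))}"
  using E_xfer01[where a = "rev (enc s)"] enc_symbols[of s] by simp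
 have 4: "E (xfer 3 1) (st z [] (enc s @ m) [] y (rev (enc t))) (12 * sz t + 1) {ms z y (enc t @ enc s @ m)}"
  using E_xfer31[where a = "rev (enc t)"] enc_symbols[of t] by simp
 have 1: "E (mvt 0) (ms z y (enc s @ enc t @ m)) (25 * sz s) {st z (rev (enc s)) (enc t @ m) [] y []}"
  using E_mvt0[where a = "[]" and b = "[]" and t = s] by simp
 have 2: "E (mvt 3) (st z (rev (enc s)) (enc t @ m) [] y []) (25 * sz t) {st z (rev (enc s)) m [] y (rev (enc t))}"
  using E_mvt3[where a = "[]" and b = "rev (enc s)" and t = t] by simp
 show ?thesis
  unfolding swap_op_def using sz_pos[of t] sz_pos[of s]
  by (intro E_mono[OF E_Seq[OF 1 E_Seq[OF 2 E_Seq[OF 3 4]]]]) (simp add: One_nat_def)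
qed

fun bt :: "bool list => tree" where
 "bt [] = Nl"
| "bt (b # w) = Cn (if b then Cn Nl Nl else Nl) (bt w)"

text \<open>The list is built from its end, hence the word is first reversed by a transfer to tape
  3.\<close>

definition input_op :: com where
 "input_op = xfer 0 3 ;; push 1 1 ;; Whl 3 {1, 2}
   (Ite 3 {2} (pop 3 ;; push 1 1 ;; push 1 1 ;; push 1 2 ;; push 1 2) (pop 3 ;; push 1 1 ;; push 1 2))"

lemma symb_mem [simp]: "symb b = 1 \<or> symb b = 2" "symb ` A \<subseteq> {1, 2}"
 by (auto simp: symb_def)

lemma E_input: "E input_op (st z (map symb w) [] [] y []) (50 * length w + 10) {ms z y (enc (bt w))}"
proof -
 define body where "body = Ite 3 {2} (pop 3 ;; push 1 1 ;; push 1 1 ;; push 1 2 ;; push 1 2) (pop 3 ;; push 1 1 ;; push 1 2)"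
 have 1: "E body (st z [] m [] y (symb x # b)) 20 {st z [] (2 # enc (if x then Cn Nl Nl else Nl) @ m) [] y b}" for x b m
 proof (cases x)
  case True
  show ?thesis unfolding body_def
   by (rule E_mono, rule E_If1, simp add: True symb_def, simp, rule E_Seq[OF pop_st(4)], rule E_Seq[OF push_st(2)],
     rule E_Seq[OF push_st(2)], rule E_Seq[OF push_st(2)], simp add: True, rule push_st(2)[simplified]) simp
 next
  case False
  show ?thesis unfolding body_def
   by (rule E_mono, rule E_If2, simp add: False symb_def, simp, rule E_Seq[OF pop_st(4)], rule E_Seq[OF push_st(2)],
     simp add: False, rule push_st(2)[simplified]) simp
 qed
 have 2: "E (Whl 3 {1, 2} body) (st z [] (enc (bt v)) [] y (map symb u)) (30 * length u + 1) {ms z y (enc (bt (rev u @ v)))}" for u v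
 proof (induction u arbitrary: v)
  case Nil
  show ?case using E_Whl2[of "ms z y (enc (bt v))" 3 "{1, 2}"] by simp
 next
  case (Cons x u)
  have "E (Whl 3 {1, 2} body) (st z [] (2 # enc (if x then Cn Nl Nl else Nl) @ enc (bt v)) [] y (map symb u))
    (30 * length u + 1) {ms z y (enc (bt (rev (x # u) @ v)))}"
   using Cons[of "x # v"] by simp
  then show ?case
   by (simp, intro E_mono[OF E_Whl1[OF _ _ 1]]) auto
 qed
 have 3: "E (xfer 0 3) (st z (map symb w) [] [] y []) (12 * length w + 1) {st z [] [] [] y (map symb (rev w))}"
  using E_xfer03[where a = "map symb w" and b = "[]"] by (auto simp: rev_map)
 show ?thesis
  unfolding input_op_def body_def[symmetric]
  using 2[of "[]" "rev w"] by (intro E_mono[OF E_Seq[OF 3 E_Seq[OF push_st(2)]]]) auto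
qed

definition output_op :: com where
 "output_op = Whl 1 {2} (pop 1 ;; Ite 1 {2} (pop 1 ;; pop 1 ;; pop 1 ;; push 0 2) (pop 1 ;; push 0 1) ;; Mv 3 Go_Right) ;;
   xfer 0 3"

text \<open>Tape 3 stays empty while its head moves right once per letter, so its bottom ends at
  \<open>length w\<close>; by \<open>word_stk\<close> the stack then placed on it is the word
  starting at cell 0.\<close>

lemma E_output: "E output_op (ms z 0 (enc (bt w))) (60 * length w + 10)
  {st z [] [1] [] (int (length w)) (map symb w)}"
proof -
 define body where "body = pop 1 ;; Ite 1 {2} (pop 1 ;; pop 1 ;; pop 1 ;; push 0 2) (pop 1 ;; push 0 1) ;; Mv 3 Go_Right"
 have mv: "E (Mv 3 Go_Right) (st z a m c y []) 1 {st z a m c (y + 1) []}" for a m c y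
  using E_Mv[of 3 "st z a m c y []" Go_Right] by (simp add: shift_stk) (simp add: st_def One_nat_def shift_stk[simplified])
 have 1: "E body (st z a (enc (bt (x # v))) [] y []) 30 {st z (symb x # a) (enc (bt v)) [] (y + 1) []}" for x v a y
 proof (cases x)
  case True
  have "E (Ite 1 {2} (pop 1 ;; pop 1 ;; pop 1 ;; push 0 2) (pop 1 ;; push 0 1)) (st z a (2 # 1 # 1 # enc (bt v)) [] y [])
    16 {st z (symb x # a) (enc (bt v)) [] y []}"
   by (rule E_mono, rule E_If1, simp, simp, rule E_Seq[OF pop_st(2)], rule E_Seq[OF pop_st(2)],
     rule E_Seq[OF pop_st(2)], simp add: True symb_def, rule push_st) simp
  then show ?thesis
   unfolding body_def using True by (intro E_mono[OF E_Seq[OF _ E_Seq[OF _ mv]]]) (auto intro: pop_st)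
 next
  case False
  have "E (Ite 1 {2} (pop 1 ;; pop 1 ;; pop 1 ;; push 0 2) (pop 1 ;; push 0 1)) (st z a (1 # enc (bt v)) [] y [])
    16 {st z (symb x # a) (enc (bt v)) [] y []}"
   by (rule E_mono, rule E_If2, simp, simp, rule E_Seq[OF pop_st(2)], simp add: False symb_def, rule push_st) simp
  then show ?thesis
   unfolding body_def using False by (intro E_mono[OF E_Seq[OF _ E_Seq[OF _ mv]]]) (auto intro: pop_st)
 qed
 have 2: "E (Whl 1 {2} body) (st z a (enc (bt v)) [] y []) (40 * length v + 1)
   {st z (rev (map symb v) @ a) [1] [] (y + int (length v)) []}" for a v y
 proof (induction v arbitrary: a y)
  case Nil
  show ?case using E_Whl2[of "st z a [1] [] y []" 1 "{2}"] by simp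
 next
  case (Cons x v)
  have "E (Whl 1 {2} body) (st z (symb x # a) (enc (bt v)) [] (y + 1) []) (40 * length v + 1)
    {st z (rev (map symb (x # v)) @ a) [1] [] (y + int (length (x # v))) []}"
   using Cons[of "symb x # a" "y + 1"] by (simp add: add_ac)
  then show ?case
   by (intro E_mono[OF E_Whl1[OF _ _ 1]]) auto
 qed
 have 3: "E (xfer 0 3) (st z (rev (map symb w)) [1] [] (int (length w)) []) (12 * length w + 1)
   {st z [] [1] [] (int (length w)) (map symb w)}"
  using E_xfer03[where a = "rev (map symb w)" and b = "[]"] by auto
 show ?thesis
  unfolding output_op_def body_def[symmetric]
  using 2[of "[]" w 0] by (intro E_mono[OF E_Seq[OF _ 3]]) auto
qed

declare One_nat_def [simp]

lemma st_nth_Suc [simp]: "st z a m c y b ! Suc 0 = stk 0 m"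
 using st_nth(3) by simp

section \<open>Polynomially bounded functions\<close>

text \<open>Bounds of the form \<open>D x ^ k\<close> with \<open>D x \<ge> 2\<close> absorb
  constants and sums into the exponent. \<open>D x\<close> is \<open>sz x + 1\<close> for polynomial
  time and an exponential function of the input length for \<open>NEXPTIME\<close>.\<close>

definition pbd :: "('a => nat) => ('a => nat) => bool" where
 "pbd D q \<longleftrightarrow> (\<exists>k. \<forall>x. q x \<le> D x ^ k)"

lemma pbd_le: "pbd D q ==> (\<And>x. p x \<le> q x) ==> pbd D p"
 unfolding pbd_def by (meson le_trans)

lemma pbd_self: "pbd D D"
 unfolding pbd_def by (intro exI[of _ 1]) simp

lemma less_exp: "(c::nat) \<le> d ^ c" if "d \<ge> 2"
proof -
 have "c \<le> 2 ^ c" by simp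
 also have "\<dots> \<le> d ^ c" using that by (intro power_mono) auto
 finally show ?thesis .
qed

lemma pbd_const:
 assumes "\<And>x. D x \<ge> 2"
 shows "pbd D (%_. c)"
 unfolding pbd_def using less_exp[OF assms] by blast

lemma pbd_mult: "pbd D p ==> pbd D q ==> pbd D (%x. p x * q x)"
proof -
 assume "pbd D p" "pbd D q"
 then obtain k l where "\<And>x. p x \<le> D x ^ k" "\<And>x. q x \<le> D x ^ l"
  unfolding pbd_def by blast
 then have "p x * q x \<le> D x ^ (k + l)" for x
  unfolding power_add by (intro mult_mono) auto
 then show ?thesis unfolding pbd_def by blast
qed

lemma pbd_add:
 assumes "\<And>x. D x \<ge> 2" "pbd D p" "pbd D q"
 shows "pbd D (%x. p x + q x)"
proof -
 obtain k l where kl: "\<And>x. p x \<le> D x ^ k" "\<And>x. q x \<le> D x ^ l"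
  using assms unfolding pbd_def by blast
 have "p x + q x \<le> D x ^ Suc (k + l)" for x
 proof -
  have "D x ^ k \<le> D x ^ (k + l)" "D x ^ l \<le> D x ^ (k + l)"
   using assms(1)[of x] by (auto intro!: power_increasing)
  then have "p x + q x \<le> 2 * D x ^ (k + l)"
   using kl[of x] by linarith
  also have "\<dots> \<le> D x * D x ^ (k + l)" using assms(1)[of x] by (rule mult_right_mono) simp
  finally show ?thesis by simp
 qed
 then show ?thesis unfolding pbd_def by blast
qed

lemma pbd_power:
 assumes "pbd D p"
 shows "pbd D (%x. p x ^ n)"
proof -
 obtain k where "\<And>x. p x \<le> D x ^ k" using assms unfolding pbd_def by blast
 then have "p x ^ n \<le> D x ^ (k * n)" for x
  unfolding power_mult by (intro power_mono) auto
 then show ?thesis unfolding pbd_def by blast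
qed

lemma pbd_comp:
 assumes "pbd D p" "pbd D' (%x. D (f x))"
 shows "pbd D' (%x. p (f x))"
proof -
 obtain k where "\<And>x. p x \<le> D x ^ k" using assms unfolding pbd_def by blast
 then show ?thesis using pbd_le[OF pbd_power[OF assms(2), of k], of "%x. p (f x)"] by blast
qed

definition pb :: "(tree => nat) => bool" where
 "pb = pbd (%x. sz x + 1)"

lemma sz1: "2 \<le> sz x + 1"
 using sz_pos[of x] by simp

lemma pb_sz: "pb sz"
 unfolding pb_def by (rule pbd_le[OF pbd_self]) simp

lemmas pb_le = pbd_le[of "%x. sz x + 1", folded pb_def]
lemmas pb_const = pbd_const[of "%x. sz x + 1", OF sz1, folded pb_def]
lemmas pb_mult = pbd_mult[of "%x. sz x + 1", folded pb_def]
lemmas pb_add = pbd_add[of "%x. sz x + 1", OF sz1, folded pb_def]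
lemmas pb_power = pbd_power[of "%x. sz x + 1", folded pb_def]

lemma pb_Suc: "pb p ==> pb (%x. Suc (p x))"
 using pb_add[OF _ pb_const[of 1]] by simp

lemmas pb_intros = pb_add pb_mult pb_const pb_Suc pb_sz pb_power

lemma pb_comp: "pb p ==> pb (%x. sz (f x)) ==> pb (%x. p (f x))"
 unfolding pb_def by (rule pbd_comp[where D = "%x. sz x + 1"]) (assumption, fold pb_def, (intro pb_intros)?, (assumption | intro pb_intros)+)

section \<open>Polynomial-time functions on trees\<close>

text \<open>The argument on top of the main stack is replaced by the value; whatever lies below, and
  the bottoms of the two outer tapes, are arbitrary. This is what makes programs compose.\<close>

definition computes :: "com => (tree => tree) => (tree => nat) => bool" where
 "computes c f T \<longleftrightarrow> wfc 4 c & altfree c &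
   (\<forall>z y m x. E c (ms z y (enc x @ m)) (T x) {ms z y (enc (f x) @ m)})"

text \<open>The bound on the size of the value is carried along because the running time of an outer
  function is a polynomial in it.\<close>

definition FP :: "(tree => tree) => bool" where
 "FP f \<longleftrightarrow> (\<exists>c T. computes c f T & pb T & pb (%x. sz (f x)))"

lemma FP_I: "computes c f T ==> pb T ==> pb (%x. sz (f x)) ==> FP f"
 unfolding FP_def by blast

lemma FP_size: "FP f ==> pb (%x. sz (f x))"
 unfolding FP_def by blast

lemma wf_basic [simp]:
 "j < 4 ==> s < 3 ==> wfc 4 (push j s)" "j < 4 ==> wfc 4 (pop j)" "altfree (push j s)" "altfree (pop j)"
 "wfc 4 drop_op" "altfree drop_op" "wfc 4 dup_op" "altfree dup_op" "wfc 4 swap_op" "altfree swap_op"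
 "wfc 4 input_op" "altfree input_op" "wfc 4 output_op" "altfree output_op"
 by (auto simp: push_def pop_def drop_op_def dup_op_def swap_op_def mvt_def mvl_def clear_def copy_def xfer_def
   input_op_def output_op_def)

lemma FP_id: "FP (%x. x)"
 by (rule FP_I[of Skip _ "%_. 0"]) (auto simp: computes_def intro: E_Skip pb_intros)

lemma FP_comp:
 assumes "FP g" "FP f"
 shows "FP (%x. g (f x))"
proof -
 obtain c T d U where *: "computes c f T" "pb T" "computes d g U" "pb U"
  using assms unfolding FP_def by blast
 have "computes (c ;; d) (%x. g (f x)) (%x. Suc (T x + U (f x)))"
  using *(1,3) unfolding computes_def by (auto intro!: E_Seq)
 then show ?thesis
  by (rule FP_I) (intro pb_intros * pb_comp[OF *(4)] FP_size assms pb_comp[OF FP_size[OF assms(1)]])+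
qed

lemma FP_Nl: "FP (%_. Nl)"
proof (rule FP_I)
 show "computes (drop_op ;; push 1 1) (%_. Nl) (%x. Suc (40 * sz x + 3))"
  unfolding computes_def using E_Seq[OF E_drop push_st(2)] by auto
qed (intro pb_intros)+

lemma FP_Cn:
 assumes "FP f" "FP g"
 shows "FP (%x. Cn (f x) (g x))"
proof -
 obtain c T d U where *: "computes c f T" "pb T" "computes d g U" "pb U"
  using assms unfolding FP_def by blast
 show ?thesis
 proof (rule FP_I)
  show "computes (dup_op ;; c ;; swap_op ;; d ;; swap_op ;; push 1 2) (%x. Cn (f x) (g x))
    (%x. Suc (100 * sz x + Suc (T x + Suc (100 * (sz (f x) + sz x) + Suc (U x + Suc (100 * (sz (g x) + sz (f x)) + 3))))))"
   unfolding computes_def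
  proof (intro conjI allI)
   fix z y m x
   have 1: "E c (ms z y (enc x @ enc x @ m)) (T x) {ms z y (enc (f x) @ enc x @ m)}"
    and 2: "E d (ms z y (enc x @ enc (f x) @ m)) (U x) {ms z y (enc (g x) @ enc (f x) @ m)}"
    using * unfolding computes_def by auto
   show "E (dup_op ;; c ;; swap_op ;; d ;; swap_op ;; push 1 2) (ms z y (enc x @ m))
    (Suc (100 * sz x + Suc (T x + Suc (100 * (sz (f x) + sz x) + Suc (U x + Suc (100 * (sz (g x) + sz (f x)) + 3))))))
    {ms z y (enc (Cn (f x) (g x)) @ m)}"
    using E_Seq[OF E_dup E_Seq[OF 1 E_Seq[OF E_swap E_Seq[OF 2 E_Seq[OF E_swap push_st(2)[of 2]]]]]]
    by simp
  qed (use * in \<open>auto simp: computes_def\<close>)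
 qed (auto intro!: pb_intros *(2,4) FP_size[OF assms(1)] FP_size[OF assms(2)])
qed

lemma FP_const: "FP (%_. t)"
 by (induction t) (auto intro: FP_Nl FP_Cn)

fun th :: "tree => tree" where
 "th Nl = Nl" | "th (Cn a b) = a"

fun tt :: "tree => tree" where
 "tt Nl = Nl" | "tt (Cn a b) = b"

lemma sz_th: "sz (th t) \<le> sz t" and sz_tt: "sz (tt t) \<le> sz t"
 by (cases t; simp)+

lemma FP_th0: "FP th"
proof (rule FP_I)
 show "computes (Ite 1 {2} (pop 1 ;; swap_op ;; drop_op) Skip) th (%x. 200 * sz x + 10)"
  unfolding computes_def
 proof (intro conjI allI)
  fix z y m x
  show "E (Ite 1 {2} (pop 1 ;; swap_op ;; drop_op) Skip) (ms z y (enc x @ m)) (200 * sz x + 10) {ms z y (enc (th x) @ m)}"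
  proof (cases x)
   case Nl
   then show ?thesis by (auto intro!: E_mono[OF E_If2[OF _ _ E_Skip[of _ 0]]])
  next
   case (Cn a b)
   have "E (Ite 1 {2} (pop 1 ;; swap_op ;; drop_op) Skip) (ms z y (2 # enc a @ enc b @ m))
     (Suc (Suc (3 + Suc (100 * (sz a + sz b) + 40 * sz b)))) {ms z y (enc a @ m)}"
    by (rule E_If1[OF _ _ E_Seq[OF pop_st(2) E_Seq[OF E_swap E_drop]]]) auto
   then show ?thesis unfolding Cn by (auto elim!: E_mono)
  qed
 qed auto
 show "pb (%x. sz (th x))" by (rule pb_le[OF pb_sz]) (rule sz_th)
qed (intro pb_intros)

lemma FP_tt0: "FP tt"
proof (rule FP_I)
 show "computes (Ite 1 {2} (pop 1 ;; drop_op) Skip) tt (%x. 200 * sz x + 10)"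
  unfolding computes_def
 proof (intro conjI allI)
  fix z y m x
  show "E (Ite 1 {2} (pop 1 ;; drop_op) Skip) (ms z y (enc x @ m)) (200 * sz x + 10) {ms z y (enc (tt x) @ m)}"
  proof (cases x)
   case Nl
   then show ?thesis by (auto intro!: E_mono[OF E_If2[OF _ _ E_Skip[of _ 0]]])
  next
   case (Cn a b)
   have "E (Ite 1 {2} (pop 1 ;; drop_op) Skip) (ms z y (2 # enc a @ enc b @ m))
     (Suc (Suc (3 + 40 * sz a))) {ms z y (enc b @ m)}"
    by (rule E_If1[OF _ _ E_Seq[OF pop_st(2) E_drop]]) auto
   then show ?thesis unfolding Cn by (auto elim!: E_mono)
  qed
 qed auto
 show "pb (%x. sz (tt x))" by (rule pb_le[OF pb_sz]) (rule sz_tt)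
qed (intro pb_intros)

lemmas FP_th = FP_comp[OF FP_th0] and FP_tt = FP_comp[OF FP_tt0]

lemma FP_if_tree:
 assumes "FP b" "FP f" "FP g"
 shows "FP (%x. if b x ~= Nl then f x else g x)"
proof -
 obtain c T d U e V where *: "computes c f T" "pb T" "computes d g U" "pb U" "computes e b V" "pb V"
  using assms unfolding FP_def by blast
 let ?c = "dup_op ;; e ;; Ite 1 {2} (drop_op ;; c) (drop_op ;; d)"
 let ?T = "%x. 100 * sz x + V x + 40 * sz (b x) + T x + U x + 10"
 show ?thesis
 proof (rule FP_I)
  show "computes ?c (%x. if b x ~= Nl then f x else g x) ?T"
   unfolding computes_def
  proof (intro conjI allI)
   fix z y m x
   have 1: "E e (ms z y (enc x @ enc x @ m)) (V x) {ms z y (enc (b x) @ enc x @ m)}"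
    and 2: "E c (ms z y (enc x @ m)) (T x) {ms z y (enc (f x) @ m)}"
    and 3: "E d (ms z y (enc x @ m)) (U x) {ms z y (enc (g x) @ m)}"
    using * unfolding computes_def by auto
   have "E (Ite 1 {2} (drop_op ;; c) (drop_op ;; d)) (ms z y (enc (b x) @ enc x @ m))
     (Suc (Suc (40 * sz (b x) + (T x + U x)))) {ms z y (enc (if b x ~= Nl then f x else g x) @ m)}"
   proof (cases "b x = Nl")
    case True
    then show ?thesis
     using E_If2[OF _ _ E_Seq[OF E_drop[where t = "b x"] E_mono[OF 3]], of 1 "{2}"] by auto
   next
    case False
    then show ?thesis
     using E_If1[OF _ _ E_Seq[OF E_drop[where t = "b x"] E_mono[OF 2]], of 1 "{2}"] by (cases "b x") auto
   qed
   then show "E ?c (ms z y (enc x @ m)) (?T x) {ms z y (enc (if b x ~= Nl then f x else g x) @ m)}"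
    by (intro E_mono[OF E_Seq[OF E_dup E_Seq[OF 1]]]) auto
  qed (use * in \<open>auto simp: computes_def\<close>)
  show "pb (%x. sz (if b x ~= Nl then f x else g x))"
   by (rule pb_le[OF pb_add[OF FP_size[OF assms(2)] FP_size[OF assms(3)]]]) auto
 qed (auto intro!: pb_intros * FP_size[OF assms(1)])
qed

subsection \<open>Folding over the tails of a list\<close>

text \<open>A tree is read as a list of trees; \<open>foldt\<close> hands the step function the whole remaining list.\<close>

fun foldt :: "(tree => tree) => tree => tree => tree" where
 "foldt h Nl S = S"
| "foldt h (Cn a L) S = foldt h L (h (Cn (Cn a L) S))"

text \<open>All arguments handed to the step during the fold, and the final pair; a common bound on
  their sizes bounds the time of every iteration.\<close>

fun vis :: "(tree => tree) => tree => tree => tree set" where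
 "vis h Nl S = {Cn Nl S}"
| "vis h (Cn a L) S = insert (Cn (Cn a L) S) (vis h L (h (Cn (Cn a L) S)))"

text \<open>Between iterations list and accumulator are two separate trees, so that the top symbol
  tells whether the list is exhausted; the pushed 2 joins them into one argument, and the
  \<open>pop 1\<close> at the end of the loop body splits the result again.\<close>

definition foldc :: "com => com" where
 "foldc c = Ite 1 {2} (pop 1 ;; Whl 1 {2} (push 1 2 ;; c ;; pop 1) ;; pop 1) Skip"

lemma E_foldc:
 assumes "computes c (%x. Cn (tt (th x)) (h x)) T" "\<And>v. v \<in> vis h (th x) (tt x) ==> T v \<le> B"
 shows "E (foldc c) (ms z y (enc x @ m)) ((B + 20) * sz x + 20) {ms z y (enc (foldt h (th x) (tt x)) @ m)}"
proof -
 have loop: "E (Whl 1 {2} (push 1 2 ;; c ;; pop 1)) (ms z y (enc L @ enc S @ m)) ((B + 20) * sz L)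
   {ms z y (1 # enc (foldt h L S) @ m)}" if "\<And>v. v \<in> vis h L S ==> T v \<le> B" for L S
  using that
 proof (induction L arbitrary: S)
  case Nl
  show ?case using E_mono[OF E_Whl2[of "ms z y (1 # enc S @ m)" 1 "{2}"]] by auto
 next
  case (Cn a L)
  let ?x = "Cn (Cn a L) S"
  have "E c (ms z y (enc ?x @ m)) (T ?x) {ms z y (enc (Cn L (h ?x)) @ m)}"
   using assms(1) unfolding computes_def by (metis th.simps(2) tt.simps(2))
  then have "E c (ms z y (2 # enc (Cn a L) @ enc S @ m)) B {ms z y (2 # enc L @ enc (h ?x) @ m)}"
   using Cn.prems[of ?x] by (auto elim: E_mono)
  from E_Seq[OF push_st(2) E_Seq[OF this pop_st(2)]]
  have 1: "E (push 1 2 ;; c ;; pop 1) (ms z y (enc (Cn a L) @ enc S @ m)) (Suc (3 + Suc (B + 3)))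
    {ms z y (enc L @ enc (h ?x) @ m)}" .
  have "B + 20 \<le> (B + 20) * sz a" using sz_pos[of a] by (simp add: mult_le_cancel1)
  then show ?case
   using Cn.IH[of "h ?x"] Cn.prems by (intro E_mono[OF E_Whl1[OF _ _ 1]]) (auto simp: algebra_simps)
 qed
 show ?thesis
 proof (cases x)
  case Nl
  then show ?thesis unfolding foldc_def by (auto intro!: E_mono[OF E_If2[OF _ _ E_Skip[of _ 0]]])
 next
  case (Cn L S)
  have "E (foldc c) (ms z y (2 # enc L @ enc S @ m)) (Suc (Suc (3 + Suc ((B + 20) * sz L + 3))))
    {ms z y (enc (foldt h L S) @ m)}"
   unfolding foldc_def
   by (rule E_If1[OF _ _ E_Seq[OF pop_st(2) E_Seq[OF loop pop_st(2)]]]) (use assms Cn in auto)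
  then show ?thesis unfolding Cn by (auto elim!: E_mono simp: algebra_simps)
 qed
qed

lemma foldt_in_vis: "Cn Nl (foldt h L S) \<in> vis h L S"
 by (induction L arbitrary: S) auto

lemma FP_foldt:
 assumes "FP h" "FP L" "FP S" "pb q" "\<And>x v. v \<in> vis h (L x) (S x) ==> sz v \<le> q x"
 shows "FP (%x. foldt h (L x) (S x))"
proof -
 have "FP (%x. Cn (tt (th x)) (h x))"
  by (intro FP_Cn assms(1) FP_tt FP_th0)
 then obtain c T where c: "computes c (%x. Cn (tt (th x)) (h x)) T" "pb T"
  unfolding FP_def by blast
 then obtain k where k: "T v \<le> (sz v + 1) ^ k" for v
  unfolding pb_def pbd_def by blast
 have "FP (%x. Cn (L x) (S x))" by (intro FP_Cn assms)
 then obtain d U where d: "computes d (%x. Cn (L x) (S x)) U" "pb U" "pb (%x. sz (Cn (L x) (S x)))"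
  unfolding FP_def by blast
 show ?thesis
 proof (rule FP_I)
  show "computes (d ;; foldc c) (%x. foldt h (L x) (S x))
    (%x. Suc (U x + (((q x + 1) ^ k + 20) * sz (Cn (L x) (S x)) + 20)))"
   unfolding computes_def
  proof (intro conjI allI)
   fix z y m x
   have "T v \<le> (q x + 1) ^ k" if "v \<in> vis h (L x) (S x)" for v
    using k[of v] power_mono[of "sz v + 1" "q x + 1" k] assms(5)[OF that] by simp
   then have "E (foldc c) (ms z y (enc (Cn (L x) (S x)) @ m)) (((q x + 1) ^ k + 20) * sz (Cn (L x) (S x)) + 20)
     {ms z y (enc (foldt h (L x) (S x)) @ m)}"
    using E_foldc[OF c(1), of "Cn (L x) (S x)" "(q x + 1) ^ k"] by simp
   then show "E (d ;; foldc c) (ms z y (enc x @ m)) (Suc (U x + (((q x + 1) ^ k + 20) * sz (Cn (L x) (S x)) + 20)))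
     {ms z y (enc (foldt h (L x) (S x)) @ m)}"
    using d(1) unfolding computes_def by (intro E_Seq) auto
  qed (use c(1) d(1) in \<open>auto simp: computes_def foldc_def\<close>)
  show "pb (%x. sz (foldt h (L x) (S x)))"
  proof (rule pb_le[OF assms(4)])
   fix x show "sz (foldt h (L x) (S x)) \<le> q x"
    using assms(5)[OF foldt_in_vis[of h "L x" "S x"]] by simp
  qed
 qed (intro pb_intros assms(4) d)+
qed

lemma vis_bound:
 assumes "I S" "\<And>L' S'. I S' ==> sz L' \<le> n ==> I (h (Cn L' S')) & sz (h (Cn L' S')) \<le> sz S' + r"
  and "sz L \<le> n" "v \<in> vis h L S"
 shows "sz v \<le> sz L + sz S + 1 + sz L * r"
 using assms(1,3,4)
proof (induction L arbitrary: S)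
 case (Cn a L)
 let ?S = "h (Cn (Cn a L) S)"
 have *: "I ?S" "sz ?S \<le> sz S + r" using assms(2) Cn.prems by auto
 consider "v = Cn (Cn a L) S" | "v \<in> vis h L ?S" using Cn.prems by auto
 then show ?case
 proof cases
  case 2
  have "sz v \<le> sz L + sz ?S + 1 + sz L * r" using Cn.IH(2)[OF *(1) _ 2] Cn.prems by simp
  then show ?thesis using * by (simp add: algebra_simps)
 qed simp
qed simp

text \<open>Iterating a polynomial-time step need not stay polynomial. As in Cobham's bounded
  recursion a size condition is imposed: under an invariant \<open>I\<close> every step adds at most
  \<open>r x\<close>, so sizes grow only linearly with the number of steps.\<close>

lemma FP_fold:
 assumes "FP h" "FP L" "FP S" "pb r"
  and "\<And>x. I x (S x)"
  and "\<And>x L' S'. I x S' ==> sz L' \<le> sz (L x) ==> I x (h (Cn L' S')) & sz (h (Cn L' S')) \<le> sz S' + r x"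
 shows "FP (%x. foldt h (L x) (S x))"
proof (rule FP_foldt[OF assms(1-3)])
 show "pb (%x. sz (L x) + sz (S x) + 1 + sz (L x) * r x)"
  by (intro pb_intros FP_size assms)
 fix x v assume v: "v \<in> vis h (L x) (S x)"
 show "sz v \<le> sz (L x) + sz (S x) + 1 + sz (L x) * r x"
  by (rule vis_bound[of "I x", OF assms(5) assms(6) order.refl v])
qed

section \<open>List operations as folds\<close>

fun rva :: "tree => tree => tree" where
 "rva Nl S = S"
| "rva (Cn a L) S = rva L (Cn a S)"

lemma rva_foldt: "rva L S = foldt (%v. Cn (th (th v)) (tt v)) L S"
 by (induction L arbitrary: S) auto

lemma FP_rva:
 assumes "FP L" "FP S"
 shows "FP (%x. rva (L x) (S x))"
 unfolding rva_foldt
proof (rule FP_fold[where I = "%_ _. True" and r = "%x. sz (L x) + 1"])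
 fix x L' S' assume "sz L' \<le> sz (L x)"
 then show "True & sz (Cn (th (th (Cn L' S'))) (tt (Cn L' S'))) \<le> sz S' + (sz (L x) + 1)"
  using sz_th[of L'] by simp
qed (intro FP_Cn FP_th FP_tt FP_id assms pb_intros FP_size TrueI)+

definition app :: "tree => tree => tree" where
 "app L M = rva (rva L Nl) M"

lemma FP_app: "FP L ==> FP M ==> FP (%x. app (L x) (M x))"
 unfolding app_def by (intro FP_rva FP_const)

lemma rva_rva: "rva (rva L M) N = rva M (app L N)"
 unfolding app_def
proof (induction L arbitrary: M N)
 case (Cn a L)
 have "rva (rva (Cn a L) M) N = rva (Cn a M) (rva (rva L Nl) N)"
  by (simp only: rva.simps(2) Cn(2)[of "Cn a M"])
 moreover have "rva (rva (Cn a L) Nl) N = Cn a (rva (rva L Nl) N)"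
  by (simp only: rva.simps Cn(2)[of "Cn a Nl"])
 ultimately show ?case by (simp only: rva.simps)
qed simp

lemma app_simps [simp]: "app Nl M = M" "app (Cn a L) M = Cn a (app L M)"
proof -
 show "app (Cn a L) M = Cn a (app L M)"
  unfolding app_def[of "Cn a L"] using rva_rva[of L "Cn a Nl" M] by simp
qed (simp add: app_def)

lemma rva_app: "rva (app L N) M = rva N (rva L M)"
 by (induction L arbitrary: M) auto

lemma app_assoc: "app (app L M) N = app L (app M N)"
 by (induction L) auto

lemma app_Nl [simp]: "app L Nl = L"
 by (induction L) auto

lemma sz_app: "sz (app L M) + 1 = sz L + sz M"
 by (induction L) auto

lemma sz_rva: "sz (rva L M) + 1 = sz L + sz M"
 by (induction L arbitrary: M) auto

fun ctl :: "(tree => tree => tree) => tree => tree => tree" where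
 "ctl F e Nl = Nl"
| "ctl F e (Cn a L) = app (F e (Cn a L)) (ctl F e L)"

text \<open>A fold step knows only the remaining list and the accumulator; the environment
  \<open>e\<close> therefore travels in the accumulator, next to the output in reverse.\<close>

lemma ctl_foldt:
 "foldt (%v. Cn (th (tt v)) (rva (F (th (tt v)) (th v)) (tt (tt v)))) L (Cn e M) = Cn e (rva (ctl F e L) M)"
 by (induction L arbitrary: M) (auto simp: rva_app)

lemma FP_ctl:
 assumes "FP (%z. F (th z) (tt z))" "FP e" "FP L"
 shows "FP (%x. ctl F (e x) (L x))"
proof -
 let ?h = "%v. Cn (th (tt v)) (rva (F (th (tt v)) (th v)) (tt (tt v)))"
 obtain k where k: "sz (F (th z) (tt z)) \<le> (sz z + 1) ^ k" for z
  using FP_size[OF assms(1)] unfolding pb_def pbd_def by blast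
 let ?r = "%x. (sz (e x) + sz (L x) + 2) ^ k"
 have 1: "FP (%v. F (th (tt v)) (th v))"
  using FP_comp[OF assms(1), of "%v. Cn (th (tt v)) (th v)"] by (simp add: FP_Cn FP_th FP_tt FP_id)
 have "FP (%x. foldt ?h (L x) (Cn (e x) Nl))"
 proof (rule FP_fold[where I = "%x S. th S = e x & S ~= Nl" and r = ?r])
  fix x L' S' assume *: "th S' = e x & S' ~= Nl" "sz L' \<le> sz (L x)"
  then obtain M where M: "S' = Cn (e x) M" by (cases S') auto
  have "sz (F (e x) L') \<le> (sz (e x) + sz L' + 2) ^ k" using k[of "Cn (e x) L'"] by simp
  also have "\<dots> \<le> ?r x" using *(2) by (intro power_mono) auto
  finally have "sz (rva (F (e x) L') M) \<le> sz M + ?r x" using sz_rva[of "F (e x) L'" M] by linarith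
  then show "(th (?h (Cn L' S')) = e x & ?h (Cn L' S') ~= Nl) & sz (?h (Cn L' S')) \<le> sz S' + ?r x"
   by (simp add: M)
 qed (auto intro!: FP_Cn FP_th FP_tt FP_id FP_rva 1 assms FP_const pb_intros FP_size)
 then have "FP (%x. rva (tt (foldt ?h (L x) (Cn (e x) Nl))) Nl)"
  by (intro FP_rva FP_tt FP_const)
 moreover have "rva (rva L Nl) Nl = L" for L
  using rva_rva[of L Nl Nl] by simp
 ultimately show ?thesis by (simp add: ctl_foldt)
qed

fun els :: "tree => tree set" where
 "els Nl = {}"
| "els (Cn a L) = insert a (els L)"

fun tails :: "tree => tree set" where
 "tails Nl = {}"
| "tails (Cn a L) = insert (Cn a L) (tails L)"

lemma els_tails: "els L = th ` tails L"
 by (induction L) auto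

section \<open>Polynomial-time predicates and quantifiers bounded by a list\<close>

definition b2t :: "bool => tree" where
 "b2t P = (if P then Cn Nl Nl else Nl)"

definition FPp :: "(tree => bool) => bool" where
 "FPp P \<longleftrightarrow> FP (%x. b2t (P x))"

lemma b2t_Nl [simp]: "b2t P = Nl \<longleftrightarrow> \<not> P"
 by (simp add: b2t_def)

lemma FPp_nonNl: "FP f ==> FPp (%x. f x ~= Nl)"
 unfolding FPp_def using FP_if_tree[of f "%_. Cn Nl Nl" "%_. Nl"] by (simp add: b2t_def FP_const)

lemma FP_if: "FPp P ==> FP f ==> FP g ==> FP (%x. if P x then f x else g x)"
 unfolding FPp_def using FP_if_tree[of "%x. b2t (P x)" f g] by simp

lemma FPp_not: "FPp P ==> FPp (%x. \<not> P x)"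
proof -
 assume "FPp P"
 then have "FP (%x. if P x then Nl else Cn Nl Nl)" by (intro FP_if FP_const)
 moreover have "b2t (\<not> P x) = (if P x then Nl else Cn Nl Nl)" for x by (simp add: b2t_def)
 ultimately show ?thesis by (simp add: FPp_def)
qed

lemma FPp_conj: "FPp P ==> FPp Q ==> FPp (%x. P x & Q x)"
proof -
 assume "FPp P" "FPp Q"
 then have "FP (%x. if P x then b2t (Q x) else Nl)" by (intro FP_if FP_const) (auto simp: FPp_def)
 moreover have "b2t (P x & Q x) = (if P x then b2t (Q x) else Nl)" for x by (simp add: b2t_def)
 ultimately show ?thesis by (simp add: FPp_def)
qed

lemma FPp_disj:
 assumes "FPp P" "FPp Q"
 shows "FPp (%x. P x \<or> Q x)"
proof -
 have "FPp (%x. \<not> (\<not> P x & \<not> Q x))" by (intro FPp_not FPp_conj assms)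
 then show ?thesis by simp
qed

lemma FPp_imp: "FPp P ==> FPp Q ==> FPp (%x. P x --> Q x)"
 unfolding imp_conv_disj by (intro FPp_disj FPp_not)

lemma FPp_iff: "FPp P ==> FPp Q ==> FPp (%x. P x \<longleftrightarrow> Q x)"
 unfolding iff_conv_conj_imp by (intro FPp_conj FPp_imp)

lemma FPp_const: "FPp (%_. b)"
 unfolding FPp_def by (rule FP_const)

lemma FPp_ex_tails:
 assumes "FPp (%z. P (th z) (tt z))" "FP L"
 shows "FPp (%x. \<exists>s\<in>tails (L x). P x s)"
proof -
 \<comment> \<open>As a list, \<open>b2t True\<close> has one entry and \<open>b2t False\<close>
   none; the concatenation is nonempty exactly if some tail satisfies \<open>P\<close>.\<close>
 have "ctl (%e s. b2t (P e s)) x L ~= Nl \<longleftrightarrow> (\<exists>s\<in>tails L. P x s)" for x L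
  by (induction L) (auto simp: b2t_def)
 moreover have "FP (%x. ctl (%e s. b2t (P e s)) x (L x))"
  using assms by (intro FP_ctl FP_id) (auto simp: FPp_def)
 ultimately show ?thesis using FPp_nonNl[of "%x. ctl (%e s. b2t (P e s)) x (L x)"] by simp
qed

lemma FPp_all_tails:
 assumes "FPp (%z. P (th z) (tt z))" "FP L"
 shows "FPp (%x. \<forall>s\<in>tails (L x). P x s)"
proof -
 have "FPp (%x. \<not> (\<exists>s\<in>tails (L x). \<not> P x s))" by (intro FPp_not FPp_ex_tails assms)
 then show ?thesis by simp
qed

lemma bex_els: "(\<exists>a\<in>els L. P a) \<longleftrightarrow> (\<exists>s\<in>tails L. P (th s))"
 and ball_els: "(\<forall>a\<in>els L. P a) \<longleftrightarrow> (\<forall>s\<in>tails L. P (th s))"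
 by (simp_all only: els_tails bex_simps ball_simps)

lemma FPp_ex:
 assumes "FPp (%z. P (th z) (th (tt z)))" "FP L"
 shows "FPp (%x. \<exists>a\<in>els (L x). P x a)"
 unfolding bex_els by (rule FPp_ex_tails[of "%x s. P x (th s)", OF assms])

lemma FPp_all:
 assumes "FPp (%z. P (th z) (th (tt z)))" "FP L"
 shows "FPp (%x. \<forall>a\<in>els (L x). P x a)"
 unfolding ball_els by (rule FPp_all_tails[of "%x s. P x (th s)", OF assms])

subsection \<open>Equality of trees\<close>

lemma enc_prefix: "enc s @ m = enc t @ m' ==> s = t & m = m'"
proof (induction s arbitrary: t m m')
 case Nl
 then show ?case by (cases t) auto
next
 case (Cn a b)
 obtain a' b' where t: "t = Cn a' b'" using Cn.prems by (cases t) auto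
 then have "enc a @ (enc b @ m) = enc a' @ (enc b' @ m')" using Cn.prems by simp
 from Cn.IH(1)[OF this] have "a = a'" "enc b @ m = enc b' @ m'" by auto
 with Cn.IH(2)[of m b' m'] t show ?case by simp
qed

lemma enc_eq_iff: "enc s = enc t \<longleftrightarrow> s = t"
 using enc_prefix[of s "[]" t "[]"] by auto

definition cmp_loop :: com where
 "cmp_loop = Whl 0 {1, 2} (Ite 0 {2} (Ite 3 {2} (pop 0 ;; pop 3) (push 2 1 ;; clear))
   (Ite 3 {1} (pop 0 ;; pop 3) (push 2 1 ;; clear)))"

definition eq_op :: com where
 "eq_op = mvt 0 ;; mvt 3 ;; cmp_loop ;; Ite 3 {1, 2} (push 2 1 ;; xfer 3 0 ;; clear) Skip ;;
   Ite 2 {1} (Whl 2 {1} (pop 2) ;; push 1 1) (push 1 1 ;; push 1 1 ;; push 1 2)"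

text \<open>There are two signs of a difference: a mark \<open>c\<close> on tape 2, left when the
  tops disagree or tape 3 runs out, and a rest \<open>b'\<close> on tape 3. Tape 0 is emptied in any
  case.\<close>

lemma E_cmp_loop:
 assumes "set a \<subseteq> {1, 2}" "set b \<subseteq> {1, 2}"
 shows "\<exists>c b'. set b' \<subseteq> {1, 2} & length b' \<le> length b & (c = [] \<or> c = [1]) & (c = [] & b' = [] \<longleftrightarrow> a = b) &
   E cmp_loop (st z a m [] y b) (30 * length a + 30) {st z [] m c y b'}"
 using assms
proof (induction a arbitrary: b)
 case Nil
 have "E cmp_loop (st z [] m [] y b) 1 {st z [] m [] y b}"
  unfolding cmp_loop_def by (rule E_Whl2) auto
 then have "E cmp_loop (st z [] m [] y b) 30 {st z [] m [] y b}" by (rule E_mono) simp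
 then show ?case
  by - (rule exI[of _ "[]"], rule exI[of _ b], use Nil in auto)
next
 case (Cons x a)
 let ?body = "Ite 0 {2} (Ite 3 {2} (pop 0 ;; pop 3) (push 2 1 ;; clear)) (Ite 3 {1} (pop 0 ;; pop 3) (push 2 1 ;; clear))"
 have x: "x = 1 \<or> x = 2" using Cons.prems by auto
 show ?case
 proof (cases "\<exists>b1. b = x # b1")
  case True
  then obtain b1 where b: "b = x # b1" by blast
  have pp: "E (pop 0 ;; pop 3) (st z (x # a) m [] y (x # b1)) 7 {st z a m [] y b1}"
   using E_Seq[OF pop_st(1) pop_st(4)] by simp
  have body: "E ?body (st z (x # a) m [] y b) 9 {st z a m [] y b1}"
  proof (cases "x = 2")
   case True
   show ?thesis unfolding b
    by (rule E_mono, rule E_If1[OF _ _ E_If1[OF _ _ pp]]) (auto simp: True)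
  next
   case False
   then have "x = 1" using x by simp
   show ?thesis unfolding b
    by (rule E_mono, rule E_If2[OF _ _ E_If1[OF _ _ pp]]) (auto simp: \<open>x = 1\<close>)
  qed
  obtain c b' where *: "set b' \<subseteq> {1, 2}" "length b' \<le> length b1" "c = [] \<or> c = [1]" "c = [] & b' = [] \<longleftrightarrow> a = b1"
   "E cmp_loop (st z a m [] y b1) (30 * length a + 30) {st z [] m c y b'}"
   using Cons.IH[of b1] Cons.prems b by auto
  have "E cmp_loop (st z (x # a) m [] y b) (2 + 9 + (30 * length a + 30)) {st z [] m c y b'}"
   unfolding cmp_loop_def
   by (rule E_Whl1[OF _ _ body]) (use x *(5) in \<open>auto simp: cmp_loop_def\<close>)
  then have "E cmp_loop (st z (x # a) m [] y b) (30 * length (x # a) + 30) {st z [] m c y b'}"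
   by (rule E_mono) simp
  then show ?thesis
   using * b by - (rule exI[of _ c], rule exI[of _ b'], auto elim: E_mono)
 next
  case False
  have "E clear (st z (x # a) m [1] y b) (5 * length (x # a) + 1) {st z [] m [1] y b}"
   using E_clear[of "x # a"] Cons.prems by auto
  note cl = E_Seq[OF push_st(3) this]
  have body: "E ?body (st z (x # a) m [] y b) (5 * length a + 15) {st z [] m [1] y b}"
  proof (cases "x = 2")
   case True
   then have "read_tape (stk y b) ~= 2" using False by (cases b) auto
   then show ?thesis
    using True by (intro E_mono[OF E_If1[OF _ _ E_If2[OF _ _ cl]]]) auto
  next
   case f: False
   then have "x = 1" "read_tape (stk y b) ~= 1" using x False by (cases b; auto)+
   then show ?thesis
    by (intro E_mono[OF E_If2[OF _ _ E_If2[OF _ _ cl]]]) auto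
  qed
  have "E cmp_loop (st z (x # a) m [] y b) (2 + (5 * length a + 15) + 1) {st z [] m [1] y b}"
   unfolding cmp_loop_def by (rule E_Whl1[OF _ _ body E_Whl2]) (use x in auto)
  then show ?thesis
   using False Cons.prems by - (rule exI[of _ "[1]"], rule exI[of _ b], auto elim!: E_mono)
 qed
qed

lemma E_eq: "E eq_op (ms z y (enc s @ enc t @ m)) (100 * (sz s + sz t) + 100) {ms z y (enc (b2t (s = t)) @ m)}"
proof -
 have 1: "E (mvt 0) (ms z y (enc s @ enc t @ m)) (25 * sz s) {st z (rev (enc s)) (enc t @ m) [] y []}"
  using E_mvt0[where a = "[]" and b = "[]" and t = s] by simp
 have 2: "E (mvt 3) (st z (rev (enc s)) (enc t @ m) [] y []) (25 * sz t) {st z (rev (enc s)) m [] y (rev (enc t))}"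
  using E_mvt3[where a = "[]" and b = "rev (enc s)" and t = t] by simp
 obtain c b' where *: "set b' \<subseteq> {1, 2}" "length b' \<le> sz t" "c = [] \<or> c = [1]" "c = [] & b' = [] \<longleftrightarrow> s = t"
   "E cmp_loop (st z (rev (enc s)) m [] y (rev (enc t))) (30 * sz s + 30) {st z [] m c y b'}"
  using E_cmp_loop[of "rev (enc s)" "rev (enc t)" z m y] enc_symbols[of s] enc_symbols[of t]
  by (auto simp: enc_eq_iff)
 obtain c' where c': "c' = (if b' = [] then c else 1 # c)" by blast
 have 3: "E (Ite 3 {1, 2} (push 2 1 ;; xfer 3 0 ;; clear) Skip) (st z [] m c y b') (20 * length b' + 20) {st z [] m c' y []}"
 proof (cases "b' = []")
  case True
  then show ?thesis using c' by (auto intro!: E_mono[OF E_If2[OF _ _ E_Skip[of _ 0]]])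
 next
  case False
  have a: "E (xfer 3 0) (st z [] m (1 # c) y b') (12 * length b' + 1) {st z (rev b') m (1 # c) y []}"
   using E_xfer30[of b' z "[]"] *(1) by simp
  have b: "E clear (st z (rev b') m (1 # c) y []) (5 * length b' + 1) {st z [] m (1 # c) y []}"
   using E_clear[of "rev b'"] *(1) by simp
  have "read_tape (stk y b') \<in> {1, 2}" using False *(1) by (cases b') auto
  then show ?thesis
   unfolding c' if_not_P[OF False] by (intro E_mono[OF E_If1[OF _ _ E_Seq[OF push_st(3) E_Seq[OF a b]]]]) auto
 qed
 have 5: "E (Whl 2 {1} (pop 2)) (st z [] m c' y []) (5 * length c' + 1) {ms z y m}" if "set c' \<subseteq> {1}" for c'
  using that
 proof (induction c')
  case Nil
  show ?case using E_Whl2[of "ms z y m" 2 "{1}" "pop 2"] by simp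
 next
  case (Cons x c')
  then show ?case by (intro E_mono[OF E_Whl1[OF _ _ pop_st(3)]]) auto
 qed
 have 6: "E (Ite 2 {1} (Whl 2 {1} (pop 2) ;; push 1 1) (push 1 1 ;; push 1 1 ;; push 1 2)) (st z [] m c' y []) 20
   {ms z y (enc (b2t (s = t)) @ m)}"
 proof (cases "c' = []")
  case True
  then have "s = t" using *(3,4) c' by (auto split: if_splits)
  have "E (push 1 1 ;; push 1 1 ;; push 1 2) (ms z y m) 11 {ms z y (2 # 1 # 1 # m)}"
   using E_Seq[OF push_st(2) E_Seq[OF push_st(2) push_st(2)]] by simp
  then show ?thesis
   using True \<open>s = t\<close> by (intro E_mono[OF E_If2]) (auto simp: b2t_def)
 next
  case False
  then have st: "s ~= t" "set c' \<subseteq> {1}" "length c' \<le> 2" using *(3,4) c' by (auto split: if_splits)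
  have r: "read_tape (stk 0 c') = 1" using False st by (cases c') auto
  show ?thesis
   using st r E_Seq[OF 5[OF st(2)] push_st(2)[of 1]]
   by (intro E_mono[OF E_If1]) (auto simp: b2t_def)
 qed
 show ?thesis
  unfolding eq_op_def using sz_pos[of s] sz_pos[of t] *(2)
  by (intro E_mono[OF E_Seq[OF 1 E_Seq[OF 2 E_Seq[OF *(5) E_Seq[OF 3 6]]]]]) auto
qed

lemma FP_eq: "FP f ==> FP g ==> FPp (%x. f x = g x)"
proof -
 assume fg: "FP f" "FP g"
 have "FP (%v. b2t (v ~= Nl & th v = tt v))"
 proof (rule FP_I)
  show "computes (Ite 1 {2} (pop 1 ;; eq_op) Skip) (%v. b2t (v ~= Nl & th v = tt v)) (%v. 200 * sz v + 200)"
   unfolding computes_def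
  proof (intro conjI allI)
   fix z y m x
   show "E (Ite 1 {2} (pop 1 ;; eq_op) Skip) (ms z y (enc x @ m)) (200 * sz x + 200) {ms z y (enc (b2t (x ~= Nl & th x = tt x)) @ m)}"
   proof (cases x)
    case Nl
    then show ?thesis by (auto simp: b2t_def intro!: E_mono[OF E_If2[OF _ _ E_Skip[of _ 0]]])
   next
    case (Cn a b)
    have "E (Ite 1 {2} (pop 1 ;; eq_op) Skip) (ms z y (2 # enc a @ enc b @ m))
      (Suc (Suc (3 + (100 * (sz a + sz b) + 100)))) {ms z y (enc (b2t (a = b)) @ m)}"
     by (rule E_If1[OF _ _ E_Seq[OF pop_st(2) E_eq]]) auto
    then show ?thesis unfolding Cn by (auto elim!: E_mono)
   qed
  qed (auto simp: eq_op_def cmp_loop_def mvt_def mvl_def clear_def xfer_def)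
  show "pb (%x. sz (b2t (x ~= Nl & th x = tt x)))"
   by (rule pb_le[OF pb_const[of 3]]) (auto simp: b2t_def)
 qed (intro pb_intros)
 from FP_comp[OF this FP_Cn[OF fg]] show ?thesis by (simp add: FPp_def)
qed

section \<open>From tree functions to Turing machines\<close>

lemma initial_st: "initial (machine 4 c) w = (index c c, st (int (length w)) (map symb w) [] [] 0 [])"
 unfolding st_def word_stk[symmetric]
 by (simp add: initial_def machine_def index_def numeral_eq_Suc stk_def fun_eq_iff)

lemma good_st:
 assumes "set a \<subseteq> {..<3}" "set m \<subseteq> {..<3}" "set c \<subseteq> {..<3}" "set b \<subseteq> {..<3}"
 shows "good 4 (st z a m c y b)"
proof -
 have "fst (stk z s) j < 3" if "set s \<subseteq> {..<3}" for z s j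
 proof -
  have "s ! nat (j - (z - int (length s))) < 3" if "z - int (length s) \<le> j" "j < z"
  proof -
   have "nat (j - (z - int (length s))) < length s" using that by linarith
   then show ?thesis using \<open>set s \<subseteq> {..<3}\<close> nth_mem by blast
  qed
  then show ?thesis by (auto simp: stk_def)
 qed
 then show ?thesis using assms by (auto simp: good_def st_def)
qed

lemma length_bt: "length w \<le> sz (bt w)" "sz (bt w) \<le> 4 * length w + 1"
 by (induction w) auto

lemma good_initial: "good 4 (st z (map symb w) [] [] y [])"
 by (rule good_st) (auto simp: symb_def)

theorem polytime_computable_FP:
 assumes "FP F" "\<And>w. F (bt w) = bt (f w)"
 shows "polytime_computable f"
proof -
 obtain c T where c: "computes c F T" "pb T" using assms unfolding FP_def by blast
 let ?U = "%x. 50 * sz x + 10 + T x + 60 * sz (F x) + 20"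
 have "pb ?U" by (intro pb_intros c FP_size assms)
 then obtain k where k: "?U x \<le> (sz x + 1) ^ k" for x unfolding pb_def pbd_def by blast
 let ?c = "input_op ;; c ;; output_op"
 let ?M = "machine 4 ?c"
 \<comment> \<open>The size of \<open>bt w\<close> is at most \<open>4 n + 1\<close>, where n is the
   length of \<open>w\<close>; \<open>(4 n + 2) ^ k\<close> is at most \<open>6 ^ k * n ^ k\<close>
   for n \<ge> 1 and at most \<open>6 ^ k\<close> for the empty word.\<close>
 have "\<exists>n \<le> 6 ^ k * length w ^ k + 6 ^ k. \<exists>C. (step ?M ^^ n) (initial ?M w) C & halted ?M C &
    fst (last (snd C)) = word_content (f w)" for w
 proof -
  let ?ts = "st (int (length w)) [] [1] [] (int (length (f w))) (map symb (f w))"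
  have 1: "E c (ms (int (length w)) 0 (enc (bt w))) (T (bt w)) {ms (int (length w)) 0 (enc (bt (f w)))}"
   using c(1) unfolding computes_def assms(2)[symmetric] by (metis append_Nil2)
  have 2: "E ?c (st (int (length w)) (map symb w) [] [] 0 [])
    (Suc (50 * length w + 10 + Suc (T (bt w) + (60 * length (f w) + 10))))
    {st (int (length w)) [] [1] [] (int (length (f w))) (map symb (f w))}"
   by (rule E_Seq[OF E_input E_Seq[OF 1 E_output]])
  have "Suc (50 * length w + 10 + Suc (T (bt w) + (60 * length (f w) + 10))) \<le> ?U (bt w)"
   using length_bt(1)[of w] length_bt(1)[of "f w"] assms(2)[of w] by simp
  also have "\<dots> \<le> (sz (bt w) + 1) ^ k" by (rule k)
  also have "\<dots> \<le> (4 * length w + 2) ^ k" using length_bt(2)[of w] by (intro power_mono) auto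
  also have "\<dots> \<le> 6 ^ k * length w ^ k + 6 ^ k"
  proof (cases "length w = 0")
   case True
   have "(2::nat) ^ k \<le> 6 ^ k" by (intro power_mono) auto
   moreover have "4 * length w + 2 = 2" using True by simp
   ultimately show ?thesis by (metis trans_le_add2)
  next
   case False
   then have "1 \<le> length w" by (simp add: Suc_leI)
   then have "(4 * length w + 2) ^ k \<le> (6 * length w) ^ k" by (intro power_mono) auto
   then show ?thesis by (simp add: power_mult_distrib)
  qed
  finally have le: "Suc (50 * length w + 10 + Suc (T (bt w) + (60 * length (f w) + 10))) \<le> 6 ^ k * length w ^ k + 6 ^ k" .
  have w: "wfc 4 ?c" using c(1) by (auto simp: computes_def)
  note em = E_machine[OF 2 good_initial w self_derivs]
  let ?C = "(index ?c Skip, ?ts)"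
  have "?C \<in> {C. (step ?M)\<^sup>*\<^sup>* (index ?c ?c, st (int (length w)) (map symb w) [] [] 0 []) C & halted ?M C & fst C \<in> accepting ?M}"
   unfolding em[THEN conjunct2] by simp
  then have C: "(step ?M)\<^sup>*\<^sup>* (initial ?M w) ?C" "halted ?M ?C"
   by (auto simp: initial_st)
  then obtain n where n: "(step ?M ^^ n) (initial ?M w) ?C" using rtranclp_imp_relpowp by metis
  then have "n \<le> Suc (50 * length w + 10 + Suc (T (bt w) + (60 * length (f w) + 10)))"
   using em[THEN conjunct1] unfolding initial_st by blast
  note le_trans[OF this le]
  moreover have "fst (last (snd ?C)) = word_content (f w)"
   using word_stk[of "f w"] by (simp add: st_def) (metis fst_conv)
  ultimately show ?thesis using n C by blast
 qed
 moreover have "wf_tm ?M" "deterministic ?M"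
  using c(1) by (auto intro!: wf_machine deterministic_machine simp: computes_def)
 ultimately show ?thesis unfolding polytime_computable_def by blast
qed

lemma stk_inj: "stk z s = stk z s' ==> s = s'"
proof -
 assume *: "stk z s = stk z s'"
 then have l: "length s = length s'" by (auto simp: stk_def)
 have "s ! i = s' ! i" if "i < length s" for i
 proof -
  have "fst (stk z s) (z - int (length s) + int i) = fst (stk z s') (z - int (length s) + int i)"
   using * by simp
  then show ?thesis using that l by (simp add: stk_def)
 qed
 then show ?thesis using l by (auto intro: nth_equalityI)
qed

text \<open>If the tapes left by the first program determine the parameter \<open>i\<close>, the
  second program may be specified through \<open>i\<close>. Nondeterministic guesses are tracked in
  this way.\<close>

lemma E_Seqs_inj:
 assumes "E c1 ts t1 (f ` I)" "inj_on f I" "\<And>i. i \<in> I ==> E c2 (f i) t2 (Q i)"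
 shows "E (c1 ;; c2) ts (Suc (t1 + t2)) (\<Union>i\<in>I. Q i)"
proof -
 have "E (c1 ;; c2) ts (Suc (t1 + t2)) (\<Union>x\<in>f ` I. Q (inv_into I f x))"
  using assms by (intro E_Seqs[OF assms(1)]) auto
 then show ?thesis using assms(2) by (simp add: inv_into_f_f)
qed

section \<open>Guessing a tree\<close>

text \<open>A tree is guessed in postfix order on a stack (a tree read as a list), next to a fixed
 parameter.\<close>

definition guessA :: "tree => tree" where
 "guessA S = Cn (Cn Nl (th S)) (tt S)"

definition guessB :: "tree => tree" where
 "guessB S = Cn (Cn (Cn (th (th S)) (th (tt (th S)))) (tt (tt (th S)))) (tt S)"

fun grow :: "nat => tree => tree set" where
 "grow 0 S = {S}"
| "grow (Suc n) S = grow n (guessA S) \<union> (grow n (guessB S) \<union> grow n S)"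

lemma grow_tt: "S' \<in> grow n S ==> tt S' = tt S"
 by (induction n arbitrary: S) (auto simp: guessA_def guessB_def)

lemma grow_self: "S \<in> grow n S"
 by (induction n) auto

lemma grow_trans: "S' \<in> grow n S ==> S'' \<in> grow m S' ==> S'' \<in> grow (n + m) S"
 by (induction n arbitrary: S) auto

lemma grow_mono: "S' \<in> grow n S ==> n \<le> m ==> S' \<in> grow m S"
 using grow_trans[of S' n S S' "m - n"] grow_self by auto

text \<open>Postfix guessing: the right subtree, then the left one, then the node that joins them.
  This takes one operation for each leaf and each node, and \<open>sz u\<close> is their
  number.\<close>

lemma grow_tree: "Cn (Cn u k) w \<in> grow (sz u) (Cn k w)"
proof (induction u arbitrary: k)
 case Nl
 show ?case by (simp add: guessA_def)
next
 case (Cn a b)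
 have "Cn (Cn a (Cn b k)) w \<in> grow (sz b + sz a) (Cn k w)"
  by (rule grow_trans[OF Cn(2) Cn(1)])
 moreover have "Cn (Cn (Cn a b) k) w \<in> grow 1 (Cn (Cn a (Cn b k)) w)"
  by (simp add: guessB_def)
 ultimately have "Cn (Cn (Cn a b) k) w \<in> grow (sz b + sz a + 1) (Cn k w)"
  by (rule grow_trans)
 then show ?case by (simp add: add_ac)
qed

fun len :: "tree => nat" where
 "len Nl = 0"
| "len (Cn a L) = Suc (len L)"

lemma sz_guess: "sz (guessA S) \<le> sz S + 10" "sz (guessB S) \<le> sz S + 10"
proof -
 show "sz (guessA S) \<le> sz S + 10" by (cases S) (auto simp: guessA_def)
 show "sz (guessB S) \<le> sz S + 10"
 proof (cases S)
  case (Cn k w)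
  then show ?thesis by (cases k; cases "tt k") (auto simp: guessB_def)
 qed (simp add: guessB_def)
qed

text \<open>The prefixes made of \<open>Skip\<close> turn the branches into different programs, as
  \<open>E_Alt\<close> demands, whatever \<open>a\<close>, \<open>b\<close> and \<open>c\<close>
  are. The third branch leaves the guess as it is, so that smaller trees can be guessed under the
  same clock.\<close>

definition guess_body :: "com => com => com => com" where
 "guess_body a b c = Alt (Skip ;; push 1 2 ;; a ;; pop 1)
   ((Skip ;; Skip) ;; Alt (Skip ;; push 1 2 ;; b ;; pop 1) ((Skip ;; Skip) ;; push 1 2 ;; c ;; pop 1))"

definition guess_op :: "com => com => com => com" where
 "guess_op a b c = pop 1 ;; Whl 1 {2} (guess_body a b c) ;; pop 1"

text \<open>The list \<open>L\<close> is the clock: one operation per entry. The quantity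
  \<open>11 * sz L + sz S\<close> never grows, since a step removes an entry from \<open>L\<close>
  and adds at most 10 to \<open>sz S\<close>; it keeps every argument within the size
  \<open>N\<close> for which the times are bounded.\<close>

lemma E_guess:
 assumes "computes a (%v. Cn (tt (th v)) (guessA (tt v))) T1"
  "computes b (%v. Cn (tt (th v)) (guessB (tt v))) T2"
  "computes c (%v. Cn (tt (th v)) (tt v)) T3"
  and B: "\<And>v. sz v \<le> N ==> T1 v \<le> B & T2 v \<le> B & T3 v \<le> B"
 shows "11 * sz L + sz S \<le> N ==> E (Whl 1 {2} (guess_body a b c)) (ms z y (enc L @ enc S @ m)) ((B + 40) * sz L)
  ((%S'. ms z y (1 # enc S' @ m)) ` grow (len L) S)"
proof (induction L arbitrary: S)
 case Nl
 show ?case using E_mono[OF E_Whl2[of "ms z y (1 # enc S @ m)" 1 "{2}"]] by auto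
next
 case (Cn x L)
 let ?v = "Cn (Cn x L) S"
 let ?s = "%S'. ms z y (enc L @ enc S' @ m)"
 have br: "E (push 1 2 ;; d ;; pop 1) (ms z y (enc (Cn x L) @ enc S @ m)) (B + 8) {?s (f S)}"
  if "computes d (%v. Cn (tt (th v)) (f (tt v))) T" "T ?v \<le> B" for d f T
 proof -
  have "E d (ms z y (enc ?v @ m)) (T ?v) {ms z y (enc (Cn L (f S)) @ m)}"
   using that(1) unfolding computes_def by (metis th.simps(2) tt.simps(2))
  then have "E d (ms z y (2 # enc (Cn x L) @ enc S @ m)) (T ?v) {ms z y (2 # enc L @ enc (f S) @ m)}"
   by simp
  then have "E d (ms z y (2 # enc (Cn x L) @ enc S @ m)) B {ms z y (2 # enc L @ enc (f S) @ m)}"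
   using that(2) by (rule E_mono)
  from E_Seq[OF push_st(2) E_Seq[OF this pop_st(2)]]
  show ?thesis by (rule E_mono) simp
 qed
 have "sz ?v \<le> N" using Cn.prems by simp
 note le = B[OF this]
 note brs = br[OF assms(1)] br[OF assms(2)] br[of c "%x. x" T3, OF assms(3)]
 have sk: "E (Skip ;; d) ts (t + 1) Q" if "E d ts t Q" for d ts t Q
  using E_Seq[OF E_Skip[of ts 0] that] by simp
 have sk2: "E ((Skip ;; Skip) ;; d) ts (t + 2) Q" if "E d ts t Q" for d ts t Q
  using E_Seq[OF E_Seq[OF E_Skip[of ts 0] E_Skip[of ts 0]] that] by simp
 have A: "E (Alt (Skip ;; push 1 2 ;; b ;; pop 1) ((Skip ;; Skip) ;; push 1 2 ;; c ;; pop 1))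
   (ms z y (enc (Cn x L) @ enc S @ m)) (Suc (B + 10)) ({?s (guessB S)} \<union> {?s S})"
  using le brs(2,3) by (intro E_Alt E_mono[OF sk] E_mono[OF sk2]) auto
 have "E (guess_body a b c) (ms z y (enc (Cn x L) @ enc S @ m)) (Suc (B + 13)) ({?s (guessA S)} \<union> ({?s (guessB S)} \<union> {?s S}))"
  unfolding guess_body_def
  using le brs(1) A by (intro E_Alt E_mono[OF sk] E_mono[OF sk2]) auto
 moreover have "{?s (guessA S)} \<union> ({?s (guessB S)} \<union> {?s S}) = ?s ` {guessA S, guessB S, S}" by auto
 ultimately have A2: "E (guess_body a b c) (ms z y (enc (Cn x L) @ enc S @ m)) (B + 14) (?s ` {guessA S, guessB S, S})"
  by (simp only:) (erule E_mono, simp)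
 have inj: "inj_on ?s I" for I
  by (rule inj_onI) (auto simp: st_def dest!: stk_inj enc_prefix)
 have rest: "E (Whl 1 {2} (guess_body a b c)) (?s S') ((B + 40) * sz L) ((%S'. ms z y (1 # enc S' @ m)) ` grow (len L) S')"
  if "S' \<in> {guessA S, guessB S, S}" for S'
  using that Cn.prems sz_guess[of S] sz_pos[of x] by (intro Cn.IH(2)) auto
 have "E (guess_body a b c ;; Whl 1 {2} (guess_body a b c)) (ms z y (enc (Cn x L) @ enc S @ m)) (Suc (B + 14 + (B + 40) * sz L))
   (\<Union>S'\<in>{guessA S, guessB S, S}. (%S'. ms z y (1 # enc S' @ m)) ` grow (len L) S')"
  by (rule E_Seqs_inj[OF A2 inj rest])
 then have "E (Whl 1 {2} (guess_body a b c)) (ms z y (enc (Cn x L) @ enc S @ m)) (Suc (Suc (B + 14 + (B + 40) * sz L)))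
   (\<Union>S'\<in>{guessA S, guessB S, S}. (%S'. ms z y (1 # enc S' @ m)) ` grow (len L) S')"
  by (intro E_Whl) auto
 moreover have "(\<Union>S'\<in>{guessA S, guessB S, S}. (%S'. ms z y (1 # enc S' @ m)) ` grow (len L) S') =
   (%S'. ms z y (1 # enc S' @ m)) ` grow (len (Cn x L)) S"
  by (simp add: image_Un)
 moreover have "Suc (Suc (B + 14 + (B + 40) * sz L)) \<le> (B + 40) * sz (Cn x L)"
  by (simp add: algebra_simps)
 ultimately show ?case by (simp only:) (rule E_mono)
qed

section \<open>A clock of exponential length\<close>

definition doubling :: "tree => tree" where
 "doubling v = Cn (app (th (tt v)) (th (tt v))) (tt (tt v))"

text \<open>Folding over a list of length p doubles the clock p times. The equation between
  \<open>sz\<close> and \<open>len\<close> says that all entries of the clock are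
  \<open>Nl\<close>.\<close>

lemma foldt_doubling:
 assumes "sz clk = 2 * len clk + 1"
 shows "\<exists>clk'. foldt doubling L (Cn clk x) = Cn clk' x & len clk' = 2 ^ len L * len clk & sz clk' = 2 * len clk' + 1"
 using assms
proof (induction L arbitrary: clk)
 case (Cn a L)
 have [simp]: "len (app L M) = len L + len M" for L M by (induction L) auto
 have "sz (app clk clk) = 2 * len (app clk clk) + 1" using sz_app[of clk clk] Cn.prems by simp
 from Cn.IH(2)[OF this] show ?case by (auto simp: doubling_def algebra_simps)
qed simp

lemma vis_doubling:
 assumes "sz clk = 2 * len clk + 1" "v \<in> vis doubling L (Cn clk x)"
 shows "sz v \<le> sz L + 2 * (2 ^ len L * len clk) + sz x + 3"
 using assms
proof (induction L arbitrary: clk)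
 case (Cn a L)
 have [simp]: "len (app L M) = len L + len M" for L M by (induction L) auto
 have s: "sz (app clk clk) = 2 * len (app clk clk) + 1" using sz_app[of clk clk] Cn.prems by simp
 have "doubling (Cn (Cn a L) (Cn clk x)) = Cn (app clk clk) x" by (simp add: doubling_def)
 then consider "v = Cn (Cn a L) (Cn clk x)" | "v \<in> vis doubling L (Cn (app clk clk) x)"
  using Cn.prems(2) by auto
 then show ?case
 proof cases
  case 1
  have "len clk \<le> 2 ^ len (Cn a L) * len clk" by simp
  then show ?thesis using 1 Cn.prems(1) by simp
 next
  case 2
  from Cn.IH(2)[OF s 2] show ?thesis by (simp add: algebra_simps)
 qed
qed simp

text \<open>Supplies the polynomial exponent of the clock as the length
  \<open>(len x + 2) ^ k\<close> of a list.\<close>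

fun lpow :: "nat => tree => tree" where
 "lpow 0 x = Cn Nl Nl"
| "lpow (Suc k) x = ctl (%e s. e) (lpow k x) (Cn Nl (Cn Nl x))"

lemma len_lpow: "len (lpow k x) = (len x + 2) ^ k"
proof (induction k)
 case (Suc k)
 have [simp]: "len (app L M) = len L + len M" for L M by (induction L) auto
 have "len (ctl (%e s. e) e L) = len L * len e" for e L
  by (induction L) auto
 then show ?case using Suc by simp
qed simp

lemma FP_lpow: "FP (lpow k)"
proof (induction k)
 case 0
 have "lpow 0 = (%_. Cn Nl Nl)" by auto
 then show ?case by (simp add: FP_const)
next
 case (Suc k)
 have "lpow (Suc k) = (%x. ctl (%e s. e) (lpow k x) (Cn Nl (Cn Nl x)))" by (rule ext) simp
 then show ?case by (simp only:) (intro FP_ctl FP_Cn FP_id FP_const FP_th Suc)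
qed

lemma len_bt: "len (bt w) = length w"
 by (induction w) auto

lemma sz_grow: "S' \<in> grow n S ==> sz S' \<le> sz S + 10 * n"
proof (induction n arbitrary: S)
 case (Suc n)
 have "sz (guessA S) \<le> sz S + 10" "sz (guessB S) \<le> sz S + 10" by (rule sz_guess)+
 moreover consider "S' \<in> grow n (guessA S)" | "S' \<in> grow n (guessB S)" | "S' \<in> grow n S"
  using Suc.prems by auto
 then have "sz S' \<le> sz (guessA S) + 10 * n \<or> sz S' \<le> sz (guessB S) + 10 * n \<or> sz S' \<le> sz S + 10 * n"
  using Suc.IH by blast
 ultimately show ?case by auto
qed simp

text \<open>\<open>NEXPTIME\<close> is defined with exponents \<open>n ^ K\<close>, which do not
  grow with \<open>K\<close> for n \<le> 1. From n = 2 on \<open>n + 2 \<le> n ^ 2\<close> and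
  \<open>J \<le> n ^ J\<close> suffice; below that the constant takes over.\<close>

lemma double_exp_bound: "\<exists>b K. \<forall>n. (2::nat) ^ ((n + 2) ^ k * J) \<le> b * 2 ^ (n ^ K) + b"
proof (intro exI allI)
 fix n :: nat
 let ?b = "(2::nat) ^ (3 ^ k * J)"
 show "2 ^ ((n + 2) ^ k * J) \<le> ?b * 2 ^ (n ^ (2 * k + J)) + ?b"
 proof (cases "n \<ge> 2")
  case True
  then have "2 * n \<le> n * n" by (rule mult_right_mono) simp
  then have "n + 2 \<le> n ^ 2" using True unfolding power2_eq_square by linarith
  then have "(n + 2) ^ k \<le> n ^ (2 * k)" unfolding power_mult by (intro power_mono) auto
  moreover have "J \<le> n ^ J" using less_exp[OF True] .
  ultimately have "(n + 2) ^ k * J \<le> n ^ (2 * k + J)" unfolding power_add by (intro mult_mono) auto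
  then have "(2::nat) ^ ((n + 2) ^ k * J) \<le> 2 ^ (n ^ (2 * k + J))" by (intro power_increasing) auto
  also have "\<dots> \<le> ?b * 2 ^ (n ^ (2 * k + J))" by simp
  finally show ?thesis by linarith
 next
  case False
  then have "(n + 2) ^ k \<le> 3 ^ k" by (intro power_mono) auto
  then have "(2::nat) ^ ((n + 2) ^ k * J) \<le> ?b" by (intro power_increasing mult_right_mono) auto
  then show ?thesis by linarith
 qed
qed

lemma E_Abort: "E Abort ts 1 {}"
 using E_step[of Abort ts 0 "%_. {}"] by (auto simp: succs_def)

text \<open>\<open>NEXPTIME\<close> through exponential certificates: a tree is guessed by
  \<open>D w\<close> operations, and a verifier that is polynomial in input and certificate together
  is run on it. Polynomials in an exponential quantity remain exponential, which is
  \<open>pbd D U\<close>.\<close>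

theorem NEXPTIME_FP:
 assumes chk: "FP chk"
  and L: "\<And>w. w \<in> L \<longleftrightarrow> (\<exists>u. chk (Cn (bt w) u) ~= Nl)"
  and small: "\<And>w. w \<in> L ==> \<exists>u. sz u \<le> 2 ^ ((length w + 2) ^ k) & chk (Cn (bt w) u) ~= Nl"
 shows "L \<in> NEXPTIME"
proof -
 \<comment> \<open>The exponent \<open>Suc k\<close> makes \<open>D w\<close> at least
   \<open>length w\<close> even for \<open>k = 0\<close>, so that the input size is bounded by a
   power of \<open>D w\<close>.\<close>
 define D where "D w = (2::nat) ^ ((length w + 2) ^ Suc k)" for w :: "bool list"
 have D2: "2 \<le> D w" for w
 proof -
  have "(2::nat) ^ 1 \<le> 2 ^ ((length w + 2) ^ Suc k)" by (intro power_increasing one_le_power) auto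
  then show ?thesis by (simp add: D_def)
 qed
 have "pbd D (%w. sz (bt w))"
 proof (rule pbd_le)
  show "pbd D (%w. 4 * D w + 1)" by (intro pbd_add pbd_mult pbd_const pbd_self D2)
  fix w :: "bool list"
  have "length w \<le> length w + 2" by simp
  also have "\<dots> \<le> (length w + 2) ^ Suc k" by (rule self_le_power) auto
  also have "\<dots> \<le> D w" unfolding D_def by (rule less_exp) simp
  finally show "sz (bt w) \<le> 4 * D w + 1" using length_bt(2)[of w] by linarith
 qed
 note szw = this
 have pbD: "pbd D (%w. q (bt w))" if "pb q" for q
  by (rule pbd_comp[of "%x. sz x + 1" q D bt, OF that[unfolded pb_def]]) (intro pbd_add szw pbd_const D2)
 have pbk: "\<exists>k. \<forall>v. T v \<le> (sz v + 1) ^ k" if "pb T" for T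
  using that unfolding pb_def pbd_def .
 have "FP (%x. Cn (lpow (Suc k) x) (Cn (Cn Nl Nl) x))"
  by (intro FP_Cn FP_const FP_id FP_lpow)
 then obtain c1 T1 where c1: "computes c1 (%x. Cn (lpow (Suc k) x) (Cn (Cn Nl Nl) x)) T1" "pb T1"
  unfolding FP_def by blast
 have "FP (%v. Cn (tt (th v)) (doubling v))"
  unfolding doubling_def by (intro FP_Cn FP_app FP_th FP_tt FP_id)
 then obtain cd Td where cd: "computes cd (%v. Cn (tt (th v)) (doubling v)) Td" "pb Td"
  unfolding FP_def by blast
 have "FP (%S. Cn (th S) (Cn Nl (tt S)))"
  by (intro FP_Cn FP_th FP_tt FP_id FP_const)
 then obtain c2 T2 where c2: "computes c2 (%S. Cn (th S) (Cn Nl (tt S))) T2" "pb T2"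
  unfolding FP_def by blast
 have "FP (%v. Cn (tt (th v)) (guessA (tt v)))"
  unfolding guessA_def by (intro FP_Cn FP_th FP_tt FP_id FP_const)
 then obtain ca Ta where ca: "computes ca (%v. Cn (tt (th v)) (guessA (tt v))) Ta" "pb Ta"
  unfolding FP_def by blast
 have "FP (%v. Cn (tt (th v)) (guessB (tt v)))"
  unfolding guessB_def by (intro FP_Cn FP_th FP_tt FP_id FP_const)
 then obtain cb Tb where cb: "computes cb (%v. Cn (tt (th v)) (guessB (tt v))) Tb" "pb Tb"
  unfolding FP_def by blast
 have "FP (%v. Cn (tt (th v)) (tt v))"
  by (intro FP_Cn FP_th FP_tt FP_id FP_const)
 then obtain cc Tc where cc: "computes cc (%v. Cn (tt (th v)) (tt v)) Tc" "pb Tc"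
  unfolding FP_def by blast
 have "FP (%S. chk (Cn (tt S) (th (th S))))"
  by (intro FP_comp[OF chk] FP_Cn FP_th FP_tt FP_id)
 then obtain c3 T3 where c3: "computes c3 (%S. chk (Cn (tt S) (th (th S)))) T3" "pb T3"
  unfolding FP_def by blast
 obtain kd where kd: "Td v \<le> (sz v + 1) ^ kd" for v using pbk[OF cd(2)] by blast
 obtain k2 where k2: "T2 v \<le> (sz v + 1) ^ k2" for v using pbk[OF c2(2)] by blast
 obtain ka where ka: "Ta v + Tb v + Tc v \<le> (sz v + 1) ^ ka" for v
  using pbk[OF pb_add[OF pb_add[OF ca(2) cb(2)] cc(2)]] by blast
 obtain k3 where k3: "T3 v \<le> (sz v + 1) ^ k3" for v using pbk[OF c3(2)] by blast
 define N1 where "N1 w = sz (lpow (Suc k) (bt w)) + 2 * D w + sz (bt w) + 5" for w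
 define N2 where "N2 w = 22 * D w + sz (bt w) + 15" for w
 define V1 where "V1 w = ((N1 w + 1) ^ kd + 20) * (N1 w + 3) + 20" for w
 define V2 where "V2 w = (2 * D w + sz (bt w) + 3) ^ k2" for w
 define V3 where "V3 w = ((N2 w + 1) ^ ka + 40) * (2 * D w + 1) + 20" for w
 define V4 where "V4 w = (N2 w + 1) ^ k3" for w
 define U where "U w = 50 * length w + T1 (bt w) + V1 w + V2 w + V3 w + V4 w + 40" for w
 let ?c = "input_op ;; c1 ;; foldc cd ;; c2 ;; guess_op ca cb cc ;; c3 ;; Ite 1 {2} Skip Abort"
 let ?M = "machine 4 ?c"
 have main: "\<exists>Q. E ?c (st (int (length w)) (map symb w) [] [] 0 []) (U w) Q & (Q ~= {} \<longleftrightarrow> w \<in> L)" for w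
 proof -
  let ?x = "bt w" and ?z = "int (length w)"
  let ?S0 = "Cn (lpow (Suc k) ?x) (Cn (Cn Nl Nl) ?x)"
  have Dw: "2 ^ len (lpow (Suc k) ?x) = D w" by (simp only: len_lpow len_bt D_def)
  obtain clk where clk: "foldt doubling (lpow (Suc k) ?x) (Cn (Cn Nl Nl) ?x) = Cn clk ?x"
    "len clk = D w" "sz clk = 2 * D w + 1"
   using foldt_doubling[of "Cn Nl Nl" "lpow (Suc k) ?x" ?x] unfolding Dw by auto
  have e1: "E c1 (ms ?z 0 (enc ?x)) (T1 ?x) {ms ?z 0 (enc ?S0)}"
   using c1(1) unfolding computes_def by (metis append_Nil2)
  have vb: "Td v \<le> (N1 w + 1) ^ kd" if "v \<in> vis doubling (lpow (Suc k) ?x) (Cn (Cn Nl Nl) ?x)" for v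
  proof -
   have "sz v \<le> N1 w" using vis_doubling[OF _ that] unfolding Dw by (simp add: N1_def)
   then have "(sz v + 1) ^ kd \<le> (N1 w + 1) ^ kd" by (intro power_mono) auto
   then show ?thesis using kd[of v] by linarith
  qed
  have "E (foldc cd) (ms ?z 0 (enc ?S0 @ [])) (((N1 w + 1) ^ kd + 20) * sz ?S0 + 20) {ms ?z 0 (enc (foldt doubling (th ?S0) (tt ?S0)) @ [])}"
   by (rule E_foldc[OF cd(1)]) (use vb in auto)
  moreover have "((N1 w + 1) ^ kd + 20) * sz ?S0 + 20 \<le> V1 w"
   unfolding V1_def by (intro add_mono mult_mono) (auto simp: N1_def)
  ultimately have e2: "E (foldc cd) (ms ?z 0 (enc ?S0)) (V1 w) {ms ?z 0 (enc (Cn clk ?x))}"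
   using clk(1) by (auto elim: E_mono)
  have "E c2 (ms ?z 0 (enc (Cn clk ?x) @ [])) (T2 (Cn clk ?x)) {ms ?z 0 (enc (Cn (th (Cn clk ?x)) (Cn Nl (tt (Cn clk ?x)))) @ [])}"
   using c2(1) unfolding computes_def by blast
  moreover have "T2 (Cn clk ?x) \<le> V2 w" using k2[of "Cn clk ?x"] clk(3) by (simp add: V2_def numeral_3_eq_3)
  ultimately have e3: "E c2 (ms ?z 0 (enc (Cn clk ?x))) (V2 w) {ms ?z 0 (enc (Cn clk (Cn Nl ?x)))}"
   by (auto elim: E_mono)
  let ?G = "grow (D w) (Cn Nl ?x)"
  have N2: "11 * sz clk + sz (Cn Nl ?x) \<le> N2 w" using clk(3) by (simp add: N2_def)
  have "E (Whl 1 {2} (guess_body ca cb cc)) (ms ?z 0 (enc clk @ enc (Cn Nl ?x) @ [])) (((N2 w + 1) ^ ka + 40) * sz clk)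
    ((%S'. ms ?z 0 (1 # enc S' @ [])) ` grow (len clk) (Cn Nl ?x))"
  proof -
   have "Ta v \<le> (N2 w + 1) ^ ka & Tb v \<le> (N2 w + 1) ^ ka & Tc v \<le> (N2 w + 1) ^ ka" if "sz v \<le> N2 w" for v
    using ka[of v] power_mono[of "sz v + 1" "N2 w + 1" ka] that by simp
   then show ?thesis
    by (intro E_guess[OF ca(1) cb(1) cc(1) _ N2])
  qed
  then have wh: "E (Whl 1 {2} (guess_body ca cb cc)) (ms ?z 0 (enc clk @ enc (Cn Nl ?x))) (((N2 w + 1) ^ ka + 40) * (2 * D w + 1))
    ((%S'. ms ?z 0 (1 # enc S')) ` ?G)"
   by (simp only: append_Nil2 clk(2,3))
  have inj1: "inj_on (%S'. ms ?z 0 (1 # enc S')) ?G"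
   by (rule inj_onI) (auto simp: st_def enc_eq_iff dest!: stk_inj)
  have "E (Whl 1 {2} (guess_body ca cb cc) ;; pop 1) (ms ?z 0 (enc clk @ enc (Cn Nl ?x)))
    (Suc (((N2 w + 1) ^ ka + 40) * (2 * D w + 1) + 3)) (\<Union>S'\<in>?G. {ms ?z 0 (enc S')})"
   by (rule E_Seqs_inj[OF wh inj1 pop_st(2)])
  from E_Seq[OF pop_st(2)[of _ _ 2] this]
  have e4: "E (guess_op ca cb cc) (ms ?z 0 (enc (Cn clk (Cn Nl ?x)))) (V3 w) ((%S'. ms ?z 0 (enc S')) ` ?G)"
   unfolding guess_op_def V3_def UNION_singleton_eq_range by (auto elim: E_mono)
  have inj2: "inj_on (%S'. ms ?z 0 (enc S')) ?G" by (rule inj_onI) (auto simp: st_def enc_eq_iff dest!: stk_inj)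
  let ?f = "%S. chk (Cn (tt S) (th (th S)))"
  let ?Q = "%S. if ?f S ~= Nl then {ms ?z 0 (enc (?f S))} else {}"
  have e5: "E (c3 ;; Ite 1 {2} Skip Abort) (ms ?z 0 (enc S)) (Suc (V4 w + 2)) (?Q S)" if "S \<in> ?G" for S
  proof -
   have "E c3 (ms ?z 0 (enc S @ [])) (T3 S) {ms ?z 0 (enc (?f S) @ [])}"
    using c3(1) unfolding computes_def by blast
   moreover have "T3 S \<le> V4 w"
   proof -
    have "sz S \<le> N2 w" using sz_grow[OF that] by (simp add: N2_def)
    then have "(sz S + 1) ^ k3 \<le> V4 w" unfolding V4_def by (intro power_mono) auto
    then show ?thesis using k3[of S] by linarith
   qed
   ultimately have 1: "E c3 (ms ?z 0 (enc S)) (V4 w) {ms ?z 0 (enc (?f S))}" by (auto elim: E_mono)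
   have "E (Ite 1 {2} Skip Abort) (ms ?z 0 (enc (?f S))) 2 (?Q S)"
   proof (cases "?f S")
    case Nl
    then show ?thesis using E_If2[OF _ _ E_Abort, of "ms ?z 0 (enc (?f S))" 1 "{2}" Skip] by (simp add: numeral_2_eq_2)
   next
    case (Cn a b)
    then show ?thesis using E_If1[OF _ _ E_Skip[of _ 1], of "ms ?z 0 (enc (?f S))" 1 "{2}" Abort] by (simp add: numeral_2_eq_2)
   qed
   then show ?thesis by (rule E_Seq[OF 1])
  qed
  have e6: "E (guess_op ca cb cc ;; c3 ;; Ite 1 {2} Skip Abort) (ms ?z 0 (enc (Cn clk (Cn Nl ?x)))) (Suc (V3 w + Suc (V4 w + 2)))
    (\<Union>S\<in>?G. ?Q S)"
   by (rule E_Seqs_inj[OF e4 inj2 e5])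
  have "E ?c (st ?z (map symb w) [] [] 0 []) (U w) (\<Union>S\<in>?G. ?Q S)"
   by (rule E_mono[OF E_Seq[OF E_input E_Seq[OF e1 E_Seq[OF e2 E_Seq[OF e3 e6]]]]]) (simp add: U_def)
  moreover have "(\<Union>S\<in>?G. ?Q S) ~= {} \<longleftrightarrow> w \<in> L"
  proof
   assume "(\<Union>S\<in>?G. ?Q S) ~= {}"
   then obtain S where "S \<in> ?G" "?f S ~= Nl" by (auto split: if_splits)
   then have "chk (Cn (bt w) (th (th S))) ~= Nl" using grow_tt by fastforce
   then show "w \<in> L" using L by blast
  next
   assume "w \<in> L"
   then obtain u where u: "sz u \<le> 2 ^ ((length w + 2) ^ k)" "chk (Cn (bt w) u) ~= Nl" using small by blast
   have "(2::nat) ^ ((length w + 2) ^ k) \<le> D w" unfolding D_def by (intro power_increasing) auto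
   then have "Cn (Cn u Nl) (bt w) \<in> ?G" using grow_mono[OF grow_tree] u(1) by (meson le_trans)
   then show "(\<Union>S\<in>?G. ?Q S) ~= {}" using u(2) by (auto intro!: bexI[of _ "Cn (Cn u Nl) (bt w)"])
  qed
  ultimately show ?thesis by blast
 qed
 have "pbd D N1"
  unfolding N1_def by (intro pbd_add pbd_mult pbd_const pbd_self szw D2 pbD FP_size FP_lpow)
 moreover have "pbd D N2"
  unfolding N2_def by (intro pbd_add pbd_mult pbd_const pbd_self szw D2)
 moreover have "pbd D length"
  by (rule pbd_le[OF szw]) (rule length_bt)
 ultimately have "pbd D U"
  unfolding U_def V1_def V2_def V3_def V4_def
  by (intro pbd_add pbd_mult pbd_const pbd_self pbd_power szw D2 pbD c1(2))
 then obtain J where J: "U w \<le> D w ^ J" for w unfolding pbd_def by blast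
 obtain b K where bK: "(2::nat) ^ ((n + 2) ^ Suc k * J) \<le> b * 2 ^ (n ^ K) + b" for n
  using double_exp_bound by blast
 have Ub: "U w \<le> b * 2 ^ (length w ^ K) + b" for w
  using J[of w] bK[of "length w"] by (simp add: D_def power_mult)
 have wf: "wfc 4 ?c"
  using c1(1) cd(1) c2(1) ca(1) cb(1) cc(1) c3(1)
  by (auto simp: computes_def foldc_def guess_op_def guess_body_def)
 have "halts_within ?M w (b * 2 ^ (length w ^ K) + b) & (w \<in> L \<longleftrightarrow> accepts ?M w)" for w
 proof -
  obtain Q where Q: "E ?c (st (int (length w)) (map symb w) [] [] 0 []) (U w) Q" "Q ~= {} \<longleftrightarrow> w \<in> L"
   using main by blast
  note em = E_machine[OF Q(1) good_initial wf self_derivs, folded initial_st]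
  have "halts_within ?M w (b * 2 ^ (length w ^ K) + b)"
   unfolding halts_within_def using em[THEN conjunct1] Ub[of w] le_trans by blast
  moreover have "accepts ?M w \<longleftrightarrow> Q ~= {}"
   unfolding accepts_def using em[THEN conjunct2] by blast
  ultimately show ?thesis using Q(2) by blast
 qed
 moreover have "wf_tm ?M" by (rule wf_machine[OF wf]) simp
 ultimately have "L \<in> NTIME (%n. 2 ^ (n ^ K))"
  unfolding NTIME_def by blast
 then show ?thesis unfolding NEXPTIME_def by blast
qed

section \<open>Computations as tilings\<close>

text \<open>A tile describes one cell at one time: the state, the symbols read by all heads and the
 transition taken (\<open>None\<close> at the end of an accepting run), together with, for each tape, the symbol
 in the cell and whether the head is there. Positions are taken modulo \<open>W\<close>.\<close>

type_synonym tile = "(nat \<times> nat list \<times> (nat \<times> nat list \<times> dir list) option) \<times> (nat \<times> bool) list"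

definition act :: "tile => (nat \<times> nat list \<times> dir list) option" where "act a = snd (snd (fst a))"
definition tsym :: "nat => tile => nat" where "tsym j a = fst (snd a ! j)"
definition hd_at :: "nat => tile => bool" where "hd_at j a = snd (snd a ! j)"

definition tiles :: "tm => tile set" where
 "tiles M = {a. (case a of ((q, rs, t), cs) => q < states M & length rs = tapes M & set rs \<subseteq> {..<symbols M} &
   length cs = tapes M & fst ` set cs \<subseteq> {..<symbols M} & (\<forall>j<tapes M. hd_at j a --> tsym j a = rs ! j) &
   (case t of None => q \<in> accepting M & (\<forall>q' ws ds. (q, rs, q', ws, ds) \<notin> transitions M)
    | Some (q', ws, ds) => (q, rs, q', ws, ds) \<in> transitions M))}"

definition no_clash :: "tm => tile => tile => bool" where
 "no_clash M a b \<longleftrightarrow> (\<forall>j<tapes M. \<not> (hd_at j a & hd_at j b))"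

definition update :: "tm => tile => tile => bool" where
 "update M a b \<longleftrightarrow> (case act a of None => True | Some (q', ws, ds) => fst (fst b) = q' &
   (\<forall>j<tapes M. tsym j b = (if hd_at j a then ws ! j else tsym j a)))"

definition moves :: "tm => dir => tile => tile => bool" where
 "moves M d a b \<longleftrightarrow> (case act a of None => True | Some (q', ws, ds) =>
   (\<forall>j<tapes M. hd_at j a & ds ! j = d --> hd_at j b))"

definition init_tile :: "tm => bool list => nat => tile => bool" where
 "init_tile M w p a \<longleftrightarrow> fst (fst a) = 0 & (p = 0 --> (\<forall>j<tapes M. hd_at j a)) &
   (\<forall>j<tapes M. tsym j a = (if j = 0 & p < length w then symb (w ! p) else 0))"

text \<open>Elements of \<open>V\<close> are arbitrary objects with coordinates; several may share a
  cell, as the formula below does not exclude that. Successors are taken modulo \<open>W\<close>, as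
  binary numbers of fixed width provide; only the demand for a next row uses \<open>tm e + 1\<close>
  itself, so that time does not wrap around.\<close>

definition tiling :: "tm => bool list => nat => 'v set => ('v => nat) => ('v => nat) => ('v => tile) => bool" where
 "tiling M w W V tm ps lb \<longleftrightarrow>
   (\<forall>e\<in>V. tm e < W & ps e < W & lb e \<in> tiles M) &
   (\<exists>e\<in>V. tm e = 0 & ps e = 0) &
   (\<forall>e\<in>V. \<exists>f\<in>V. tm f = tm e & ps f = (ps e + 1) mod W) &
   (\<forall>e\<in>V. act (lb e) = None \<or> (\<exists>f\<in>V. tm f = tm e + 1 & ps f = ps e)) &
   (\<forall>e\<in>V. tm e = 0 --> init_tile M w (ps e) (lb e)) &
   (\<forall>e\<in>V. \<forall>f\<in>V. (tm e = tm f --> fst (lb e) = fst (lb f)) &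
    (tm e = tm f & ps e ~= ps f --> no_clash M (lb e) (lb f)) &
    (tm f = (tm e + 1) mod W -->
      (ps e = ps f --> update M (lb e) (lb f) & moves M Stay (lb e) (lb f)) &
      (ps f = (ps e + 1) mod W --> moves M Go_Right (lb e) (lb f)) &
      (ps e = (ps f + 1) mod W --> moves M Go_Left (lb e) (lb f))))"

text \<open>If \<open>M\<close> does not accept, no row can be the end of a run, so the rows spell
  out a run of \<open>T + 1\<close> steps, which \<open>halts_within\<close> forbids. Within
  \<open>T + 1 < H\<close> steps no head leaves the window from \<open>- H\<close> to
  \<open>H - 1\<close>, so reducing positions modulo \<open>W = 2 * H\<close> does no harm.\<close>

lemma tiling_accepts:
 assumes wf: "wf_tm M" and til: "tiling M w W V tm ps lb"
  and halt: "halts_within M w T" and W: "W = 2 * H" "T + 1 < H" "length w \<le> H"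
 shows "accepts M w"
proof (rule ccontr)
 assume na: "\<not> accepts M w"
 note ti = til[unfolded tiling_def]
 have t1: "tm e < W" "ps e < W" "lb e \<in> tiles M" if "e \<in> V" for e using ti that by blast+
 have t2: "\<exists>e\<in>V. tm e = 0 & ps e = 0" using ti by blast
 have t3: "\<exists>f\<in>V. tm f = tm e & ps f = (ps e + 1) mod W" if "e \<in> V" for e using ti that by blast
 have t4: "act (lb e) = None \<or> (\<exists>f\<in>V. tm f = tm e + 1 & ps f = ps e)" if "e \<in> V" for e using ti that by blast
 have t5: "init_tile M w (ps e) (lb e)" if "e \<in> V" "tm e = 0" for e using ti that by blast
 have t6: "fst (lb e) = fst (lb f)" if "e \<in> V" "f \<in> V" "tm e = tm f" for e f using ti that by blast
 have t7: "no_clash M (lb e) (lb f)" if "e \<in> V" "f \<in> V" "tm e = tm f" "ps e ~= ps f" for e f using ti that by blast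
 have t8: "update M (lb e) (lb f)" "moves M Stay (lb e) (lb f)"
  if "e \<in> V" "f \<in> V" "tm f = (tm e + 1) mod W" "ps e = ps f" for e f using ti that by blast+
 have t9: "moves M Go_Right (lb e) (lb f)"
  if "e \<in> V" "f \<in> V" "tm f = (tm e + 1) mod W" "ps f = (ps e + 1) mod W" for e f using ti that by blast
 have t10: "moves M Go_Left (lb e) (lb f)"
  if "e \<in> V" "f \<in> V" "tm f = (tm e + 1) mod W" "ps e = (ps f + 1) mod W" for e f using ti that by blast
 have Wpos: "W > 0" using W by simp
 have all_pos: "\<exists>f\<in>V. tm f = tm e & ps f = v" if "e \<in> V" "v < W" for e v
 proof -
  have "\<exists>f\<in>V. tm f = tm e & ps f = (ps e + i) mod W" for i
  proof (induction i)
   case 0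
   then show ?case using that t1 by auto
  next
   case (Suc i)
   then obtain f where "f \<in> V" "tm f = tm e" "ps f = (ps e + i) mod W" by blast
   then show ?case using t3[of f] by (auto simp: mod_Suc_eq)
  qed
  from this[of "W - ps e + v"] show ?thesis
   using that t1(2)[OF that(1)] by simp
 qed
 define cell where "cell p = nat (p mod int W)" for p
 have cell_less: "cell p < W" for p using Wpos by (auto simp: cell_def nat_less_iff)
 have cell_eq: "cell p = cell p' \<longleftrightarrow> p = p'"
  if "- int H \<le> p" "p < int H" "- int H \<le> p'" "p' < int H" for p p'
 proof
  assume "cell p = cell p'"
  then have "p mod int W = p' mod int W" using Wpos by (simp add: cell_def eq_nat_nat_iff)
  then have "int W dvd p - p'" by (simp add: mod_eq_dvd_iff)
  moreover have "\<bar>p - p'\<bar> < int W" using that W by linarith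
  ultimately show "p = p'" using dvd_imp_le_int[of "p - p'" "int W"] by force
 qed simp
 have cell_Suc: "cell (p + 1) = (cell p + 1) mod W" for p
 proof -
  have "int (cell (p + 1)) = int ((cell p + 1) mod W)"
   using Wpos by (simp add: cell_def zmod_int mod_add_left_eq mod_add_right_eq add.commute)
  then show ?thesis by simp
 qed
 \<comment> \<open>Row \<open>t\<close> describes the configuration exactly on the window; the
   equivalence for \<open>hd_at\<close> also says that there are no spurious heads.\<close>
 define inv where "inv t C \<longleftrightarrow> length (snd C) = tapes M & (\<exists>e\<in>V. tm e = t) &
   (\<forall>j<tapes M. \<bar>snd (snd C ! j)\<bar> \<le> int t) &
   (\<forall>e\<in>V. tm e = t --> fst (fst (lb e)) = fst C & (\<forall>j<tapes M. \<forall>p. - int H \<le> p & p < int H & ps e = cell p -->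
     tsym j (lb e) = fst (snd C ! j) p & (hd_at j (lb e) \<longleftrightarrow> snd (snd C ! j) = p)))" for t C
 have run: "\<exists>C. (step M ^^ t) (initial M w) C & inv t C" if "t \<le> T + 1" for t
  using that
 proof (induction t)
  case 0
  obtain e0 where e0: "e0 \<in> V" "tm e0 = 0" "ps e0 = 0" using t2 by blast
  have nthj: "snd (initial M w) ! j = (if j = 0 then (word_content w, 0) else ((%_. 0), 0))" if "j < tapes M" for j
   using that by (auto simp: initial_def nth_Cons')
  have "inv 0 (initial M w)"
   unfolding inv_def
  proof (intro conjI ballI allI impI)
   show "length (snd (initial M w)) = tapes M" using wf by (auto simp: initial_def wf_tm_def)
   show "\<exists>e\<in>V. tm e = 0" using e0 by blast
   fix e assume e: "e \<in> V" "tm e = 0"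
   show "fst (fst (lb e)) = fst (initial M w)" using t5[OF e] by (auto simp: init_tile_def initial_def)
   fix j p assume j: "j < tapes M" and p: "- int H \<le> p & p < int H & ps e = cell p"
   have "cell p = (if p \<ge> 0 then nat p else nat (p + int W))"
   proof (cases "p \<ge> 0")
    case True
    then show ?thesis using p W by (simp add: cell_def)
   next
    case False
    have "p mod int W = (p + int W) mod int W" by simp
    also have "\<dots> = p + int W" using p W False by (intro mod_pos_pos_trivial) auto
    finally show ?thesis using False by (simp add: cell_def)
   qed
   moreover have "word_content w p = (if cell p < length w then symb (w ! cell p) else 0)"
    using calculation p W by (auto simp: word_content_def symb_def)
   ultimately show "tsym j (lb e) = fst (snd (initial M w) ! j) p"
    using t5[OF e] j p by (auto simp: init_tile_def nthj)
   show "hd_at j (lb e) \<longleftrightarrow> snd (snd (initial M w) ! j) = p"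
   proof (cases "p = 0")
    case True
    then show ?thesis using t5[OF e] j p by (auto simp: init_tile_def nthj cell_def)
   next
    case False
    then have "ps e ~= 0" using p cell_eq[of p 0] W by (auto simp: cell_def)
    then have "no_clash M (lb e) (lb e0)" using t7[of e e0] e e0 by simp
    moreover have "hd_at j (lb e0)" using t5[of e0] e0 j by (simp add: init_tile_def)
    ultimately show ?thesis using False j by (auto simp: no_clash_def nthj)
   qed
  qed (auto simp: nthj)
  then show ?case by auto
 next
  case (Suc t)
  then obtain C where C: "(step M ^^ t) (initial M w) C" "inv t C" by auto
  obtain q ts where Cq: "C = (q, ts)" by force
  note iv = C(2)[unfolded inv_def Cq snd_conv fst_conv]
  have lts: "length ts = tapes M" using iv by blast
  have head_bd: "\<bar>snd (ts ! j)\<bar> \<le> int t" if "j < tapes M" for j using iv that by blast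
  have iv1: "fst (fst (lb e)) = q" if "e \<in> V" "tm e = t" for e using iv that by blast
  have iv2: "tsym j (lb e) = fst (ts ! j) p" "hd_at j (lb e) \<longleftrightarrow> snd (ts ! j) = p"
   if "e \<in> V" "tm e = t" "j < tapes M" "- int H \<le> p" "p < int H" "ps e = cell p" for e j p
   using iv that by blast+
  have tH: "int t + 1 < int H" using Suc.prems W by linarith
  obtain e where e: "e \<in> V" "tm e = t" using iv by blast
  obtain rs ac cs where tle: "lb e = ((q, rs, ac), cs)" using iv1[OF e] by (cases "lb e") auto
  have all_t: "fst (lb f) = (q, rs, ac)" if "f \<in> V" "tm f = t" for f
   using t6[OF that(1) e(1)] that e tle by simp
  note te = t1(3)[OF e(1), unfolded tiles_def tle, simplified]
  have head_el: "\<exists>f\<in>V. tm f = t & ps f = cell p" for p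
   using all_pos[OF e(1) cell_less] e(2) by blast
  have rs: "rs = map read_tape ts"
  proof (rule nth_equalityI)
   show l: "length rs = length (map read_tape ts)" using te lts by simp
   fix j assume "j < length rs"
   then have j: "j < tapes M" using l lts by simp
   obtain f where f: "f \<in> V" "tm f = t" "ps f = cell (snd (ts ! j))" using head_el by blast
   have b: "- int H \<le> snd (ts ! j)" "snd (ts ! j) < int H" using head_bd[OF j] tH by linarith+
   have "hd_at j (lb f)" "tsym j (lb f) = fst (ts ! j) (snd (ts ! j))"
    using iv2[OF f(1,2) j b f(3)] by auto
   moreover obtain cs' where "lb f = ((q, rs, ac), cs')" using all_t[OF f(1,2)] by (cases "lb f") auto
   ultimately have "rs ! j = fst (ts ! j) (snd (ts ! j))"
    using t1(3)[OF f(1)] j by (auto simp: tiles_def)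
   then show "rs ! j = map read_tape ts ! j" using j lts by (simp add: read_tape_def)
  qed
  show ?case
  proof (cases ac)
   case None
   then have acc: "q \<in> accepting M" and no: "\<And>q' ws ds. (q, rs, q', ws, ds) \<notin> transitions M" using te by auto
   have "halted M C"
    unfolding halted_def
   proof
    assume "\<exists>C'. step M C C'"
    then obtain C' where "step M C C'" by blast
    then show False using no rs by (cases C') (auto simp: Cq step.simps)
   qed
   then have "accepts M w"
    unfolding accepts_def using relpowp_imp_rtranclp[OF C(1)] acc by (intro exI[of _ C]) (auto simp: Cq)
   then show ?thesis using na by blast
  next
   case (Some a)
   obtain q' ws ds where a: "a = (q', ws, ds)" by (cases a)
   have tr: "(q, rs, q', ws, ds) \<in> transitions M" using te Some a by auto
   then have lwd: "length ws = tapes M" "length ds = tapes M"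
    using wf unfolding wf_tm_def by fast+
   let ?ts = "map2 act_tape ts (zip ws ds)"
   have st: "step M C (q', ?ts)" using tr rs by (auto simp: Cq step.simps)
   have nth: "?ts ! j = ((fst (ts ! j))(snd (ts ! j) := ws ! j), move (ds ! j) (snd (ts ! j)))" if "j < tapes M" for j
    using that lts lwd by (cases "ts ! j") auto
   have mv: "\<bar>move d h\<bar> \<le> \<bar>h\<bar> + 1" for d h by (cases d) auto
   have acte: "act (lb f) = Some (q', ws, ds)" if "f \<in> V" "tm f = t" for f
    using all_t[OF that] Some a by (simp add: act_def)
   obtain e1 where e1: "e1 \<in> V" "tm e1 = t + 1" using t4[OF e(1)] acte[OF e] e(2) by auto
   have tmod: "t + 1 = (t + 1) mod W" using tH W by simp
   have head: "hd_at j (lb f)" if f: "f \<in> V" "tm f = t + 1" and j: "j < tapes M" and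
    p: "ps f = cell (snd (?ts ! j))" for f j
   proof -
    let ?h = "snd (ts ! j)"
    have b: "- int H \<le> ?h" "?h < int H" using head_bd[OF j] tH by linarith+
    obtain g where g: "g \<in> V" "tm g = t" "ps g = cell ?h" using head_el by blast
    have hg: "hd_at j (lb g)" using iv2[OF g(1,2) j b g(3)] by auto
    have tm: "tm f = (tm g + 1) mod W" using f(2) g(2) tmod by simp
    show ?thesis
    proof (cases "ds ! j")
     case Stay
     then have "moves M Stay (lb g) (lb f)" using t8(2)[OF g(1) f(1) tm] p g(3) nth[OF j] by simp
     then show ?thesis using hg j Stay acte[OF g(1,2)] by (auto simp: moves_def)
    next
     case Go_Right
     then have "moves M Go_Right (lb g) (lb f)" using t9[OF g(1) f(1) tm] p g(3) nth[OF j] by (simp add: cell_Suc)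
     then show ?thesis using hg j Go_Right acte[OF g(1,2)] by (auto simp: moves_def)
    next
     case Go_Left
     then have "moves M Go_Left (lb g) (lb f)"
      using t10[OF g(1) f(1) tm] p g(3) nth[OF j] cell_Suc[of "?h - 1"] by simp
     then show ?thesis using hg j Go_Left acte[OF g(1,2)] by (auto simp: moves_def)
    qed
   qed
   have "inv (Suc t) (q', ?ts)"
    unfolding inv_def
   proof (intro conjI ballI allI impI)
    show "length (snd (q', ?ts)) = tapes M" using lts lwd by simp
    show "\<exists>e\<in>V. tm e = Suc t" using e1 by auto
    fix j assume j: "j < tapes M"
    show "\<bar>snd (snd (q', ?ts) ! j)\<bar> \<le> int (Suc t)"
     using mv[of "ds ! j" "snd (ts ! j)"] head_bd[OF j] nth[OF j] by simp
   next
    fix f assume f: "f \<in> V" "tm f = Suc t"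
    obtain g where g: "g \<in> V" "tm g = t" "ps g = ps f" using all_pos[OF e(1) t1(2)[OF f(1)]] e(2) by blast
    have tm: "tm f = (tm g + 1) mod W" using f(2) g(2) tmod by simp
    have up: "update M (lb g) (lb f)" using t8(1)[OF g(1) f(1) tm g(3)] .
    show "fst (fst (lb f)) = fst (q', ?ts)" using up acte[OF g(1,2)] by (simp add: update_def)
    fix j p assume j: "j < tapes M" and p: "- int H \<le> p & p < int H & ps f = cell p"
    have i2: "tsym j (lb g) = fst (ts ! j) p" "hd_at j (lb g) \<longleftrightarrow> snd (ts ! j) = p"
     using iv2[OF g(1,2) j] p g(3) by auto
    show "tsym j (lb f) = fst (snd (q', ?ts) ! j) p"
     using up acte[OF g(1,2)] j i2 nth[OF j] by (auto simp: update_def)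
    show "hd_at j (lb f) \<longleftrightarrow> snd (snd (q', ?ts) ! j) = p"
    proof
     assume "snd (snd (q', ?ts) ! j) = p"
     then show "hd_at j (lb f)" using head[of f j] f j p by simp
    next
     \<comment> \<open>\<open>moves\<close> puts a head at the right cell; \<open>no_clash\<close>
       then excludes any other.\<close>
     assume hf: "hd_at j (lb f)"
     let ?h = "snd (?ts ! j)"
     have b: "- int H \<le> ?h" "?h < int H"
      using mv[of "ds ! j" "snd (ts ! j)"] head_bd[OF j] nth[OF j] tH by auto
     obtain f' where f': "f' \<in> V" "tm f' = Suc t" "ps f' = cell ?h"
      using all_pos[OF f(1) cell_less] f(2) by metis
     have "hd_at j (lb f')" using head[of f' j] f' j by simp
     then have "ps f = ps f'" using t7[of f f'] f f' hf j by (auto simp: no_clash_def)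
     then show "snd (snd (q', ?ts) ! j) = p" using f'(3) p cell_eq[of ?h p] b by auto
    qed
   qed
   moreover have "(step M ^^ Suc t) (initial M w) (q', ?ts)" using C(1) st by auto
   ultimately show ?thesis by blast
  qed
 qed
 then obtain C where "(step M ^^ (T + 1)) (initial M w) C" by blast
 then have "T + 1 \<le> T" using halt unfolding halts_within_def by blast
 then show False by simp
qed

text \<open>The tiles are read off an accepting run of \<open>t\<close> steps; its last row carries
  \<open>None\<close>. In the proof \<open>ip\<close> turns a cyclic position into its
  representative between \<open>- H\<close> and \<open>H - 1\<close>.\<close>

lemma accepts_tiling:
 assumes wf: "wf_tm M" and acc: "accepts M w"
  and halt: "halts_within M w T" and W: "W = 2 * H" "T + 1 < H" "length w \<le> H"
 shows "\<exists>t lb. t < W & tiling M w W ({..t} \<times> {..<W}) fst snd lb"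
proof -
 obtain C where "(step M)\<^sup>*\<^sup>* (initial M w) C" and hC: "halted M C" "fst C \<in> accepting M"
  using acc unfolding accepts_def by blast
 then obtain t where t: "(step M ^^ t) (initial M w) C" using rtranclp_imp_relpowp by metis
 then have "t \<le> T" using halt unfolding halts_within_def by blast
 then have tH: "t + 1 < H" using W by simp
 obtain c where c: "c 0 = initial M w" "c t = C" "\<And>i. i < t ==> step M (c i) (c (Suc i))"
  using t unfolding relpowp_fun_conv by blast
 have "\<exists>ws ds. (fst (c i), map read_tape (snd (c i)), fst (c (Suc i)), ws, ds) \<in> transitions M &
   snd (c (Suc i)) = map2 act_tape (snd (c i)) (zip ws ds)" if "i < t" for i
  using c(3)[OF that] by (cases "c i"; cases "c (Suc i)") (auto simp: step.simps)
 then obtain ws ds where wd: "\<And>i. i < t ==> (fst (c i), map read_tape (snd (c i)), fst (c (Suc i)), ws i, ds i) \<in> transitions M"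
   "\<And>i. i < t ==> snd (c (Suc i)) = map2 act_tape (snd (c i)) (zip (ws i) (ds i))"
  by metis
 have wtr: "q < states M & q' < states M & length rs = tapes M & length ws = tapes M & length ds = tapes M &
   (\<forall>s\<in>set rs \<union> set ws. s < symbols M)" if "(q, rs, q', ws, ds) \<in> transitions M" for q rs q' ws ds
  using wf that unfolding wf_tm_def by fast
 have inv: "length (snd (c i)) = tapes M & fst (c i) < states M & (\<forall>j<tapes M. \<bar>snd (snd (c i) ! j)\<bar> \<le> int i &
   (\<forall>p. fst (snd (c i) ! j) p < symbols M))" if "i \<le> t" for i
  using that
 proof (induction i)
  case 0
  have "snd (initial M w) ! j = (if j = 0 then (word_content w, 0) else ((%_. 0), 0))" if "j < tapes M" for j
   using that by (auto simp: initial_def nth_Cons')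
  moreover have "word_content w p < symbols M" for p using wf by (auto simp: word_content_def wf_tm_def)
  ultimately show ?case using wf by (auto simp: c(1) wf_tm_def) (auto simp: initial_def)
 next
  case (Suc i)
  then have IH: "length (snd (c i)) = tapes M" "\<And>j. j < tapes M ==> \<bar>snd (snd (c i) ! j)\<bar> \<le> int i"
   "\<And>j p. j < tapes M ==> fst (snd (c i) ! j) p < symbols M" and i: "i < t" by auto
  note tr = wtr[OF wd(1)[OF i]]
  have "snd (c (Suc i)) ! j = ((fst (snd (c i) ! j))(snd (snd (c i) ! j) := ws i ! j), move (ds i ! j) (snd (snd (c i) ! j)))"
   if "j < tapes M" for j
   using that tr IH(1) wd(2)[OF i] by (cases "snd (c i) ! j") auto
  moreover have "\<bar>move d h\<bar> \<le> \<bar>h\<bar> + 1" for d h by (cases d) auto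
  moreover have "ws i ! j < symbols M" if "j < tapes M" for j using tr that nth_mem[of j "ws i"] by auto
  ultimately show ?case
   using IH tr wd(2)[OF i] by (auto intro: order.trans)  (smt (verit) IH(2))
 qed
 have nthS: "snd (c (Suc i)) ! j = ((fst (snd (c i) ! j))(snd (snd (c i) ! j) := ws i ! j), move (ds i ! j) (snd (snd (c i) ! j)))"
  if "i < t" "j < tapes M" for i j
  using that wtr[OF wd(1)[OF that(1)]] inv[of i] wd(2)[OF that(1)] by (cases "snd (c i) ! j") auto
 define ip where "ip v = (if v < H then int v else int v - int W)" for v
 define lb where "lb e = ((fst (c (fst e)), map read_tape (snd (c (fst e))),
   if fst e < t then Some (fst (c (Suc (fst e))), ws (fst e), ds (fst e)) else None),
   map (%x. (fst x (ip (snd e)), snd x = ip (snd e))) (snd (c (fst e))))" for e :: "nat \<times> nat"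
 let ?V = "{..t} \<times> {..<W}"
 have s: "tsym j (lb (i, v)) = fst (snd (c i) ! j) (ip v)" "hd_at j (lb (i, v)) \<longleftrightarrow> snd (snd (c i) ! j) = ip v"
  if "i \<le> t" "j < tapes M" for i j v
  using that inv[of i] by (auto simp: tsym_def hd_at_def lb_def)
 have a: "act (lb (i, v)) = (if i < t then Some (fst (c (Suc i)), ws i, ds i) else None)" for i v
  by (simp add: act_def lb_def)
 have ip_inj: "ip v = ip v' \<longleftrightarrow> v = v'" if "v < W" "v' < W" for v v'
  using that W by (auto simp: ip_def)
 have ip_Suc: "ip ((v + 1) mod W) = ip v + 1" if "v < W" "ip v + 1 < int H" for v
  using that W by (cases "v + 1 = W") (auto simp: ip_def)
 have in_tiles: "lb (i, v) \<in> tiles M" if "i \<le> t" for i v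
 proof -
  note I = inv[OF that]
  have "read_tape x < symbols M" if "x \<in> set (snd (c i))" for x
   using that I by (auto simp: in_set_conv_nth read_tape_def)
  moreover have "fst x p < symbols M" if "x \<in> set (snd (c i))" for x p
   using that I by (auto simp: in_set_conv_nth)
  moreover have "no_tr": "(fst C, map read_tape (snd C), q', ws, ds) \<notin> transitions M" for q' ws ds
   using hC(1) unfolding halted_def by (cases C) (auto simp: step.simps)
  moreover have "hd_at j (lb (i, v)) --> tsym j (lb (i, v)) = map read_tape (snd (c i)) ! j" if "j < tapes M" for j
   using that I s[OF \<open>i \<le> t\<close> that] by (auto simp: read_tape_def)
  moreover have "i < t \<or> c i = C" using \<open>i \<le> t\<close> c(2) by (cases "i = t") auto
  ultimately show ?thesis
   using I hC(2) wd(1)[of i] unfolding tiles_def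
   by (auto simp: lb_def[of "(i, v)"] split: if_splits)
 qed
 have step_tile: "update M (lb (i, v)) (lb (Suc i, v)) &
   moves M Stay (lb (i, v)) (lb (Suc i, v)) & moves M Go_Right (lb (i, v)) (lb (Suc i, (v + 1) mod W)) &
   (\<forall>v'<W. v = (v' + 1) mod W --> moves M Go_Left (lb (i, v)) (lb (Suc i, v')))" if "i < t" "v < W" for i v
 proof (intro conjI allI impI)
  show "update M (lb (i, v)) (lb (Suc i, v))"
   using that s[of i _ v] s[of "Suc i" _ v] nthS[OF that(1)] by (auto simp: update_def a) (simp_all add: lb_def)
  show "moves M Stay (lb (i, v)) (lb (Suc i, v))"
   using that s[of i _ v] s[of "Suc i" _ v] nthS[OF that(1)] by (auto simp: moves_def a)
  have hb: "ip v + 1 < int H" "- int H < ip v" if "j < tapes M" "hd_at j (lb (i, v))" for j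
   using inv[of i] that s[of i j v] \<open>i < t\<close> tH by force+
  show "moves M Go_Right (lb (i, v)) (lb (Suc i, (v + 1) mod W))"
   using that s[of i _ v] s[of "Suc i" _ "(v + 1) mod W"] nthS[OF that(1)] hb ip_Suc[OF that(2)]
   by (auto simp: moves_def a)
  fix v' assume v': "v' < W" "v = (v' + 1) mod W"
  have "ip v' = ip v - 1" if "- int H < ip v"
   using that v' W ip_Suc[of v'] by (cases "v' + 1 = W"; cases "v' + 1 = H") (auto simp: ip_def split: if_splits)
  then show "moves M Go_Left (lb (i, v)) (lb (Suc i, v'))"
   using that s[of i _ v] s[of "Suc i" _ v'] nthS[OF that(1)] hb by (auto simp: moves_def a)
 qed
 have "tiling M w W ?V fst snd lb"
  unfolding tiling_def
 proof (intro conjI ballI impI)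
  fix e assume "e \<in> ?V"
  then obtain i v where e: "e = (i, v)" "i \<le> t" "v < W" by auto
  show "fst e < W" "snd e < W" "lb e \<in> tiles M" using e tH W in_tiles by auto
  show "\<exists>f\<in>?V. fst f = fst e & snd f = (snd e + 1) mod W" using e W by auto
  show "act (lb e) = None \<or> (\<exists>f\<in>?V. fst f = fst e + 1 & snd f = snd e)"
   using e by (auto simp: a)
  show "init_tile M w (snd e) (lb e)" if "fst e = 0"
  proof -
   have "snd (initial M w) ! j = (if j = 0 then (word_content w, 0) else ((%_. 0), 0))" if "j < tapes M" for j
    using that by (auto simp: initial_def nth_Cons')
   moreover have "word_content w (ip v) = (if v < length w then symb (w ! v) else 0)"
    using e W by (auto simp: word_content_def ip_def symb_def)
   moreover have "ip 0 = 0" using W by (simp add: ip_def)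
   ultimately show ?thesis
    using that e s[of 0 _ v] by (auto simp: init_tile_def c(1)) (simp add: lb_def c(1) initial_def)
  qed
  fix f assume "f \<in> ?V"
  then obtain i' v' where f: "f = (i', v')" "i' \<le> t" "v' < W" by auto
  show "fst (lb e) = fst (lb f)" if "fst e = fst f" using that e f by (simp add: lb_def)
  show "no_clash M (lb e) (lb f)" if "fst e = fst f & snd e ~= snd f"
   using that e f s ip_inj by (auto simp: no_clash_def)
  have tm: "i < t" "i' = Suc i" if "fst f = (fst e + 1) mod W"
   using that e f tH W by auto
  have n: "\<And>d b. i = t ==> update M (lb e) b & moves M d (lb e) b" using e by (auto simp: update_def moves_def a)
  show "update M (lb e) (lb f)" "moves M Stay (lb e) (lb f)" if "fst f = (fst e + 1) mod W" "snd e = snd f"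
   using step_tile[OF tm(1)[OF that(1)] e(3)] that e f tm by auto
  show "moves M Go_Right (lb e) (lb f)" if "fst f = (fst e + 1) mod W" "snd f = (snd e + 1) mod W"
   using step_tile[OF tm(1)[OF that(1)] e(3)] that e f tm by auto
  show "moves M Go_Left (lb e) (lb f)" if "fst f = (fst e + 1) mod W" "snd e = (snd f + 1) mod W"
   using step_tile[OF tm(1)[OF that(1)] e(3)] that e f tm by auto
 qed (use W in auto)
 moreover have "t < W" using tH W by simp
 ultimately show ?thesis by blast
qed

section \<open>Describing tilings by formulas\<close>

definition Iff :: "fm => fm => fm" where "Iff a b = Disj (Conj a b) (Conj (Neg a) (Neg b))"
definition Imp :: "fm => fm => fm" where "Imp a b = Disj (Neg a) b"
definition TT :: fm where "TT = Disj (Letter 0 X) (Neg (Letter 0 X))"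

lemma sat_derived [simp]:
 "sat \<pi> \<sigma> \<mu> (Iff a b) \<longleftrightarrow> (sat \<pi> \<sigma> \<mu> a \<longleftrightarrow> sat \<pi> \<sigma> \<mu> b)"
 "sat \<pi> \<sigma> \<mu> (Imp a b) \<longleftrightarrow> (sat \<pi> \<sigma> \<mu> a --> sat \<pi> \<sigma> \<mu> b)"
 "sat \<pi> \<sigma> \<mu> TT"
 by (auto simp: Iff_def Imp_def TT_def)

text \<open>Conjunctions over bit positions are driven by the tails of a list \<open>U\<close> whose
  length is the number of bits, position \<open>len (tt s)\<close> belonging to the tail
  \<open>s\<close>. In this form they are produced by a fold (\<open>FPf_loopt\<close>).\<close>

fun loopt :: "(tree => fm) => tree => fm" where
 "loopt G Nl = TT"
| "loopt G (Cn a L) = Conj (G (Cn a L)) (loopt G L)"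

lemma sat_loopt [simp]: "sat \<pi> \<sigma> \<mu> (loopt G U) \<longleftrightarrow> (\<forall>s\<in>tails U. sat \<pi> \<sigma> \<mu> (G s))"
 by (induction U) auto

lemma ball_tails: "(\<forall>s\<in>tails U. P (len (tt s))) \<longleftrightarrow> (\<forall>i<len U. P i)"
 by (induction U) (auto simp: less_Suc_eq)

lemma ball_tails2: "(\<forall>s\<in>tails U. P (len s) (len (tt s))) \<longleftrightarrow> (\<forall>i<len U. P (Suc i) i)"
 by (induction U) (auto simp: less_Suc_eq)

fun bigD :: "fm list => fm" where
 "bigD [] = Neg TT"
| "bigD (f # fs) = Disj f (bigD fs)"

fun bigC :: "fm list => fm" where
 "bigC [] = TT"
| "bigC (f # fs) = Conj f (bigC fs)"

lemma sat_big [simp]: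
 "sat \<pi> \<sigma> \<mu> (bigD fs) \<longleftrightarrow> (\<exists>f\<in>set fs. sat \<pi> \<sigma> \<mu> f)" "sat \<pi> \<sigma> \<mu> (bigC fs) \<longleftrightarrow> (\<forall>f\<in>set fs. sat \<pi> \<sigma> \<mu> f)"
 by (induction fs) auto

text \<open>The letter with index \<open>i\<close> of kind \<open>k < 8\<close>; its binary representation has length linear in
 \<open>i\<close> and is easy to write down. Kinds: 0 tiles, 1 and 3 the bits of time and position, 2 and 4 the
 carries of their successors, 5 the distance to the end of the input.\<close>

definition lt :: "nat => nat => nat" where
 "lt k i = k + 8 * 2 ^ i"

lemma lt_eq_iff [simp]: "k < 8 ==> k' < 8 ==> lt k i = lt k' i' \<longleftrightarrow> k = k' & i = i'"
proof -
 assume k: "k < 8" "k' < 8"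
 have "lt k i mod 8 = k" "lt k' i' mod 8 = k'" "lt k i div 8 = 2 ^ i" "lt k' i' div 8 = 2 ^ i'"
  using k by (auto simp: lt_def)
 then show ?thesis by (metis power_inject_exp one_less_numeral_iff semiring_norm(76))
qed

abbreviation L1 :: "nat => nat => var => fm" where "L1 k i a \<equiv> Letter (lt k i) a"

definition eqs :: "nat => tree => fm" where
 "eqs k U = loopt (%s. Iff (L1 k (len (tt s)) X) (L1 k (len (tt s)) Y)) U"

text \<open>The carries of incrementing a number are stored as letters at the element itself and
  tied to its digits by \<open>cars\<close>; so being the successor is checked digit by digit, as
  digit xor carry.\<close>

definition sucs :: "nat => var => var => tree => fm" where
 "sucs k a b U = loopt (%s. Iff (L1 k (len (tt s)) b) (Neg (Iff (L1 k (len (tt s)) a) (L1 (k + 1) (len (tt s)) a)))) U"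

definition zers :: "nat => var => tree => fm" where
 "zers k a U = loopt (%s. Neg (L1 k (len (tt s)) a)) U"

definition cars :: "nat => tree => fm" where
 "cars k U = Conj (L1 (k + 1) 0 X)
   (loopt (%s. Iff (L1 (k + 1) (len s) X) (Conj (L1 (k + 1) (len (tt s)) X) (L1 k (len (tt s)) X))) U)"

definition R2 :: "tile list => (tile => tile => bool) => fm" where
 "R2 gs P = bigD (concat (map (%a. map (%b. Conj (L1 0 a X) (L1 0 b Y))
   (filter (%b. P (gs ! a) (gs ! b)) [0..<length gs])) [0..<length gs]))"

definition R1 :: "tile list => (tile => bool) => fm" where
 "R1 gs P = bigD (map (%a. L1 0 a X) (filter (%a. P (gs ! a)) [0..<length gs]))"

definition uniq :: "nat => fm" where
 "uniq g = bigD (map (%a. Conj (L1 0 a X) (bigC (map (%b. Neg (L1 0 b X)) (filter (%b. b ~= a) [0..<g])))) [0..<g])"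

definition all2 :: "fm => fm" where "all2 f = Forall X (Forall Y f)"

lemma sat_all2 [simp]: "sat \<pi> \<sigma> \<mu> (all2 f) \<longleftrightarrow> (\<forall>e\<in>\<pi>. \<forall>e'\<in>\<pi>. sat \<pi> \<sigma> (\<mu>(X := e, Y := e')) f)"
 by (simp add: all2_def)

text \<open>In row 0 the letter \<open>lt 5 i\<close> says that i input letters remain from this
  cell on. It starts with the length of the input at cell 0 and decreases from cell to cell, so each
  input letter costs one conjunct and no position has to be named in binary.\<close>

definition Phi13 :: "tile list => tree => tree => fm" where
 "Phi13 gs U s = Conj (Imp (Conj (zers 1 X U) (L1 5 (len s) X))
    (if th s ~= Nl then R1 gs (%a. tsym 0 a = symb True) else R1 gs (%a. tsym 0 a = symb False)))
   (Imp (Conj (zers 1 X U) (Conj (eqs 1 U) (Conj (sucs 3 X Y U) (L1 5 (len s) X)))) (L1 5 (len (tt s)) Y))"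

text \<open>The carry \<open>lt 2 (len U)\<close> out of the top digit signals the last time step;
  its negation makes the successor of time a proper one. The outermost quantifier binds the
  \<open>X\<close> that \<open>TT\<close> leaves free.\<close>

definition Phi :: "tm => tile list => tree => tree => fm" where
 "Phi M gs U x = Forall X (bigC [all2 (Conj (cars 1 U) (cars 3 U)),
    all2 (uniq (length gs)),
    Forall Y (Exists X (Conj (zers 1 X U) (zers 3 X U))),
    Forall X (Exists Y (Conj (eqs 1 U) (sucs 3 X Y U))),
    all2 (Disj (R1 gs (%a. act a = None)) (Conj (Neg (L1 2 (len U) X)) (Exists Y (Conj (sucs 1 X Y U) (eqs 3 U))))),
    all2 (Imp (eqs 1 U) (R2 gs (%a b. fst a = fst b))),
    all2 (Imp (Conj (eqs 1 U) (Neg (eqs 3 U))) (R2 gs (no_clash M))),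
    all2 (Imp (Conj (sucs 1 X Y U) (eqs 3 U)) (R2 gs (%a b. update M a b & moves M Stay a b))),
    all2 (Imp (Conj (sucs 1 X Y U) (sucs 3 X Y U)) (R2 gs (moves M Go_Right))),
    all2 (Imp (Conj (sucs 1 X Y U) (sucs 3 Y X U)) (R2 gs (moves M Go_Left))),
    all2 (Imp (zers 1 X U) (R1 gs (%a. fst (fst a) = 0 & (\<forall>j<tapes M. 0 < j --> tsym j a = 0)))),
    all2 (Imp (Conj (zers 1 X U) (zers 3 X U)) (Conj (R1 gs (%a. \<forall>j<tapes M. hd_at j a)) (L1 5 (len x) X))),
    all2 (loopt (Phi13 gs U) x),
    all2 (Conj (Imp (Conj (zers 1 X U) (L1 5 0 X)) (R1 gs (%a. tsym 0 a = 0)))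
     (Imp (Conj (zers 1 X U) (Conj (eqs 1 U) (Conj (sucs 3 X Y U) (Conj (L1 5 0 X) (Neg (zers 3 Y U)))))) (L1 5 0 Y)))])"

lemma closed_Phi: "closed_fm (Phi M gs U x)"
proof -
 have vd: "A - {X} - {Y} = {}" "A - {Y} - {X} = {}" for A :: "var set"
  using var.exhaust by auto
 have "free_vars (all2 f) = {}" for f
  by (simp add: all2_def vd)
 moreover have "free_vars TT = {X}" by (simp add: TT_def)
 ultimately show ?thesis
  by (simp add: closed_fm_def Phi_def vd)
qed

subsection \<open>Binary numbers given by letters\<close>

definition bsum :: "(nat => bool) => nat => nat" where
 "bsum P m = (\<Sum>i<m. if P i then 2 ^ i else 0)"

lemma bsum_simps [simp]: "bsum P 0 = 0" "bsum P (Suc m) = bsum P m + (if P m then 2 ^ m else 0)"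
 by (simp_all add: bsum_def)

lemma bsum_less: "bsum P m < 2 ^ m"
 by (induction m) auto

lemma bsum_eq_iff: "bsum P m = bsum Q m \<longleftrightarrow> (\<forall>i<m. P i = Q i)"
proof (induction m)
 case (Suc m)
 show ?case
  using bsum_less[of P m] bsum_less[of Q m] Suc by (auto simp: less_Suc_eq)
qed simp

lemma bsum_zero_iff: "bsum P m = 0 \<longleftrightarrow> (\<forall>i<m. \<not> P i)"
 by (induction m) (auto simp: less_Suc_eq)

lemma bsum_carry:
 assumes "c 0" "\<And>i. i < m ==> c (Suc i) \<longleftrightarrow> c i & P i"
 shows "bsum (%i. P i ~= c i) m + (if c m then 2 ^ m else 0) = bsum P m + 1"
 using assms(2)
proof (induction m)
 case (Suc m)
 then have "bsum (%i. P i ~= c i) m + (if c m then 2 ^ m else 0) = bsum P m + 1" by simp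
 then show ?case using Suc.prems[of m] by (cases "P m"; cases "c m") auto
qed (use assms in simp)

lemma bsum_Suc_iff:
 assumes "c 0" "\<And>i. i < m ==> c (Suc i) \<longleftrightarrow> c i & P i"
 shows "bsum Q m = (bsum P m + 1) mod 2 ^ m \<longleftrightarrow> (\<forall>i<m. Q i \<longleftrightarrow> P i ~= c i)"
  and "c m \<longleftrightarrow> bsum P m + 1 = 2 ^ m"
proof -
 note * = bsum_carry[of c m P, OF assms]
 show "c m \<longleftrightarrow> bsum P m + 1 = 2 ^ m"
  using * bsum_less[of P m] bsum_less[of "%i. P i ~= c i" m] by (auto split: if_splits)
 have "(bsum P m + 1) mod 2 ^ m = (bsum (%i. P i ~= c i) m + (if c m then 2 ^ m else 0)) mod 2 ^ m"
  by (simp only: *)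
 also have "\<dots> = bsum (%i. P i ~= c i) m"
  using bsum_less[of "%i. P i ~= c i" m] by (auto simp del: bsum_simps)
 finally have "(bsum P m + 1) mod 2 ^ m = bsum (%i. P i ~= c i) m" .
 then show "bsum Q m = (bsum P m + 1) mod 2 ^ m \<longleftrightarrow> (\<forall>i<m. Q i \<longleftrightarrow> P i ~= c i)"
  by (simp only: bsum_eq_iff)
qed

lemma mod_power_Suc: "v mod 2 ^ Suc i = (if odd (v div 2 ^ i) then 2 ^ i else 0) + v mod 2 ^ i" for v :: nat
 using mod_mult2_eq[of v "2 ^ i" 2] by (simp add: mult.commute mod_2_eq_odd)

lemma bsum_odd: "bsum (%i. odd (v div 2 ^ i)) m = v mod 2 ^ m"
proof (induction m)
 case (Suc m)
 then show ?case unfolding mod_power_Suc by simp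
qed simp

text \<open>The carry into digit i is 1 exactly if the i lowest digits are all 1, that is
  \<open>v mod 2 ^ i = 2 ^ i - 1\<close>. The model built from a tiling sets its carry letters by
  this formula.\<close>

lemma carry_mod: "v mod 2 ^ Suc i = 2 ^ Suc i - 1 \<longleftrightarrow> v mod 2 ^ i = 2 ^ i - 1 & odd (v div 2 ^ i)" for v :: nat
proof -
 define p where "p = (2::nat) ^ i"
 have "v mod p < p" "p \<ge> 1" by (auto simp: p_def)
 then obtain a where a: "v mod p = a" "a < p" by blast
 have "v mod (2 * p) = (if odd (v div p) then p else 0) + a"
  using mod_power_Suc[of v i] a by (simp add: p_def)
 then show ?thesis
  unfolding power_Suc p_def[symmetric] a(1) using a(2) by auto
qed

subsection \<open>Semantics of the formula\<close>

text \<open>What the first two conjuncts of \<open>Phi\<close> express: correct carries and exactly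
  one tile letter per element. Under these conditions letters can be read as numbers
  \<open>vl k\<close> and tiles \<open>lb\<close>.\<close>

locale lettered =
 fixes \<pi> :: "position set" and \<sigma> :: valuation and m :: nat and gs :: "tile list" and lb :: "position => tile"
 assumes nonempty: "\<pi> ~= {}"
  and car: "e \<in> \<pi> ==> k = 1 \<or> k = 3 ==> lt (k + 1) 0 \<in> \<sigma> e"
   "e \<in> \<pi> ==> k = 1 \<or> k = 3 ==> i < m ==> lt (k + 1) (Suc i) \<in> \<sigma> e \<longleftrightarrow> lt (k + 1) i \<in> \<sigma> e & lt k i \<in> \<sigma> e"
  and lab: "e \<in> \<pi> ==> lb e \<in> set gs" "e \<in> \<pi> ==> a < length gs ==> lt 0 a \<in> \<sigma> e \<longleftrightarrow> gs ! a = lb e"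
begin

definition vl :: "nat => position => nat" where
 "vl k e = bsum (%i. lt k i \<in> \<sigma> e) m"

lemma vl_less: "vl k e < 2 ^ m"
 unfolding vl_def by (rule bsum_less)

lemma sat_eqs: "len U = m ==> sat \<pi> \<sigma> \<mu> (eqs k U) \<longleftrightarrow> vl k (\<mu> X) = vl k (\<mu> Y)"
 using ball_tails[of U "%i. lt k i \<in> \<sigma> (\<mu> X) \<longleftrightarrow> lt k i \<in> \<sigma> (\<mu> Y)"]
 by (simp add: eqs_def vl_def bsum_eq_iff)

lemma sat_zers: "len U = m ==> sat \<pi> \<sigma> \<mu> (zers k a U) \<longleftrightarrow> vl k (\<mu> a) = 0"
 using ball_tails[of U "%i. lt k i \<notin> \<sigma> (\<mu> a)"]
 by (simp add: zers_def vl_def bsum_zero_iff)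

lemma sat_sucs:
 assumes "len U = m" "\<mu> a \<in> \<pi>" "k = 1 \<or> k = 3"
 shows "sat \<pi> \<sigma> \<mu> (sucs k a b U) \<longleftrightarrow> vl k (\<mu> b) = (vl k (\<mu> a) + 1) mod 2 ^ m"
proof -
 have "sat \<pi> \<sigma> \<mu> (sucs k a b U) \<longleftrightarrow> (\<forall>i<m. lt k i \<in> \<sigma> (\<mu> b) \<longleftrightarrow> (lt k i \<in> \<sigma> (\<mu> a)) ~= (lt (k + 1) i \<in> \<sigma> (\<mu> a)))"
  using ball_tails[of U "%i. lt k i \<in> \<sigma> (\<mu> b) \<longleftrightarrow> (lt k i \<in> \<sigma> (\<mu> a)) ~= (lt (k + 1) i \<in> \<sigma> (\<mu> a))"] assms(1)
  by (simp add: sucs_def)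
 then show ?thesis
  unfolding vl_def
  using bsum_Suc_iff(1)[of "%i. lt (k + 1) i \<in> \<sigma> (\<mu> a)" m "%i. lt k i \<in> \<sigma> (\<mu> a)" "%i. lt k i \<in> \<sigma> (\<mu> b)"]
   car[OF assms(2,3)] by blast
qed

lemma overflow: "e \<in> \<pi> ==> lt 2 m \<in> \<sigma> e \<longleftrightarrow> vl 1 e + 1 = 2 ^ m"
 unfolding vl_def
 using bsum_Suc_iff(2)[of "%i. lt 2 i \<in> \<sigma> e" m "%i. lt 1 i \<in> \<sigma> e"] car[of e 1] by (simp add: numeral_2_eq_2)

lemma index_ex: "e \<in> \<pi> ==> \<exists>a<length gs. gs ! a = lb e"
 using lab(1) by (auto simp: in_set_conv_nth)

lemma sat_R1: "\<mu> X \<in> \<pi> ==> sat \<pi> \<sigma> \<mu> (R1 gs P) \<longleftrightarrow> P (lb (\<mu> X))"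
 using index_ex[of "\<mu> X"] lab(2)[of "\<mu> X"] by (auto simp: R1_def)

lemma sat_R2:
 assumes "\<mu> X \<in> \<pi>" "\<mu> Y \<in> \<pi>"
 shows "sat \<pi> \<sigma> \<mu> (R2 gs P) \<longleftrightarrow> P (lb (\<mu> X)) (lb (\<mu> Y))"
proof -
 have 1: "sat \<pi> \<sigma> \<mu> (R2 gs P) \<longleftrightarrow> (\<exists>a<length gs. \<exists>b<length gs. P (gs ! a) (gs ! b) &
   lt 0 a \<in> \<sigma> (\<mu> X) & lt 0 b \<in> \<sigma> (\<mu> Y))"
  by (auto simp: R2_def)
 obtain a b where ab: "a < length gs" "gs ! a = lb (\<mu> X)" "b < length gs" "gs ! b = lb (\<mu> Y)"
  using index_ex assms by blast
 show ?thesis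
 proof
  assume "sat \<pi> \<sigma> \<mu> (R2 gs P)"
  then show "P (lb (\<mu> X)) (lb (\<mu> Y))" unfolding 1 using lab(2)[OF assms(1)] lab(2)[OF assms(2)] by auto
 next
  assume "P (lb (\<mu> X)) (lb (\<mu> Y))"
  then show "sat \<pi> \<sigma> \<mu> (R2 gs P)" unfolding 1
   using lab(2)[OF assms(1)] lab(2)[OF assms(2)] ab by (intro exI[of _ a] conjI exI[of _ b]) auto
 qed
qed

lemma sat_cars: "len U = m ==> \<mu> X \<in> \<pi> ==> k = 1 \<or> k = 3 ==> sat \<pi> \<sigma> \<mu> (cars k U)"
 using ball_tails2[of U "%j i. lt (k + 1) j \<in> \<sigma> (\<mu> X) \<longleftrightarrow> lt (k + 1) i \<in> \<sigma> (\<mu> X) & lt k i \<in> \<sigma> (\<mu> X)"] car[of "\<mu> X" k]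
 unfolding cars_def by auto

lemma sat_uniq:
 assumes "distinct gs" "\<mu> X \<in> \<pi>"
 shows "sat \<pi> \<sigma> \<mu> (uniq (length gs))"
proof -
 obtain a where a: "a < length gs" "gs ! a = lb (\<mu> X)"
  using index_ex assms by blast
 then have "lt 0 b \<in> \<sigma> (\<mu> X) \<longleftrightarrow> b = a" if "b < length gs" for b
  using lab(2)[OF assms(2) that] assms(1) that nth_eq_iff_index_eq by metis
 then show ?thesis
  using a unfolding uniq_def by (auto intro!: bexI[of _ a])
qed

lemma sat_Phi13:
 assumes "len U = m" "\<mu> X \<in> \<pi>" "\<mu> Y \<in> \<pi>"
 shows "sat \<pi> \<sigma> \<mu> (Phi13 gs U s) \<longleftrightarrow>
   (vl 1 (\<mu> X) = 0 & lt 5 (len s) \<in> \<sigma> (\<mu> X) --> tsym 0 (lb (\<mu> X)) = symb (th s ~= Nl)) &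
   (vl 1 (\<mu> X) = 0 & vl 1 (\<mu> X) = vl 1 (\<mu> Y) & vl 3 (\<mu> Y) = (vl 3 (\<mu> X) + 1) mod 2 ^ m & lt 5 (len s) \<in> \<sigma> (\<mu> X) -->
    lt 5 (len (tt s)) \<in> \<sigma> (\<mu> Y))"
 using assms by (auto simp: Phi13_def sat_zers sat_eqs sat_sucs sat_R1)

lemma sat_Phi:
 assumes "len U = m" "distinct gs"
 shows "sat \<pi> \<sigma> \<mu> (Phi M gs U x) \<longleftrightarrow>
  (\<exists>e\<in>\<pi>. vl 1 e = 0 & vl 3 e = 0) &
  (\<forall>e\<in>\<pi>. \<exists>f\<in>\<pi>. vl 1 e = vl 1 f & vl 3 f = (vl 3 e + 1) mod 2 ^ m) &
  (\<forall>e\<in>\<pi>. act (lb e) = None \<or> vl 1 e + 1 ~= 2 ^ m & (\<exists>f\<in>\<pi>. vl 1 f = (vl 1 e + 1) mod 2 ^ m & vl 3 e = vl 3 f)) &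
  (\<forall>e\<in>\<pi>. \<forall>f\<in>\<pi>. vl 1 e = vl 1 f --> fst (lb e) = fst (lb f)) &
  (\<forall>e\<in>\<pi>. \<forall>f\<in>\<pi>. vl 1 e = vl 1 f & vl 3 e ~= vl 3 f --> no_clash M (lb e) (lb f)) &
  (\<forall>e\<in>\<pi>. \<forall>f\<in>\<pi>. vl 1 f = (vl 1 e + 1) mod 2 ^ m & vl 3 e = vl 3 f -->
    update M (lb e) (lb f) & moves M Stay (lb e) (lb f)) &
  (\<forall>e\<in>\<pi>. \<forall>f\<in>\<pi>. vl 1 f = (vl 1 e + 1) mod 2 ^ m & vl 3 f = (vl 3 e + 1) mod 2 ^ m -->
    moves M Go_Right (lb e) (lb f)) &
  (\<forall>e\<in>\<pi>. \<forall>f\<in>\<pi>. vl 1 f = (vl 1 e + 1) mod 2 ^ m & vl 3 e = (vl 3 f + 1) mod 2 ^ m -->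
    moves M Go_Left (lb e) (lb f)) &
  (\<forall>e\<in>\<pi>. vl 1 e = 0 --> fst (fst (lb e)) = 0 & (\<forall>j<tapes M. 0 < j --> tsym j (lb e) = 0)) &
  (\<forall>e\<in>\<pi>. vl 1 e = 0 & vl 3 e = 0 --> (\<forall>j<tapes M. hd_at j (lb e)) & lt 5 (len x) \<in> \<sigma> e) &
  (\<forall>e\<in>\<pi>. \<forall>f\<in>\<pi>. \<forall>s\<in>tails x. (vl 1 e = 0 & lt 5 (len s) \<in> \<sigma> e --> tsym 0 (lb e) = symb (th s ~= Nl)) &
    (vl 1 e = 0 & vl 1 e = vl 1 f & vl 3 f = (vl 3 e + 1) mod 2 ^ m & lt 5 (len s) \<in> \<sigma> e --> lt 5 (len (tt s)) \<in> \<sigma> f)) &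
  (\<forall>e\<in>\<pi>. \<forall>f\<in>\<pi>. (vl 1 e = 0 & lt 5 0 \<in> \<sigma> e --> tsym 0 (lb e) = 0) &
    (vl 1 e = 0 & vl 1 e = vl 1 f & vl 3 f = (vl 3 e + 1) mod 2 ^ m & lt 5 0 \<in> \<sigma> e & vl 3 f ~= 0 --> lt 5 0 \<in> \<sigma> f))"
proof -
 have c: "(\<forall>e\<in>\<pi>. P) \<longleftrightarrow> P" for P using nonempty by auto
 have ne: "\<exists>a b. (a, b) \<in> \<pi>" using nonempty by auto
 have ov: "e \<in> \<pi> ==> lt 2 m \<in> \<sigma> e \<longleftrightarrow> vl (Suc 0) e + 1 = 2 ^ m" for e
  using overflow by simp
 show ?thesis
  unfolding Phi_def sat.simps(8)[of _ _ _ X "bigC _"]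
  using assms
  by (simp add: sat_zers sat_eqs sat_sucs sat_R1 sat_R2 sat_cars sat_uniq sat_Phi13 ov c ne)
qed

end

lemma sat_cars_iff: "sat \<pi> \<sigma> \<mu> (cars k U) \<longleftrightarrow> lt (k + 1) 0 \<in> \<sigma> (\<mu> X) &
  (\<forall>i<len U. lt (k + 1) (Suc i) \<in> \<sigma> (\<mu> X) \<longleftrightarrow> lt (k + 1) i \<in> \<sigma> (\<mu> X) & lt k i \<in> \<sigma> (\<mu> X))"
 using ball_tails2[of U "%j i. lt (k + 1) j \<in> \<sigma> (\<mu> X) \<longleftrightarrow> lt (k + 1) i \<in> \<sigma> (\<mu> X) & lt k i \<in> \<sigma> (\<mu> X)"]
 by (simp add: cars_def)

lemma tails_bt: "p < length w ==> \<exists>s\<in>tails (bt w). len s = length w - p & len (tt s) = length w - p - 1 & (th s ~= Nl) = w ! p"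
proof (induction w arbitrary: p)
 case (Cons b w)
 show ?case
 proof (cases p)
  case 0
  then show ?thesis by (auto simp: len_bt)
 next
  case (Suc q)
  then show ?thesis using Cons.IH[of q] Cons.prems by auto
 qed
qed simp

lemma bt_tails: "s \<in> tails (bt w) ==> \<exists>p<length w. len s = length w - p & len (tt s) = length w - p - 1 & (th s ~= Nl) = w ! p"
proof (induction w)
 case (Cons b w)
 then consider "s = bt (b # w)" | "s \<in> tails (bt w)" by auto
 then show ?case
 proof cases
  case 1
  then show ?thesis by (intro exI[of _ 0]) (auto simp: len_bt)
 next
  case 2
  then obtain p where "p < length w" "len s = length w - p" "len (tt s) = length w - p - 1" "(th s ~= Nl) = w ! p"
   using Cons.IH by blast
  then show ?thesis by (intro exI[of _ "Suc p"]) auto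
 qed
qed simp

lemma Phi_tiling:
 assumes "satisfiable (Phi M gs U (bt w))" "distinct gs" "set gs = tiles M" "length w < 2 ^ len U"
 shows "\<exists>(V :: position set) tm ps lb. tiling M w (2 ^ len U) V tm ps lb"
proof -
 let ?m = "len U" and ?n = "length w"
 obtain \<pi> \<sigma> where vp: "valued_permutation \<pi> \<sigma>" and mo: "models \<pi> \<sigma> (Phi M gs U (bt w))"
  using assms(1) unfolding satisfiable_def by blast
 obtain n where n: "n \<ge> 1" "is_permutation n \<pi>" using vp by (auto simp: valued_permutation_def)
 then have ne: "\<pi> ~= {}" unfolding is_permutation_def by force
 have sat: "sat \<pi> \<sigma> \<mu> (Phi M gs U (bt w))" for \<mu>
  using mo models_closed_iff[OF vp closed_Phi] by blast
 have two: "sat \<pi> \<sigma> (\<mu>(X := e)) f & sat \<pi> \<sigma> (\<mu>(X := e)) g"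
  if "sat \<pi> \<sigma> \<mu> (Forall X (Conj f (Conj g h)))" "e \<in> \<pi>" for f g h \<mu> e
  using that by simp
 have 1: "sat \<pi> \<sigma> (\<mu>(X := e)) (all2 (Conj (cars 1 U) (cars 3 U)))" "sat \<pi> \<sigma> (\<mu>(X := e)) (all2 (uniq (length gs)))"
  if "e \<in> \<pi>" for e \<mu>
  using two[OF sat[of \<mu>, unfolded Phi_def bigC.simps] that] by blast+
 have car: "lt (k + 1) 0 \<in> \<sigma> e & (\<forall>i<?m. lt (k + 1) (Suc i) \<in> \<sigma> e \<longleftrightarrow> lt (k + 1) i \<in> \<sigma> e & lt k i \<in> \<sigma> e)"
  if "e \<in> \<pi>" "k = 1 \<or> k = 3" for e k
 proof -
  have "sat \<pi> \<sigma> ((%_. e)(X := e, X := e, Y := e)) (Conj (cars 1 U) (cars 3 U))"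
   using 1(1)[OF that(1), of "%_. e"] that(1) unfolding sat_all2 by blast
  then have c: "sat \<pi> \<sigma> (%_. e) (cars 1 U)" "sat \<pi> \<sigma> (%_. e) (cars 3 U)"
   by (simp_all add: fun_upd_def)
  from that(2) show ?thesis
  proof
   assume "k = 1"
   show ?thesis unfolding \<open>k = 1\<close> by (rule c(1)[unfolded sat_cars_iff])
  next
   assume "k = 3"
   show ?thesis unfolding \<open>k = 3\<close> by (rule c(2)[unfolded sat_cars_iff])
  qed
 qed
 have ex1: "\<exists>!a. a < length gs & lt 0 a \<in> \<sigma> e" if e: "e \<in> \<pi>" for e
 proof -
  have "sat \<pi> \<sigma> ((%_. e)(X := e, X := e, Y := e)) (uniq (length gs))"
   using 1(2)[OF e, of "%_. e"] e unfolding sat_all2 by blast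
  then obtain a where "a < length gs" "lt 0 a \<in> \<sigma> e" "\<forall>b<length gs. b ~= a --> lt 0 b \<notin> \<sigma> e"
   by (auto simp: uniq_def)
  then show ?thesis by blast
 qed
 define ix where "ix e = (THE a. a < length gs & lt 0 a \<in> \<sigma> e)" for e
 have ix: "ix e < length gs" "lt 0 (ix e) \<in> \<sigma> e" if "e \<in> \<pi>" for e
  using theI'[OF ex1[OF that]] unfolding ix_def by auto
 have ix_eq: "a < length gs ==> lt 0 a \<in> \<sigma> e \<longleftrightarrow> a = ix e" if "e \<in> \<pi>" for a e
  using ix[OF that] ex1[OF that] by blast
 interpret lettered \<pi> \<sigma> ?m gs "%e. gs ! ix e"
  using ne car ix ix_eq assms(2) by unfold_locales (auto simp: nth_eq_iff_index_eq)
 let ?lb = "%e. gs ! ix e"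
 note S = sat[unfolded sat_Phi[OF refl assms(2)]]
 note s1 = S[THEN conjunct1]
 have s2: "\<exists>f\<in>\<pi>. vl 1 e = vl 1 f & vl 3 f = (vl 3 e + 1) mod 2 ^ ?m" if "e \<in> \<pi>" for e
  using S[THEN conjunct2, THEN conjunct1] that by blast
 have s3: "act (?lb e) = None \<or> vl 1 e + 1 ~= 2 ^ ?m & (\<exists>f\<in>\<pi>. vl 1 f = (vl 1 e + 1) mod 2 ^ ?m & vl 3 e = vl 3 f)"
  if "e \<in> \<pi>" for e
  using S[THEN conjunct2, THEN conjunct2, THEN conjunct1] that by blast
 note s4 = S[THEN conjunct2, THEN conjunct2, THEN conjunct2, THEN conjunct1, rule_format]
  S[THEN conjunct2, THEN conjunct2, THEN conjunct2, THEN conjunct2, THEN conjunct1, rule_format]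
  S[THEN conjunct2, THEN conjunct2, THEN conjunct2, THEN conjunct2, THEN conjunct2, THEN conjunct1, rule_format]
  S[THEN conjunct2, THEN conjunct2, THEN conjunct2, THEN conjunct2, THEN conjunct2, THEN conjunct2, THEN conjunct1, rule_format]
  S[THEN conjunct2, THEN conjunct2, THEN conjunct2, THEN conjunct2, THEN conjunct2, THEN conjunct2, THEN conjunct2, THEN conjunct1, rule_format]
 have s5: "fst (fst (?lb e)) = 0" "\<forall>j<tapes M. 0 < j --> tsym j (?lb e) = 0" if "e \<in> \<pi>" "vl 1 e = 0" for e
  using S[THEN conjunct2, THEN conjunct2, THEN conjunct2, THEN conjunct2, THEN conjunct2, THEN conjunct2, THEN conjunct2, THEN conjunct2, THEN conjunct1] that by blast+
 have s6: "\<forall>j<tapes M. hd_at j (?lb e)" "lt 5 ?n \<in> \<sigma> e" if "e \<in> \<pi>" "vl 1 e = 0" "vl 3 e = 0" for e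
  using S[THEN conjunct2, THEN conjunct2, THEN conjunct2, THEN conjunct2, THEN conjunct2, THEN conjunct2, THEN conjunct2, THEN conjunct2, THEN conjunct2, THEN conjunct1] that unfolding len_bt by blast+
 have s7: "lt 5 (len s) \<in> \<sigma> e --> tsym 0 (?lb e) = symb (th s ~= Nl)"
  "vl 1 f = 0 & vl 3 f = (vl 3 e + 1) mod 2 ^ ?m & lt 5 (len s) \<in> \<sigma> e --> lt 5 (len (tt s)) \<in> \<sigma> f"
  if "e \<in> \<pi>" "f \<in> \<pi>" "s \<in> tails (bt w)" "vl 1 e = 0" for e f s
  using S[THEN conjunct2, THEN conjunct2, THEN conjunct2, THEN conjunct2, THEN conjunct2, THEN conjunct2, THEN conjunct2, THEN conjunct2, THEN conjunct2, THEN conjunct2, THEN conjunct1, THEN bspec, THEN bspec, THEN bspec, OF that(1-3)] that(4) by simp_all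
 have s8: "lt 5 0 \<in> \<sigma> e --> tsym 0 (?lb e) = 0"
  "vl 1 f = 0 & vl 3 f = (vl 3 e + 1) mod 2 ^ ?m & lt 5 0 \<in> \<sigma> e & vl 3 f ~= 0 --> lt 5 0 \<in> \<sigma> f"
  if "e \<in> \<pi>" "f \<in> \<pi>" "vl 1 e = 0" for e f
  using S[THEN conjunct2, THEN conjunct2, THEN conjunct2, THEN conjunct2, THEN conjunct2, THEN conjunct2, THEN conjunct2, THEN conjunct2, THEN conjunct2, THEN conjunct2, THEN conjunct2, THEN bspec, THEN bspec, OF that(1,2)] that(3) by simp_all
 \<comment> \<open>Row 0 is explored from cell to cell: every position occurs, and the letters of
   kind 5 count down, staying at 0 behind the input by truncated subtraction.\<close>
 have N: "(\<exists>e\<in>\<pi>. vl 1 e = 0 & vl 3 e = v) & (\<forall>e\<in>\<pi>. vl 1 e = 0 & vl 3 e = v --> lt 5 (?n - v) \<in> \<sigma> e)"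
  if "v < 2 ^ ?m" for v
  using that
 proof (induction v)
  case 0
  then show ?case using s1 s6 by auto
 next
  case (Suc v)
  then obtain e where e: "e \<in> \<pi>" "vl 1 e = 0" "vl 3 e = v" "lt 5 (?n - v) \<in> \<sigma> e" by auto
  have v: "(vl 3 e + 1) mod 2 ^ ?m = Suc v" using e Suc.prems by simp
  have "lt 5 (?n - Suc v) \<in> \<sigma> f" if f: "f \<in> \<pi>" "vl 1 f = 0" "vl 3 f = Suc v" for f
  proof (cases "v < ?n")
   case True
   then obtain s where s: "s \<in> tails (bt w)" "len s = ?n - v" "len (tt s) = ?n - v - 1"
    using tails_bt by blast
   then show ?thesis using s7(2)[OF e(1) f(1) s(1) e(2)] e f v by auto
  next
   case False
   then show ?thesis using s8(2)[OF e(1) f(1)] e f v by auto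
  qed
  then show ?case using s2[OF e(1)] e v by auto
 qed
 have init: "init_tile M w (vl 3 e) (?lb e)" if e: "e \<in> \<pi>" "vl 1 e = 0" for e
 proof -
  have l5: "lt 5 (?n - vl 3 e) \<in> \<sigma> e" using N[OF vl_less] e by blast
  have "tsym 0 (?lb e) = (if vl 3 e < ?n then symb (w ! vl 3 e) else 0)"
  proof (cases "vl 3 e < ?n")
   case True
   then obtain s where "s \<in> tails (bt w)" "len s = ?n - vl 3 e" "(th s ~= Nl) = w ! vl 3 e"
    using tails_bt by blast
   then show ?thesis using s7(1)[OF e(1) e(1) _ e(2)] l5 True by auto
  next
   case False
   then show ?thesis using s8(1)[OF e(1) e(1) e(2)] l5 by simp
  qed
  then show ?thesis
   using s5[OF e] s6(1)[OF e] by (auto simp: init_tile_def)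
 qed
 have "tiling M w (2 ^ ?m) \<pi> (vl 1) (vl 3) ?lb"
  unfolding tiling_def
 proof (intro conjI ballI impI)
  fix e assume e: "e \<in> \<pi>"
  show "?lb e \<in> tiles M" using nth_mem[OF ix(1)[OF e]] unfolding assms(3) .
  show "\<exists>f\<in>\<pi>. vl 1 f = vl 1 e & vl 3 f = (vl 3 e + 1) mod 2 ^ ?m"
  proof -
   obtain f where "f \<in> \<pi>" "vl 1 e = vl 1 f" "vl 3 f = (vl 3 e + 1) mod 2 ^ ?m" using s2[OF e] by blast
   then show ?thesis by (intro bexI[of _ f] conjI) simp_all
  qed
  show "act (?lb e) = None \<or> (\<exists>f\<in>\<pi>. vl 1 f = vl 1 e + 1 & vl 3 f = vl 3 e)"
   using s3[OF e]
  proof (elim disjE conjE bexE)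
   fix f assume ne: "vl 1 e + 1 ~= 2 ^ ?m" and f: "f \<in> \<pi>" "vl 1 f = (vl 1 e + 1) mod 2 ^ ?m" "vl 3 e = vl 3 f"
   have "vl 1 e + 1 < 2 ^ ?m" using vl_less[of 1 e] ne by linarith
   then have "vl 1 f = vl 1 e + 1" using f(2) by simp
   then show ?thesis using f by (intro disjI2 bexI[of _ f]) simp_all
  qed simp
  show "vl 1 e = 0 ==> init_tile M w (vl 3 e) (?lb e)" using init e by blast
  show "vl 1 e < 2 ^ ?m" "vl 3 e < 2 ^ ?m" by (rule vl_less)+
  fix f assume f: "f \<in> \<pi>"
  show "fst (?lb e) = fst (?lb f)" if "vl 1 e = vl 1 f" using s4(1)[OF e f that] .
  show "no_clash M (?lb e) (?lb f)" if "vl 1 e = vl 1 f & vl 3 e ~= vl 3 f" using s4(2)[OF e f that] .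
  show "update M (?lb e) (?lb f)" "moves M Stay (?lb e) (?lb f)"
   if "vl 1 f = (vl 1 e + 1) mod 2 ^ ?m" "vl 3 e = vl 3 f" using s4(3)[OF e f conjI[OF that]] by blast+
  show "moves M Go_Right (?lb e) (?lb f)"
   if "vl 1 f = (vl 1 e + 1) mod 2 ^ ?m" "vl 3 f = (vl 3 e + 1) mod 2 ^ ?m" using s4(4)[OF e f conjI[OF that]] .
  show "moves M Go_Left (?lb e) (?lb f)"
   if "vl 1 f = (vl 1 e + 1) mod 2 ^ ?m" "vl 3 e = (vl 3 f + 1) mod 2 ^ ?m" using s4(5)[OF e f conjI[OF that]] .
 qed (rule s1)
 then show ?thesis by blast
qed

lemma tiling_Phi:
 assumes til: "tiling M w (2 ^ len U) ({..t} \<times> {..<2 ^ len U}) fst snd lb"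
  and gs: "distinct gs" "set gs = tiles M" and t: "t < 2 ^ len U" and n: "length w < 2 ^ len U" and tapes: "tapes M \<ge> 1"
 shows "satisfiable (Phi M gs U (bt w))"
proof -
 let ?m = "len U" and ?n = "length w"
 define W where "W = (2::nat) ^ ?m"
 have W: "W > 0" by (simp add: W_def)
 \<comment> \<open>The model is a diagonal with one element per cell, row after row;
   \<open>dec\<close> recovers the cell from the index.\<close>
 define \<pi> where "\<pi> = (%i. (i + 1, i + 1)) ` {..<Suc t * W}"
 define dec where "dec e = ((fst e - 1) div W, (fst e - 1) mod W)" for e :: position
 define \<sigma> where "\<sigma> e = {lt 0 a | a. a < length gs & gs ! a = lb (dec e)} \<union> {lt 1 i | i. odd (fst (dec e) div 2 ^ i)} \<union>
   {lt 2 i | i. fst (dec e) mod 2 ^ i = 2 ^ i - 1} \<union> {lt 3 i | i. odd (snd (dec e) div 2 ^ i)} \<union>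
   {lt 4 i | i. snd (dec e) mod 2 ^ i = 2 ^ i - 1} \<union> (if fst (dec e) = 0 then {lt 5 (?n - snd (dec e))} else {})" for e
 let ?V = "{..t} \<times> {..<W}"
 have perm: "is_permutation (Suc t * W) \<pi>"
  unfolding is_permutation_def \<pi>_def
 proof (intro conjI ballI)
  fix k assume "k \<in> {1..Suc t * W}"
  then obtain i where i: "k = i + 1" "i < Suc t * W" by (cases k) auto
  show "\<exists>!c. (k, c) \<in> (%i. (i + 1, i + 1)) ` {..<Suc t * W}" using i by (intro ex1I[of _ k]) auto
  show "\<exists>!r. (r, k) \<in> (%i. (i + 1, i + 1)) ` {..<Suc t * W}" using i by (intro ex1I[of _ k]) auto
 qed auto
 have "Suc t * W \<ge> 1" using W by simp
 then have vp: "valued_permutation \<pi> \<sigma>" using perm unfolding valued_permutation_def by blast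
 have dec: "dec ` \<pi> = ?V"
 proof (intro equalityI subsetI)
  fix c assume "c \<in> dec ` \<pi>"
  then obtain i where i: "i < Suc t * W" "c = (i div W, i mod W)" by (auto simp: \<pi>_def dec_def)
  then have "i div W < Suc t" by (intro less_mult_imp_div_less)
  then show "c \<in> ?V" using i W by auto
 next
  fix c assume "c \<in> ?V"
  then obtain i v where c: "c = (i, v)" "i \<le> t" "v < W" by auto
  have "i * W + v < Suc t * W"
  proof -
   have "i * W + v < Suc i * W" using c by simp
   also have "\<dots> \<le> Suc t * W" using c by (intro mult_right_mono) auto
   finally show ?thesis .
  qed
  moreover have "dec (i * W + v + 1, i * W + v + 1) = c" using c W by (simp add: dec_def)
  ultimately show "c \<in> dec ` \<pi>" unfolding \<pi>_def by force
 qed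
 then have decV: "dec e \<in> ?V" if "e \<in> \<pi>" for e using that by blast
 have sg: "a < length gs ==> lt 0 a \<in> \<sigma> e \<longleftrightarrow> gs ! a = lb (dec e)"
  "lt (Suc 0) i \<in> \<sigma> e \<longleftrightarrow> odd (fst (dec e) div 2 ^ i)" "lt 2 i \<in> \<sigma> e \<longleftrightarrow> fst (dec e) mod 2 ^ i = 2 ^ i - 1"
  "lt 3 i \<in> \<sigma> e \<longleftrightarrow> odd (snd (dec e) div 2 ^ i)" "lt 4 i \<in> \<sigma> e \<longleftrightarrow> snd (dec e) mod 2 ^ i = 2 ^ i - 1"
  "lt 5 i \<in> \<sigma> e \<longleftrightarrow> fst (dec e) = 0 & i = ?n - snd (dec e)" for a i e
 proof -
  have mem: "lt k i \<in> {lt k' j | j. P j} \<longleftrightarrow> k = k' & P i" if "k < 8" "k' < 8" for k k' i P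
   using that by auto
  show "a < length gs ==> lt 0 a \<in> \<sigma> e \<longleftrightarrow> gs ! a = lb (dec e)"
   "lt (Suc 0) i \<in> \<sigma> e \<longleftrightarrow> odd (fst (dec e) div 2 ^ i)" "lt 2 i \<in> \<sigma> e \<longleftrightarrow> fst (dec e) mod 2 ^ i = 2 ^ i - 1"
   "lt 3 i \<in> \<sigma> e \<longleftrightarrow> odd (snd (dec e) div 2 ^ i)" "lt 4 i \<in> \<sigma> e \<longleftrightarrow> snd (dec e) mod 2 ^ i = 2 ^ i - 1"
   "lt 5 i \<in> \<sigma> e \<longleftrightarrow> fst (dec e) = 0 & i = ?n - snd (dec e)"
   unfolding \<sigma>_def Un_iff by (simp_all add: mem del: mem_Collect_eq)
 qed
 interpret lettered \<pi> \<sigma> ?m gs "%e. lb (dec e)"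
 proof
  have "0 \<in> {..<Suc t * W}" using W by simp
  then show "\<pi> ~= {}" unfolding \<pi>_def by blast
  fix e :: position and k :: nat assume e: "e \<in> \<pi>"
  have "\<forall>c\<in>?V. lb c \<in> tiles M" using til unfolding tiling_def W_def by blast
  then show "lb (dec e) \<in> set gs" unfolding gs(2) using decV[OF e] by (rule bspec)
  show "lt 0 a \<in> \<sigma> e \<longleftrightarrow> gs ! a = lb (dec e)" if "a < length gs" for a
   using that by (rule sg(1))
  assume k: "k = 1 \<or> k = 3"
  show "lt (k + 1) 0 \<in> \<sigma> e" using k by (auto simp: sg numeral_2_eq_2[symmetric])
  have a2: "(1::nat) + 1 = 2" "(3::nat) + 1 = 4" by simp_all
  have sg1: "lt 1 i \<in> \<sigma> e \<longleftrightarrow> odd (fst (dec e) div 2 ^ i)" for i using sg(2) by simp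
  fix i show "lt (k + 1) (Suc i) \<in> \<sigma> e \<longleftrightarrow> lt (k + 1) i \<in> \<sigma> e & lt k i \<in> \<sigma> e"
   using k
  proof
   assume "k = 1"
   show ?thesis unfolding \<open>k = 1\<close> a2 sg(3) sg1 by (rule carry_mod)
  next
   assume "k = 3"
   show ?thesis unfolding \<open>k = 3\<close> a2 sg(4,5) by (rule carry_mod)
  qed
 qed
 have vl1: "vl 1 e = fst (dec e)" if "e \<in> \<pi>" for e
  using decV[OF that] t unfolding vl_def by (auto simp: sg bsum_odd W_def)
 have vl3: "vl 3 e = snd (dec e)" if "e \<in> \<pi>" for e
  using decV[OF that] unfolding vl_def by (auto simp: sg bsum_odd W_def)
 note ti = til[unfolded tiling_def, folded W_def]
 have i0: "init_tile M w v (lb (0, v))" if "v < W" for v using ti that by force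
 have "sat \<pi> \<sigma> (%_. (1, 1)) (Phi M gs U (bt w))"
  unfolding sat_Phi[OF refl gs(1)]
 proof (intro conjI)
  show "\<exists>e\<in>\<pi>. vl 1 e = 0 & vl 3 e = 0"
  proof -
   have "(0, 0) \<in> dec ` \<pi>" unfolding dec using W by simp
   then obtain e where "e \<in> \<pi>" "dec e = (0, 0)" by force
   then show ?thesis using vl1[of e] vl3[of e] by (auto intro!: bexI[of _ e])
  qed
  show "\<forall>e\<in>\<pi>. \<exists>f\<in>\<pi>. vl 1 e = vl 1 f & vl 3 f = (vl 3 e + 1) mod 2 ^ ?m"
  proof
   fix e assume e: "e \<in> \<pi>"
   have "\<exists>c\<in>?V. fst (dec e) = fst c & snd c = (snd (dec e) + 1) mod W"
    using ti[THEN conjunct2, THEN conjunct2, THEN conjunct1, THEN bspec, OF decV[OF e]] by metis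
   then obtain f where "f \<in> \<pi>" "fst (dec e) = fst (dec f)" "snd (dec f) = (snd (dec e) + 1) mod W"
    using dec by (metis (no_types, lifting) imageE)
   then show "\<exists>f\<in>\<pi>. vl 1 e = vl 1 f & vl 3 f = (vl 3 e + 1) mod 2 ^ ?m"
    unfolding W_def using vl1[OF e] vl3[OF e] vl1[of f] vl3[of f] by (intro bexI[of _ f] conjI) simp_all
  qed
  show "\<forall>e\<in>\<pi>. act (lb (dec e)) = None \<or> vl 1 e + 1 ~= 2 ^ ?m &
    (\<exists>f\<in>\<pi>. vl 1 f = (vl 1 e + 1) mod 2 ^ ?m & vl 3 e = vl 3 f)"
  proof
   fix e assume e: "e \<in> \<pi>"
   have "act (lb (dec e)) = None \<or> (\<exists>c\<in>?V. fst c = fst (dec e) + 1 & snd c = snd (dec e))"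
    using ti[THEN conjunct2, THEN conjunct2, THEN conjunct2, THEN conjunct1] decV[OF e] by (rule bspec)
   then consider "act (lb (dec e)) = None" | f where "f \<in> \<pi>" "fst (dec f) = fst (dec e) + 1" "snd (dec f) = snd (dec e)"
    using dec by (metis (no_types, lifting) imageE)
   then show "act (lb (dec e)) = None \<or> vl 1 e + 1 ~= 2 ^ ?m &
     (\<exists>f\<in>\<pi>. vl 1 f = (vl 1 e + 1) mod 2 ^ ?m & vl 3 e = vl 3 f)"
   proof cases
    case (2 f)
    then have "vl 1 f = vl 1 e + 1" "vl 3 e = vl 3 f" using vl1[OF e] vl3[OF e] vl1[of f] vl3[of f] by simp_all
    then show ?thesis using vl_less[of 1 f] 2(1) by (intro disjI2 conjI bexI[of _ f]) auto
   qed simp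
  qed
  have q: "\<forall>e\<in>\<pi>. \<forall>f\<in>\<pi>. (vl 1 e = vl 1 f --> fst (lb (dec e)) = fst (lb (dec f))) &
    (vl 1 e = vl 1 f & vl 3 e ~= vl 3 f --> no_clash M (lb (dec e)) (lb (dec f))) &
    (vl 1 f = (vl 1 e + 1) mod 2 ^ ?m -->
      (vl 3 e = vl 3 f --> update M (lb (dec e)) (lb (dec f)) & moves M Stay (lb (dec e)) (lb (dec f))) &
      (vl 3 f = (vl 3 e + 1) mod 2 ^ ?m --> moves M Go_Right (lb (dec e)) (lb (dec f))) &
      (vl 3 e = (vl 3 f + 1) mod 2 ^ ?m --> moves M Go_Left (lb (dec e)) (lb (dec f))))"
  proof (intro ballI)
   fix e f assume ef: "e \<in> \<pi>" "f \<in> \<pi>"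
   have "\<forall>e\<in>?V. \<forall>f\<in>?V. (fst e = fst f --> fst (lb e) = fst (lb f)) &
    (fst e = fst f & snd e ~= snd f --> no_clash M (lb e) (lb f)) &
    (fst f = (fst e + 1) mod W -->
      (snd e = snd f --> update M (lb e) (lb f) & moves M Stay (lb e) (lb f)) &
      (snd f = (snd e + 1) mod W --> moves M Go_Right (lb e) (lb f)) &
      (snd e = (snd f + 1) mod W --> moves M Go_Left (lb e) (lb f)))"
    by (rule ti[THEN conjunct2, THEN conjunct2, THEN conjunct2, THEN conjunct2, THEN conjunct2])
   from this[rule_format, OF decV decV, OF ef] show "(vl 1 e = vl 1 f --> fst (lb (dec e)) = fst (lb (dec f))) &
    (vl 1 e = vl 1 f & vl 3 e ~= vl 3 f --> no_clash M (lb (dec e)) (lb (dec f))) &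
    (vl 1 f = (vl 1 e + 1) mod 2 ^ ?m -->
      (vl 3 e = vl 3 f --> update M (lb (dec e)) (lb (dec f)) & moves M Stay (lb (dec e)) (lb (dec f))) &
      (vl 3 f = (vl 3 e + 1) mod 2 ^ ?m --> moves M Go_Right (lb (dec e)) (lb (dec f))) &
      (vl 3 e = (vl 3 f + 1) mod 2 ^ ?m --> moves M Go_Left (lb (dec e)) (lb (dec f))))"
    unfolding vl1[OF ef(1)] vl1[OF ef(2)] vl3[OF ef(1)] vl3[OF ef(2)] W_def .
  qed
  show "\<forall>e\<in>\<pi>. \<forall>f\<in>\<pi>. vl 1 e = vl 1 f --> fst (lb (dec e)) = fst (lb (dec f))"
   "\<forall>e\<in>\<pi>. \<forall>f\<in>\<pi>. vl 1 e = vl 1 f & vl 3 e ~= vl 3 f --> no_clash M (lb (dec e)) (lb (dec f))"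
   "\<forall>e\<in>\<pi>. \<forall>f\<in>\<pi>. vl 1 f = (vl 1 e + 1) mod 2 ^ ?m & vl 3 e = vl 3 f -->
     update M (lb (dec e)) (lb (dec f)) & moves M Stay (lb (dec e)) (lb (dec f))"
   "\<forall>e\<in>\<pi>. \<forall>f\<in>\<pi>. vl 1 f = (vl 1 e + 1) mod 2 ^ ?m & vl 3 f = (vl 3 e + 1) mod 2 ^ ?m -->
     moves M Go_Right (lb (dec e)) (lb (dec f))"
   "\<forall>e\<in>\<pi>. \<forall>f\<in>\<pi>. vl 1 f = (vl 1 e + 1) mod 2 ^ ?m & vl 3 e = (vl 3 f + 1) mod 2 ^ ?m -->
     moves M Go_Left (lb (dec e)) (lb (dec f))"
   using q by blast+
  have ini: "init_tile M w (snd (dec e)) (lb (dec e))" if "e \<in> \<pi>" "vl 1 e = 0" for e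
   using i0[of "snd (dec e)"] decV[OF that(1)] that vl1[OF that(1)] by (cases "dec e") auto
  show "\<forall>e\<in>\<pi>. vl 1 e = 0 --> fst (fst (lb (dec e))) = 0 & (\<forall>j<tapes M. 0 < j --> tsym j (lb (dec e)) = 0)"
   using ini unfolding init_tile_def by simp
  show "\<forall>e\<in>\<pi>. vl 1 e = 0 & vl 3 e = 0 --> (\<forall>j<tapes M. hd_at j (lb (dec e))) & lt 5 (len (bt w)) \<in> \<sigma> e"
  proof (intro ballI impI conjI allI; elim conjE)
   fix e j assume e: "e \<in> \<pi>" "vl 1 e = 0" "vl 3 e = 0"
   show "lt 5 (len (bt w)) \<in> \<sigma> e" using e vl1[OF e(1)] vl3[OF e(1)] by (simp add: sg len_bt)
   assume "j < tapes M"
   then show "hd_at j (lb (dec e))" using ini[OF e(1,2)] e vl3[OF e(1)] by (simp add: init_tile_def)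
  qed
  have sym0: "tsym 0 (lb (dec e)) = (if vl 3 e < ?n then symb (w ! vl 3 e) else 0)" if "e \<in> \<pi>" "vl 1 e = 0" for e
   using ini[OF that] that tapes by (auto simp: init_tile_def vl3)
  have N: "lt 5 i \<in> \<sigma> e \<longleftrightarrow> i = ?n - vl 3 e" if "e \<in> \<pi>" "vl 1 e = 0" for e i
   using that vl1[OF that(1)] vl3[OF that(1)] by (simp add: sg)
  show "\<forall>e\<in>\<pi>. \<forall>f\<in>\<pi>. \<forall>s\<in>tails (bt w). (vl 1 e = 0 & lt 5 (len s) \<in> \<sigma> e --> tsym 0 (lb (dec e)) = symb (th s ~= Nl)) &
    (vl 1 e = 0 & vl 1 e = vl 1 f & vl 3 f = (vl 3 e + 1) mod 2 ^ ?m & lt 5 (len s) \<in> \<sigma> e --> lt 5 (len (tt s)) \<in> \<sigma> f)"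
  proof (intro ballI conjI impI; elim conjE)
   fix e f s assume e: "e \<in> \<pi>" "vl 1 e = 0" "lt 5 (len s) \<in> \<sigma> e" and s: "s \<in> tails (bt w)"
   obtain p where p: "p < ?n" "len s = ?n - p" "len (tt s) = ?n - p - 1" "(th s ~= Nl) = w ! p"
    using bt_tails[OF s] by blast
   have "?n - p = ?n - vl 3 e" using N[OF e(1,2)] e(3) p(2) by simp
   then have v: "vl 3 e = p" using p(1) by linarith
   show "tsym 0 (lb (dec e)) = symb (th s ~= Nl)" using sym0[OF e(1,2)] v p by simp
   assume f: "f \<in> \<pi>" "vl 1 e = vl 1 f" "vl 3 f = (vl 3 e + 1) mod 2 ^ ?m"
   have "vl 3 f = p + 1" using f v p(1) n by simp
   then show "lt 5 (len (tt s)) \<in> \<sigma> f" using N[of f] f e p by simp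
  qed
  show "\<forall>e\<in>\<pi>. \<forall>f\<in>\<pi>. (vl 1 e = 0 & lt 5 0 \<in> \<sigma> e --> tsym 0 (lb (dec e)) = 0) &
    (vl 1 e = 0 & vl 1 e = vl 1 f & vl 3 f = (vl 3 e + 1) mod 2 ^ ?m & lt 5 0 \<in> \<sigma> e & vl 3 f ~= 0 --> lt 5 0 \<in> \<sigma> f)"
  proof (intro ballI conjI impI; elim conjE)
   fix e f assume e: "e \<in> \<pi>" "vl 1 e = 0" "lt 5 0 \<in> \<sigma> e"
   then have v: "?n \<le> vl 3 e" using N[OF e(1,2)] by simp
   show "tsym 0 (lb (dec e)) = 0" using sym0[OF e(1,2)] v by simp
   assume f: "f \<in> \<pi>" "vl 1 e = vl 1 f" "vl 3 f = (vl 3 e + 1) mod 2 ^ ?m" "vl 3 f ~= 0"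
   have "vl 3 e + 1 < 2 ^ ?m"
   proof (rule ccontr)
    assume "\<not> vl 3 e + 1 < 2 ^ ?m"
    then have "vl 3 e + 1 = 2 ^ ?m" using vl_less[of 3 e] by linarith
    then show False using f by simp
   qed
   then have "?n \<le> vl 3 f" using f v by simp
   then show "lt 5 0 \<in> \<sigma> f" using N[of f] f e by simp
  qed
 qed
 then have "models \<pi> \<sigma> (Phi M gs U (bt w))" using models_closed_iff[OF vp closed_Phi] by blast
 then show ?thesis using vp unfolding satisfiable_def by blast
qed

subsection \<open>The reduction\<close>

lemma finite_tiles:
 assumes "wf_tm M"
 shows "finite (tiles M)"
proof -
 let ?S = "%n::nat. {xs. set xs \<subseteq> {..<n} & length xs = tapes M}"
 let ?D = "{ds. set ds \<subseteq> {Go_Left, Stay, Go_Right} & length ds = tapes M}"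
 let ?B = "{cs. set cs \<subseteq> {..<symbols M} \<times> (UNIV :: bool set) & length cs = tapes M}"
 have fin: "finite (?S n)" "finite ?D" "finite ?B" for n
  by - (rule finite_lists_length_eq, simp)+
 have "set ds \<subseteq> {Go_Left, Stay, Go_Right}" for ds :: "dir list"
  using dir.exhaust by blast
 then have "transitions M \<subseteq> {..<states M} \<times> ?S (symbols M) \<times> {..<states M} \<times> ?S (symbols M) \<times> ?D"
  using assms unfolding wf_tm_def by fast
 then have "finite (transitions M)" using fin by (meson finite_SigmaI finite_lessThan finite_subset)
 then have A: "finite (insert None (Some ` (%(q, rs, a). a) ` transitions M))" by simp
 have "tiles M \<subseteq> ({..<states M} \<times> ?S (symbols M) \<times> insert None (Some ` (%(q, rs, a). a) ` transitions M)) \<times> ?B"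
 proof
  fix a assume "a \<in> tiles M"
  moreover obtain q rs t cs where a: "a = ((q, rs, t), cs)" by (metis prod.collapse)
  ultimately have *: "q < states M" "length rs = tapes M" "set rs \<subseteq> {..<symbols M}" "length cs = tapes M"
   "fst ` set cs \<subseteq> {..<symbols M}"
   "case t of None => True | Some (q', ws, ds) => (q, rs, q', ws, ds) \<in> transitions M"
   by (auto simp: tiles_def split: option.splits)
  have "t \<in> insert None (Some ` (%(q, rs, a). a) ` transitions M)"
  proof (cases t)
   case (Some p)
   then have "(q, rs, p) \<in> transitions M" using *(6) by (simp add: split_def)
   then have "p \<in> (%(q, rs, a). a) ` transitions M" by (rule rev_image_eqI) simp
   then show ?thesis using Some by blast
  qed simp
  moreover have "set cs \<subseteq> {..<symbols M} \<times> UNIV" using *(5) by fastforce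
  ultimately show "a \<in> ({..<states M} \<times> ?S (symbols M) \<times> insert None (Some ` (%(q, rs, a). a) ` transitions M)) \<times> ?B"
   using * unfolding a by blast
 qed
 then show ?thesis using A fin by (meson finite_SigmaI finite_lessThan finite_subset)
qed

definition FPf :: "(tree => fm) => bool" where
 "FPf F \<longleftrightarrow> FP (%x. bt (encode (F x)))"

definition FPl :: "(tree => nat) => bool" where
 "FPl n \<longleftrightarrow> FP (%x. bt (encode_nat (n x)))"

lemma bt_append: "bt (u @ v) = app (bt u) (bt v)"
 by (induction u) auto

lemma FPf_const: "FPf (%_. f)"
 unfolding FPf_def by (rule FP_const)

lemma FPf_Letter: "FPl n ==> FPf (%x. Letter (n x) a)"
 unfolding FPf_def FPl_def encode.simps bt_append by (intro FP_app FP_const)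

lemma FPf_Neg: "FPf F ==> FPf (%x. Neg (F x))"
 and FPf_Conj: "FPf F ==> FPf G ==> FPf (%x. Conj (F x) (G x))"
 and FPf_Disj: "FPf F ==> FPf G ==> FPf (%x. Disj (F x) (G x))"
 and FPf_Exists: "FPf F ==> FPf (%x. Exists a (F x))"
 and FPf_Forall: "FPf F ==> FPf (%x. Forall a (F x))"
 unfolding FPf_def encode.simps bt_append by (intro FP_app FP_const; assumption)+

lemma FPf_Iff: "FPf F ==> FPf G ==> FPf (%x. Iff (F x) (G x))"
 and FPf_Imp: "FPf F ==> FPf G ==> FPf (%x. Imp (F x) (G x))"
 and FPf_all2: "FPf F ==> FPf (%x. all2 (F x))"
 unfolding Iff_def Imp_def all2_def by (intro FPf_Conj FPf_Disj FPf_Neg FPf_Forall; assumption)+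

lemma FPf_if: "FPp P ==> FPf F ==> FPf G ==> FPf (%x. if P x then F x else G x)"
 using FP_if[of P "%x. bt (encode (F x))" "%x. bt (encode (G x))"] unfolding FPf_def by (simp add: if_distrib cong: if_cong)

lemma FPf_loopt:
 assumes "FPf (%z. G (th z) (tt z))" "FP p" "FP U"
 shows "FPf (%x. loopt (G (p x)) (U x))"
proof -
 have *: "bt (encode (loopt (G e) U)) =
   app (ctl (%e s. app (bt [True, False, False]) (bt (encode (G e s)))) e U) (bt (encode TT))" for e U
  by (induction U) (auto simp: bt_append app_assoc)
 have "FP (%z. app (bt [True, False, False]) (bt (encode (G (th z) (tt z)))))"
  using assms(1) unfolding FPf_def by (intro FP_app FP_const)
 from FP_app[OF FP_ctl[of "%e s. app (bt [True, False, False]) (bt (encode (G e s)))", OF this assms(2,3)] FP_const]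
 show ?thesis unfolding FPf_def * .
qed

lemma encode_lt:
 assumes "k < 8"
 shows "encode_nat (lt k i) = [True, odd k, True, odd (k div 2), True, odd (k div 4)] @
  concat (replicate i [True, False]) @ [True, True, False]"
proof -
 have p: "encode_nat n = True # odd n # encode_nat (n div 2)" if "n > 0" for n
  using that encode_nat.simps[of n] by simp
 have 2: "encode_nat (2 ^ i) = concat (replicate i [True, False]) @ [True, True, False]"
 proof (induction i)
  case 0
  show ?case using p[of 1] encode_nat.simps[of 0] by simp
 next
  case (Suc i)
  then show ?case using p[of "2 ^ Suc i"] by simp
 qed
 have "encode_nat (k + 8 * 2 ^ i) = True # odd k # encode_nat ((k + 8 * 2 ^ i) div 2)"
  using p[of "k + 8 * 2 ^ i"] by simp
 also have "(k + 8 * 2 ^ i) div 2 = k div 2 + 4 * 2 ^ i" by linarith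
 also have "encode_nat (k div 2 + 4 * 2 ^ i) = True # odd (k div 2) # encode_nat ((k div 2 + 4 * 2 ^ i) div 2)"
  using p[of "k div 2 + 4 * 2 ^ i"] by simp
 also have "(k div 2 + 4 * 2 ^ i) div 2 = k div 4 + 2 * 2 ^ i" by linarith
 also have "encode_nat (k div 4 + 2 * 2 ^ i) = True # odd (k div 4) # encode_nat ((k div 4 + 2 * 2 ^ i) div 2)"
  using p[of "k div 4 + 2 * 2 ^ i"] by simp
 also have "(k div 4 + 2 * 2 ^ i) div 2 = 2 ^ i" using assms by linarith
 finally show ?thesis by (simp add: lt_def 2)
qed

lemma FPl_lt:
 assumes "k < 8" "FP L"
 shows "FPl (%x. lt k (len (L x)))"
proof -
 have *: "bt (concat (replicate (len L) [True, False])) = ctl (%e s. bt [True, False]) Nl L" for L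
  by (induction L) auto
 show ?thesis
  unfolding FPl_def encode_lt[OF assms(1)] bt_append *
  by (intro FP_app FP_const FP_ctl[where F = "%e s. bt [True, False]"] assms)
qed

lemma FPl_const: "FPl (%_. n)"
 unfolding FPl_def by (rule FP_const)

lemmas FPf_intros = FPf_Neg FPf_Conj FPf_Disj FPf_Exists FPf_Forall FPf_Iff FPf_Imp FPf_Letter FPl_lt

lemma FPf_loop:
 assumes "FPf (%z. G (tt z))" "FP U"
 shows "FPf (%x. loopt G (U x))"
 using FPf_loopt[of "%_. G", OF assms(1) FP_id assms(2)] .

lemma FPf_bits:
 assumes "FP U" "k < 7"
 shows "FPf (%x. eqs k (U x))" "FPf (%x. sucs k a b (U x))" "FPf (%x. zers k a (U x))" "FPf (%x. cars k (U x))"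
 unfolding eqs_def sucs_def zers_def cars_def using assms(2)
 by (intro FPf_loop FPf_intros FPl_const FP_tt FP_id assms(1); simp)+

lemma FPf_Phi:
 assumes "FP U"
 shows "FPf (%x. Phi M gs (U x) x)"
proof -
 note b = FPf_bits[OF FP_th[OF FP_id]]
 have 13: "FPf (%z. Phi13 gs (th z) (tt z))"
  unfolding Phi13_def
  by (intro FPf_intros FPf_if FPf_const FPp_nonNl FP_th FP_tt FP_id b) simp_all
 show ?thesis
  unfolding Phi_def bigC.simps
  by (intro FPf_intros FPf_all2 FPf_const FPl_const FPf_bits FPf_loopt[OF 13] FP_id assms) simp_all
qed

theorem sat_NEXPTIME_hard: "NEXPTIME_hard {encode \<phi> | \<phi>. closed_fm \<phi> & satisfiable \<phi>}"
 unfolding NEXPTIME_hard_def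
proof
 fix L' assume "L' \<in> NEXPTIME"
 then obtain k M b where wf: "wf_tm M" and
  M: "\<And>w. halts_within M w (b * 2 ^ (length w ^ k) + b)" "\<And>w. w \<in> L' \<longleftrightarrow> accepts M w"
  unfolding NEXPTIME_def NTIME_def by blast
 obtain gs where gs: "set gs = tiles M" "distinct gs"
  using finite_distinct_list[OF finite_tiles[OF wf]] by blast
 \<comment> \<open>With \<open>b + 3\<close> further entries \<open>U\<close> gets the length
   \<open>(n + b + 5) ^ (k + 1)\<close>, n being the input length; this is at least
   \<open>n ^ k + n + b + 4\<close>. For a window of \<open>2 ^ len U\<close> cells the half width
   \<open>H\<close> is then large enough for both the time bound and the input.\<close>
 define pad where "pad = (Cn Nl) ^^ (b + 3)"
 have len_pad: "len (pad x) = len x + b + 3" for x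
 proof -
  have "len ((Cn Nl ^^ n) x) = len x + n" for n by (induction n) auto
  then show ?thesis by (simp add: pad_def)
 qed
 have FP_pad: "FP pad"
 proof -
  have "FP (Cn Nl ^^ n)" for n
  proof (induction n)
   case 0
   then show ?case using FP_id by (simp add: id_def)
  next
   case (Suc n)
   have "(Cn Nl ^^ Suc n) = (%x. Cn Nl ((Cn Nl ^^ n) x))" by auto
   then show ?case using Suc by (simp only:) (intro FP_Cn FP_const)
  qed
  then show ?thesis by (simp add: pad_def)
 qed
 define U where "U x = lpow (Suc k) (pad x)" for x
 have FP_U: "FP U" unfolding U_def by (intro FP_comp[OF FP_lpow] FP_pad)
 define f where "f w = encode (Phi M gs (U (bt w)) (bt w))" for w
 have "polytime_computable f"
  by (rule polytime_computable_FP[OF FPf_Phi[OF FP_U, unfolded FPf_def, of M gs]]) (simp add: f_def)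
 moreover have "w \<in> L' \<longleftrightarrow> f w \<in> {encode \<phi> | \<phi>. closed_fm \<phi> & satisfiable \<phi>}" for w
 proof -
  let ?m = "len (U (bt w))" and ?n = "length w" and ?T = "b * 2 ^ (length w ^ k) + b"
  have m: "?m = (?n + b + 5) ^ Suc k"
  proof -
   have "?n + b + 3 + 2 = ?n + b + 5" by simp
   then show ?thesis by (simp only: U_def len_lpow len_pad len_bt)
  qed
  have mge: "?m \<ge> ?n ^ k + ?n + b + 4"
  proof -
   let ?B = "(?n + b + 5) ^ k"
   have "?n ^ k \<le> ?B" by (intro power_mono) auto
   moreover have "?B \<ge> 1" by simp
   then have "(?n + b + 4) * 1 \<le> (?n + b + 4) * ?B" by (intro mult_left_mono) auto
   moreover have eq: "?m = ?B + (?n + b + 4) * ?B" unfolding m by (simp add: algebra_simps)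
   ultimately have "?n ^ k + (?n + b + 4) * 1 \<le> ?m" unfolding eq by (intro add_mono)
   then show ?thesis by (simp add: add.assoc)
  qed
  define H where "H = (2::nat) ^ (?m - 1)"
  have W: "2 ^ ?m = 2 * H" unfolding H_def using mge by (metis One_nat_def Suc_pred add_gr_0 less_le_trans power_Suc zero_less_numeral)
  have "b + 1 \<le> 2 ^ b" by (induction b) auto
  have T: "?T + 1 < H"
  proof -
   have "?T + 1 \<le> 2 ^ b * 2 ^ (?n ^ k) + 2 ^ b"
    using \<open>b + 1 \<le> 2 ^ b\<close> mult_right_mono[of b "2 ^ b" "2 ^ (?n ^ k)"] by linarith
   also have "\<dots> \<le> 2 ^ (b + ?n ^ k) + 2 ^ (b + ?n ^ k)"
    unfolding power_add[symmetric] by (rule add_mono, simp, rule power_increasing, simp_all)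
   also have "\<dots> = 2 ^ (b + ?n ^ k + 1)" by simp
   also have "\<dots> < H" unfolding H_def using mge by (intro power_strict_increasing) auto
   finally show ?thesis .
  qed
  have n: "?n \<le> H"
  proof -
   have "?n \<le> 2 ^ ?n" by (rule less_exp) simp
   also have "\<dots> \<le> H" unfolding H_def using mge by (intro power_increasing) auto
   finally show ?thesis .
  qed
  have n2: "?n < 2 ^ ?m" using n W T by linarith
  have tp: "tapes M \<ge> 1" using wf by (simp add: wf_tm_def)
  have "accepts M w \<longleftrightarrow> satisfiable (Phi M gs (U (bt w)) (bt w))"
  proof
   assume "accepts M w"
   from accepts_tiling[OF wf this M(1) W T n] obtain t lb where "t < 2 ^ ?m"
    "tiling M w (2 ^ ?m) ({..t} \<times> {..<2 ^ ?m}) fst snd lb" by blast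
   then show "satisfiable (Phi M gs (U (bt w)) (bt w))"
    using tiling_Phi[OF _ gs(2,1) _ n2 tp] by blast
  next
   assume "satisfiable (Phi M gs (U (bt w)) (bt w))"
   from Phi_tiling[OF this gs(2,1) n2] show "accepts M w"
    using tiling_accepts[OF wf _ M(1) W T n] by blast
  qed
  then show ?thesis
   unfolding M(2) f_def using closed_Phi inj_encode by (auto dest: injD)
 qed
 ultimately show "polytime_reducible L' {encode \<phi> | \<phi>. closed_fm \<phi> & satisfiable \<phi>}"
  unfolding polytime_reducible_def by blast
qed

section \<open>Euler tours\<close>

fun tour :: "('i => 'v) => ('i => 'v) => 'v => 'i list => 'v => bool" where
 "tour s t u [] v \<longleftrightarrow> u = v"
| "tour s t u (i # is) v \<longleftrightarrow> s i = u & tour s t (t i) is v"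

text \<open>Reachability from \<open>v0\<close> yields weak connectivity, and with balanced degrees
  Euler's theorem gives a closed trail through all arcs; it is rotated to start at
  \<open>v0\<close>. The arcs are the indices themselves, so parallel arcs are kept apart.\<close>

lemma euler_tour:
 fixes s t :: "'i => 'v"
 assumes "finite I" and bal: "\<And>v. card {i \<in> I. s i = v} = card {i \<in> I. t i = v}"
  and reach: "\<And>i. i \<in> I ==> (v0, s i) \<in> ((%i. (s i, t i)) ` I)\<^sup>*"
 shows "\<exists>p. distinct p & set p = I & tour s t v0 p v0"
proof -
 define G where "G = \<lparr>verts = insert v0 (s ` I \<union> t ` I), arcs = I, tail = s, head = t\<rparr>"
 interpret fin_digraph G
  using assms(1) by unfold_locales (auto simp: G_def)
 have dom: "(s i, t i) \<in> arcs_ends G" if "i \<in> I" for i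
  using that by (auto simp: G_def arcs_ends_def arc_to_ends_def)
 have v0: "v0 \<in> verts G" by (simp add: G_def)
 have R: "v0 \<rightarrow>\<^sup>*\<^bsub>G\<^esub> w" if "(v0, w) \<in> ((%i. (s i, t i)) ` I)\<^sup>*" for w
  using that
 proof (induction rule: rtrancl_induct)
  case base
  show ?case using v0 by (rule reachable_refl)
 next
  case (step y z)
  then have "(y, z) \<in> arcs_ends G" using dom by auto
  then show ?case using step.IH by (rule reachable_adj_trans[rotated])
 qed
 have all: "v0 \<rightarrow>\<^sup>*\<^bsub>G\<^esub> w" if "w \<in> verts G" for w
 proof -
  consider "w = v0" | i where "i \<in> I" "w = s i" | i where "i \<in> I" "w = t i"
   using \<open>w \<in> verts G\<close> by (auto simp: G_def)
  then show ?thesis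
  proof cases
   case 1
   then show ?thesis using v0 by (simp add: reachable_refl)
  next
   case 2
   then show ?thesis using R[OF reach] by simp
  next
   case 3
   then show ?thesis using reachable_adj_trans[OF R[OF reach] dom] by simp
  qed
 qed
 interpret S: pair_wf_digraph "mk_symmetric G" ..
 have "u \<rightarrow>\<^sup>*\<^bsub>mk_symmetric G\<^esub> v" if "u \<in> verts G" "v \<in> verts G" for u v
 proof -
  have "u \<rightarrow>\<^sup>*\<^bsub>mk_symmetric G\<^esub> v0"
   using symmetric_reachable[OF symmetric_mk_symmetric reachable_mk_symmetricI[OF all[OF that(1)]]] .
  moreover have "v0 \<rightarrow>\<^sup>*\<^bsub>mk_symmetric G\<^esub> v" using reachable_mk_symmetricI[OF all[OF that(2)]] .
  ultimately show ?thesis by (rule S.reachable_trans)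
 qed
 then have "connected G"
  unfolding connected_def strongly_connected_def using v0 by auto
 moreover have "in_degree G u = out_degree G u" for u
  using bal[of u] by (simp add: in_degree_def out_degree_def in_arcs_def out_arcs_def G_def)
 ultimately obtain u p where p: "trail u p u" "set p = arcs G" "set (awalk_verts u p) = verts G"
  using closed_euler1 unfolding euler_trail_def by blast
 then have "v0 \<in> set (awalk_verts u p)" using v0 by simp
 from rotate_trailE'[OF p(1) this] obtain q where q: "trail v0 q v0" "set q = set p" by blast
 have "cas v0 q v0" "distinct q" using q(1) by (auto simp: trail_def awalk_def)
 moreover have tail: "tail G = s" and head: "head G = t" by (simp_all add: G_def)
 moreover have "tour s t a q b" if "cas a q b" for a b
  using that
 proof (induction q arbitrary: a)
  case Nil
  then show ?case by simp
 next
  case (Cons e q)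
  have "s e = a" "cas (t e) q b" using Cons.prems by (simp_all add: tail head)
  then show ?case using Cons.IH by simp
 qed
 ultimately show ?thesis using q(2) p(2) by (auto simp: G_def)
qed

section \<open>Small solutions of homogeneous linear systems\<close>

definition solv :: "('e => 'p => 'a::comm_ring) => 'e set => 'p set => ('p => 'a) => bool" where
 "solv A R S x \<longleftrightarrow> (\<forall>e\<in>R. (\<Sum>p\<in>S. A e p * x p) = 0)"

text \<open>Gaussian elimination: a row with nonzero entry at \<open>s\<close> eliminates that
  variable. \<open>R\<close> may be infinite; a finite part no larger than the number of unknowns
  has the same solutions, and a nontrivial solution makes it strictly smaller.\<close>

lemma few_equations:
 fixes A :: "'e => 'p => real"
 assumes "finite S"
 shows "\<exists>R'\<subseteq>R. finite R' & card R' \<le> card S & (\<forall>x. solv A R' S x --> solv A R S x) &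
  ((\<exists>x. solv A R S x & (\<exists>p\<in>S. x p ~= 0)) --> card R' < card S)"
 using assms
proof (induction S arbitrary: A)
 case empty
 then show ?case by (intro exI[of _ "{}"]) (auto simp: solv_def)
next
 case (insert s S)
 show ?case
 proof (cases "\<forall>e\<in>R. A e s = 0")
  case True
  have eq: "solv A R' (insert s S) x \<longleftrightarrow> solv A R' S x" if "R' \<subseteq> R" for R' x
  proof -
   have "(\<Sum>p\<in>insert s S. A e p * x p) = (\<Sum>p\<in>S. A e p * x p)" if "e \<in> R'" for e
   proof -
    have "A e s = 0" using True \<open>R' \<subseteq> R\<close> that by blast
    then show ?thesis using insert.hyps by simp
   qed
   then show ?thesis by (simp add: solv_def)
  qed
  from insert.IH[of A] obtain R' where "R' \<subseteq> R" "finite R'" "card R' \<le> card S"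
   "\<forall>x. solv A R' S x --> solv A R S x"
   by (elim exE conjE)
  show ?thesis
  proof (intro exI[of _ R'] conjI allI impI)
   show "R' \<subseteq> R" "finite R'" by fact+
   show "card R' \<le> card (insert s S)" "card R' < card (insert s S)"
    using \<open>card R' \<le> card S\<close> insert.hyps by simp_all
   fix x
   assume "solv A R' (insert s S) x"
   then have "solv A R' S x" unfolding eq[OF \<open>R' \<subseteq> R\<close>] .
   then have "solv A R S x" using \<open>\<forall>x. solv A R' S x --> solv A R S x\<close> by (elim allE impE)
   then show "solv A R (insert s S) x" unfolding eq[OF order_refl] .
  qed
 next
  case False
  then obtain e0 where e0: "e0 \<in> R" "A e0 s ~= 0" by blast
  define B where "B e p = A e p - A e s / A e0 s * A e0 p" for e p
  have sumB: "(\<Sum>p\<in>S. B e p * x p) = (\<Sum>p\<in>S. A e p * x p) - A e s / A e0 s * (\<Sum>p\<in>S. A e0 p * x p)" for e x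
   by (simp add: B_def algebra_simps sum_subtractf sum_distrib_left)
  have ins: "(\<Sum>p\<in>insert s S. A e p * x p) = A e s * x s + (\<Sum>p\<in>S. A e p * x p)" for e x
   using insert.hyps by simp
  have B0: "(\<Sum>p\<in>S. B e p * x p) = (\<Sum>p\<in>insert s S. A e p * x p)" if "(\<Sum>p\<in>insert s S. A e0 p * x p) = 0" for e x
  proof -
   have "(\<Sum>p\<in>S. A e0 p * x p) = - (A e0 s * x s)" using that ins[of e0 x] by linarith
   then show ?thesis unfolding sumB ins using e0 by simp
  qed
  obtain R' where R': "R' \<subseteq> R" "finite R'" "card R' \<le> card S" "\<forall>x. solv B R' S x --> solv B R S x"
   "(\<exists>x. solv B R S x & (\<exists>p\<in>S. x p ~= 0)) --> card R' < card S"
   using insert.IH[of B] by blast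
  show ?thesis
  proof (intro exI[of _ "insert e0 R'"] conjI allI impI)
   show "insert e0 R' \<subseteq> R" "finite (insert e0 R')" using R' e0 by auto
   show "card (insert e0 R') \<le> card (insert s S)"
    using R' insert.hyps by (simp add: card_insert_if)
   show "solv A R (insert s S) x" if x: "solv A (insert e0 R') (insert s S) x" for x
   proof -
    have z: "(\<Sum>p\<in>insert s S. A e0 p * x p) = 0" using x by (simp add: solv_def)
    have "solv B R' S x" unfolding solv_def B0[OF z] using x by (simp add: solv_def)
    then have "solv B R S x" using R' by blast
    then show ?thesis unfolding solv_def B0[OF z] .
   qed
   assume "\<exists>x. solv A R (insert s S) x & (\<exists>p\<in>insert s S. x p ~= 0)"
   then obtain x where x: "solv A R (insert s S) x" "\<exists>p\<in>insert s S. x p ~= 0" by blast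
   have z: "(\<Sum>p\<in>insert s S. A e0 p * x p) = 0" using x(1) e0 by (simp add: solv_def)
   have "solv B R S x" unfolding solv_def B0[OF z] using x(1) by (simp add: solv_def)
   moreover have "\<exists>p\<in>S. x p ~= 0"
   proof (rule ccontr)
    assume "\<not> (\<exists>p\<in>S. x p ~= 0)"
    then have "A e0 s * x s = 0" using z ins[of e0 x] by simp
    then show False using e0 x(2) \<open>\<not> (\<exists>p\<in>S. x p ~= 0)\<close> by simp
   qed
   ultimately have "card R' < card S" using R' by blast
   then show "card (insert e0 R') < card (insert s S)"
    using R' insert.hyps by (simp add: card_insert_if)
  qed
 qed
qed

text \<open>Siegel's lemma by pigeonhole. With N unknowns, fewer than N equations and
  \<open>B = N ^ N\<close>, the \<open>(B + 1) ^ N\<close> vectors with entries from 0 to B take at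
  most \<open>(N * B + 1) ^ (N - 1)\<close> values, which is less; the difference of two vectors
  with the same value is the solution.\<close>

lemma siegel:
 fixes A :: "'e => 'p => int"
 assumes "finite S" and A: "\<And>e p. A e p \<in> {-1, 0, 1}"
  and x: "solv (%e p. real_of_int (A e p)) R S x" "\<exists>p\<in>S. x p ~= 0"
 shows "\<exists>z. (\<forall>p. p \<notin> S --> z p = 0) & (\<exists>p. z p ~= 0) & solv A R S z & (\<forall>p. \<bar>z p\<bar> \<le> int (card S ^ card S))"
proof -
 let ?A = "%e p. real_of_int (A e p)"
 let ?N = "card S"
 define B where "B = ?N ^ ?N"
 obtain R' where R': "R' \<subseteq> R" "finite R'" "\<forall>x. solv ?A R' S x --> solv ?A R S x" "card R' < ?N"
  using few_equations[OF assms(1), of R ?A] x by blast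
 have N1: "?N \<ge> 1" using R' by simp
 let ?F = "PiE S (%_. {0..int B})"
 \<comment> \<open>Adding B for every coefficient -1 moves the value of each row into the interval
   from 0 to \<open>N * B\<close>.\<close>
 define c where "c e = (\<Sum>p\<in>S. if A e p = -1 then int B else 0)" for e
 define g where "g f = restrict (%e. c e + (\<Sum>p\<in>S. A e p * f p)) R'" for f
 have range: "c e + (\<Sum>p\<in>S. A e p * f p) \<in> {0..int (?N * B)}" if "f \<in> ?F" for f e
 proof -
  have *: "c e + (\<Sum>p\<in>S. A e p * f p) = (\<Sum>p\<in>S. (if A e p = -1 then int B else 0) + A e p * f p)"
   by (simp add: c_def sum.distrib)
  have b: "0 \<le> (if A e p = -1 then int B else 0) + A e p * f p &
    (if A e p = -1 then int B else 0) + A e p * f p \<le> int B" if "p \<in> S" for p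
   using A[of e p] PiE_mem[OF \<open>f \<in> ?F\<close> that] by auto
  have "(\<Sum>p\<in>S. (if A e p = -1 then int B else 0) + A e p * f p) \<le> (\<Sum>p\<in>S. int B)"
   using b by (intro sum_mono) auto
  moreover have "0 \<le> (\<Sum>p\<in>S. (if A e p = -1 then int B else 0) + A e p * f p)"
   using b by (intro sum_nonneg) auto
  ultimately show ?thesis unfolding * by simp
 qed
 have "g ` ?F \<subseteq> PiE R' (%_. {0..int (?N * B)})"
  using range by (auto simp: g_def)
 then have "card (g ` ?F) \<le> card (PiE R' (%_. {0..int (?N * B)}))"
  using R'(2) by (intro card_mono finite_PiE) auto
 also have "\<dots> = (?N * B + 1) ^ card R'"
  using R'(2) by (simp add: card_PiE nat_add_distrib nat_mult_distrib)
 also have "\<dots> \<le> (?N * B + 1) ^ (?N - 1)" using R'(4) by (intro power_increasing) auto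
 also have "\<dots> \<le> (?N * (B + 1)) ^ (?N - 1)" using N1 by (intro power_mono) auto
 also have "\<dots> = ?N ^ (?N - 1) * (B + 1) ^ (?N - 1)" by (rule power_mult_distrib)
 also have "\<dots> \<le> B * (B + 1) ^ (?N - 1)"
  unfolding B_def using N1 by (intro mult_right_mono power_increasing) auto
 also have "\<dots> < (B + 1) * (B + 1) ^ (?N - 1)" by simp
 also have "\<dots> = (B + 1) ^ ?N" using N1 by (simp flip: power_Suc)
 also have "\<dots> = card ?F" using assms(1) by (simp add: card_PiE nat_add_distrib)
 finally have "\<not> inj_on g ?F" by (rule pigeonhole)
 then obtain f f' where f: "f \<in> ?F" "f' \<in> ?F" "f ~= f'" "g f = g f'" by (auto simp: inj_on_def)
 define z where "z p = (if p \<in> S then f p - f' p else 0)" for p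
 have "solv A R' S z"
  unfolding solv_def
 proof
  fix e assume "e \<in> R'"
  then have "(\<Sum>p\<in>S. A e p * f p) = (\<Sum>p\<in>S. A e p * f' p)"
   using fun_cong[OF f(4), of e] by (simp add: g_def)
  then show "(\<Sum>p\<in>S. A e p * z p) = 0"
   by (simp add: z_def algebra_simps sum_subtractf)
 qed
 moreover have real: "solv ?A T S (%p. real_of_int (z p)) \<longleftrightarrow> solv A T S z" for T
  unfolding solv_def by (simp flip: of_int_mult of_int_sum)
 ultimately have "solv A R S z" using R'(3) by blast
 moreover have "\<exists>p. z p ~= 0"
 proof -
  obtain p where "f p ~= f' p" using f(3) by blast
  moreover have "p \<in> S"
  proof (rule ccontr)
   assume "p \<notin> S"
   then show False using PiE_arb[OF f(1)] PiE_arb[OF f(2)] \<open>f p ~= f' p\<close> by simp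
  qed
  ultimately show ?thesis by (auto simp: z_def intro!: exI[of _ p])
 qed
 moreover have "\<bar>z p\<bar> \<le> int B" for p
  using PiE_mem[OF f(1), of p] PiE_mem[OF f(2), of p] by (auto simp: z_def)
 ultimately show ?thesis by (intro exI[of _ z]) (auto simp: z_def B_def)
qed

section \<open>Nonnegative solutions of bounded size\<close>

lemma self_power_mono: "a ^ a \<le> b ^ b" if "a \<le> b" for a b :: nat
proof (cases "a = 0")
 case True
 then show ?thesis by (cases "b = 0") auto
next
 case False
 have "a ^ a \<le> b ^ a" using that by (rule power_mono) simp
 also have "\<dots> \<le> b ^ b" using that False by (intro power_increasing) auto
 finally show ?thesis .
qed

text \<open>A bounded integral solution \<open>z\<close> on the support of \<open>x\<close> may have
  mixed signs. Then the largest multiple of \<open>z\<close> that keeps \<open>x\<close> nonnegative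
  is subtracted; this shrinks the support and leaves a nonzero vector, as entries with negative
  \<open>z\<close> do not decrease.\<close>

lemma small_nonneg:
 fixes A :: "'e => 'p => int" and x :: "'p => real"
 assumes "finite S" and A: "\<And>e p. A e p \<in> {-1, 0, 1}"
  and "solv (%e p. real_of_int (A e p)) R S x" "\<And>p. 0 \<le> x p" "\<And>p. p \<notin> S ==> x p = 0" "\<exists>p. x p ~= 0"
 shows "\<exists>c :: 'p => int. (\<forall>p. 0 \<le> c p & c p \<le> int (card S ^ card S)) & (\<forall>p. c p ~= 0 --> x p > 0) &
  (\<exists>p. c p ~= 0) & solv A R S c"
 using assms(3-6)
proof (induction "card {p. x p ~= 0}" arbitrary: x rule: less_induct)
 case less
 let ?A = "%e p. real_of_int (A e p)"
 let ?S = "{p. x p ~= 0}"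
 have sub: "?S \<subseteq> S" using less.prems(3) by auto
 have fin: "finite ?S" using sub assms(1) by (rule finite_subset)
 have restr: "(\<Sum>p\<in>S. a p * y p) = (\<Sum>p\<in>?S. a p * y p)" if "\<And>p. x p = 0 ==> y p = 0"
  for a y :: "'p => 'a :: comm_ring_1"
  using that assms(1) sub by (intro sum.mono_neutral_right) auto
 have restr': "solv B R S y \<longleftrightarrow> solv B R ?S y" if "\<And>p. x p = 0 ==> y p = 0"
  for B and y :: "'p => 'a :: comm_ring_1"
  unfolding solv_def using restr[OF that] by simp
 have "solv ?A R ?S x" using less.prems(1) restr'[of x ?A] by simp
 moreover have "\<exists>p\<in>?S. x p ~= 0" using less.prems(4) by auto
 ultimately obtain z where z: "\<forall>p. p \<notin> ?S --> z p = 0" "\<exists>p. z p ~= 0" "solv A R ?S z"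
  "\<forall>p. \<bar>z p\<bar> \<le> int (card ?S ^ card ?S)"
  using siegel[of ?S A R x, OF fin A] by blast
 have zS: "solv A R S z" using z(1,3) restr'[of z A] by simp
 have "card ?S \<le> card S" using sub assms(1) by (rule card_mono[rotated])
 then have bd: "\<bar>z p\<bar> \<le> int (card S ^ card S)" for p
  using z(4) self_power_mono[of "card ?S" "card S"] by (meson le_trans of_nat_le_iff order_trans)
 have pos: "x p > 0" if "z p ~= 0" for p
  using that z(1) less.prems(2)[of p] by force
 consider "\<forall>p. z p \<ge> 0" | "\<forall>p. z p \<le> 0" | "\<exists>p. z p > 0" "\<exists>p. z p < 0" by (meson not_less)
 then show ?case
 proof cases
  case 1
  then show ?thesis using z(2) zS bd pos by (intro exI[of _ z]) (auto simp: abs_le_iff)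
 next
  case 2
  have "solv A R S (%p. - z p)" using zS by (simp add: solv_def sum_negf)
  then show ?thesis using 2 z(2) bd pos by (intro exI[of _ "%p. - z p"]) (auto simp: abs_le_iff)
 next
  case 3
  let ?P = "{p \<in> ?S. z p > 0}"
  have finP: "finite ?P" "?P ~= {}" using fin 3(1) z(1) by auto
  define l where "l = Min ((%p. x p / z p) ` ?P)"
  have "l \<in> (%p. x p / z p) ` ?P" unfolding l_def using finP by (intro Min_in) auto
  then obtain q where q: "q \<in> ?P" "l = x q / z q" by blast
  have lmin: "l \<le> x p / z p" if "p \<in> ?P" for p unfolding l_def using that finP by (intro Min_le) auto
  have l0: "l \<ge> 0" using q less.prems(2)[of q] by auto
  define y where "y p = x p - l * z p" for p
  have y0: "0 \<le> y p" for p
  proof (cases "z p > 0")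
   case True
   then have "p \<in> ?P" using z(1) by force
   from lmin[OF this] show ?thesis using True by (simp add: y_def field_simps)
  next
   case False
   then have "l * z p \<le> 0" using l0 by (simp add: mult_nonneg_nonpos)
   then show ?thesis using less.prems(2)[of p] by (simp add: y_def)
  qed
  have ySub: "{p. y p ~= 0} \<subset> ?S"
  proof -
   have "y p = 0" if "x p = 0" for p using that z(1) by (simp add: y_def)
   moreover have "y q = 0" using q by (simp add: y_def)
   ultimately show ?thesis using q by auto
  qed
  have "card {p. y p ~= 0} < card ?S" using fin ySub by (rule psubset_card_mono)
  moreover have "solv ?A R S y"
  proof -
   have "solv ?A R S (%p. real_of_int (z p))"
    using zS unfolding solv_def by (simp flip: of_int_mult of_int_sum)
   then show ?thesis
    using less.prems(1) unfolding solv_def y_def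
    by (simp add: algebra_simps sum_subtractf flip: sum_distrib_left)
  qed
  moreover have "y p = 0" if "p \<notin> S" for p using that sub ySub by auto
  moreover have "\<exists>p. y p ~= 0"
  proof -
   obtain p where p: "z p < 0" using 3(2) by blast
   then have "x p > 0" using pos by auto
   moreover have "l * z p \<le> 0" using l0 p by (simp add: mult_nonneg_nonpos)
   ultimately have "y p > 0" by (simp add: y_def)
   then show ?thesis by (intro exI[of _ p]) simp
  qed
  ultimately obtain c :: "'p => int" where c: "\<forall>p. 0 \<le> c p & c p \<le> int (card S ^ card S)" "\<forall>p. c p ~= 0 --> y p > 0"
   "\<exists>p. c p ~= 0" "solv A R S c"
   using less.hyps[of y] y0 by blast
  moreover have "x p > 0" if "y p > 0" for p
   using that ySub less.prems(2)[of p] by force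
  ultimately show ?thesis by blast
 qed
qed

text \<open>\<open>x\<close> is peeled by multiples \<open>l * c\<close> of small solutions,
  \<open>l\<close> being the largest factor with \<open>l * c \<le> x\<close>. If some
  \<open>l \<ge> 3\<close>, that \<open>c\<close> is as desired. Otherwise every round lowers
  \<open>x q\<close> by at most 3 times the bound on \<open>c\<close> and empties an entry of the
  support, which contradicts the size of \<open>x q\<close>.\<close>

lemma big_solution:
 fixes A :: "'e => 'p => int" and x :: "'p => real"
 assumes "finite S" and A: "\<And>e p. A e p \<in> {-1, 0, 1}"
  and "solv (%e p. real_of_int (A e p)) R S x" "\<And>p. 0 \<le> x p" "\<And>p. p \<notin> S ==> x p = 0"
  "x q > 3 * card {p. x p ~= 0} * (card S ^ card S)"
 shows "\<exists>c :: 'p => int. (\<forall>p. 0 \<le> c p & 3 * c p \<le> x p) & (\<exists>p. c p ~= 0) & solv A R S c"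
 using assms(3-6)
proof (induction "card {p. x p ~= 0}" arbitrary: x rule: less_induct)
 case less
 let ?A = "%e p. real_of_int (A e p)"
 let ?S = "{p. x p ~= 0}" and ?B = "card S ^ card S"
 have sub: "?S \<subseteq> S" using less.prems(3) by auto
 have fin: "finite ?S" using sub assms(1) by (rule finite_subset)
 have "x q > 0" using less.prems(4) by (meson le_less_trans of_nat_0_le_iff)
 then have "\<exists>p. x p ~= 0" by (intro exI[of _ q]) simp
 then obtain c :: "'p => int" where c: "\<forall>p. 0 \<le> c p & c p \<le> int ?B" "\<forall>p. c p ~= 0 --> x p > 0"
   "\<exists>p. c p ~= 0" "solv A R S c"
  using small_nonneg[OF assms(1) A less.prems(1-3)] by blast
 let ?P = "{p. c p ~= 0}"
 have PS: "?P \<subseteq> ?S" using c(2) by auto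
 have finP: "finite ?P" using PS fin by (rule finite_subset)
 define l where "l = Min ((%p. x p / c p) ` ?P)"
 have "l \<in> (%p. x p / c p) ` ?P" unfolding l_def using finP c(3) by (intro Min_in) auto
 then obtain r where r: "r \<in> ?P" "l = x r / c r" by blast
 have lmin: "l * c p \<le> x p" for p
 proof (cases "c p = 0")
  case False
  then have "l \<le> x p / c p" unfolding l_def using finP by (intro Min_le) auto
  moreover have "c p > 0" using False c(1) by (simp add: order_less_le)
  ultimately show ?thesis by (simp add: field_simps)
 qed (use less.prems(2) in simp)
 show ?case
 proof (cases "l \<ge> 3")
  case True
  have "3 * real_of_int (c p) \<le> x p" for p
  proof -
   have "3 * real_of_int (c p) \<le> l * c p" using True c(1) by (intro mult_right_mono) auto
   then show ?thesis using lmin[of p] by linarith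
  qed
  then show ?thesis using c(1,3,4) by (intro exI[of _ c]) simp
 next
  case False
  define y where "y p = x p - l * c p" for p
  have l0: "l \<ge> 0" using r less.prems(2)[of r] c(1) by auto
  have yS: "{p. y p ~= 0} \<subset> ?S"
  proof -
   have "y p = 0" if "x p = 0" for p using that c(2) by (auto simp: y_def)
   moreover have "y r = 0" "r \<in> ?S" using r PS by (auto simp: y_def)
   ultimately show ?thesis by auto
  qed
  have card: "card {p. y p ~= 0} < card ?S" using fin yS by (rule psubset_card_mono)
  have "solv ?A R S (%p. real_of_int (c p))"
   using c(4) unfolding solv_def by (simp flip: of_int_mult of_int_sum)
  then have ysol: "solv ?A R S y"
   using less.prems(1) unfolding solv_def y_def
   by (simp add: algebra_simps sum_subtractf flip: sum_distrib_left)
  have y0: "0 \<le> y p" "y p \<le> x p" for p using lmin[of p] l0 c(1) by (auto simp: y_def)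
  have "l * c q \<le> 3 * ?B"
  proof -
   have "real_of_int (c q) \<le> real ?B" using c(1) by (metis of_int_le_iff of_int_of_nat_eq)
   then have "l * real_of_int (c q) \<le> 3 * real ?B"
    using False l0 c(1) by (intro mult_mono) auto
   then show ?thesis by simp
  qed
  then have "y q > 3 * real (card ?S) * ?B - 3 * real ?B" using less.prems(4) by (simp add: y_def)
  moreover have "3 * real (card {p. y p ~= 0}) * ?B \<le> 3 * real (card ?S) * ?B - 3 * real ?B"
  proof -
   have "real (card {p. y p ~= 0}) + 1 \<le> real (card ?S)" using card by linarith
   then have "(real (card {p. y p ~= 0}) + 1) * (3 * ?B) \<le> real (card ?S) * (3 * ?B)" by (rule mult_right_mono) simp
   then show ?thesis by (simp add: algebra_simps)
  qed
  ultimately have "y q > 3 * card {p. y p ~= 0} * ?B" by simp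
  moreover have "y p = 0" if "p \<notin> S" for p using that sub yS by auto
  ultimately have ex: "\<exists>d :: 'p => int. (\<forall>p. 0 \<le> d p & 3 * d p \<le> y p) & (\<exists>p. d p ~= 0) & solv A R S d"
   by (intro less.hyps[OF card ysol y0(1)])
  define d where "d = (SOME d :: 'p => int. (\<forall>p. 0 \<le> d p & 3 * d p \<le> y p) & (\<exists>p. d p ~= 0) & solv A R S d)"
  note d' = someI_ex[OF ex, folded d_def]
  note d = conjunct1[OF d'] conjunct1[OF conjunct2[OF d']] conjunct2[OF conjunct2[OF d']]
  have "0 \<le> d p & 3 * d p \<le> x p" for p
   using d(1)[rule_format, of p] y0(2)[of p] by linarith
  then show ?thesis using d(2,3) by (intro exI[of _ d]) simp
 qed
qed

text \<open>A solution minimal among those between \<open>min (x p) 2\<close> and \<open>x p\<close>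
  is small: at a large entry \<open>big_solution\<close> gives \<open>c\<close> with
  \<open>3 * c \<le> y\<close>, and subtracting it keeps \<open>y - c \<ge> 2 * c \<ge> 2\<close>
  wherever \<open>c\<close> is nonzero. This is where the factor 3 comes from. Entries below 2 are
  preserved, larger ones stay at least 2.\<close>

theorem small_solution:
 fixes A :: "'e => 'p => int" and x :: "'p => nat"
 assumes "finite S" and A: "\<And>e p. A e p \<in> {-1, 0, 1}"
  and x: "solv A R S (%p. int (x p))" "\<And>p. p \<notin> S ==> x p = 0"
 shows "\<exists>y. solv A R S (%p. int (y p)) &
  (\<forall>p. y p \<le> x p & min (x p) 2 \<le> y p & y p \<le> 3 * card S * card S ^ card S)"
proof -
 let ?ok = "%y. solv A R S (%p. int (y p)) & (\<forall>p. y p \<le> x p & min (x p) 2 \<le> y p)"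
 have "?ok x" using x by auto
 then obtain y where y: "?ok y" and least: "\<And>y'. ?ok y' ==> (\<Sum>p\<in>S. y p) \<le> (\<Sum>p\<in>S. y' p)"
  using ex_has_least_nat[of ?ok x "%y. \<Sum>p\<in>S. y p"] by blast
 have y_out: "y p = 0" if "p \<notin> S" for p using y x(2)[OF that] by (metis le_zero_eq)
 have "y q \<le> 3 * card S * card S ^ card S" for q
 proof (rule ccontr)
  assume big: "\<not> ?thesis"
  let ?x = "%p. real (y p)"
  have "{p. ?x p ~= 0} \<subseteq> S"
  proof
   fix p assume "p \<in> {p. ?x p ~= 0}"
   then show "p \<in> S" using y_out[of p] by (cases "p \<in> S") auto
  qed
  then have "card {p. ?x p ~= 0} \<le> card S" by (intro card_mono assms(1))
  then have "3 * card {p. ?x p ~= 0} * (card S ^ card S) \<le> 3 * card S * card S ^ card S" by simp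
  then have "3 * card {p. ?x p ~= 0} * (card S ^ card S) < y q" using big by linarith
  then have "real (3 * card {p. ?x p ~= 0} * (card S ^ card S)) < real (y q)" by (simp only: of_nat_less_iff)
  then have q: "?x q > 3 * card {p. ?x p ~= 0} * (card S ^ card S)" by simp
  have "solv (%e p. real_of_int (A e p)) R S ?x"
   unfolding solv_def
  proof
   fix e assume "e \<in> R"
   then have "real_of_int (\<Sum>p\<in>S. A e p * int (y p)) = 0" using y by (simp add: solv_def)
   then show "(\<Sum>p\<in>S. real_of_int (A e p) * ?x p) = 0" by simp
  qed
  then obtain c :: "'p => int" where c: "\<forall>p. 0 \<le> c p & 3 * c p \<le> ?x p" "\<exists>p. c p ~= 0" "solv A R S c"
   using big_solution[of S A R ?x q, OF assms(1) A _ _ _ q] y_out by auto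
  have c3: "3 * nat (c p) \<le> y p" for p
  proof -
   have "real_of_int (3 * c p) \<le> real_of_int (int (y p))" using c(1) by simp
   then have "3 * c p \<le> int (y p)" by (simp only: of_int_le_iff)
   then show ?thesis using c(1) by linarith
  qed
  define y' where "y' p = y p - nat (c p)" for p
  have int: "int (y' p) = int (y p) - c p" for p
   using c(1)[rule_format, of p] c3[of p] by (simp add: y'_def of_nat_diff)
  have "solv A R S (%p. int (y' p))"
   using y c(3) unfolding int solv_def by (simp add: algebra_simps sum_subtractf)
  moreover have "y' p \<le> x p & min (x p) 2 \<le> y' p" for p
  proof (cases "c p = 0")
   case True
   then show ?thesis using y by (simp add: y'_def)
  next
   case False
   then have "nat (c p) \<ge> 1" using c(1)[rule_format, of p] by linarith
   then show ?thesis using y c3[of p] unfolding y'_def by (auto simp: min_def intro: order.trans[OF diff_le_self])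
  qed
  ultimately have "(\<Sum>p\<in>S. y p) \<le> (\<Sum>p\<in>S. y' p)" using least by blast
  moreover have "(\<Sum>p\<in>S. y' p) < (\<Sum>p\<in>S. y p)"
  proof -
   obtain p where p: "c p ~= 0" using c(2) by blast
   then have "nat (c p) \<ge> 1" using c(1)[rule_format, of p] by linarith
   then have less: "y' p < y p" and "y p ~= 0" using c3[of p] by (auto simp: y'_def)
   then have "p \<in> S" using y_out[of p] by (cases "p \<in> S") auto
   then show ?thesis
    using less by (intro sum_strict_mono_ex1 assms(1)) (auto simp: y'_def)
  qed
  ultimately show False by simp
 qed
 then show ?thesis using y by blast
qed

section \<open>Pairs of linear orders and their labels\<close>

definition adj :: "'e list => 'e => 'e => bool" where
 "adj l e f \<longleftrightarrow> (\<exists>i. Suc i < length l & l ! i = e & l ! Suc i = f)"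

definition pos :: "'e list => 'e => nat" where
 "pos l e = (THE i. i < length l & l ! i = e)"

lemma pos_nth: "distinct l ==> i < length l ==> pos l (l ! i) = i"
 unfolding pos_def by (rule the_equality) (auto simp: nth_eq_iff_index_eq)

lemma nth_pos: "distinct l ==> e \<in> set l ==> pos l e < length l & l ! pos l e = e"
 by (metis in_set_conv_nth pos_nth)

lemma nxt_set: "adj l e f ==> e \<in> set l & f \<in> set l"
 unfolding adj_def by auto

lemma nxt_pos: "distinct l ==> adj l e f \<longleftrightarrow> e \<in> set l & f \<in> set l & pos l f = Suc (pos l e)"
proof
 assume d: "distinct l" and "adj l e f"
 then obtain i where "Suc i < length l" "l ! i = e" "l ! Suc i = f" by (auto simp: adj_def)
 then show "e \<in> set l & f \<in> set l & pos l f = Suc (pos l e)"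
  using pos_nth[OF d, of i] pos_nth[OF d, of "Suc i"] by auto
next
 assume d: "distinct l" and *: "e \<in> set l & f \<in> set l & pos l f = Suc (pos l e)"
 then show "adj l e f"
  unfolding adj_def using nth_pos[OF d, of e] nth_pos[OF d, of f] by (intro exI[of _ "pos l e"]) simp
qed

lemma pos_inj: "distinct l ==> e \<in> set l ==> f \<in> set l ==> pos l e = pos l f ==> e = f"
 by (metis nth_pos)

lemma nxt_fun: "distinct l ==> adj l e f ==> adj l e g ==> f = g"
 using pos_inj by (metis nxt_pos)

lemma nxt_inj: "distinct l ==> adj l f e ==> adj l g e ==> f = g"
 using pos_inj by (metis nxt_pos Suc_inject)

definition dr :: "'e list => 'e list => nat => 'e => 'e => bool" where
 "dr xs ys d e f \<longleftrightarrow> (if d = 0 then adj xs e f else if d = 1 then adj xs f e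
   else if d = 2 then adj ys e f else d = 3 & adj ys f e)"

definition nb :: "nat => tree => tree" where
 "nb d s = (if d = 0 then th (tt s) else if d = 1 then th (tt (tt s))
   else if d = 2 then th (tt (tt (tt s))) else tt (tt (tt (tt s))))"

text \<open>Four bits telling in which directions the other element lies, computed from the star
  \<open>s\<close> of the one and the label \<open>t\<close> of the other. For a neighbour this is
  its true position, since labels of neighbours differ (\<open>rel_nb\<close>).\<close>

definition rho :: "tree => tree => tree" where
 "rho s t = Cn (b2t (nb 0 s = t)) (Cn (b2t (nb 1 s = t)) (Cn (b2t (nb 2 s = t)) (b2t (nb 3 s = t))))"

definition r0 :: tree where
 "r0 = Cn Nl (Cn Nl (Cn Nl Nl))"

definition flip :: "tree => tree" where
 "flip r = Cn (th (tt r)) (Cn (th r) (Cn (tt (tt (tt r))) (th (tt (tt r)))))"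

text \<open>What an element with star \<open>s\<close> sees: the labels of its neighbours, and every label occurring at
 some element that is not a neighbour. \<open>T\<close> contains the labels that occur, \<open>K\<close> those occurring once.\<close>

definition view :: "tree set => tree set => tree => tree => tree => bool" where
 "view T K s t r \<longleftrightarrow> (t ~= Nl & (\<exists>d<4. nb d s = t) & r = rho s t) \<or>
   (t \<in> T & ((\<forall>d<4. nb d s ~= t) \<or> t \<notin> K) & r = r0)"

lemma less4: "(\<exists>d<4. P d) \<longleftrightarrow> P 0 \<or> P (1::nat) \<or> P 2 \<or> P 3" "(\<forall>d<4. P d) \<longleftrightarrow> P 0 & P (1::nat) & P 2 & P 3"
 by (auto simp: numeral_eq_Suc less_Suc_eq)

text \<open>\<open>xs\<close> lists the elements along \<open>Rightarrow\<close>, \<open>ys\<close>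
  along \<open>Downarrow\<close>. Colouring a model achieves \<open>apart\<close>: neighbours of one
  element that carry the same label are the same element.\<close>

locale order_pair =
 fixes xs ys :: "'e list" and lab :: "'e => tree"
 assumes dx: "distinct xs" and dy: "distinct ys" and set_ys: "set ys = set xs" and ne: "xs ~= []"
  and lab: "\<And>e. e \<in> set xs ==> lab e ~= Nl"
  and apart: "\<And>d d' e f g. dr xs ys d e f ==> dr xs ys d' e g ==> lab f = lab g ==> f = g"
begin

definition nbl :: "nat => 'e => tree" where
 "nbl d e = (if \<exists>f. dr xs ys d e f then lab (THE f. dr xs ys d e f) else Nl)"

definition star :: "'e => tree" where
 "star e = Cn (lab e) (Cn (nbl 0 e) (Cn (nbl 1 e) (Cn (nbl 2 e) (nbl 3 e))))"

definition rel :: "'e => 'e => tree" where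
 "rel e f = Cn (b2t (dr xs ys 0 e f)) (Cn (b2t (dr xs ys 1 e f)) (Cn (b2t (dr xs ys 2 e f)) (b2t (dr xs ys 3 e f))))"

lemma dr_lt: "dr xs ys d e f ==> d < 4"
 unfolding dr_def by (simp split: if_splits)

lemma dr_simps:
 "dr xs ys 0 e f = adj xs e f" "dr xs ys (Suc 0) e f = adj xs f e"
 "dr xs ys 2 e f = adj ys e f" "dr xs ys 3 e f = adj ys f e"
 by (simp_all add: dr_def)

lemma d4: "d < 4 ==> d = 0 \<or> d = Suc 0 \<or> d = 2 \<or> d = (3::nat)"
 by arith

lemma dr_fun:
 assumes "dr xs ys d e f" "dr xs ys d e g"
 shows "f = g"
 using d4[OF dr_lt[OF assms(1)]] assms
  nxt_fun[OF dx, of e f g] nxt_fun[OF dy, of e f g] nxt_inj[OF dx, of f e g] nxt_inj[OF dy, of f e g]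
 by (elim disjE) (simp_all only: dr_simps)

lemma dr_set: "dr xs ys d e f ==> e \<in> set xs & f \<in> set xs"
 using d4[OF dr_lt[of d e f]] nxt_set[of xs e f] nxt_set[of ys e f] nxt_set[of xs f e] nxt_set[of ys f e]
 by (auto simp: dr_simps set_ys)

lemma nbl_I: "dr xs ys d e f ==> nbl d e = lab f"
 unfolding nbl_def using dr_fun by (auto intro!: arg_cong[of _ _ lab] the_equality)

lemma nbl_D: "nbl d e = t ==> t ~= Nl ==> \<exists>f. dr xs ys d e f & lab f = t"
proof -
 assume *: "nbl d e = t" "t ~= Nl"
 then obtain f where "dr xs ys d e f" unfolding nbl_def by metis
 then show ?thesis using nbl_I[of d e f] * by auto
qed

lemma th_star [simp]: "th (star e) = lab e"
 by (simp add: star_def)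

lemma nb_star: "d < 4 ==> nb d (star e) = nbl d e"
 by (auto simp: nb_def star_def numeral_eq_Suc less_Suc_eq)

lemma nb_star' [simp]: "nb 0 (star e) = nbl 0 e" "nb (Suc 0) (star e) = nbl 1 e" "nb 2 (star e) = nbl 2 e" "nb 3 (star e) = nbl 3 e"
 by (simp_all add: nb_star)

lemma dr_iff:
 assumes "dr xs ys d e f"
 shows "dr xs ys d' e f \<longleftrightarrow> nbl d' e = lab f"
proof
 assume "nbl d' e = lab f"
 then obtain g where g: "dr xs ys d' e g" "lab g = lab f"
  using nbl_D lab dr_set[OF assms] by blast
 then have "g = f" using apart[OF g(1) assms] by simp
 then show "dr xs ys d' e f" using g by simp
qed (rule nbl_I)

lemma rel_nb: "dr xs ys d e f ==> rel e f = rho (star e) (lab f)"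
 unfolding rel_def rho_def by (simp add: dr_iff[of d e f])

lemma rel_r0: "(\<And>d. \<not> dr xs ys d e f) ==> rel e f = r0"
 unfolding rel_def r0_def by (simp add: b2t_def)

lemma rel_flip: "rel f e = flip (rel e f)"
 unfolding rel_def flip_def dr_def by simp

abbreviation "Tl \<equiv> lab ` set xs"
abbreviation "Kl \<equiv> {t. card {f \<in> set xs. lab f = t} = 1}"

text \<open>Locality of quantification. A label seen at a non-neighbour is either carried by no
  neighbour, and any bearer will do, or it occurs twice; of two bearers at most one is a neighbour
  by \<open>apart\<close>. The element itself counts among its non-neighbours.\<close>

lemma views:
 assumes e: "e \<in> set xs"
 shows "(\<exists>f\<in>set xs. t = lab f & r = rel e f) \<longleftrightarrow> view Tl Kl (star e) t r"
proof
 assume "\<exists>f\<in>set xs. t = lab f & r = rel e f"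
 then obtain f where f: "f \<in> set xs" "t = lab f" "r = rel e f" by blast
 show "view Tl Kl (star e) t r"
 proof (cases "\<exists>d. dr xs ys d e f")
  case True
  then obtain d where d: "dr xs ys d e f" ..
  have "t ~= Nl & (\<exists>d<4. nb d (star e) = t) & r = rho (star e) t"
   using lab[OF f(1)] nbl_I[OF d] rel_nb[OF d] dr_lt[OF d] f nb_star by auto
  then show ?thesis unfolding view_def ..
 next
  case False
  then have r: "r = r0" using rel_r0 f by blast
  have "(\<forall>d<4. nb d (star e) ~= t) \<or> t \<notin> Kl"
  proof (rule ccontr)
   assume "\<not> ?thesis"
   then obtain d where d: "d < 4" "nbl d e = t" and K: "card {f \<in> set xs. lab f = t} = 1" using nb_star by auto
   from nbl_D[OF d(2)] lab[OF f(1)] f(2) obtain g where g: "dr xs ys d e g" "lab g = t" by auto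
   have "f \<in> {f \<in> set xs. lab f = t}" "g \<in> {f \<in> set xs. lab f = t}" using f g dr_set by auto
   moreover from K obtain h where "{f \<in> set xs. lab f = t} = {h}" by (rule card_1_singletonE)
   ultimately have "f = g" by simp
   then show False using False g by blast
  qed
  then have "t \<in> Tl & ((\<forall>d<4. nb d (star e) ~= t) \<or> t \<notin> Kl) & r = r0" using f r by blast
  then show ?thesis unfolding view_def ..
 qed
next
 assume "view Tl Kl (star e) t r"
 then consider d where "t ~= Nl" "d < 4" "nb d (star e) = t" "r = rho (star e) t"
  | "t \<in> Tl" "\<forall>d<4. nb d (star e) ~= t" "r = r0" | "t \<in> Tl" "t \<notin> Kl" "r = r0"
  unfolding view_def by blast
 then show "\<exists>f\<in>set xs. t = lab f & r = rel e f"
 proof cases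
  case 1
  then have "nbl d e = t" using nb_star by simp
  then obtain f where f: "dr xs ys d e f" "lab f = t" using nbl_D 1 by blast
  then show ?thesis using rel_nb[OF f(1)] dr_set[OF f(1)] 1 by (intro bexI[of _ f]) auto
 next
  case 2
  then obtain f where f: "f \<in> set xs" "t = lab f" by blast
  have "\<not> dr xs ys d e f" for d
  proof
   assume d: "dr xs ys d e f"
   then show False using nbl_I[OF d] dr_lt[OF d] nb_star 2 f by auto
  qed
  then show ?thesis using rel_r0 f 2 by (intro bexI[of _ f]) auto
 next
  case 3
  then obtain f where f: "f \<in> set xs" "t = lab f" by blast
  have "\<exists>g\<in>set xs. lab g = t & g ~= f"
  proof (rule ccontr)
   assume "\<not> ?thesis"
   then have "{f \<in> set xs. lab f = t} = {f}" using f by auto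
   then show False using 3 by simp
  qed
  then obtain g where g: "g \<in> set xs" "lab g = t" "g ~= f" by blast
  have "(\<forall>d. \<not> dr xs ys d e f) \<or> (\<forall>d. \<not> dr xs ys d e g)"
   using apart f(2) g by metis
  then show ?thesis
  proof
   assume "\<forall>d. \<not> dr xs ys d e f"
   then show ?thesis using rel_r0[of e f] f 3 by (intro bexI[of _ f]) auto
  next
   assume "\<forall>d. \<not> dr xs ys d e g"
   then show ?thesis using rel_r0[of e g] g 3 by (intro bexI[of _ g]) auto
  qed
 qed
qed

definition ps :: "'e => position" where
 "ps e = (Suc (pos ys e), Suc (pos xs e))"

lemma dr_ps:
 assumes "e \<in> set xs" "f \<in> set xs"
 shows "dr xs ys 0 e f \<longleftrightarrow> (\<exists>r r' c. ps e = (r, c) & ps f = (r', c + 1))"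
  and "dr xs ys 2 e f \<longleftrightarrow> (\<exists>r c c'. ps e = (r, c) & ps f = (r + 1, c'))"
 using assms set_ys by (auto simp: dr_def ps_def nxt_pos[OF dx] nxt_pos[OF dy])

lemma valued: "valued_permutation (ps ` set xs) \<sigma>"
proof -
 let ?n = "length xs"
 have len: "length ys = ?n" using dx dy set_ys distinct_card by metis
 have "is_permutation ?n (ps ` set xs)"
  unfolding is_permutation_def
 proof (intro conjI ballI)
  show "ps ` set xs \<subseteq> {1..?n} \<times> {1..?n}"
   using nth_pos[OF dx] nth_pos[OF dy] set_ys len by (auto simp: ps_def Suc_le_eq)
  fix k assume k: "k \<in> {1..?n}"
  have k': "k - 1 < ?n" "Suc (k - 1) = k" using k by auto
  show "\<exists>!c. (k, c) \<in> ps ` set xs"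
  proof (rule ex1I[of _ "Suc (pos xs (ys ! (k - 1)))"])
   have "ps (ys ! (k - 1)) = (k, Suc (pos xs (ys ! (k - 1))))"
    using pos_nth[OF dy, of "k - 1"] k' len by (simp add: ps_def)
   moreover have "ys ! (k - 1) \<in> set xs" using k' len set_ys nth_mem by metis
   ultimately show "(k, Suc (pos xs (ys ! (k - 1)))) \<in> ps ` set xs" by force
   fix c assume "(k, c) \<in> ps ` set xs"
   then obtain e where e: "e \<in> set xs" "k = Suc (pos ys e)" "c = Suc (pos xs e)" by (auto simp: ps_def)
   then have "ys ! (k - 1) = e" using nth_pos[OF dy, of e] set_ys by simp
   then show "c = Suc (pos xs (ys ! (k - 1)))" using e by simp
  qed
  show "\<exists>!r. (r, k) \<in> ps ` set xs"
  proof (rule ex1I[of _ "Suc (pos ys (xs ! (k - 1)))"])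
   have "ps (xs ! (k - 1)) = (Suc (pos ys (xs ! (k - 1))), k)"
    using pos_nth[OF dx, of "k - 1"] k' by (simp add: ps_def)
   moreover have "xs ! (k - 1) \<in> set xs" using k' nth_mem by metis
   ultimately show "(Suc (pos ys (xs ! (k - 1))), k) \<in> ps ` set xs" by force
   fix c assume "(c, k) \<in> ps ` set xs"
   then obtain e where e: "e \<in> set xs" "k = Suc (pos xs e)" "c = Suc (pos ys e)" by (auto simp: ps_def)
   then have "xs ! (k - 1) = e" using nth_pos[OF dx, of e] by simp
   then show "c = Suc (pos ys (xs ! (k - 1)))" using e by simp
  qed
 qed
 moreover have "?n \<ge> 1" using ne by (cases xs) auto
 ultimately show ?thesis unfolding valued_permutation_def by blast
qed

end

section \<open>Formulas as lists of tokens\<close>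

fun vt :: "var => tree" where
 "vt X = Nl"
| "vt Y = Cn Nl Nl"

fun other :: "var => var" where
 "other X = Y"
| "other Y = X"

fun dg :: "nat => tree" where
 "dg p = (if p = 0 then Nl else Cn (b2t (odd p)) (dg (p div 2)))"

declare dg.simps [simp del]

fun tok :: "fm => tree" where
 "tok (Letter p a) = Cn (bt [False, False, False]) (Cn (vt a) (dg p))"
| "tok (Rightarrow a b) = Cn (bt [False, False, True]) (Cn (vt a) (vt b))"
| "tok (Downarrow a b) = Cn (bt [False, True, False]) (Cn (vt a) (vt b))"
| "tok (Neg \<phi>) = Cn (bt [False, True, True]) Nl"
| "tok (Conj \<phi> \<psi>) = Cn (bt [True, False, False]) Nl"
| "tok (Disj \<phi> \<psi>) = Cn (bt [True, False, True]) Nl"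
| "tok (Exists a \<phi>) = Cn (bt [True, True, False]) (vt a)"
| "tok (Forall a \<phi>) = Cn (bt [True, True, True]) (vt a)"

text \<open>Prefix notation followed by the continuation \<open>r\<close>. As the continuation is
  part of the list, two occurrences of the same subformula in a formula have different lists and get
  separate entries in the labels.\<close>

fun tk :: "fm => tree => tree" where
 "tk (Letter p a) r = Cn (tok (Letter p a)) r"
| "tk (Rightarrow a b) r = Cn (tok (Rightarrow a b)) r"
| "tk (Downarrow a b) r = Cn (tok (Downarrow a b)) r"
| "tk (Neg \<phi>) r = Cn (tok (Neg \<phi>)) (tk \<phi> r)"
| "tk (Conj \<phi> \<psi>) r = Cn (tok (Conj \<phi> \<psi>)) (tk \<phi> (tk \<psi> r))"
| "tk (Disj \<phi> \<psi>) r = Cn (tok (Disj \<phi> \<psi>)) (tk \<phi> (tk \<psi> r))"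
| "tk (Exists a \<phi>) r = Cn (tok (Exists a \<phi>)) (tk \<phi> r)"
| "tk (Forall a \<phi>) r = Cn (tok (Forall a \<phi>)) (tk \<phi> r)"

text \<open>A label is a colour followed by a list of keys: \<open>Cn Nl (dg p)\<close> for a letter
  and a list of tokens for a quantified subformula. A key is listed if it is true at the
  element.\<close>

definition U :: "tree => tree => bool" where
 "U k l \<longleftrightarrow> k \<in> els (tt l)"

definition lv :: "var => tree => tree" where
 "lv a z = (if a = X then th z else th (tt z))"

text \<open>The value of a subformula for two elements depends on their labels and their relative position,
 which make up \<open>z\<close>. A label contains the true letters and the true quantified subformulas; an
 occurrence of a subformula is identified by the list of tokens starting there.\<close>

fun evf :: "fm => tree => tree => bool" where
 "evf (Letter p a) r z \<longleftrightarrow> U (Cn Nl (dg p)) (lv a z)"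
| "evf (Rightarrow a b) r z \<longleftrightarrow> a ~= b & (if a = X then th (tt (tt z)) else th (tt (tt (tt z)))) ~= Nl"
| "evf (Downarrow a b) r z \<longleftrightarrow> a ~= b & (if a = X then th (tt (tt (tt (tt z)))) else tt (tt (tt (tt (tt z))))) ~= Nl"
| "evf (Neg \<phi>) r z \<longleftrightarrow> \<not> evf \<phi> r z"
| "evf (Conj \<phi> \<psi>) r z \<longleftrightarrow> evf \<phi> (tk \<psi> r) z & evf \<psi> r z"
| "evf (Disj \<phi> \<psi>) r z \<longleftrightarrow> evf \<phi> (tk \<psi> r) z \<or> evf \<psi> r z"
| "evf (Exists a \<phi>) r z \<longleftrightarrow> U (tk (Exists a \<phi>) r) (lv (other a) z)"
| "evf (Forall a \<phi>) r z \<longleftrightarrow> U (tk (Forall a \<phi>) r) (lv (other a) z)"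

fun occ :: "fm => tree => (bool \<times> var \<times> fm \<times> tree) set" where
 "occ (Neg \<phi>) r = occ \<phi> r"
| "occ (Conj \<phi> \<psi>) r = occ \<phi> (tk \<psi> r) \<union> occ \<psi> r"
| "occ (Disj \<phi> \<psi>) r = occ \<phi> (tk \<psi> r) \<union> occ \<psi> r"
| "occ (Exists a \<phi>) r = insert (True, a, \<phi>, r) (occ \<phi> r)"
| "occ (Forall a \<phi>) r = insert (False, a, \<phi>, r) (occ \<phi> r)"
| "occ _ r = {}"

fun lets :: "fm => nat set" where
 "lets (Letter p a) = {p}"
| "lets (Neg \<phi>) = lets \<phi>"
| "lets (Conj \<phi> \<psi>) = lets \<phi> \<union> lets \<psi>"
| "lets (Disj \<phi> \<psi>) = lets \<phi> \<union> lets \<psi>"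
| "lets (Exists a \<phi>) = lets \<phi>"
| "lets (Forall a \<phi>) = lets \<phi>"
| "lets _ = {}"

definition Qf :: "bool => var => fm => fm" where
 "Qf b a \<phi> = (if b then Exists a \<phi> else Forall a \<phi>)"

text \<open>In a situation \<open>z\<close> the element of \<open>X\<close> comes first, and the
  relative position is that of \<open>Y\<close> seen from \<open>X\<close>. If the quantifier binds
  \<open>X\<close>, the fixed element is that of \<open>Y\<close>, and the roles are
  exchanged.\<close>

definition env :: "var => tree => tree => tree => tree" where
 "env a l t r = (if a = Y then Cn l (Cn t r) else Cn t (Cn l (flip r)))"

definition qval :: "bool => (tree => tree => bool) => (tree => tree => bool) => bool" where
 "qval b V P \<longleftrightarrow> (if b then \<exists>t r. V t r & P t r else \<forall>t r. V t r --> P t r)"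

section \<open>Truth in a structure against local consistency of labels\<close>

context order_pair
begin

definition agrees :: "valuation => fm => tree => bool" where
 "agrees \<sigma> \<phi> r \<longleftrightarrow> (\<forall>e\<in>set xs. (\<forall>p\<in>lets \<phi>. U (Cn Nl (dg p)) (lab e) \<longleftrightarrow> p \<in> \<sigma> (ps e)) &
   (\<forall>(b, a, \<psi>, r')\<in>occ \<phi> r. U (tk (Qf b a \<psi>) r') (lab e) \<longleftrightarrow> sat (ps ` set xs) \<sigma> (%_. ps e) (Qf b a \<psi>)))"

definition zz :: "(var => 'e) => tree" where
 "zz \<mu> = Cn (lab (\<mu> X)) (Cn (lab (\<mu> Y)) (rel (\<mu> X) (\<mu> Y)))"

lemma agrees_Neg: "agrees \<sigma> (Neg \<phi>) r \<longleftrightarrow> agrees \<sigma> \<phi> r"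
 by (simp add: agrees_def)

lemma agrees_Conj: "agrees \<sigma> (Conj \<phi> \<psi>) r \<longleftrightarrow> agrees \<sigma> \<phi> (tk \<psi> r) & agrees \<sigma> \<psi> r"
 by (simp add: agrees_def ball_Un) blast

lemma agrees_Disj: "agrees \<sigma> (Disj \<phi> \<psi>) r \<longleftrightarrow> agrees \<sigma> \<phi> (tk \<psi> r) & agrees \<sigma> \<psi> r"
 by (simp add: agrees_def ball_Un) blast

lemma lv_zz: "lv a (zz \<mu>) = lab (\<mu> a)"
 by (cases a) (auto simp: lv_def zz_def)

text \<open>With two variables a quantifier over \<open>a\<close> keeps only the value of the other
  variable. Hence quantified subformulas are unary properties, which a label can record.\<close>

lemma upd_other: "\<mu>(a := e) = (%_. \<mu> (other a))(a := e)"
 by (rule ext, rename_tac b) (case_tac a; case_tac b; simp)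

lemma evf_sat:
 assumes "agrees \<sigma> \<phi> r" "\<And>a. \<mu> a \<in> set xs"
 shows "evf \<phi> r (zz \<mu>) \<longleftrightarrow> sat (ps ` set xs) \<sigma> (%a. ps (\<mu> a)) \<phi>"
 using assms(1)
proof (induction \<phi> arbitrary: r)
 case (Letter p a)
 then show ?case using assms(2)[of a] by (simp add: agrees_def lv_zz)
next
 case (Rightarrow a b)
 have "adj xs e e \<longleftrightarrow> False" for e by (simp add: nxt_pos[OF dx])
 then have "dr xs ys 0 (\<mu> a) (\<mu> b) \<longleftrightarrow> evf (Rightarrow a b) r (zz \<mu>)"
  by (cases a; cases b) (auto simp: zz_def rel_def dr_def)
 then show ?case using dr_ps(1)[OF assms(2)[of a] assms(2)[of b]] by simp
next
 case (Downarrow a b)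
 have "adj ys e e \<longleftrightarrow> False" for e by (simp add: nxt_pos[OF dy])
 then have "dr xs ys 2 (\<mu> a) (\<mu> b) \<longleftrightarrow> evf (Downarrow a b) r (zz \<mu>)"
  by (cases a; cases b) (auto simp: zz_def rel_def dr_def)
 then show ?case using dr_ps(2)[OF assms(2)[of a] assms(2)[of b]] by simp
next
 case (Neg \<phi>)
 have "agrees \<sigma> \<phi> r" using Neg.prems by (simp add: agrees_def)
 then show ?case using Neg.IH by simp
next
 case (Conj \<phi> \<psi>)
 have "agrees \<sigma> \<phi> (tk \<psi> r)" "agrees \<sigma> \<psi> r" using Conj.prems unfolding agrees_Conj by simp_all
 then show ?case using Conj.IH by simp
next
 case (Disj \<phi> \<psi>)
 have "agrees \<sigma> \<phi> (tk \<psi> r)" "agrees \<sigma> \<psi> r" using Disj.prems unfolding agrees_Disj by simp_all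
 then show ?case using Disj.IH by simp
next
 case (Exists a \<phi>)
 have "evf (Exists a \<phi>) r (zz \<mu>) \<longleftrightarrow> sat (ps ` set xs) \<sigma> (%_. ps (\<mu> (other a))) (Exists a \<phi>)"
  using Exists.prems assms(2)[of "other a"] by (simp add: agrees_def lv_zz Qf_def)
 then show ?case
  unfolding sat.simps upd_other[of "%a. ps (\<mu> a)"] .
next
 case (Forall a \<phi>)
 have "evf (Forall a \<phi>) r (zz \<mu>) \<longleftrightarrow> sat (ps ` set xs) \<sigma> (%_. ps (\<mu> (other a))) (Forall a \<phi>)"
  using Forall.prems assms(2)[of "other a"] by (simp add: agrees_def lv_zz Qf_def)
 then show ?case
  unfolding sat.simps upd_other[of "%a. ps (\<mu> a)"] .
qed

lemma zz_env: "zz ((%_. e)(a := f)) = env a (lab e) (lab f) (rel e f)"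
 by (cases a) (simp_all add: zz_def env_def rel_flip[of f e])

lemma qval_sat:
 assumes "agrees \<sigma> \<phi> r" and e: "e \<in> set xs"
 shows "sat (ps ` set xs) \<sigma> (%_. ps e) (Qf b a \<phi>) \<longleftrightarrow>
  qval b (view Tl Kl (star e)) (%t r'. evf \<phi> r (env a (lab e) t r'))"
proof -
 have upd: "(%_. ps e)(a := ps f) = (%c. ps (((%_. e)(a := f)) c))" for f by auto
 have "sat (ps ` set xs) \<sigma> ((%_. ps e)(a := ps f)) \<phi> \<longleftrightarrow> evf \<phi> r (env a (lab e) (lab f) (rel e f))"
  if "f \<in> set xs" for f
  unfolding upd using e that by (subst evf_sat[OF assms(1), symmetric]) (auto simp: zz_env)
 then have "sat (ps ` set xs) \<sigma> (%_. ps e) (Qf b a \<phi>) \<longleftrightarrow>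
   (if b then \<exists>f\<in>set xs. evf \<phi> r (env a (lab e) (lab f) (rel e f))
    else \<forall>f\<in>set xs. evf \<phi> r (env a (lab e) (lab f) (rel e f)))"
  by (simp add: Qf_def)
 then show ?thesis unfolding qval_def views[OF e, symmetric] by auto
qed

text \<open>A condition on labels and stars that no longer mentions satisfaction;
  \<open>agrees_qc\<close> and \<open>qc_agrees\<close> relate it to truth. It is this condition
  that a certificate can be checked for.\<close>

definition qc :: "fm => tree => bool" where
 "qc \<phi> r \<longleftrightarrow> (\<forall>e\<in>set xs. \<forall>(b, a, \<psi>, r')\<in>occ \<phi> r.
   U (tk (Qf b a \<psi>) r') (lab e) \<longleftrightarrow> qval b (view Tl Kl (star e)) (%t r. evf \<psi> r' (env a (lab e) t r)))"

lemma agrees_occ: "agrees \<sigma> \<phi> r ==> (b, a, \<psi>', r') \<in> occ \<phi> r ==> agrees \<sigma> \<psi>' r'"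
proof (induction \<phi> arbitrary: r)
 case (Neg \<phi>)
 then show ?case unfolding agrees_Neg by simp
next
 case (Conj \<phi> \<psi>)
 have *: "agrees \<sigma> \<phi> (tk \<psi> r)" "agrees \<sigma> \<psi> r" using Conj.prems(1) unfolding agrees_Conj by simp_all
 consider "(b, a, \<psi>', r') \<in> occ \<phi> (tk \<psi> r)" | "(b, a, \<psi>', r') \<in> occ \<psi> r" using Conj.prems(2) by auto
 then show ?case using Conj.IH * by cases blast+
next
 case (Disj \<phi> \<psi>)
 have *: "agrees \<sigma> \<phi> (tk \<psi> r)" "agrees \<sigma> \<psi> r" using Disj.prems(1) unfolding agrees_Disj by simp_all
 consider "(b, a, \<psi>', r') \<in> occ \<phi> (tk \<psi> r)" | "(b, a, \<psi>', r') \<in> occ \<psi> r" using Disj.prems(2) by auto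
 then show ?case using Disj.IH * by cases blast+
next
 case (Exists c \<phi>)
 have *: "agrees \<sigma> \<phi> r" using Exists.prems by (simp add: agrees_def)
 consider "(b, a, \<psi>', r') = (True, c, \<phi>, r)" | "(b, a, \<psi>', r') \<in> occ \<phi> r" using Exists.prems(2) by auto
 then show ?case using * Exists.IH by cases auto
next
 case (Forall c \<phi>)
 have *: "agrees \<sigma> \<phi> r" using Forall.prems by (simp add: agrees_def)
 consider "(b, a, \<psi>', r') = (False, c, \<phi>, r)" | "(b, a, \<psi>', r') \<in> occ \<phi> r" using Forall.prems(2) by auto
 then show ?case using * Forall.IH by cases auto
qed simp_all

lemma agrees_qc: "agrees \<sigma> \<phi> r ==> qc \<phi> r"
 unfolding qc_def
proof (intro ballI, clarify)
 fix e b a \<psi> r' assume *: "agrees \<sigma> \<phi> r" "e \<in> set xs" "(b, a, \<psi>, r') \<in> occ \<phi> r"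
 have "U (tk (Qf b a \<psi>) r') (lab e) \<longleftrightarrow> sat (ps ` set xs) \<sigma> (%_. ps e) (Qf b a \<psi>)"
  using * unfolding agrees_def by blast
 then show "U (tk (Qf b a \<psi>) r') (lab e) \<longleftrightarrow> qval b (view Tl Kl (star e)) (%t r. evf \<psi> r' (env a (lab e) t r))"
  unfolding qval_sat[OF agrees_occ[OF *(1,3)] *(2)] .
qed

definition val :: valuation where
 "val q = {p. \<exists>e\<in>set xs. ps e = q & U (Cn Nl (dg p)) (lab e)}"

lemma val_ps: "e \<in> set xs ==> p \<in> val (ps e) \<longleftrightarrow> U (Cn Nl (dg p)) (lab e)"
 using pos_inj[OF dx] by (auto simp: val_def ps_def)

text \<open>Labels that are consistent locally are right: the induction goes from the innermost
  quantifiers outwards, with the letters taken from the labels themselves by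
  \<open>val\<close>.\<close>

lemma qc_agrees: "qc \<phi> r ==> agrees val \<phi> r"
proof (induction \<phi> arbitrary: r)
 case (Neg \<phi>)
 then show ?case by (simp add: agrees_def qc_def)
next
 case (Conj \<phi> \<psi>)
 have "qc \<phi> (tk \<psi> r)" "qc \<psi> r" using Conj.prems by (simp_all add: qc_def ball_Un)
 then have "agrees val \<phi> (tk \<psi> r)" "agrees val \<psi> r" using Conj.IH by blast+
 then show ?case unfolding agrees_Conj by simp
next
 case (Disj \<phi> \<psi>)
 have "qc \<phi> (tk \<psi> r)" "qc \<psi> r" using Disj.prems by (simp_all add: qc_def ball_Un)
 then have "agrees val \<phi> (tk \<psi> r)" "agrees val \<psi> r" using Disj.IH by blast+
 then show ?case unfolding agrees_Disj by simp
next
 case (Exists c \<phi>)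
 have "qc \<phi> r" using Exists.prems by (simp add: qc_def)
 then have *: "agrees val \<phi> r" by (rule Exists.IH)
 have "U (tk (Qf True c \<phi>) r) (lab e) \<longleftrightarrow> sat (ps ` set xs) val (%_. ps e) (Qf True c \<phi>)" if "e \<in> set xs" for e
  unfolding qval_sat[OF * that] using Exists.prems that by (simp add: qc_def)
 then show ?case using * by (simp add: agrees_def)
next
 case (Forall c \<phi>)
 have "qc \<phi> r" using Forall.prems by (simp add: qc_def)
 then have *: "agrees val \<phi> r" by (rule Forall.IH)
 have "U (tk (Qf False c \<phi>) r) (lab e) \<longleftrightarrow> sat (ps ` set xs) val (%_. ps e) (Qf False c \<phi>)" if "e \<in> set xs" for e
  unfolding qval_sat[OF * that] using Forall.prems that by (simp add: qc_def)
 then show ?case using * by (simp add: agrees_def)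
qed (simp_all add: agrees_def val_ps)

lemma qc_models:
 assumes "qc \<phi> r" "closed_fm \<phi>" "e \<in> set xs" "evf \<phi> r (Cn (lab e) (Cn (lab e) r0))"
 shows "satisfiable \<phi>"
proof -
 have "rel e e = r0"
  by (rule rel_r0) (simp add: dr_def nxt_pos[OF dx] nxt_pos[OF dy])
 then have "evf \<phi> r (zz (%_. e))" using assms by (simp add: zz_def)
 then have "sat (ps ` set xs) val (%_. ps e) \<phi>"
  using evf_sat[OF qc_agrees[OF assms(1)], of "%_. e"] assms(3) by simp
 then show ?thesis
  unfolding satisfiable_def using models_closed_iff[OF valued assms(2)] valued by blast
qed

end

section \<open>Pieces\<close>

text \<open>A piece is a maximal sequence of elements that are consecutive in both orders, in the same
 direction (\<open>k\<close>) or in opposite directions (\<open>\<not> k\<close>). It is given by the stars of its elements.\<close>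

definition nx :: "bool => tree => tree => bool" where
 "nx k s s' \<longleftrightarrow> nb 0 s = th s' & nb 1 s' = th s &
   (if k then nb 2 s = th s' & nb 3 s' = th s else nb 3 s = th s' & nb 2 s' = th s)"

definition same :: "tree => tree => bool" where
 "same a b \<longleftrightarrow> a = b & a ~= Nl"

text \<open>Labels of neighbours being apart, equal entries of a star mean the same neighbour. In a
  piece of kind \<open>k\<close> the neighbours to the right and below may coincide, as may those to
  the left and above; with \<open>\<not> k\<close> it is right with above and left with below. Other
  coincidences are impossible in a pair of orders.\<close>

definition star_ok :: "bool => tree => bool" where
 "star_ok k s \<longleftrightarrow> s = Cn (th s) (Cn (nb 0 s) (Cn (nb 1 s) (Cn (nb 2 s) (nb 3 s)))) & th s ~= Nl &
   (same (nb 0 s) (nb 2 s) --> k) & (same (nb 1 s) (nb 3 s) --> k) &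
   (same (nb 0 s) (nb 3 s) --> \<not> k) & (same (nb 1 s) (nb 2 s) --> \<not> k) &
   \<not> same (nb 0 s) (nb 1 s) & \<not> same (nb 2 s) (nb 3 s)"

text \<open>Maximality of pieces: behind the last element, and by \<open>first_ok\<close> before the
  first one, the two orders part.\<close>

definition last_ok :: "tree => bool" where
 "last_ok s \<longleftrightarrow> \<not> same (nb 0 s) (nb 2 s) & \<not> same (nb 0 s) (nb 3 s)"

definition first_ok :: "tree => bool" where
 "first_ok s \<longleftrightarrow> \<not> same (nb 1 s) (nb 3 s) & \<not> same (nb 1 s) (nb 2 s)"

definition word_ok :: "bool => tree list => bool" where
 "word_ok k w \<longleftrightarrow> w ~= [] & successively (nx k) w & (\<forall>s\<in>set w. star_ok k s) &
   last_ok (last w) & first_ok (hd w)"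

text \<open>A piece is stored in the order of \<open>xs\<close>; \<open>ys\<close> runs through it
  backwards if the kind is \<open>\<not> k\<close>. Here and below \<open>d\<close> is
  \<open>True\<close> for \<open>xs\<close> and \<open>False\<close> for \<open>ys\<close>.\<close>

definition ori :: "bool => bool => 'a list => 'a list" where
 "ori d k w = (if d \<or> k then w else rev w)"

definition fwd :: "bool => nat" where
 "fwd d = (if d then 0 else 2)"

definition bwd :: "bool => nat" where
 "bwd d = (if d then 1 else 3)"

text \<open>The vertices of the graph for order \<open>d\<close> are the pairs of labels that meet
  at a boundary between pieces; \<open>ins\<close> computes the same pair from the other side.
  \<open>Nl\<close> stands for both ends of the order.\<close>

definition outs :: "bool => tree => tree" where
 "outs d s = (if nb (fwd d) s = Nl then Nl else Cn (th s) (nb (fwd d) s))"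

definition ins :: "bool => tree => tree" where
 "ins d s = (if nb (bwd d) s = Nl then Nl else Cn (nb (bwd d) s) (th s))"

definition outv :: "bool => bool \<times> tree list => tree" where
 "outv d p = outs d (last (ori d (fst p) (snd p)))"

definition inv :: "bool => bool \<times> tree list => tree" where
 "inv d p = ins d (hd (ori d (fst p) (snd p)))"

definition flow :: "('p => bool) => (nat \<times> 'p) list => nat" where
 "flow Q P = (\<Sum>(m, p)\<leftarrow>P. if Q p then m else 0)"

definition tot :: "(nat \<times> bool \<times> tree list) list => tree => nat" where
 "tot P t = (\<Sum>(m, k, w)\<leftarrow>P. m * count_list (map th w) t)"

text \<open>Flow 1 through \<open>Nl\<close> means that a closed tour passes the ends only once, so
  that cutting it there gives a single linear order. The last condition is connectivity.\<close>

definition euler_ok :: "bool => (nat \<times> bool \<times> tree list) list => bool" where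
 "euler_ok d P \<longleftrightarrow> (\<forall>v. flow (%p. inv d p = v) P = flow (%p. outv d p = v) P) &
   flow (%p. inv d p = Nl) P = 1 &
   (\<forall>p\<in>snd ` set P. (Nl, inv d p) \<in> ((%p. (inv d p, outv d p)) ` snd ` set P)\<^sup>*)"

section \<open>Copies of pieces and their elements\<close>

lemma card_inst:
 "card {(a, i). a < length P & i < fst (P ! a) & Q (snd (P ! a))} = flow Q P"
proof -
 have "{(a, i). a < length P & i < fst (P ! a) & Q (snd (P ! a))} =
   (SIGMA a:{..<length P}. if Q (snd (P ! a)) then {..<fst (P ! a)} else {})"
  by (auto split: if_splits)
 then have "card {(a, i). a < length P & i < fst (P ! a) & Q (snd (P ! a))} =
   (\<Sum>a<length P. if Q (snd (P ! a)) then fst (P ! a) else 0)"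
  by (simp add: if_distrib cong: if_cong)
 also have "\<dots> = flow Q P"
  unfolding flow_def sum_list_sum_nth
  by (rule sum.cong) (auto simp: case_prod_unfold)
 finally show ?thesis .
qed

lemma count_list_card: "count_list w t = card {j. j < length w & w ! j = t}"
proof (induction w)
 case (Cons a w)
 have "{j. j < length (a # w) & (a # w) ! j = t} =
   (if a = t then {0} else {}) \<union> Suc ` {j. j < length w & w ! j = t}" (is "?L = ?R")
 proof (rule set_eqI)
  fix j show "j \<in> ?L \<longleftrightarrow> j \<in> ?R" by (cases j) auto
 qed
 moreover have "card (Suc ` {j. j < length w & w ! j = t}) = card {j. j < length w & w ! j = t}"
  by (rule card_image) simp
 ultimately show ?case using Cons by (auto simp: card_Un_disjoint)
qed simp

definition insts :: "(nat \<times> bool \<times> tree list) list => (nat \<times> nat) set" where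
 "insts P = {(a, i). a < length P & i < fst (P ! a)}"

text \<open>An element of the assembled structure is given by a piece, a copy of it and a place
  inside.\<close>

definition elts :: "(nat \<times> bool \<times> tree list) list => (nat \<times> nat \<times> nat) set" where
 "elts P = {(a, i, j). a < length P & i < fst (P ! a) & j < length (snd (snd (P ! a)))}"

definition stt :: "(nat \<times> bool \<times> tree list) list => nat \<times> nat \<times> nat => tree" where
 "stt P e = snd (snd (P ! fst e)) ! snd (snd e)"

lemma card_tot: "card {e \<in> elts P. th (stt P e) = t} = tot P t"
proof -
 have "{e \<in> elts P. th (stt P e) = t} = (SIGMA a:{..<length P}. {..<fst (P ! a)} \<times>
   {j. j < length (map th (snd (snd (P ! a)))) & map th (snd (snd (P ! a))) ! j = t})"
  by (auto simp: elts_def stt_def)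
 then have "card {e \<in> elts P. th (stt P e) = t} =
   (\<Sum>a<length P. fst (P ! a) * count_list (map th (snd (snd (P ! a)))) t)"
  by (simp add: card_cartesian_product count_list_card)
 also have "\<dots> = tot P t"
  unfolding tot_def sum_list_sum_nth by (rule sum.cong) (auto simp: case_prod_unfold)
 finally show ?thesis .
qed

section \<open>Assembling a structure from pieces\<close>

lemma tour_links:
 "tour s t u p v ==> successively (%i i'. t i = s i') p & (p ~= [] --> s (hd p) = u & t (last p) = v)"
proof (induction p arbitrary: u)
 case (Cons i p)
 then show ?case by (cases p) (auto simp: successively_Cons)
qed simp

lemma successively_concat:
 "(\<And>b. b \<in> set bs ==> b ~= [] & successively R b) ==> successively (%b b'. R (last b) (hd b')) bs ==>
  successively R (concat bs)"
proof (induction bs)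
 case (Cons b bs)
 have IH: "successively R (concat bs)"
 proof (rule Cons.IH)
  show "b' ~= [] & successively R b'" if "b' \<in> set bs" for b' using Cons.prems(1)[of b'] that by simp
  show "successively (%b b'. R (last b) (hd b')) bs" using Cons.prems(2) by (cases bs) (simp_all add: successively_Cons)
 qed
 show ?case
 proof (cases bs)
  case Nil
  then show ?thesis using Cons.prems by simp
 next
  case (Cons b' bs')
  have "b' ~= []" using Cons.prems(1)[of b'] Cons by simp
  then have "hd (concat bs) = hd b'" using Cons by simp
  then show ?thesis using IH Cons.prems Cons by (simp add: successively_append_iff)
 qed
qed simp

lemma nxt_mid:
 assumes "adj b e f"
 shows "adj (us @ b @ vs) e f"
proof -
 obtain i where "Suc i < length b" "b ! i = e" "b ! Suc i = f" using assms by (auto simp: adj_def)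
 then show ?thesis
  unfolding adj_def by (intro exI[of _ "length us + i"]) (auto simp: nth_append)
qed

lemma nxt_map: "adj l e f ==> adj (map g l) (g e) (g f)"
 unfolding adj_def by auto

lemma nxt_ori: "Suc j < n ==> (if d \<or> k then adj (ori d k [0..<n]) j (Suc j) else adj (ori d k [0..<n]) (Suc j) j)"
proof (cases "d \<or> k")
 case True
 then show "Suc j < n ==> ?thesis" unfolding adj_def ori_def by (auto intro!: exI[of _ j])
next
 case False
 then show "Suc j < n ==> ?thesis" unfolding adj_def ori_def by (auto simp: rev_nth intro!: exI[of _ "n - Suc (Suc j)"])
qed

definition LK :: "(nat \<times> bool \<times> tree list) list => bool => nat \<times> nat \<times> nat => nat \<times> nat \<times> nat => bool" where
 "LK P d e f \<longleftrightarrow> nb (fwd d) (stt P e) = th (stt P f) & nb (bwd d) (stt P f) = th (stt P e)"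

definition linear :: "(nat \<times> bool \<times> tree list) list => bool => (nat \<times> nat \<times> nat) list => bool" where
 "linear P d zs \<longleftrightarrow> distinct zs & set zs = elts P & zs ~= [] & successively (LK P d) zs &
   nb (bwd d) (stt P (hd zs)) = Nl & nb (fwd d) (stt P (last zs)) = Nl &
   (\<forall>a i j. (a, i) \<in> insts P --> Suc j < length (snd (snd (P ! a))) -->
    (if d \<or> fst (snd (P ! a)) then adj zs (a, i, j) (a, i, Suc j) else adj zs (a, i, Suc j) (a, i, j)))"

definition pieces_ok :: "(nat \<times> bool \<times> tree list) list => bool" where
 "pieces_ok P \<longleftrightarrow> (\<forall>(m, k, w)\<in>set P. m \<ge> 1 & word_ok k w)"

text \<open>The arcs of the tour are the copies of pieces; each is replaced by the block of its
  elements, oriented for \<open>d\<close>. Consecutive blocks fit because \<open>outv\<close> and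
  \<open>inv\<close> name the same pair of labels; the start of the tour is the only copy with
  \<open>inv\<close> equal to \<open>Nl\<close>, so at every inner boundary there is such a
  pair.\<close>

lemma linear_order:
 assumes "pieces_ok P" and eu: "euler_ok d P"
 shows "\<exists>zs. linear P d zs"
proof -
 have ok: "\<And>m k w. (m, k, w) \<in> set P ==> word_ok k w" and m1: "\<And>m p. (m, p) \<in> set P ==> m \<ge> 1"
  using assms(1) by (auto simp: pieces_ok_def)
 define s where "s i = inv d (snd (P ! fst i))" for i :: "nat \<times> nat"
 define t where "t i = outv d (snd (P ! fst i))" for i :: "nat \<times> nat"
 let ?I = "insts P"
 have fin: "finite ?I"
 proof -
  have "?I = (SIGMA a:{..<length P}. {..<fst (P ! a)})" by (auto simp: insts_def)
  then show ?thesis by simp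
 qed
 have cs: "card {i \<in> ?I. Q (snd (P ! fst i))} = flow Q P" for Q
  unfolding card_inst[symmetric] by (rule arg_cong[of _ _ card]) (auto simp: insts_def)
 have bal: "card {i \<in> ?I. s i = v} = card {i \<in> ?I. t i = v}" for v
  using eu unfolding s_def t_def cs[of "%p. inv d p = v"] cs[of "%p. outv d p = v"] euler_ok_def by blast
 have reach: "(Nl, s i) \<in> ((%i. (s i, t i)) ` ?I)\<^sup>*" if "i \<in> ?I" for i
 proof -
  have sub: "(%p. (inv d p, outv d p)) ` snd ` set P \<subseteq> (%i. (s i, t i)) ` ?I"
  proof (rule image_subsetI)
   fix p assume "p \<in> snd ` set P"
   then obtain a where a: "a < length P" "p = snd (P ! a)" by (auto simp: in_set_conv_nth)
   have "(fst (P ! a), snd (P ! a)) \<in> set P" using a by simp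
   then have "(a, 0) \<in> ?I" using m1 a by (fastforce simp: insts_def)
   then show "(inv d p, outv d p) \<in> (%i. (s i, t i)) ` ?I"
    by (rule rev_image_eqI) (simp add: s_def t_def a)
  qed
  have "snd (P ! fst i) \<in> snd ` set P" using that by (auto simp: insts_def)
  then show ?thesis
   using eu rtrancl_mono[OF sub] unfolding euler_ok_def s_def by blast
 qed
 obtain p where p: "distinct p" "set p = ?I" "tour s t Nl p Nl"
  using euler_tour[OF fin bal reach] by blast
 have one: "card {i \<in> ?I. s i = Nl} = 1"
  using eu unfolding s_def cs[of "%p. inv d p = Nl"] euler_ok_def by blast
 then obtain i0 where i0: "{i \<in> ?I. s i = Nl} = {i0}" by (rule card_1_singletonE)
 then have "p ~= []" using p(2) by auto
 note links = tour_links[OF p(3)]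
 have hdp: "s (hd p) = Nl" "t (last p) = Nl" using links \<open>p ~= []\<close> by auto
 then have "hd p = i0" using i0 p(2) \<open>p ~= []\<close> hd_in_set[of p] by blast
 have suc: "successively (%i i'. t i = s i' & s i' ~= Nl) p"
  unfolding successively_conv_nth
 proof (intro allI impI)
  fix n assume n: "Suc n < length p"
  have "s (p ! Suc n) ~= Nl"
  proof
   assume "s (p ! Suc n) = Nl"
   then have "p ! Suc n = p ! 0"
    using i0 p(2) n nth_mem[OF n] \<open>hd p = i0\<close> hd_conv_nth[OF \<open>p ~= []\<close>] by auto
   then show False using nth_eq_iff_index_eq[OF p(1) n, of 0] \<open>p ~= []\<close> by simp
  qed
  then show "t (p ! n) = s (p ! Suc n) & s (p ! Suc n) ~= Nl"
   using links n by (simp add: successively_conv_nth)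
 qed
 define W where "W a = snd (snd (P ! a))" for a
 define kk where "kk a = fst (snd (P ! a))" for a
 define blk where "blk i = map (%j. (fst i, snd i, j)) (ori d (kk (fst i)) [0..<length (W (fst i))])" for i :: "nat \<times> nat"
 have wok: "word_ok (kk a) (W a)" if "(a, i) \<in> ?I" for a i
  using ok[of "fst (P ! a)" "kk a" "W a"] that by (simp add: insts_def kk_def W_def)
 have stt_blk: "map (stt P) (blk (a, i)) = ori d (kk a) (W a)" for a i
 proof -
  have "map (%j. W a ! j) [0..<length (W a)] = W a" by (rule map_nth)
  then show ?thesis by (auto simp: blk_def stt_def ori_def W_def comp_def simp flip: rev_map)
 qed
 have setblk: "set (blk (a, i)) = {a} \<times> {i} \<times> {..<length (W a)}" for a i
  by (auto simp: blk_def ori_def)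
 have nonempty: "blk i ~= []" if "i \<in> ?I" for i
 proof
  assume "blk i = []"
  then have "W (fst i) = []" by (simp add: blk_def ori_def split: if_splits)
  then show False using wok[of "fst i" "snd i"] that by (simp add: word_ok_def)
 qed
 have hdl: "stt P (hd (blk (a, i))) = hd (ori d (kk a) (W a))" "stt P (last (blk (a, i))) = last (ori d (kk a) (W a))"
  if "(a, i) \<in> ?I" for a i
  unfolding stt_blk[of a i, symmetric] using nonempty[OF that] by (simp_all add: hd_map last_map)
 have sucb: "successively (LK P d) (blk (a, i))" if "(a, i) \<in> ?I" for a i
 proof -
  have "successively (nx (kk a)) (W a)" using wok[OF that] by (simp add: word_ok_def)
  then have "successively (%s s'. nb (fwd d) s = th s' & nb (bwd d) s' = th s) (ori d (kk a) (W a))"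
   by (auto simp: ori_def nx_def fwd_def bwd_def elim!: successively_mono)
  then have "successively (%s s'. nb (fwd d) s = th s' & nb (bwd d) s' = th s) (map (stt P) (blk (a, i)))"
   unfolding stt_blk .
  then show ?thesis by (simp add: successively_map LK_def)
 qed
 define zs where "zs = concat (map blk p)"
 have dist: "distinct (concat (map blk q))" if "distinct q" for q
  using that
 proof (induction q)
  case (Cons i q)
  obtain a b where [simp]: "i = (a, b)" by (cases i)
  have "distinct (blk i)" by (auto simp: blk_def ori_def distinct_map inj_on_def)
  moreover have "set (blk i) \<inter> set (concat (map blk q)) = {}"
   using Cons.prems by (auto simp: setblk)
  ultimately show ?case using Cons by simp
 qed simp
 have "set zs = elts P"
 proof -
  have "set zs = (\<Union>i\<in>?I. set (blk i))" using p(2) by (simp add: zs_def)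
  also have "\<dots> = elts P" by (auto simp: setblk insts_def elts_def W_def)
  finally show ?thesis .
 qed
 moreover have "zs ~= []" using \<open>p ~= []\<close> p(2) nonempty by (cases p) (auto simp: zs_def)
 moreover have "successively (LK P d) zs"
  unfolding zs_def
 proof (rule successively_concat)
  show "b ~= [] & successively (LK P d) b" if "b \<in> set (map blk p)" for b
   using that p(2) nonempty sucb by auto
  show "successively (%b b'. LK P d (last b) (hd b')) (map blk p)"
   unfolding successively_map
  proof (rule successively_mono[OF suc])
   fix i i' assume I: "i \<in> set p" "i' \<in> set p" and eq: "t i = s i' & s i' ~= Nl"
   obtain a b where [simp]: "i = (a, b)" by (cases i)
   obtain a' b' where [simp]: "i' = (a', b')" by (cases i')
   have "outs d (last (ori d (kk a) (W a))) = ins d (hd (ori d (kk a') (W a')))"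
    "ins d (hd (ori d (kk a') (W a'))) ~= Nl"
    using eq by (simp_all add: t_def s_def outv_def inv_def kk_def W_def)
   then show "LK P d (last (blk i)) (hd (blk i'))"
    using hdl[of a b] hdl[of a' b'] I p(2) by (simp add: LK_def outs_def ins_def split: if_splits)
  qed
 qed
 moreover have "nb (bwd d) (stt P (hd zs)) = Nl"
 proof -
  obtain a b q where q: "p = (a, b) # q" using \<open>p ~= []\<close> by (cases p) auto
  have ab: "(a, b) \<in> ?I" using q p(2) by auto
  have "hd zs = hd (blk (a, b))" using nonempty[OF ab] by (simp add: zs_def q)
  moreover have "ins d (hd (ori d (kk a) (W a))) = Nl"
   using hdp(1) q by (simp add: s_def inv_def kk_def W_def)
  ultimately show ?thesis using hdl(1)[OF ab] by (simp add: ins_def split: if_splits)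
 qed
 moreover have "nb (fwd d) (stt P (last zs)) = Nl"
 proof -
  obtain a b q where q: "p = q @ [(a, b)]" using \<open>p ~= []\<close> by (cases p rule: rev_cases) auto
  have ab: "(a, b) \<in> ?I" using q p(2) by auto
  have "last zs = last (blk (a, b))" using nonempty[OF ab] by (simp add: zs_def q)
  moreover have "outs d (last (ori d (kk a) (W a))) = Nl"
   using hdp(2) q by (simp add: t_def outv_def kk_def W_def)
  ultimately show ?thesis using hdl(2)[OF ab] by (simp add: outs_def split: if_splits)
 qed
 moreover have "if d \<or> kk a then adj zs (a, i, j) (a, i, Suc j) else adj zs (a, i, Suc j) (a, i, j)"
  if I: "(a, i) \<in> ?I" and j: "Suc j < length (W a)" for a i j
 proof -
  obtain q q' where q: "p = q @ (a, i) # q'" using I p(2) by (metis split_list)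
  have zs: "zs = concat (map blk q) @ blk (a, i) @ concat (map blk q')" by (simp add: zs_def q)
  have "if d \<or> kk a then adj (blk (a, i)) (a, i, j) (a, i, Suc j) else adj (blk (a, i)) (a, i, Suc j) (a, i, j)"
   using nxt_ori[OF j, of d "kk a"] nxt_map[of _ _ _ "%j. (a, i, j)"] by (auto simp: blk_def split: if_splits)
  then show ?thesis unfolding zs using nxt_mid by (auto split: if_splits)
 qed
 ultimately have "linear P d zs"
  using dist[OF p(1)] unfolding linear_def zs_def[symmetric] kk_def W_def by simp
 then show ?thesis ..
qed

lemma linear_nb:
 assumes "linear P d zs" "e \<in> set zs"
 shows "adj zs e f ==> nb (fwd d) (stt P e) = th (stt P f) & nb (bwd d) (stt P f) = th (stt P e)"
  and "(\<And>f. \<not> adj zs e f) ==> nb (fwd d) (stt P e) = Nl"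
  and "(\<And>f. \<not> adj zs f e) ==> nb (bwd d) (stt P e) = Nl"
proof -
 show "nb (fwd d) (stt P e) = th (stt P f) & nb (bwd d) (stt P f) = th (stt P e)" if "adj zs e f"
  using that assms(1) unfolding adj_def linear_def successively_conv_nth LK_def by blast
 obtain i where i: "i < length zs" "zs ! i = e" using assms(2) by (auto simp: in_set_conv_nth)
 show "nb (fwd d) (stt P e) = Nl" if "\<And>f. \<not> adj zs e f"
 proof -
  have "Suc i = length zs"
   using that[of "zs ! Suc i"] i unfolding adj_def by (metis Suc_lessI)
  then have "last zs = e" using i by (metis diff_Suc_1 last_conv_nth list.size(3) not_less0)
  then show ?thesis using assms(1) by (simp add: linear_def)
 qed
 show "nb (bwd d) (stt P e) = Nl" if "\<And>f. \<not> adj zs f e"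
 proof -
  have "i = 0"
  proof (rule ccontr)
   assume "i ~= 0"
   then have "adj zs (zs ! (i - 1)) e" unfolding adj_def using i by (intro exI[of _ "i - 1"]) simp
   then show False using that by blast
  qed
  then have "hd zs = e" using i by (cases zs) auto
  then show ?thesis using assms(1) by (simp add: linear_def)
 qed
qed

text \<open>The two tours were chosen independently, so \<open>apart\<close> has to be shown for the
  assembled structure. If two directions at an element lead to the same label,
  \<open>star_ok\<close> fixes the kind, and maximality puts the element inside its piece on that
  side; the block then provides one and the same neighbour for both directions.\<close>

lemma assemble:
 assumes "pieces_ok P" and lin: "linear P True xs" "linear P False ys"
 shows "order_pair xs ys (%e. th (stt P e))" (is ?op)
  and "e \<in> elts P ==> order_pair.star xs ys (%e. th (stt P e)) e = stt P e"
proof -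
 let ?lab = "%e. th (stt P e)"
 have ok: "\<And>m k w. (m, k, w) \<in> set P ==> word_ok k w" using assms(1) by (auto simp: pieces_ok_def)
 have dx: "distinct xs" "set xs = elts P" "xs ~= []" and dy: "distinct ys" "set ys = elts P"
  using lin by (auto simp: linear_def)
 have sok: "star_ok (fst (snd (P ! a))) (stt P (a, i, j))" if "(a, i, j) \<in> elts P" for a i j
 proof -
  have "word_ok (fst (snd (P ! a))) (snd (snd (P ! a)))"
   using ok[of "fst (P ! a)"] that by (simp add: elts_def)
  then show ?thesis using that by (simp add: word_ok_def elts_def stt_def)
 qed
 have lab: "?lab e ~= Nl" if "e \<in> elts P" for e
  using sok that by (cases e) (simp add: star_ok_def)
 note l0 = linear_nb[OF lin(1), unfolded dx(2) fwd_def bwd_def if_True]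
 note l1 = linear_nb[OF lin(2), unfolded dy(2) fwd_def bwd_def if_False]
 have dre: "e \<in> elts P & f \<in> elts P" if "dr xs ys d e f" for d e f
  using that nxt_set[of xs e f] nxt_set[of ys e f] nxt_set[of xs f e] nxt_set[of ys f e] dx dy
  unfolding dr_def by (simp split: if_splits)
 have nbd: "nb d (stt P e) = ?lab f" if "dr xs ys d e f" for d e f
  using that dre[OF that] l0(1)[of e f] l0(1)[of f e] l1(1)[of e f] l1(1)[of f e]
  unfolding dr_def by (auto split: if_splits)
 have nbn: "nb d (stt P e) = Nl" if "e \<in> elts P" "d < 4" "\<And>f. \<not> dr xs ys d e f" for d e
  proof -
  have "d = 0 \<or> d = 1 \<or> d = 2 \<or> d = 3" using that(2) by arith
  then show ?thesis
   using that(3) l0(2,3)[OF that(1)] l1(2,3)[OF that(1)] by (elim disjE) (simp_all add: dr_def)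
 qed
 have fn: "f = g" if "dr xs ys d e f" "dr xs ys d e g" for d e f g
 proof -
  have "d = 0 \<or> d = 1 \<or> d = 2 \<or> d = 3" using that(1) by (auto simp: dr_def split: if_splits)
  then show ?thesis
   using that nxt_fun[OF dx(1), of e f g] nxt_fun[OF dy(1), of e f g] nxt_inj[OF dx(1), of f e g]
    nxt_inj[OF dy(1), of f e g]
   by (elim disjE) (simp_all add: dr_def)
 qed
 have ap: "f = g" if d: "dr xs ys d e f" "dr xs ys d' e g" and eq: "?lab f = ?lab g" and less: "d < d'" for d d' e f g
 proof -
  obtain a i j where e: "e = (a, i, j)" by (cases e)
  have el: "(a, i, j) \<in> elts P" "f \<in> elts P" using dre[OF d(1)] e by auto
  let ?s = "stt P e" and ?k = "fst (snd (P ! a))" and ?w = "snd (snd (P ! a))"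
  have s: "nb d ?s = nb d' ?s" "nb d ?s ~= Nl" using nbd[OF d(1)] nbd[OF d(2)] eq lab[OF el(2)] by auto
  have sk: "star_ok ?k ?s" using sok[OF el(1)] e by simp
  have w: "word_ok ?k ?w" using ok[of "fst (P ! a)"] el by (simp add: elts_def)
  have I: "(a, i) \<in> insts P" and j: "j < length ?w" using el by (auto simp: elts_def insts_def)
  have lst: "Suc j < length ?w" if "\<not> last_ok ?s"
  proof (rule ccontr)
   assume "\<not> Suc j < length ?w"
   then have "j = length ?w - 1" "?w ~= []" using j by auto
   then have "?s = last ?w" by (simp add: e stt_def last_conv_nth)
   then show False using that w by (simp add: word_ok_def)
  qed
  have fst: "j ~= 0" if "\<not> first_ok ?s"
  proof
   assume "j = 0"
   then have "?s = hd ?w" using j by (simp add: e stt_def hd_conv_nth)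
   then show False using that w by (simp add: word_ok_def)
  qed
  have nx: "adj xs (a, i, j) (a, i, Suc j)" "if ?k then adj ys (a, i, j) (a, i, Suc j) else adj ys (a, i, Suc j) (a, i, j)"
   if "Suc j < length ?w" for j
   using lin I that unfolding linear_def by auto
  have "d' < 4" using d(2) by (simp add: dr_def split: if_splits)
  then have "d = 0 & d' = 1 \<or> d = 0 & d' = 2 \<or> d = 0 & d' = 3 \<or> d = 1 & d' = 2 \<or> d = 1 & d' = 3 \<or> d = 2 & d' = 3"
   using less by arith
  then consider "d = 0" "d' = 1" | "d = 0" "d' = 2" | "d = 0" "d' = 3" | "d = 1" "d' = 2" | "d = 1" "d' = 3"
   | "d = 2" "d' = 3" by blast
  then show ?thesis
  proof cases
   case 1
   then show ?thesis using sk s by (simp add: star_ok_def same_def)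
  next
   case 6
   then show ?thesis using sk s by (simp add: star_ok_def same_def)
  next
   case 2
   then have "?k" "\<not> last_ok ?s" using sk s by (auto simp: star_ok_def same_def last_ok_def)
   then have "dr xs ys 0 e (a, i, Suc j)" "dr xs ys 2 e (a, i, Suc j)" using nx[OF lst] e by (auto simp: dr_def)
   then show ?thesis using fn d 2 by blast
  next
   case 3
   then have "\<not> ?k" "\<not> last_ok ?s" using sk s by (auto simp: star_ok_def same_def last_ok_def)
   then have "dr xs ys 0 e (a, i, Suc j)" "dr xs ys 3 e (a, i, Suc j)" using nx[OF lst] e by (auto simp: dr_def)
   then show ?thesis using fn d 3 by blast
  next
   case 4
   then have "\<not> ?k" "\<not> first_ok ?s" using sk s by (auto simp: star_ok_def same_def first_ok_def)
   then have "dr xs ys 1 e (a, i, j - 1)" "dr xs ys 2 e (a, i, j - 1)" using nx[of "j - 1"] fst j e by (auto simp: dr_def)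
   then show ?thesis using fn d 4 by blast
  next
   case 5
   then have "?k" "\<not> first_ok ?s" using sk s by (auto simp: star_ok_def same_def first_ok_def)
   then have "dr xs ys 1 e (a, i, j - 1)" "dr xs ys 3 e (a, i, j - 1)" using nx[of "j - 1"] fst j e by (auto simp: dr_def)
   then show ?thesis using fn d 5 by blast
  qed
 qed
 show op: ?op
 proof
  fix d d' e f g assume d: "dr xs ys d e f" "dr xs ys d' e g" and eq: "?lab f = ?lab g"
  show "f = g"
  proof (cases d d' rule: linorder_cases)
   case less
   then show ?thesis using ap[OF d eq] by blast
  next
   case equal
   then show ?thesis using fn d by blast
  next
   case greater
   then show ?thesis using ap[OF d(2,1) eq[symmetric]] by blast
  qed
 qed (use dx dy lab in auto)
 assume e: "e \<in> elts P"
 have nbl: "order_pair.nbl xs ys ?lab d e = nb d (stt P e)" if "d < 4" for d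
 proof (cases "\<exists>f. dr xs ys d e f")
  case True
  then obtain f where f: "dr xs ys d e f" ..
  show ?thesis using order_pair.nbl_I[OF op f] nbd[OF f] by simp
 next
  case False
  then have "nb d (stt P e) = Nl" by (intro nbn[OF e that]) blast
  then show ?thesis unfolding order_pair.nbl_def[OF op] if_not_P[OF False] by simp
 qed
 have "star_ok (fst (snd (P ! fst e))) (stt P e)" using sok e by (cases e) simp
 then show "order_pair.star xs ys ?lab e = stt P e"
  unfolding order_pair.star_def[OF op] star_ok_def using nbl by simp
qed

definition labels :: "(nat \<times> bool \<times> tree list) list => tree set" where
 "labels P = {th s | s m k w. (m, k, w) \<in> set P & s \<in> set w}"

text \<open>The labels that occur and those that occur once are computed from the pieces with their
  multiplicities, so \<open>qc\<close> for the assembled structure becomes a condition on the list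
  \<open>P\<close>.\<close>

theorem certificate_sound:
 assumes ok: "pieces_ok P"
  and eu: "\<And>d. euler_ok d P"
  and q: "\<And>m k w s b a \<psi> r. (m, k, w) \<in> set P ==> s \<in> set w ==> (b, a, \<psi>, r) \<in> occ \<phi> Nl ==>
   U (tk (Qf b a \<psi>) r) (th s) \<longleftrightarrow>
    qval b (view (labels P) {t. tot P t = 1} s) (%t r'. evf \<psi> r (env a (th s) t r'))"
  and cl: "closed_fm \<phi>" and l: "l \<in> labels P" "evf \<phi> Nl (Cn l (Cn l r0))"
 shows "satisfiable \<phi>"
proof -
 obtain xs where xs: "linear P True xs" using linear_order[OF ok eu] by blast
 obtain ys where ys: "linear P False ys" using linear_order[OF ok eu] by blast
 let ?lab = "%e. th (stt P e)"
 interpret order_pair xs ys ?lab by (rule assemble[OF ok xs ys])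
 have star: "star e = stt P e" if "e \<in> elts P" for e using assemble(2)[OF ok xs ys that] .
 have set: "set xs = elts P" using xs by (simp add: linear_def)
 have el: "\<exists>m k w. (m, k, w) \<in> set P & stt P e \<in> set w" if "e \<in> elts P" for e
  using that by (cases e) (auto simp: elts_def stt_def intro!: exI[of _ "fst (P ! fst e)"]
    exI[of _ "fst (snd (P ! fst e))"] exI[of _ "snd (snd (P ! fst e))"])
 have T: "?lab ` set xs = labels P"
 proof (intro set_eqI iffI)
  fix t assume "t \<in> ?lab ` set xs"
  then show "t \<in> labels P" using el set unfolding labels_def by blast
 next
  fix t assume "t \<in> labels P"
  then obtain s m k w where s: "t = th s" "(m, k, w) \<in> set P" "s \<in> set w" unfolding labels_def by blast
  then obtain a j where a: "a < length P" "P ! a = (m, k, w)" "j < length w" "w ! j = s"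
   by (metis in_set_conv_nth)
  then have "(a, 0, j) \<in> elts P" using ok s(2) by (auto simp: elts_def pieces_ok_def)
  moreover have "stt P (a, 0, j) = s" using a by (simp add: stt_def)
  ultimately show "t \<in> ?lab ` set xs" using s(1) set by force
 qed
 have K: "{t. card {f \<in> set xs. ?lab f = t} = 1} = {t. tot P t = 1}"
  unfolding set card_tot ..
 have "qc \<phi> Nl"
  unfolding qc_def T K
 proof (intro ballI, clarify)
  fix e b a \<psi> r assume e: "e \<in> set xs" "(b, a, \<psi>, r) \<in> occ \<phi> Nl"
  then obtain m k w where "(m, k, w) \<in> set P" "stt P e \<in> set w" using el set by blast
  from q[OF this e(2)] show "U (tk (Qf b a \<psi>) r) (?lab e) \<longleftrightarrow>
    qval b (view (labels P) {t. tot P t = 1} (star e)) (%t r'. evf \<psi> r (env a (?lab e) t r'))"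
   using star e set by simp
 qed
 moreover have "l \<in> ?lab ` set xs" unfolding T by (rule l(1))
 then obtain e where "e \<in> set xs" "?lab e = l" by (elim imageE) simp
 ultimately show ?thesis using qc_models[of \<phi> Nl e] cl l(2) by simp
qed

section \<open>Decomposition into pieces\<close>

lemma runs:
 "\<exists>rs. concat rs = l & (\<forall>r\<in>set rs. r ~= [] & successively D r) & successively (%r r'. \<not> D (last r) (hd r')) rs"
proof (induction l)
 case Nil
 show ?case by (intro exI[of _ "[]"]) simp
next
 case (Cons a l)
 then obtain rs where rs: "concat rs = l" "\<forall>r\<in>set rs. r ~= [] & successively D r"
  "successively (%r r'. \<not> D (last r) (hd r')) rs" by blast
 show ?case
 proof (cases rs)
  case Nil
  then show ?thesis using rs by (intro exI[of _ "[[a]]"]) simp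
 next
  case (Cons r rs')
  show ?thesis
  proof (cases "D a (hd r)")
   case True
   then show ?thesis using rs Cons
    by (intro exI[of _ "(a # r) # rs'"]) (auto simp: successively_Cons)
  next
   case False
   then show ?thesis using rs Cons by (intro exI[of _ "[a] # rs"]) (auto simp: successively_Cons)
  qed
 qed
qed

lemma nxt_append:
 assumes "adj (a @ b) e f"
 shows "adj a e f \<or> adj b e f \<or> (a ~= [] & b ~= [] & e = last a & f = hd b)"
proof -
 obtain i where i: "Suc i < length (a @ b)" "(a @ b) ! i = e" "(a @ b) ! Suc i = f" using assms unfolding adj_def by blast
 consider "Suc i < length a" | "Suc i = length a" | "length a \<le> i" by linarith
 then show ?thesis
 proof cases
  case 1
  then have "adj a e f" unfolding adj_def using i by (intro exI[of _ i]) (simp add: nth_append)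
  then show ?thesis ..
 next
  case 2
  then have "a ~= []" by auto
  moreover have "b ~= []" "e = a ! (length a - 1)" "f = b ! 0"
   using i by (auto simp: nth_append simp flip: 2)
  ultimately show ?thesis by (simp add: last_conv_nth hd_conv_nth)
 next
  case 3
  then have "adj b e f" unfolding adj_def using i by (intro exI[of _ "i - length a"]) (auto simp: nth_append Suc_diff_le)
  then show ?thesis by blast
 qed
qed

lemma nxt_concat:
 "adj (concat rs) e f ==> \<forall>r\<in>set rs. r ~= [] ==>
  (\<exists>r\<in>set rs. adj r e f) \<or> (\<exists>r r'. adj rs r r' & e = last r & f = hd r')"
proof (induction rs)
 case Nil
 then show ?case by (simp add: adj_def)
next
 case (Cons r rs)
 have lift: "adj (r # rs) a b" if "adj rs a b" for a b
  using nxt_mid[OF that, of "[r]" "[]"] by simp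
 from nxt_append[of r "concat rs" e f] Cons.prems(1)
 consider "adj r e f" | "adj (concat rs) e f" | "concat rs ~= []" "e = last r" "f = hd (concat rs)" by auto
 then show ?case
 proof cases
  case 1
  then show ?thesis by simp
 next
  case 2
  then show ?thesis using Cons.IH Cons.prems(2) lift by (metis list.set_intros(2))
 next
  case 3
  then obtain r' rs' where rs: "rs = r' # rs'" by (cases rs) auto
  then have "f = hd r'" using 3 Cons.prems(2) by simp
  moreover have "adj (r # rs) r r'" unfolding rs adj_def by (intro exI[of _ 0]) simp
  ultimately show ?thesis using 3 by blast
 qed
qed

lemma succ_nxt: "successively R l ==> adj l a b ==> R a b"
 unfolding successively_conv_nth adj_def by blast

lemma nxt_succ: "(\<And>a b. adj l a b ==> R a b) ==> successively R l"
 unfolding successively_conv_nth adj_def by blast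

lemma nxt_split: "adj l a b ==> \<exists>us vs. l = us @ a # b # vs"
proof -
 assume "adj l a b"
 then obtain i where i: "Suc i < length l" "l ! i = a" "l ! Suc i = b" by (auto simp: adj_def)
 have "l = take i l @ l ! i # drop (Suc i) l" using i by (intro id_take_nth_drop) simp
 moreover have "drop (Suc i) l = l ! Suc i # drop (Suc (Suc i)) l" using Cons_nth_drop_Suc[OF i(1)] by (rule HOL.sym)
 ultimately show ?thesis using i by metis
qed

lemma nxt_I: "adj (us @ a # b # vs) a b"
 unfolding adj_def by (intro exI[of _ "length us"]) (simp add: nth_append)

lemma succ_sublist:
 assumes "distinct zs"
 shows "c ~= [] ==> set c \<subseteq> set zs ==> successively (adj zs) c ==> \<exists>us vs. zs = us @ c @ vs"
proof (induction c)
 case (Cons e c)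
 show ?case
 proof (cases c)
  case Nil
  then show ?thesis using split_list[of e zs] Cons.prems by auto
 next
  case (Cons f c')
  have "\<exists>us vs. zs = us @ c @ vs" using Cons.IH Cons.prems Cons by (simp add: successively_Cons)
  then obtain us vs where zs: "zs = us @ c @ vs" by blast
  have n: "adj zs e f" using Cons.prems Cons by (simp add: successively_Cons)
  have "zs ! length us = f" using zs Cons by simp
  then have "pos zs f = length us" using pos_nth[OF assms, of "length us"] zs Cons by simp
  then have pe: "length us = Suc (pos zs e)" "e \<in> set zs" using n nxt_pos[OF assms] by auto
  then have "us ~= []" "zs ! (length us - 1) = e" using nth_pos[OF assms, of e] by auto
  then have "last us = e" using zs by (simp add: last_conv_nth nth_append)
  then obtain us' where "us = us' @ [e]" using \<open>us ~= []\<close> by (cases us rule: rev_cases) auto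
  then have "zs = us' @ (e # c) @ vs" using zs by simp
  then show ?thesis by blast
 qed
qed simp

text \<open>The runs are defined along \<open>xs\<close>; this serves to cut \<open>ys\<close> into
  the same blocks. Blocks are contiguous in \<open>zs\<close> and pairwise equal or disjoint, so the
  block of the first element can be split off and the rest treated in the same way.\<close>

lemma chop:
 assumes "distinct zs" "\<And>e. e \<in> set zs ==> e \<in> set (g (och e)) & (\<exists>us vs. zs = us @ g (och e) @ vs) &
  (\<forall>f\<in>set (g (och e)). och f = och e)"
 shows "\<exists>qs. concat (map g qs) = zs & set qs = och ` set zs & distinct qs"
 using assms
proof (induction "length zs" arbitrary: zs rule: less_induct)
 case less
 note d = less.prems(1)
 show ?case
 proof (cases zs)
  case Nil
  then show ?thesis by (intro exI[of _ "[]"]) simp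
 next
  case (Cons e zs')
  let ?c = "g (och e)"
  have e: "e \<in> set zs" using Cons by simp
  note ee = conjunct1[OF less.prems(2)[OF e]] conjunct2[OF conjunct2[OF less.prems(2)[OF e]]]
  obtain us vs where uv: "zs = us @ ?c @ vs" using less.prems(2)[OF e] by blast
  have "us = []"
  proof (cases us)
   case (Cons u us')
   then have "u = e" using uv \<open>zs = e # zs'\<close> by simp
   then have "e \<in> set us" using Cons by simp
   moreover have "distinct (us @ ?c @ vs)" using d uv by simp
   ultimately show ?thesis using ee(1) by (simp add: disjoint_iff)
  qed
  then have zs: "zs = ?c @ vs" using uv by simp
  have cne: "?c ~= []" using ee(1) by auto
  have och: "och f ~= och e" if f: "f \<in> set vs" for f
  proof
   assume "och f = och e"
   moreover have "f \<in> set zs" using f zs by simp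
   then have "f \<in> set (g (och f))" by (rule conjunct1[OF less.prems(2)])
   moreover have "distinct (?c @ vs)" using d zs by simp
   ultimately show False using f by (simp add: disjoint_iff)
  qed
  have "\<exists>qs. concat (map g qs) = vs & set qs = och ` set vs & distinct qs"
  proof (rule less.hyps)
   show "length vs < length zs" using zs cne by simp
   show "distinct vs" using d zs by simp
   fix f assume f: "f \<in> set vs"
   then have fz: "f \<in> set zs" using zs by simp
   note ff0 = less.prems(2)[OF fz]
   note ff = conjunct1[OF ff0] conjunct2[OF conjunct2[OF ff0]]
   obtain us' vs' where uv': "zs = us' @ g (och f) @ vs'" using ff0 by blast
   have dis: "x \<notin> set ?c" if "x \<in> set (g (och f))" for x
   proof
    assume "x \<in> set ?c"
    then have "och x = och e" using ee(2) by blast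
    then show False using bspec[OF ff(2) that] och[OF f] by simp
   qed
   have "?c @ vs = us' @ g (och f) @ vs'" using zs uv' by simp
   then consider w where "?c = us' @ w" "w @ vs = g (och f) @ vs'" | w where "vs = w @ g (och f) @ vs'"
    unfolding append_eq_append_conv2 by blast
   then have "\<exists>us vs'. vs = us @ g (och f) @ vs'"
   proof cases
    case 1
    have "w = []"
    proof (rule ccontr)
     assume "w ~= []"
     have gf: "g (och f) ~= []" using ff(1) by auto
     then have "hd w = hd (g (och f))" using 1(2) \<open>w ~= []\<close> by (metis hd_append2)
     then show False using dis[of "hd w"] gf 1(1) hd_in_set[OF \<open>w ~= []\<close>] by simp
    qed
    then show ?thesis using 1 by (intro exI[of _ "[]"] exI[of _ vs']) simp
   qed blast
   then show "f \<in> set (g (och f)) & (\<exists>us vs'. vs = us @ g (och f) @ vs') & (\<forall>x\<in>set (g (och f)). och x = och f)"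
    by (intro conjI ff)
  qed
  then obtain qs where qs: "concat (map g qs) = vs" "set qs = och ` set vs" "distinct qs" by blast
  have "och ` set ?c = {och e}"
  proof
   show "och ` set ?c \<subseteq> {och e}" using ee(2) by (intro image_subsetI) blast
   show "{och e} \<subseteq> och ` set ?c" using ee(1) by simp
  qed
  then have "och ` set zs = insert (och e) (och ` set vs)"
   unfolding zs set_append image_Un by simp
  moreover have "och e \<notin> set qs" unfolding qs(2) using och by (metis imageE)
  ultimately show ?thesis using qs zs by (intro exI[of _ "och e # qs"]) simp
 qed
qed

section \<open>Shortening pieces\<close>

text \<open>In a shortest sequence with the required properties two places with the same value of
  \<open>f\<close> are separated by an element of \<open>M\<close> after the first and up to the
  second, as otherwise that stretch could be cut out. So the value of \<open>f\<close> and the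
  number of elements of \<open>M\<close> met so far determine the place.\<close>

lemma shorten:
 fixes f :: "'e => 's"
 assumes "r ~= []" "distinct r" "successively (%a b. R (f a) (f b)) r"
 shows "\<exists>r'. r' ~= [] & distinct r' & set r' \<subseteq> set r & f (hd r') = f (hd r) & f (last r') = f (last r) &
  successively (%a b. R (f a) (f b)) r' & M \<inter> set r \<subseteq> set r' & length r' \<le> card (f ` set r) * (card (M \<inter> set r) + 1)"
proof -
 let ?ok = "%r'. r' ~= [] & distinct r' & set r' \<subseteq> set r & f (hd r') = f (hd r) & f (last r') = f (last r) &
  successively (%a b. R (f a) (f b)) r' & M \<inter> set r \<subseteq> set r'"
 have "?ok r" using assms by auto
 then obtain q where q: "?ok q" and least: "\<And>q'. ?ok q' ==> length q \<le> length q'"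
  using ex_has_least_nat[of ?ok r length] by blast
 define F where "F i = (f (q ! i), card (M \<inter> set (take (Suc i) q)))" for i
 have "F i ~= F j" if ij: "i < j" "j < length q" for i j
 proof
  assume eq: "F i = F j"
  have sub: "M \<inter> set (take (Suc i) q) \<subseteq> M \<inter> set (take (Suc j) q)"
   using set_take_subset_set_take[of "Suc i" "Suc j" q] ij by auto
  have eqM: "M \<inter> set (take (Suc i) q) = M \<inter> set (take (Suc j) q)"
   using eq by (intro card_subset_eq sub) (auto simp: F_def)
  let ?q = "take (Suc i) q @ drop (Suc j) q"
  have dec: "q = take (Suc j) q @ drop (Suc j) q" by simp
  have M: "M \<inter> set q \<subseteq> set ?q"
  proof
   fix x assume x: "x \<in> M \<inter> set q"
   have "set q = set (take (Suc j) q) \<union> set (drop (Suc j) q)" by (metis append_take_drop_id set_append)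
   then show "x \<in> set ?q" using x eqM by auto
  qed
  have setq: "set ?q \<subseteq> set q" using set_take_subset[of "Suc i" q] set_drop_subset[of "Suc j" q] by auto
  have len: "length ?q < length q" using ij by simp
  have fij: "f (q ! i) = f (q ! j)" using eq by (simp add: F_def)
  have lt: "last (take (Suc i) q) = q ! i" using ij by (simp add: take_Suc_conv_app_nth)
  have tne: "take (Suc i) q ~= []" using q by simp
  have okq: "?ok ?q"
  proof (intro conjI)
   show "?q ~= []" using tne by simp
   have "distinct (take (Suc j) q @ drop (Suc j) q)" using q by simp
   moreover have "set (take (Suc i) q) \<subseteq> set (take (Suc j) q)"
    using set_take_subset_set_take[of "Suc i" "Suc j" q] ij by simp
   moreover have "distinct (take (Suc i) q)" using q by simp
   ultimately show "distinct ?q" unfolding distinct_append by blast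
   show "set ?q \<subseteq> set r" using setq q by blast
   have "hd ?q = hd q" using q by (cases q) auto
   then show "f (hd ?q) = f (hd r)" using q by simp
   show "M \<inter> set r \<subseteq> set ?q" using M q by blast
   show "f (last ?q) = f (last r)"
   proof (cases "drop (Suc j) q = []")
    case True
    then have "j = length q - 1" using ij by simp
    then have "last q = q ! j" using q by (simp add: last_conv_nth)
    then show ?thesis using True lt fij q by simp
   next
    case False
    then have "last ?q = last q" using dec by (metis last_append)
    then show ?thesis using q by simp
   qed
   show "successively (%a b. R (f a) (f b)) ?q"
   proof -
    have s: "successively (%a b. R (f a) (f b)) (take (Suc j) q @ drop (Suc j) q)" using q by simp
    have s': "successively (%a b. R (f a) (f b)) (take (Suc i) q @ drop (Suc i) q)" using q by simp
    have "last (take (Suc j) q) = q ! j" using ij by (simp add: take_Suc_conv_app_nth)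
    then show ?thesis using conjunct1[OF s'[unfolded successively_append_iff]]
      s[unfolded successively_append_iff] lt fij q by (simp add: successively_append_iff)
   qed
  qed
  show False using least[OF okq] len by simp
 qed
 then have "inj_on F {..<length q}" by (intro linorder_inj_onI) auto
 then have "card {..<length q} = card (F ` {..<length q})" by (rule card_image[symmetric])
 also have "\<dots> \<le> card (f ` set r \<times> {..card (M \<inter> set r)})"
 proof (rule card_mono)
  show "F ` {..<length q} \<subseteq> f ` set r \<times> {..card (M \<inter> set r)}"
  proof (rule image_subsetI)
   fix i assume i: "i \<in> {..<length q}"
   then have "q ! i \<in> set r" using q nth_mem by blast
   moreover have "card (M \<inter> set (take (Suc i) q)) \<le> card (M \<inter> set r)"
    using q set_take_subset[of "Suc i" q] by (intro card_mono) auto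
   ultimately show "F i \<in> f ` set r \<times> {..card (M \<inter> set r)}" by (simp add: F_def)
  qed
 qed simp
 finally have "length q \<le> card (f ` set r) * (card (M \<inter> set r) + 1)" by (simp add: card_cartesian_product)
 then show ?thesis using q by blast
qed

section \<open>Counting\<close>

lemma sum_min2:
 fixes f g :: "'p => nat"
 assumes "finite S" "\<And>p. p \<in> S ==> min (f p) 2 \<le> g p & g p \<le> f p"
 shows "min (sum f S) 2 \<le> sum g S & sum g S \<le> sum f S"
 using assms
proof (induction S)
 case (insert p S)
 have "min (sum f S) 2 \<le> sum g S & sum g S \<le> sum f S" using insert by simp
 moreover have "min (f p) 2 \<le> g p & g p \<le> f p" using insert by simp
 ultimately show ?case using insert.hyps by (auto simp: min_def split: if_splits)
qed simp

lemma sum_fibres: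
 fixes h :: "'p => nat"
 assumes "finite R"
 shows "(\<Sum>r\<in>R. h (c r)) = (\<Sum>p\<in>c ` R. card {r \<in> R. c r = p} * h p)"
proof -
 have "(\<Sum>r\<in>R. h (c r)) = (\<Sum>p\<in>c ` R. \<Sum>r\<in>{r. r \<in> R & c r = p}. h (c r))"
  by (rule sum.image_gen[OF assms])
 also have "\<dots> = (\<Sum>p\<in>c ` R. card {r \<in> R. c r = p} * h p)" by (rule sum.cong) auto
 finally show ?thesis .
qed

section \<open>Balance along a path, and reachability by a listing\<close>

lemma path_count:
 assumes "L ~= []" "successively (%r r'. ou r = i r') L"
 shows "length (filter (%r. ou r = v) L) + (if i (hd L) = v then 1 else 0) =
  length (filter (%r. i r = v) L) + (if ou (last L) = v then 1 else 0)"
 using assms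
proof (induction L)
 case (Cons r L)
 then show ?case by (cases L) (auto simp: successively_Cons split: if_splits)
qed simp

text \<open>Reachability from \<open>Nl\<close> in a form that can be checked in polynomial time:
  each entry starts at \<open>Nl\<close> or where an entry further to the right ends. Listing the
  pieces of a tour backwards gives such a list.\<close>

fun rooted :: "bool => (bool \<times> tree list) list => bool" where
 "rooted d [] \<longleftrightarrow> True"
| "rooted d (p # L) \<longleftrightarrow> (inv d p = Nl \<or> (\<exists>q\<in>set L. outv d q = inv d p)) & rooted d L"

lemma good_remdups: "rooted d L ==> rooted d (remdups L)"
 by (induction L) auto

lemma good_rev:
 assumes "L ~= []" "inv d (c (hd L)) = Nl" "successively (%r r'. outv d (c r) = inv d (c r')) L"
 shows "rooted d (rev (map c L))"
 using assms
proof (induction L rule: rev_induct)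
 case (snoc r L)
 show ?case
 proof (cases "L = []")
  case False
  then have "rooted d (rev (map c L))" using snoc by (simp add: successively_append_iff)
  moreover have "outv d (c (last L)) = inv d (c r)" using snoc.prems False by (simp add: successively_append_iff)
  moreover have "c (last L) \<in> c ` set L" using False by simp
  ultimately show ?thesis by (auto intro: bexI[of _ "c (last L)"])
 qed (use snoc in simp)
qed simp

lemma good_reach: "rooted d L ==> p \<in> set L ==> (Nl, inv d p) \<in> ((%p. (inv d p, outv d p)) ` set L)\<^sup>*"
proof (induction L arbitrary: p)
 case (Cons a L)
 let ?E = "%L. (%p. (inv d p, outv d p)) ` set L"
 have mono: "(?E L)\<^sup>* \<subseteq> (?E (a # L))\<^sup>*" by (rule rtrancl_mono) auto
 have IH: "(Nl, inv d q) \<in> (?E (a # L))\<^sup>*" if "q \<in> set L" for q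
  by (rule subsetD[OF mono Cons.IH]) (use Cons.prems that in simp_all)
 show ?case
 proof (cases "p \<in> set L")
  case False
  then have "p = a" using Cons.prems by simp
  then consider "inv d p = Nl" | q where "q \<in> set L" "outv d q = inv d p" using Cons.prems by auto
  then show ?thesis
  proof cases
   case 2
   then have "(inv d q, inv d p) \<in> ?E (a # L)" by (auto intro!: image_eqI[of _ _ q])
   then show ?thesis using IH[OF 2(1)] by (rule rtrancl_into_rtrancl[rotated])
  qed simp
 qed (rule IH)
qed simp

definition flow_ok :: "bool => (nat \<times> bool \<times> tree list) list => bool" where
 "flow_ok d P \<longleftrightarrow> (\<forall>v. flow (%p. inv d p = v) P = flow (%p. outv d p = v) P) & flow (%p. inv d p = Nl) P = 1"

lemma euler_ok_I: "flow_ok d P ==> rooted d L ==> set L = snd ` set P ==> euler_ok d P"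
 unfolding euler_ok_def flow_ok_def using good_reach[of d L] by metis

section \<open>Runs of elements adjacent in both orders\<close>

context order_pair
begin

definition dbl :: "'e => 'e => bool" where
 "dbl e f \<longleftrightarrow> adj ys e f \<or> adj ys f e"

definition rs :: "'e list list" where
 "rs = (SOME rs. concat rs = xs & (\<forall>r\<in>set rs. r ~= [] & successively dbl r) &
   successively (%r r'. \<not> dbl (last r) (hd r')) rs)"

lemma rs: "concat rs = xs" "\<And>r. r \<in> set rs ==> r ~= [] & successively dbl r"
 "successively (%r r'. \<not> dbl (last r) (hd r')) rs"
 using someI_ex[OF runs[of xs dbl], folded rs_def] by blast+

lemma set_rs: "set xs = (\<Union>r\<in>set rs. set r)"
 using arg_cong[OF rs(1), of set] by simp

lemma dist_rs: "distinct rs" "r \<in> set rs ==> distinct r"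
 "r \<in> set rs ==> r' \<in> set rs ==> e \<in> set r ==> e \<in> set r' ==> r = r'"
proof -
 have d: "distinct (concat rs)" unfolding rs(1) by (rule dx)
 have "removeAll [] rs = rs" using rs(2) by (intro removeAll_id) blast
 then show "distinct rs" using d by (simp add: distinct_concat_iff)
 show "distinct r" if "r \<in> set rs" using d that by (simp add: distinct_concat_iff)
 show "r = r'" if "r \<in> set rs" "r' \<in> set rs" "e \<in> set r" "e \<in> set r'"
  using d that unfolding distinct_concat_iff by blast
qed

lemma run_sub: "r \<in> set rs ==> set r \<subseteq> set xs"
 using set_rs by blast

lemma irr: "\<not> adj xs e e" "\<not> adj ys e e" "adj xs e f ==> \<not> adj xs f e" "adj ys e f ==> \<not> adj ys f e"
 by (auto simp: nxt_pos[OF dx] nxt_pos[OF dy])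

lemma run_step:
 assumes "adj xs e f" "dbl e f" "r \<in> set rs" "e \<in> set r \<or> f \<in> set r"
 shows "adj r e f"
proof -
 have "(\<exists>r\<in>set rs. adj r e f) \<or> (\<exists>r r'. adj rs r r' & e = last r & f = hd r')"
  using nxt_concat[of rs e f] assms(1) rs(1,2) by simp
 then show ?thesis
 proof
  assume "\<exists>r\<in>set rs. adj r e f"
  then obtain r' where r': "r' \<in> set rs" "adj r' e f" by blast
  then have "r = r'" using dist_rs(3)[OF assms(3) r'(1)] assms(4) nxt_set[OF r'(2)] by blast
  then show ?thesis using r' by simp
 next
  assume "\<exists>r r'. adj rs r r' & e = last r & f = hd r'"
  then obtain r r' where "adj rs r r'" "e = last r" "f = hd r'" by blast
  then show ?thesis using succ_nxt[OF rs(3)] assms(2) by blast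
 qed
qed

lemma run_nxt:
 assumes "r \<in> set rs" "adj r e f"
 shows "adj xs e f"
proof -
 obtain us vs where "rs = us @ r # vs" using split_list[OF assms(1)] by blast
 then have "xs = concat us @ r @ concat vs" using rs(1) by simp
 then show ?thesis using nxt_mid[OF assms(2)] by simp
qed

definition kd :: "'e list => bool" where
 "kd r \<longleftrightarrow> successively (adj ys) r"

text \<open>The sense in which \<open>ys\<close> follows a run cannot change inside it: otherwise
  the element at the turn would have two different successors or two different predecessors in
  \<open>ys\<close>.\<close>

lemma mono_run:
 "distinct r ==> successively dbl r ==> successively (adj ys) r \<or> successively (%e f. adj ys f e) r"
proof (induction r)
 case (Cons a r)
 show ?case
 proof (cases r)
  case Nil
  then show ?thesis by simp
 next
  case (Cons b r')
  have IH: "successively (adj ys) r \<or> successively (%e f. adj ys f e) r" and d: "dbl a b"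
   using Cons.IH Cons.prems \<open>r = b # r'\<close> by simp_all
  show ?thesis
  proof (cases r')
   case Nil
   then show ?thesis using d Cons by (auto simp: dbl_def)
  next
   case (Cons c r'')
   have ac: "a ~= c" using Cons.prems \<open>r = b # r'\<close> Cons by simp
   from IH show ?thesis
   proof
    assume s: "successively (adj ys) r"
    then have "adj ys b c" using Cons \<open>r = b # r'\<close> by simp
    then have "\<not> adj ys b a" using nxt_fun[OF dy] ac by blast
    then show ?thesis using d s \<open>r = b # r'\<close> by (simp add: dbl_def)
   next
    assume s: "successively (%e f. adj ys f e) r"
    then have "adj ys c b" using Cons \<open>r = b # r'\<close> by simp
    then have "\<not> adj ys a b" using nxt_inj[OF dy] ac by blast
    then show ?thesis using d s \<open>r = b # r'\<close> by (simp add: dbl_def)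
   qed
  qed
 qed
qed simp

lemma run_kind: "r \<in> set rs ==> \<not> kd r ==> successively (%e f. adj ys f e) r"
 using mono_run[OF dist_rs(2)] rs(2) unfolding kd_def by blast

definition pc :: "'e list => bool \<times> tree list" where
 "pc r = (kd r, map star r)"

lemma nbl_nxt:
 "adj xs e f ==> nbl 0 e = lab f & nbl 1 f = lab e"
 "adj ys e f ==> nbl 2 e = lab f & nbl 3 f = lab e"
 using nbl_I[of 0 e f] nbl_I[of 1 f e] nbl_I[of 2 e f] nbl_I[of 3 f e] by (simp_all add: dr_def)

lemma same_nbl: "same (nbl d e) (nbl d' e) ==> \<exists>f. dr xs ys d e f & dr xs ys d' e f"
proof -
 assume s: "same (nbl d e) (nbl d' e)"
 then obtain f where f: "dr xs ys d e f" "lab f = nbl d e" using nbl_D[of d e] unfolding same_def by blast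
 have "nbl d' e = lab f" using s f by (simp add: same_def)
 then have "dr xs ys d' e f" using dr_iff[OF f(1)] by blast
 then show ?thesis using f by blast
qed

lemma nx_star: "adj xs e f ==> (if k then adj ys e f else adj ys f e) ==> nx k (star e) (star f)"
 using nbl_nxt(1)[of e f] nbl_nxt(2)[of e f] nbl_nxt(2)[of f e] unfolding nx_def by (auto split: if_splits)

lemma ncons: "adj r e f ==> distinct r ==> e ~= last r & f ~= hd r"
proof -
 assume n: "adj r e f" and d: "distinct r"
 then obtain us vs where r: "r = us @ e # f # vs" using nxt_split by fast
 have "last r = last (f # vs)" unfolding r by simp
 moreover have "last (f # vs) \<in> set (f # vs)" by (rule last_in_set) simp
 moreover have "hd r \<in> set (us @ [e])" unfolding r by (cases us) auto
 ultimately show ?thesis using d unfolding r by auto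
qed

text \<open>A coincidence of neighbours at an element is a link common to both orders; by maximality
  of runs it lies inside the run and so respects its kind.\<close>

lemma word_ok_run:
 assumes r: "r \<in> set rs"
 shows "word_ok (kd r) (map star r)"
proof -
 have d: "distinct r" and ne: "r ~= []" using dist_rs(2) rs(2) r by auto
 have k: "if kd r then adj ys e f else adj ys f e" if "adj r e f" for e f
 proof (cases "kd r")
  case True
  then have "adj ys e f" unfolding kd_def using that by (rule succ_nxt)
  then show ?thesis using True by simp
 next
  case False
  then show ?thesis using succ_nxt[OF run_kind[OF r False] that] by simp
 qed
 have "successively (nx (kd r)) (map star r)"
  unfolding successively_map
  by (rule nxt_succ) (rule nx_star[OF run_nxt[OF r] k])
 moreover have "star_ok (kd r) (star e)" if e: "e \<in> set r" for e
 proof -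
  have step: "adj r a b" if "adj xs a b" "dbl a b" "a = e \<or> b = e" for a b
   using run_step[OF that(1,2) r] that(3) e by blast
  have "kd r" if s: "same (nbl 0 e) (nbl 2 e)"
  proof -
   obtain f where "adj xs e f" "adj ys e f" using same_nbl[OF s] by (auto simp: dr_def)
   then have "adj r e f" using step[of e f] by (simp add: dbl_def)
   then show ?thesis using k \<open>adj ys e f\<close> irr(4) by (metis (full_types))
  qed
  moreover have "kd r" if s: "same (nbl 1 e) (nbl 3 e)"
  proof -
   obtain f where "adj xs f e" "adj ys f e" using same_nbl[OF s] by (auto simp: dr_def)
   then have "adj r f e" using step[of f e] by (simp add: dbl_def)
   then show ?thesis using k \<open>adj ys f e\<close> irr(4) by (metis (full_types))
  qed
  moreover have "\<not> kd r" if s: "same (nbl 0 e) (nbl 3 e)"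
  proof -
   obtain f where "adj xs e f" "adj ys f e" using same_nbl[OF s] by (auto simp: dr_def)
   then have "adj r e f" using step[of e f] by (simp add: dbl_def)
   then show ?thesis using k \<open>adj ys f e\<close> irr(4) by (metis (full_types))
  qed
  moreover have "\<not> kd r" if s: "same (nbl 1 e) (nbl 2 e)"
  proof -
   obtain f where "adj xs f e" "adj ys e f" using same_nbl[OF s] by (auto simp: dr_def)
   then have "adj r f e" using step[of f e] by (simp add: dbl_def)
   then show ?thesis using k \<open>adj ys e f\<close> irr(4) by (metis (full_types))
  qed
  moreover have "\<not> same (nbl 0 e) (nbl 1 e)"
   using same_nbl[of 0 e 1] irr(3) by (auto simp: dr_def)
  moreover have "\<not> same (nbl 2 e) (nbl 3 e)"
   using same_nbl[of 2 e 3] irr(4) by (auto simp: dr_def)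
  moreover have "Cn (lab e) (Cn (nbl 0 e) (Cn (nbl (Suc 0) e) (Cn (nbl 2 e) (nbl 3 e)))) = star e"
   by (simp add: star_def)
  moreover have "lab e ~= Nl" using lab run_sub[OF r] e by blast
  ultimately show ?thesis unfolding star_ok_def by simp
 qed
 moreover have "last_ok (star (last r))"
 proof -
  have "\<not> (adj xs (last r) f & dbl (last r) f)" for f
   using run_step[of "last r" f r] r ne ncons[of r "last r" f] d by auto
  then show ?thesis
   using same_nbl[of 0 "last r" 2] same_nbl[of 0 "last r" 3] unfolding last_ok_def by (auto simp: dr_def dbl_def)
 qed
 moreover have "first_ok (star (hd r))"
 proof -
  have "\<not> (adj xs f (hd r) & dbl f (hd r))" for f
   using run_step[of f "hd r" r] r ne ncons[of r f "hd r"] d by auto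
  then show ?thesis
   using same_nbl[of 1 "hd r" 3] same_nbl[of 1 "hd r" 2] unfolding first_ok_def by (auto simp: dr_def dbl_def)
 qed
 ultimately show ?thesis unfolding word_ok_def using ne by (simp add: last_map hd_map)
qed

definition runof :: "'e => 'e list" where
 "runof e = (SOME r. r \<in> set rs & e \<in> set r)"

lemma runof: "e \<in> set xs ==> runof e \<in> set rs & e \<in> set (runof e)"
proof -
 assume "e \<in> set xs"
 then have "\<exists>r. r \<in> set rs & e \<in> set r" unfolding set_rs by (elim UN_E) (intro exI conjI)
 then show ?thesis unfolding runof_def by (rule someI_ex)
qed

lemma runof_eq: "r \<in> set rs ==> e \<in> set r ==> runof e = r"
proof -
 assume r: "r \<in> set rs" "e \<in> set r"
 then have "e \<in> set xs" using run_sub by blast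
 then show ?thesis using dist_rs(3)[OF _ r(1) _ r(2)] runof by simp
qed

text \<open>Each run is contiguous in \<open>ys\<close> too, forwards or backwards according to its
  kind, hence both orders are cut into the same runs.\<close>

lemma ys_runs: "\<exists>qs. concat (map (%r. ori False (kd r) r) qs) = ys & set qs = set rs & distinct qs"
proof -
 let ?g = "%r. ori False (kd r) r"
 have "\<exists>qs. concat (map ?g qs) = ys & set qs = runof ` set ys & distinct qs"
 proof (rule chop[OF dy])
  fix e assume "e \<in> set ys"
  then have e: "e \<in> set xs" using set_ys by simp
  note r = runof[OF e]
  have s: "successively (adj ys) (?g (runof e))"
  proof (cases "kd (runof e)")
   case True
   then show ?thesis by (simp add: ori_def kd_def)
  next
   case False
   then show ?thesis using run_kind[of "runof e"] r by (simp add: ori_def)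
  qed
  have st: "set (?g (runof e)) = set (runof e)" by (simp add: ori_def)
  have ne: "?g (runof e) ~= []" using r st by auto
  have "\<exists>us vs. ys = us @ ?g (runof e) @ vs"
   using run_sub r st set_ys by (intro succ_sublist[OF dy ne _ s]) auto
  moreover have "\<forall>f\<in>set (?g (runof e)). runof f = runof e"
   using st runof_eq r by blast
  ultimately show "e \<in> set (?g (runof e)) & (\<exists>us vs. ys = us @ ?g (runof e) @ vs) &
    (\<forall>f\<in>set (?g (runof e)). runof f = runof e)"
   using r st by blast
 qed
 moreover have "runof ` set ys = set rs"
 proof
  show "runof ` set ys \<subseteq> set rs" using runof set_ys by auto
  show "set rs \<subseteq> runof ` set ys"
  proof
   fix r assume r: "r \<in> set rs"
   then have "hd r \<in> set r" using rs(2) by simp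
   then have "r = runof (hd r)" "hd r \<in> set ys" using runof_eq[OF r] run_sub[OF r] set_ys by auto
   then show "r \<in> runof ` set ys" by (rule image_eqI)
  qed
 qed
 ultimately show ?thesis by simp
qed

lemma chain_list:
 "\<exists>L. set L = set rs & distinct L & concat (map (%r. ori d (kd r) r) L) = (if d then xs else ys)"
proof (cases d)
 case True
 then show ?thesis using rs(1) dist_rs(1) by (intro exI[of _ rs]) (simp add: ori_def)
next
 case False
 then show ?thesis using ys_runs by auto
qed

lemma nbl_dir:
 "adj (if d then xs else ys) e f ==> nbl (fwd d) e = lab f & nbl (bwd d) f = lab e"
 using nbl_nxt[of e f] by (auto simp: fwd_def bwd_def split: if_splits)

lemma nbl_end: "(\<And>f. \<not> adj (if d then xs else ys) e f) ==> nbl (fwd d) e = Nl"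
 and nbl_begin: "(\<And>f. \<not> adj (if d then xs else ys) f e) ==> nbl (bwd d) e = Nl"
 unfolding nbl_def by (auto simp: dr_def fwd_def bwd_def split: if_splits)

lemma nb_fb: "nb (fwd d) (star e) = nbl (fwd d) e" "nb (bwd d) (star e) = nbl (bwd d) e"
 by (simp_all add: nb_star fwd_def bwd_def)

lemma chain_links:
 assumes L: "set L = set rs" "concat (map (%r. ori d (kd r) r) L) = (if d then xs else ys)"
 shows "L ~= [] & inv d (pc (hd L)) = Nl & outv d (pc (last L)) = Nl &
  successively (%r r'. outv d (pc r) = inv d (pc r') & inv d (pc r') ~= Nl) L"
proof -
 let ?g = "%r. ori d (kd r) r"
 define zs where "zs = (if d then xs else ys)"
 have z: "distinct zs" "set zs = set xs" "zs ~= []" using dx dy set_ys ne by (auto simp: zs_def)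
 have gne: "?g r ~= []" if "r \<in> set L" for r using rs(2) that L(1) by (simp add: ori_def)
 have gmap: "ori d k (map star r) = map star (ori d k r)" for k r by (simp add: ori_def rev_map)
 have ov: "outv d (pc r) = outs d (star (last (?g r)))" if "r \<in> set L" for r
  using gne[OF that] by (simp add: outv_def pc_def gmap last_map)
 have iv: "inv d (pc r) = ins d (star (hd (?g r)))" if "r \<in> set L" for r
  using gne[OF that] by (simp add: inv_def pc_def gmap hd_map)
 have Lne: "L ~= []" using L(2) z(3) by (auto simp: zs_def)
 have cz: "concat (map ?g L) = zs" using L(2) by (simp add: zs_def)
 have "inv d (pc (hd L)) = Nl"
 proof -
  have "hd zs = hd (?g (hd L))" using Lne gne[of "hd L"] unfolding cz[symmetric] by (cases L) simp_all
  moreover have "nbl (bwd d) (hd zs) = Nl"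
   using ncons[OF _ z(1)] by (intro nbl_begin notI) (unfold zs_def[symmetric], blast)
  ultimately show ?thesis using iv[of "hd L"] Lne by (simp add: ins_def nb_fb)
 qed
 moreover have "outv d (pc (last L)) = Nl"
 proof -
  obtain L' r where r: "L = L' @ [r]" using Lne by (cases L rule: rev_cases) auto
  have "last zs = last (?g r)" using gne[of r] unfolding cz[symmetric] r by simp
  moreover have "nbl (fwd d) (last zs) = Nl"
   using ncons[OF _ z(1)] by (intro nbl_end notI) (unfold zs_def[symmetric], blast)
  ultimately show ?thesis using ov[of r] r by (simp add: outs_def nb_fb)
 qed
 moreover have "successively (%r r'. outv d (pc r) = inv d (pc r') & inv d (pc r') ~= Nl) L"
 proof (rule nxt_succ)
  fix r r' assume "adj L r r'"
  then obtain us vs where u: "L = us @ r # r' # vs" using nxt_split by fast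
  have rr: "r \<in> set L" "r' \<in> set L" using u by auto
  obtain a e where a: "?g r = a @ [e]" using gne[OF rr(1)] by (cases "?g r" rule: rev_cases) auto
  obtain f b where b: "?g r' = f # b" using gne[OF rr(2)] by (cases "?g r'") auto
  have "zs = (concat (map ?g us) @ a) @ e # f # b @ concat (map ?g vs)" unfolding cz[symmetric] u by (simp add: a b)
  then have n: "adj zs e f" using nxt_I by metis
  have "e \<in> set xs" "f \<in> set xs" using nxt_set[OF n] z by auto
  then have "lab e ~= Nl" "lab f ~= Nl" using lab by auto
  then show "outv d (pc r) = inv d (pc r') & inv d (pc r') ~= Nl"
   using nbl_dir[of d e f] n ov[OF rr(1)] iv[OF rr(2)] a b
   by (simp add: zs_def outs_def ins_def nb_fb)
 qed
 ultimately show ?thesis using Lne by blast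
qed

end

section \<open>Compressing a structure to a certificate\<close>

context order_pair
begin

text \<open>Up to two elements of every label are marked and survive all compression; thus labels
  occurring once and labels occurring several times remain distinguishable.\<close>

definition Mt :: "tree => 'e set" where
 "Mt t = (SOME A. A \<subseteq> {e \<in> set xs. lab e = t} & card A = min 2 (card {e \<in> set xs. lab e = t}))"

lemma Mt: "Mt t \<subseteq> {e \<in> set xs. lab e = t}" "card (Mt t) = min 2 (card {e \<in> set xs. lab e = t})"
proof -
 have "\<exists>A. A \<subseteq> {e \<in> set xs. lab e = t} & card A = min 2 (card {e \<in> set xs. lab e = t})"
 proof -
  have "min 2 (card {e \<in> set xs. lab e = t}) \<le> card {e \<in> set xs. lab e = t}" by simp
  then obtain A where "A \<subseteq> {e \<in> set xs. lab e = t}" "card A = min 2 (card {e \<in> set xs. lab e = t})"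
   by (rule obtain_subset_with_card_n)
  then show ?thesis by (intro exI conjI)
 qed
 from someI_ex[OF this, folded Mt_def]
 show "Mt t \<subseteq> {e \<in> set xs. lab e = t}" "card (Mt t) = min 2 (card {e \<in> set xs. lab e = t})" by blast+
qed

definition MM :: "'e set" where
 "MM = (\<Union>t\<in>Tl. Mt t)"

lemma MM_sub: "MM \<subseteq> set xs"
 unfolding MM_def using Mt(1) by blast

lemma card_MM: "card MM \<le> 2 * card Tl"
proof -
 have "card MM \<le> (\<Sum>t\<in>Tl. card (Mt t))" unfolding MM_def by (rule card_UN_le) simp
 also have "\<dots> \<le> (\<Sum>t\<in>Tl. 2)" by (rule sum_mono) (simp add: Mt(2))
 finally show ?thesis by simp
qed

definition nst :: nat where
 "nst = card (star ` set xs)"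

definition sh :: "'e list => 'e list" where
 "sh r = (SOME r'. r' ~= [] & distinct r' & set r' \<subseteq> set r & star (hd r') = star (hd r) & star (last r') = star (last r) &
  successively (%a b. nx (kd r) (star a) (star b)) r' & MM \<inter> set r \<subseteq> set r' &
  length r' \<le> card (star ` set r) * (card (MM \<inter> set r) + 1))"

lemma sh:
 assumes "r \<in> set rs"
 shows "sh r ~= []" "distinct (sh r)" "set (sh r) \<subseteq> set r" "star (hd (sh r)) = star (hd r)"
  "star (last (sh r)) = star (last r)" "successively (%a b. nx (kd r) (star a) (star b)) (sh r)"
  "MM \<inter> set r \<subseteq> set (sh r)" "length (sh r) \<le> card (star ` set r) * (card (MM \<inter> set r) + 1)"
proof -
 have "successively (%a b. nx (kd r) (star a) (star b)) r"
  using word_ok_run[OF assms] by (simp add: word_ok_def successively_map)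
 from someI_ex[OF shorten[where f = star and R = "nx (kd r)" and M = MM and r = r,
  OF conjunct1[OF rs(2)[OF assms]] dist_rs(2)[OF assms] this], folded sh_def]
 show "sh r ~= []" "distinct (sh r)" "set (sh r) \<subseteq> set r" "star (hd (sh r)) = star (hd r)"
  "star (last (sh r)) = star (last r)" "successively (%a b. nx (kd r) (star a) (star b)) (sh r)"
  "MM \<inter> set r \<subseteq> set (sh r)" "length (sh r) \<le> card (star ` set r) * (card (MM \<inter> set r) + 1)"
  by blast+
qed

definition key :: "'e list => bool \<times> tree \<times> tree" where
 "key r = (kd r, star (hd r), star (last r))"

text \<open>Runs without marked elements are replaced by one representative for each kind, first and last
 star; this bounds the number of different pieces.\<close>

definition rp0 :: "bool \<times> tree \<times> tree => 'e list" where
 "rp0 c = (SOME r. r \<in> set rs & MM \<inter> set r = {} & key r = c)"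

definition rp :: "'e list => 'e list" where
 "rp r = (if MM \<inter> set r = {} then rp0 (key r) else r)"

lemma rp:
 assumes "r \<in> set rs"
 shows "rp r \<in> set rs" "key (rp r) = key r" "MM \<inter> set r ~= {} ==> rp r = r"
  "MM \<inter> set r = {} ==> MM \<inter> set (rp r) = {}"
proof -
 have ex: "\<exists>r'. r' \<in> set rs & MM \<inter> set r' = {} & key r' = key r" if "MM \<inter> set r = {}" using assms that by blast
 have *: "rp0 (key r) \<in> set rs & MM \<inter> set (rp0 (key r)) = {} & key (rp0 (key r)) = key r" if "MM \<inter> set r = {}"
  using someI_ex[OF ex[OF that]] unfolding rp0_def .
 then show "rp r \<in> set rs" "key (rp r) = key r" "MM \<inter> set r ~= {} ==> rp r = r"
  "MM \<inter> set r = {} ==> MM \<inter> set (rp r) = {}"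
  using assms by (simp_all add: rp_def)
qed

definition cc :: "'e list => bool \<times> tree list" where
 "cc r = (kd r, map star (sh (rp r)))"

lemma cc_kd: "r \<in> set rs ==> kd (rp r) = kd r & star (hd (rp r)) = star (hd r) & star (last (rp r)) = star (last r)"
 using rp(2)[of r] by (simp add: key_def)

lemma cc_ends: "r \<in> set rs ==> inv d (cc r) = inv d (pc r) & outv d (cc r) = outv d (pc r)"
proof -
 assume r: "r \<in> set rs"
 note s = sh[OF rp(1)[OF r]] and k = cc_kd[OF r]
 have "r ~= []" using rs(2)[OF r] by simp
 then show ?thesis
  using s(1,4,5) k by (simp add: inv_def outv_def cc_def pc_def ori_def hd_rev last_rev hd_map last_map)
qed

lemma cc_ok: "r \<in> set rs ==> word_ok (fst (cc r)) (snd (cc r))"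
proof -
 assume r: "r \<in> set rs"
 note s = sh[OF rp(1)[OF r]] and k = cc_kd[OF r]
 have w: "word_ok (kd r) (map star (rp r))" using word_ok_run[OF rp(1)[OF r]] k by simp
 have ne: "rp r ~= []" using rs(2)[OF rp(1)[OF r]] by simp
 show ?thesis
  using w s(1,3-6) k ne unfolding word_ok_def cc_def
  by (auto simp: hd_map last_map successively_map)
qed

lemma count_map: "distinct l ==> count_list (map f l) t = card {e \<in> set l. f e = t}"
proof (induction l)
 case (Cons a l)
 have "{e \<in> set (a # l). f e = t} = (if f a = t then insert a {e \<in> set l. f e = t} else {e \<in> set l. f e = t})" by auto
 then show ?case using Cons by simp
qed simp

lemma cc_count: "r \<in> set rs ==> count_list (map th (snd (cc r))) t = card {e \<in> set (sh (rp r)). lab e = t}"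
 using count_map[OF sh(2)[OF rp(1)], of r lab t] by (simp add: cc_def comp_def)

lemma marks_kept:
 assumes "e \<in> MM"
 shows "e \<in> set (sh (rp (runof e)))"
proof -
 have e: "e \<in> set xs" using assms MM_sub by blast
 note r = runof[OF e]
 have "MM \<inter> set (runof e) ~= {}" using assms r by blast
 then have "rp (runof e) = runof e" by (rule rp(3)[OF conjunct1[OF r]])
 then show ?thesis using sh(7)[OF conjunct1[OF r]] assms r by auto
qed

lemma cc_sub: "r \<in> set rs ==> set (sh (rp r)) \<subseteq> set xs"
 using sh(3)[OF rp(1)] run_sub[OF rp(1)] by blast

text \<open>Replacing a run by a representative could lose or duplicate a label. Marked elements are
  kept, so two occurrences stay at least two; an element with a unique label is marked, and the run
  containing it is neither replaced nor a representative of others.\<close>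

lemma total_one: "(\<Sum>r\<in>set rs. count_list (map th (snd (cc r))) t) = 1 \<longleftrightarrow> card {e \<in> set xs. lab e = t} = 1"
proof -
 let ?A = "%r. {e \<in> set (sh (rp r)). lab e = t}"
 have sum: "(\<Sum>r\<in>set rs. count_list (map th (snd (cc r))) t) = (\<Sum>r\<in>set rs. card (?A r))"
  by (rule sum.cong) (simp_all add: cc_count)
 have sub: "?A r \<subseteq> {e \<in> set xs. lab e = t}" if "r \<in> set rs" for r using cc_sub[OF that] by blast
 have ge: "Mt t \<subseteq> (\<Union>r\<in>set rs. ?A r)"
 proof
  fix e assume e: "e \<in> Mt t"
  then have "e \<in> set xs" "lab e = t" using Mt(1) by blast+
  then have "e \<in> MM" using e unfolding MM_def by blast
  then have "e \<in> ?A (runof e)" "runof e \<in> set rs" using marks_kept runof \<open>e \<in> set xs\<close> \<open>lab e = t\<close> by auto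
  then show "e \<in> (\<Union>r\<in>set rs. ?A r)" by blast
 qed
 have "card (Mt t) \<le> card (\<Union>r\<in>set rs. ?A r)" by (rule card_mono[OF _ ge]) simp
 also have "\<dots> \<le> (\<Sum>r\<in>set rs. card (?A r))" by (rule card_UN_le) simp
 finally have lower: "min 2 (card {e \<in> set xs. lab e = t}) \<le> (\<Sum>r\<in>set rs. card (?A r))" by (simp add: Mt(2))
 consider "card {e \<in> set xs. lab e = t} = 0" | "card {e \<in> set xs. lab e = t} = 1" | "card {e \<in> set xs. lab e = t} \<ge> 2"
  by linarith
 then show ?thesis
 proof cases
  case 1
  then have em: "{e \<in> set xs. lab e = t} = {}" by simp
  have "?A r = {}" if "r \<in> set rs" for r using sub[OF that] unfolding em by (simp only: subset_empty)
  then have z: "(\<Sum>r\<in>set rs. card (?A r)) = 0" by (simp del: Collect_empty_eq)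
  show ?thesis unfolding sum z 1 by simp
 next
  case 2
  then obtain e0 where e0: "{e \<in> set xs. lab e = t} = {e0}" by (rule card_1_singletonE)
  have "card (Mt t) = card {e \<in> set xs. lab e = t}" using 2 by (simp add: Mt(2))
  then have "Mt t = {e \<in> set xs. lab e = t}" by (intro card_subset_eq Mt(1)) simp
  moreover have ee: "e0 \<in> set xs" "lab e0 = t" using e0 by auto
  ultimately have m: "e0 \<in> MM" unfolding MM_def using e0 by blast
  note ro = runof[OF ee(1)]
  have "card (?A r) = (if r = runof e0 then 1 else 0)" if r: "r \<in> set rs" for r
  proof (cases "r = runof e0")
   case True
   have "?A r = {e0}" using sub[OF r] e0 marks_kept[OF m] ee(2) True by blast
   then show ?thesis using True by simp
  next
   case False
   have "e0 \<notin> set (sh (rp r))"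
   proof
    assume "e0 \<in> set (sh (rp r))"
    then have e: "e0 \<in> set (rp r)" using sh(3)[OF rp(1)[OF r]] by blast
    show False
    proof (cases "MM \<inter> set r = {}")
     case True
     then show False using rp(4)[OF r] m e by blast
    next
     case 2: False
     then have "e0 \<in> set r" using rp(3)[OF r] e by simp
     then show False using runof_eq[OF r] False by simp
    qed
   qed
   moreover have "?A r \<subseteq> {e0}" using sub[OF r] unfolding e0 .
   ultimately have "?A r = {}" by (intro equals0I) (metis (no_types, lifting) mem_Collect_eq singletonD subsetD)
   then show ?thesis using False by simp
  qed
  then have "(\<Sum>r\<in>set rs. card (?A r)) = (\<Sum>r\<in>set rs. if r = runof e0 then 1 else 0)" by (intro sum.cong) auto
  then show ?thesis using 2 ro unfolding sum by simp
 next
  case 3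
  then show ?thesis using lower unfolding sum by simp
 qed
qed

text \<open>\<open>x p\<close> counts the runs compressed to \<open>p\<close>; it solves the flow
  equations of both orders, because both pass through the same runs. \<open>small_solution\<close>
  replaces \<open>x\<close> by \<open>y\<close> with bounded entries, and what is 0, 1 or larger
  stays so, which preserves the single start and the labels occurring once. The two lists witnessing
  reachability come from the paths \<open>L\<close> and \<open>L'\<close> read backwards.\<close>

theorem certificate_complete:
 "\<exists>P OD. pieces_ok P & (\<forall>d. flow_ok d P) & rooted True (map snd P) & rooted False OD & set OD = snd ` set P &
   length OD = length P & labels P = Tl & {t. tot P t = 1} = Kl & length P \<le> 4 * card Tl + 2 * nst * nst &
   (\<forall>(m, k, w)\<in>set P. set w \<subseteq> star ` set xs & length w \<le> nst * (2 * card Tl + 1) &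
    m \<le> 3 * length P * length P ^ length P)"
proof -
 define S where "S = cc ` set rs"
 have finS: "finite S" by (simp add: S_def)
 define x where "x p = card {r \<in> set rs. cc r = p}" for p
 have x_out: "x p = 0" if "p \<notin> S" for p using that by (auto simp: x_def S_def)
 have x_in: "x p \<ge> 1" if "p \<in> S" for p
 proof -
  have "{r \<in> set rs. cc r = p} ~= {}" using that unfolding S_def by blast
  then have "card {r \<in> set rs. cc r = p} ~= 0" by (subst card_0_eq) auto
  then show ?thesis unfolding x_def by linarith
 qed
 have fib: "(\<Sum>p\<in>S. x p * h p) = (\<Sum>r\<in>set rs. h (cc r))" for h :: "_ => nat"
  unfolding S_def x_def by (rule sum_fibres[symmetric]) simp
 have cnt: "(\<Sum>r\<in>set rs. if Q r then 1 else 0) = length (filter Q L)"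
  if "set L = set rs" "distinct L" for Q and L :: "'e list list"
  unfolding that(1)[symmetric] using that(2) by (simp add: distinct_length_filter Int_def sum.If_cases conj_commute)
 have links: "\<exists>L. set L = set rs & distinct L & L ~= [] & inv d (cc (hd L)) = Nl & outv d (cc (last L)) = Nl &
   successively (%r r'. outv d (cc r) = inv d (cc r') & inv d (cc r') ~= Nl) L" for d
 proof -
  obtain L where L: "set L = set rs" "distinct L" "concat (map (%r. ori d (kd r) r) L) = (if d then xs else ys)"
   using chain_list[of d] by blast
  note cl = chain_links[OF L(1,3)]
  note c1 = conjunct1[OF cl] and c2 = conjunct1[OF conjunct2[OF cl]] and c3 = conjunct1[OF conjunct2[OF conjunct2[OF cl]]]
   and c4 = conjunct2[OF conjunct2[OF conjunct2[OF cl]]]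
  have e: "inv d (cc r) = inv d (pc r)" "outv d (cc r) = outv d (pc r)" if "r \<in> set rs" for r
   using cc_ends[OF that, of d] by simp_all
  have "successively (%r r'. outv d (cc r) = inv d (cc r') & inv d (cc r') ~= Nl) L"
  proof (rule successively_mono[OF c4])
   fix r r' assume "r \<in> set L" "r' \<in> set L" "outv d (pc r) = inv d (pc r') & inv d (pc r') ~= Nl"
   then show "outv d (cc r) = inv d (cc r') & inv d (cc r') ~= Nl" unfolding L(1) using e by simp
  qed
  moreover have "hd L \<in> set rs" "last L \<in> set rs"
   using hd_in_set[OF c1] last_in_set[OF c1] unfolding L(1) by simp_all
  then have "inv d (cc (hd L)) = Nl" "outv d (cc (last L)) = Nl" using e c2 c3 by simp_all
  ultimately show ?thesis using L(1,2) c1 by (intro exI[of _ L] conjI)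
 qed
 have bal: "(\<Sum>r\<in>set rs. if inv d (cc r) = v then 1 else 0) = (\<Sum>r\<in>set rs. if outv d (cc r) = v then 1 else (0::nat))"
  and one: "(\<Sum>r\<in>set rs. if inv d (cc r) = Nl then 1 else 0) = (1::nat)" for d v
 proof -
  obtain L where L: "set L = set rs" "distinct L" "L ~= []" "inv d (cc (hd L)) = Nl" "outv d (cc (last L)) = Nl"
   "successively (%r r'. outv d (cc r) = inv d (cc r') & inv d (cc r') ~= Nl) L" using links by blast
  have suc: "successively (%r r'. outv d (cc r) = inv d (cc r')) L" by (rule successively_mono[OF L(6)]) simp
  show "(\<Sum>r\<in>set rs. if inv d (cc r) = v then 1 else 0) = (\<Sum>r\<in>set rs. if outv d (cc r) = v then 1 else (0::nat))"
   using path_count[OF L(3) suc, of v] L(4,5) unfolding cnt[OF L(1,2)] by simp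
  obtain a L' where a: "L = a # L'" using L(3) by (cases L) auto
  have "\<forall>r\<in>set L'. inv d (cc r) ~= Nl"
  proof
   fix r assume "r \<in> set L'"
   then obtain us vs where "L' = us @ r # vs" using split_list by fast
   then have "adj L (last (a # us)) r"
    unfolding a adj_def by (intro exI[of _ "length us"]) (simp add: nth_append last_conv_nth nth_Cons')
   then show "inv d (cc r) ~= Nl" using succ_nxt[OF L(6)] by blast
  qed
  then have "filter (%r. inv d (cc r) = Nl) L' = []" by (simp add: filter_empty_conv)
  then show "(\<Sum>r\<in>set rs. if inv d (cc r) = Nl then 1 else 0) = (1::nat)"
   using L(4) unfolding cnt[OF L(1,2)] a by simp
 qed
 \<comment> \<open>Row \<open>(d, v)\<close> is the balance at vertex \<open>v\<close> in the graph
   of order \<open>d\<close>. There are infinitely many rows; on \<open>S\<close> all but finitely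
   many vanish.\<close>
 define A where "A e p = (if inv (fst e) p = snd e then 1 else 0) - (if outv (fst e) p = snd e then (1::int) else 0)"
  for e :: "bool \<times> tree" and p
 have A3: "A e p \<in> {-1, 0, 1}" for e p by (simp add: A_def)
 have Asum: "(\<Sum>p\<in>S. A (d, v) p * int (z p)) =
   int (\<Sum>p\<in>S. z p * (if inv d p = v then 1 else 0)) - int (\<Sum>p\<in>S. z p * (if outv d p = v then 1 else 0))"
  for d v z
  unfolding of_nat_sum sum_subtractf[symmetric] by (rule sum.cong) (auto simp: A_def)
 have "solv A UNIV S (%p. int (x p))"
  unfolding solv_def using Asum[of _ _ x] by (auto simp: fib bal)
 from small_solution[OF finS A3 this x_out] obtain y where y: "solv A UNIV S (%p. int (y p))"
  "\<forall>p. y p \<le> x p & min (x p) 2 \<le> y p & y p \<le> 3 * card S * card S ^ card S" by blast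
 have ybal: "(\<Sum>p\<in>S. y p * (if inv d p = v then 1 else 0)) = (\<Sum>p\<in>S. y p * (if outv d p = v then 1 else 0))" for d v
 proof -
  have "(\<Sum>p\<in>S. A (d, v) p * int (y p)) = 0" using y(1) unfolding solv_def by blast
  then show ?thesis unfolding Asum by linarith
 qed
 \<comment> \<open>To be applied with \<open>h\<close> marking the pieces that start at
   \<open>Nl\<close>, and with \<open>h\<close> counting a label in a piece.\<close>
 have cmp: "min (\<Sum>p\<in>S. x p * h p) 2 \<le> (\<Sum>p\<in>S. y p * h p) & (\<Sum>p\<in>S. y p * h p) \<le> (\<Sum>p\<in>S. x p * h p)" for h :: "_ => nat"
 proof (rule sum_min2[OF finS])
  fix p
  have *: "y p \<le> x p" "min (x p) 2 \<le> y p" using y(2)[rule_format, of p] by simp_all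
  show "min (x p * h p) 2 \<le> y p * h p & y p * h p \<le> x p * h p"
  proof (cases "h p = 0")
   case False
   consider "x p = 0" | "x p = 1" | "x p \<ge> 2" by linarith
   then show ?thesis
   proof cases
    case 3
    then have "2 \<le> y p" using * by simp
    then have "2 * 1 \<le> y p * h p" using False by (intro mult_le_mono) auto
    then show ?thesis using * by simp
   qed (use * in auto)
  qed simp
 qed
 have y1: "y p \<ge> 1" if "p \<in> S" for p using y(2)[rule_format, of p] x_in[OF that] by auto
 obtain L where L: "set L = set rs" "distinct L" "L ~= []" "inv True (cc (hd L)) = Nl"
  "successively (%r r'. outv True (cc r) = inv True (cc r') & inv True (cc r') ~= Nl) L" using links[of True] by blast
 obtain L' where L': "set L' = set rs" "distinct L'" "L' ~= []" "inv False (cc (hd L')) = Nl"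
  "successively (%r r'. outv False (cc r) = inv False (cc r') & inv False (cc r') ~= Nl) L'" using links[of False] by blast
 define SL where "SL = remdups (rev (map cc L))"
 define OD where "OD = remdups (rev (map cc L'))"
 have SL: "distinct SL" "set SL = S" and OD: "distinct OD" "set OD = S"
  using L(1) L'(1) by (simp_all add: SL_def OD_def S_def)
 define P where "P = map (%p. (y p, p)) SL"
 have sndP: "map snd P = SL" by (simp add: P_def comp_def)
 have setP: "snd ` set P = S" using SL by (auto simp: P_def image_image)
 have lenP: "length P = card S" using distinct_card[OF SL(1)] SL(2) by (simp add: P_def)
 have flowP: "flow Q P = (\<Sum>p\<in>S. y p * (if Q p then 1 else 0))" for Q
 proof -
  have "flow Q P = (\<Sum>p\<leftarrow>SL. if Q p then y p else 0)" by (simp add: flow_def P_def comp_def)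
  also have "\<dots> = (\<Sum>p\<in>S. if Q p then y p else 0)" using sum_list_distinct_conv_sum_set[OF SL(1)] SL(2) by simp
  also have "\<dots> = (\<Sum>p\<in>S. y p * (if Q p then 1 else 0))" by (rule sum.cong) auto
  finally show ?thesis .
 qed
 have totP: "tot P t = (\<Sum>p\<in>S. y p * count_list (map th (snd p)) t)" for t
 proof -
  have "tot P t = (\<Sum>p\<leftarrow>SL. y p * count_list (map th (snd p)) t)" by (simp add: tot_def P_def comp_def case_prod_unfold)
  also have "\<dots> = (\<Sum>p\<in>S. y p * count_list (map th (snd p)) t)" using sum_list_distinct_conv_sum_set[OF SL(1)] SL(2) by simp
  finally show ?thesis .
 qed
 have "pieces_ok P"
  unfolding pieces_ok_def P_def using SL(2) y1 cc_ok by (auto simp: S_def) fastforce+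
 moreover have "flow_ok d P" for d
  unfolding flow_ok_def flowP
 proof (intro conjI allI)
  show "(\<Sum>p\<in>S. y p * (if inv d p = v then 1 else 0)) = (\<Sum>p\<in>S. y p * (if outv d p = v then 1 else 0))" for v
   by (rule ybal)
  show "(\<Sum>p\<in>S. y p * (if inv d p = Nl then 1 else 0)) = 1"
   using cmp[of "%p. if inv d p = Nl then 1 else 0"] unfolding fib one by simp
 qed
 moreover have "rooted True (map snd P)"
  unfolding sndP SL_def
  by (intro good_remdups good_rev L(3,4) successively_mono[OF L(5)]) simp
 moreover have "rooted False OD"
  unfolding OD_def
  by (intro good_remdups good_rev L'(3,4) successively_mono[OF L'(5)]) simp
 moreover have "set OD = snd ` set P" using OD setP by simp
 moreover have "length OD = length P" using distinct_card[OF OD(1)] OD(2) lenP by simp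
 moreover have "labels P = Tl"
 proof
  show "labels P \<subseteq> Tl"
  proof
   fix t assume "t \<in> labels P"
   then obtain s m k w where s: "t = th s" "(m, k, w) \<in> set P" "s \<in> set w" unfolding labels_def by blast
   then have "(k, w) \<in> S" using setP by force
   then obtain r where r: "r \<in> set rs" "cc r = (k, w)" unfolding S_def by auto
   then have "w = map star (sh (rp r))" by (simp add: cc_def)
   then show "t \<in> Tl" using s cc_sub[OF r(1)] by auto
  qed
  show "Tl \<subseteq> labels P"
  proof
   fix t assume t: "t \<in> Tl"
   then have "card {e \<in> set xs. lab e = t} ~= 0" by (subst card_0_eq) auto
   then have "min 2 (card {e \<in> set xs. lab e = t}) ~= 0" by linarith
   then have "card (Mt t) ~= 0" unfolding Mt(2) .
   then obtain e where e: "e \<in> Mt t" by (metis all_not_in_conv card.empty)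
   then have ex: "e \<in> set xs" "lab e = t" using Mt(1) by blast+
   have "e \<in> MM" using e t unfolding MM_def by blast
   from marks_kept[OF this] have "star e \<in> set (snd (cc (runof e)))" by (simp add: cc_def)
   moreover have "cc (runof e) \<in> S" using runof[OF ex(1)] by (simp add: S_def)
   then have "(y (cc (runof e)), fst (cc (runof e)), snd (cc (runof e))) \<in> set P" using SL by (simp add: P_def)
   moreover have "t = th (star e)" using ex by simp
   ultimately have "\<exists>s m k w. t = th s & (m, k, w) \<in> set P & s \<in> set w" by (intro exI conjI)
   then show "t \<in> labels P" unfolding labels_def by simp
  qed
 qed
 moreover have "{t. tot P t = 1} = Kl"
 proof -
  have "tot P t = 1 \<longleftrightarrow> (\<Sum>r\<in>set rs. count_list (map th (snd (cc r))) t) = 1" for t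
   using cmp[of "%p. count_list (map th (snd p)) t"] unfolding totP fib by auto
  then show ?thesis unfolding total_one by blast
 qed
 moreover have "length P \<le> 4 * card Tl + 2 * nst * nst"
 proof -
  \<comment> \<open>Runs with marked elements, at most one for each mark, and runs without, whose
    pieces are determined by kind, first and last star.\<close>
  let ?a = "{r \<in> set rs. MM \<inter> set r ~= {}}" and ?b = "{r \<in> set rs. MM \<inter> set r = {}}"
  have finM: "finite MM" using MM_sub by (rule finite_subset) simp
  have "?a \<subseteq> runof ` MM" using runof_eq by blast
  then have "card ?a \<le> card (runof ` MM)" using finM by (intro card_mono) auto
  also have "\<dots> \<le> card MM" using finM by (rule card_image_le)
  finally have a: "card (cc ` ?a) \<le> 2 * card Tl" using card_MM card_image_le[of ?a cc] by simp
  let ?G = "%c. (fst c, map star (sh (rp0 c)))"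
  let ?K = "(UNIV :: bool set) \<times> star ` set xs \<times> star ` set xs"
  have "cc ` ?b \<subseteq> ?G ` ?K"
  proof (rule image_subsetI)
   fix r assume r: "r \<in> ?b"
   then have "hd r \<in> set xs" "last r \<in> set xs" using run_sub[of r] rs(2)[of r] hd_in_set[of r] last_in_set[of r] by blast+
   then have "key r \<in> ?K" by (simp add: key_def)
   moreover have "cc r = ?G (key r)" using r by (simp add: cc_def rp_def) (simp add: key_def)
   ultimately show "cc r \<in> ?G ` ?K" by (rule rev_image_eqI)
  qed
  then have "card (cc ` ?b) \<le> card (?G ` ?K)" by (intro card_mono) auto
  also have "\<dots> \<le> card ?K" by (rule card_image_le) simp
  also have "\<dots> = 2 * nst * nst" by (simp add: card_cartesian_product nst_def)
  finally have b: "card (cc ` ?b) \<le> 2 * nst * nst" .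
  have "set rs = ?a \<union> ?b" by blast
  then have "S = cc ` ?a \<union> cc ` ?b" unfolding S_def image_Un[symmetric] by (rule arg_cong)
  then have "card S \<le> card (cc ` ?a) + card (cc ` ?b)" by (simp add: card_Un_le)
  then show ?thesis using a b lenP by simp
 qed
 moreover have "\<forall>(m, k, w)\<in>set P. set w \<subseteq> star ` set xs & length w \<le> nst * (2 * card Tl + 1) &
   m \<le> 3 * length P * length P ^ length P"
 proof (clarify)
  fix m k w assume "(m, k, w) \<in> set P"
  then have m: "m = y (k, w)" and "(k, w) \<in> S" using SL(2) by (auto simp: P_def)
  then obtain r where r: "r \<in> set rs" "cc r = (k, w)" unfolding S_def by auto
  then have w: "w = map star (sh (rp r))" by (simp add: cc_def)
  have "length w \<le> card (star ` set (rp r)) * (card (MM \<inter> set (rp r)) + 1)" using sh(8)[OF rp(1)[OF r(1)]] w by simp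
  also have "\<dots> \<le> nst * (2 * card Tl + 1)"
  proof (rule mult_le_mono)
   show "card (star ` set (rp r)) \<le> nst"
    unfolding nst_def using run_sub[OF rp(1)[OF r(1)]] by (intro card_mono) auto
   have "finite MM" using MM_sub by (rule finite_subset) simp
   then have "card (MM \<inter> set (rp r)) \<le> card MM" by (intro card_mono) auto
   then show "card (MM \<inter> set (rp r)) + 1 \<le> 2 * card Tl + 1" using card_MM by simp
  qed
  finally show "set w \<subseteq> star ` set xs & length w \<le> nst * (2 * card Tl + 1) & m \<le> 3 * length P * length P ^ length P"
   using w cc_sub[OF r(1)] m y(2) lenP by auto
 qed
 ultimately show ?thesis by blast
qed

end

section \<open>Labelling a model\<close>

text \<open>Greedy colouring: at most \<open>n\<close> conflicts leave one of the
  \<open>n + 1\<close> colours free.\<close>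

lemma colouring:
 assumes "finite V" "\<And>f. f \<in> V ==> card {g \<in> V. C f g} \<le> n" "\<And>f g. C f g ==> C g f" "\<And>f. \<not> C f f"
 shows "\<exists>col. \<forall>f\<in>V. col f \<le> n & (\<forall>g\<in>V. C f g --> col f ~= col g)"
proof -
 have "\<exists>col. \<forall>f\<in>W. col f \<le> n & (\<forall>g\<in>W. C f g --> col f ~= col g)" if "W \<subseteq> V" for W
  using finite_subset[OF that assms(1)] that
 proof (induction W)
  case (insert a W)
  then obtain col where col: "\<forall>f\<in>W. col f \<le> n & (\<forall>g\<in>W. C f g --> col f ~= col g)" by auto
  have "card (col ` {g \<in> V. C a g}) \<le> card {g \<in> V. C a g}" using assms(1) by (intro card_image_le) simp
  also have "\<dots> < card {..n}" using assms(2)[of a] insert.prems by simp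
  finally have "\<not> {..n} \<subseteq> col ` {g \<in> V. C a g}" using card_mono[of "col ` {g \<in> V. C a g}" "{..n}"] assms(1) by auto
  then obtain c where c: "c \<le> n" "c \<notin> col ` {g \<in> V. C a g}" by blast
  have new: "c ~= col g" if "g \<in> W" "C a g" for g
  proof
   assume "c = col g"
   then show False using c(2) that insert.prems by blast
  qed
  have "(col(a := c)) f \<le> n & (\<forall>g\<in>insert a W. C f g --> (col(a := c)) f ~= (col(a := c)) g)" if f: "f \<in> insert a W" for f
  proof (cases "f = a")
   case True
   then show ?thesis using c new assms(4)[of a] by auto
  next
   case False
   then show ?thesis using f col new[of f] assms(3)[of f a] by auto
  qed
  then show ?case by blast
 qed simp
 then show ?thesis by blast
qed

section \<open>Labels as trees\<close>

fun tol :: "tree list => tree" where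
 "tol [] = Nl"
| "tol (a # l) = Cn a (tol l)"

lemma els_lt [simp]: "els (tol l) = set l"
 by (induction l) auto

definition un :: "nat => tree" where
 "un n = tol (replicate n Nl)"

lemma un_inj: "un m = un n ==> m = n"
proof -
 have "tol a = tol b ==> a = b" for a b
  by (induction a arbitrary: b; case_tac b; simp)
 then show "un m = un n ==> m = n" unfolding un_def by (metis length_replicate)
qed

fun keyl :: "fm => tree => tree list" where
 "keyl (Letter p a) r = [Cn Nl (dg p)]"
| "keyl (Neg \<phi>) r = keyl \<phi> r"
| "keyl (Conj \<phi> \<psi>) r = keyl \<phi> (tk \<psi> r) @ keyl \<psi> r"
| "keyl (Disj \<phi> \<psi>) r = keyl \<phi> (tk \<psi> r) @ keyl \<psi> r"
| "keyl (Exists a \<phi>) r = tk (Exists a \<phi>) r # keyl \<phi> r"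
| "keyl (Forall a \<phi>) r = tk (Forall a \<phi>) r # keyl \<phi> r"
| "keyl _ r = []"

lemma keyl_let: "p \<in> lets \<phi> ==> Cn Nl (dg p) \<in> set (keyl \<phi> r)"
 by (induction \<phi> arbitrary: r) auto

lemma keyl_occ: "(b, a, \<psi>, r') \<in> occ \<phi> r ==> tk (Qf b a \<psi>) r' \<in> set (keyl \<phi> r)"
 by (induction \<phi> arbitrary: r) (auto simp: Qf_def)

text \<open>All labels that may arise: one of 17 colours and a subset of the keys of
  \<open>\<phi>\<close>, listed in the order of \<open>keyl\<close> so that equal subsets give equal
  trees.\<close>

definition LB :: "fm => tree set" where
 "LB \<phi> = (%(c, S). Cn (un c) (tol (filter (%k. k \<in> S) (keyl \<phi> Nl)))) ` ({..16} \<times> Pow (set (keyl \<phi> Nl)))"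

lemma dg_inj: "dg p = dg q ==> p = q"
proof (induction p arbitrary: q rule: less_induct)
 case (less p)
 show ?case
 proof (cases "p = 0 \<or> q = 0")
  case True
  then show ?thesis using less.prems dg.simps[of p] dg.simps[of q] by (auto split: if_splits)
 next
  case False
  then have "b2t (odd p) = b2t (odd q)" "dg (p div 2) = dg (q div 2)"
   using less.prems dg.simps[of p] dg.simps[of q] by auto
  then have "odd p = odd q" "p div 2 = q div 2" using less.IH[of "p div 2"] False by (auto simp: b2t_def split: if_splits)
  then show ?thesis by presburger
 qed
qed

lemma vt_inj: "vt a = vt b \<longleftrightarrow> a = b"
 by (cases a; cases b) auto

lemma tk_inj: "tk \<phi> r = tk \<psi> r' ==> \<phi> = \<psi> & r = r'"
proof (induction \<phi> arbitrary: \<psi> r r')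
 case (Letter p a)
 then show ?case by (cases \<psi>) (auto simp: vt_inj dest: dg_inj)
next
 case (Rightarrow a b)
 then show ?case by (cases \<psi>) (auto simp: vt_inj)
next
 case (Downarrow a b)
 then show ?case by (cases \<psi>) (auto simp: vt_inj)
next
 case (Neg \<phi>)
 from Neg.prems show ?case by (cases \<psi>) (auto dest!: Neg.IH)
next
 case (Conj \<phi>1 \<phi>2)
 from Conj.prems show ?case by (cases \<psi>) (auto dest!: Conj.IH)
next
 case (Disj \<phi>1 \<phi>2)
 from Disj.prems show ?case by (cases \<psi>) (auto dest!: Disj.IH)
next
 case (Exists a \<phi>)
 from Exists.prems show ?case by (cases \<psi>) (auto simp: vt_inj dest!: Exists.IH)
next
 case (Forall a \<phi>)
 from Forall.prems show ?case by (cases \<psi>) (auto simp: vt_inj dest!: Forall.IH)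
qed

lemma Qf_inj: "Qf b a \<phi> = Qf b' a' \<phi>' ==> b = b' & a = a' & \<phi> = \<phi>'"
 by (simp add: Qf_def split: if_splits)

text \<open>Truth of a key at an element. The two kinds of keys cannot be confused: that of a letter
  begins with \<open>Nl\<close>, a list of tokens with a token, which is never
  \<open>Nl\<close>.\<close>

definition tr :: "position set => valuation => fm => position => tree => bool" where
 "tr \<pi> \<sigma> \<phi> e k \<longleftrightarrow> (\<exists>p. k = Cn Nl (dg p) & p \<in> \<sigma> e) \<or>
   (\<exists>b a \<psi> r. k = tk (Qf b a \<psi>) r & sat \<pi> \<sigma> (%_. e) (Qf b a \<psi>))"

lemma tr_let: "tr \<pi> \<sigma> \<phi> e (Cn Nl (dg p)) \<longleftrightarrow> p \<in> \<sigma> e"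
 unfolding tr_def by (auto simp: Qf_def dest: dg_inj split: if_splits)

lemma tr_occ: "tr \<pi> \<sigma> \<phi> e (tk (Qf b a \<psi>) r) \<longleftrightarrow> sat \<pi> \<sigma> (%_. e) (Qf b a \<psi>)"
proof
 assume "tr \<pi> \<sigma> \<phi> e (tk (Qf b a \<psi>) r)"
 moreover have "tk (Qf b a \<psi>) r ~= Cn Nl (dg p)" for p by (simp add: Qf_def)
 ultimately obtain b' a' \<psi>' r' where *: "tk (Qf b a \<psi>) r = tk (Qf b' a' \<psi>') r'" "sat \<pi> \<sigma> (%_. e) (Qf b' a' \<psi>')"
  unfolding tr_def by blast
 from tk_inj[OF *(1)] have "Qf b a \<psi> = Qf b' a' \<psi>'" ..
 then show "sat \<pi> \<sigma> (%_. e) (Qf b a \<psi>)" using *(2) by simp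
next
 assume "sat \<pi> \<sigma> (%_. e) (Qf b a \<psi>)"
 then show "tr \<pi> \<sigma> \<phi> e (tk (Qf b a \<psi>) r)" unfolding tr_def by (intro disjI2 exI conjI) auto
qed

definition colum :: "position set => nat => position" where
 "colum \<pi> c = (THE r. (r, c) \<in> \<pi>, c)"

definition row :: "position set => nat => position" where
 "row \<pi> r = (r, THE c. (r, c) \<in> \<pi>)"

theorem model_labels:
 assumes "valued_permutation \<pi> \<sigma>" "models \<pi> \<sigma> \<phi>" "closed_fm \<phi>"
 shows "\<exists>(xs :: position list) ys lab. order_pair xs ys lab & order_pair.agrees xs ys lab \<sigma> \<phi> Nl &
  lab ` set xs \<subseteq> LB \<phi> & (\<exists>e\<in>set xs. evf \<phi> Nl (Cn (lab e) (Cn (lab e) r0)))"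
proof -
 obtain n where n: "n \<ge> 1" "is_permutation n \<pi>" using assms(1) by (auto simp: valued_permutation_def)
 have sub: "\<pi> \<subseteq> {1..n} \<times> {1..n}" and ex: "\<And>k. k \<in> {1..n} ==> (\<exists>!c. (k, c) \<in> \<pi>) & (\<exists>!r. (r, k) \<in> \<pi>)"
  using n(2) unfolding is_permutation_def by auto
 define xs where "xs = map (colum \<pi>) [1..<Suc n]"
 define ys where "ys = map (row \<pi>) [1..<Suc n]"
 have col: "colum \<pi> (snd e) = e" and rw: "row \<pi> (fst e) = e" and rg: "fst e \<in> {1..n}" "snd e \<in> {1..n}" if "e \<in> \<pi>" for e
 proof -
  show *: "fst e \<in> {1..n}" "snd e \<in> {1..n}" using that sub by (cases e; auto)+
  show "colum \<pi> (snd e) = e" using the1_equality[of "%r. (r, snd e) \<in> \<pi>" "fst e"] ex[OF *(2)] that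
   by (simp add: colum_def)
  show "row \<pi> (fst e) = e" using the1_equality[of "%c. (fst e, c) \<in> \<pi>" "snd e"] ex[OF *(1)] that
   by (simp add: row_def)
 qed
 have cin: "colum \<pi> k \<in> \<pi>" and rin: "row \<pi> k \<in> \<pi>" if "k \<in> {1..n}" for k
  using theI'[of "%r. (r, k) \<in> \<pi>"] theI'[of "%c. (k, c) \<in> \<pi>"] ex[OF that] by (simp_all add: colum_def row_def)
 have sx: "set xs = \<pi>"
 proof
  show "set xs \<subseteq> \<pi>" using cin by (auto simp: xs_def simp del: upt_Suc)
  show "\<pi> \<subseteq> set xs"
  proof
   fix e assume e: "e \<in> \<pi>"
   then have "snd e \<in> set [1..<Suc n]" using rg(2)[OF e] by (simp del: upt_Suc)
   then show "e \<in> set xs" unfolding xs_def set_map by (rule rev_image_eqI) (simp add: col[OF e])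
  qed
 qed
 have sy: "set ys = \<pi>"
 proof
  show "set ys \<subseteq> \<pi>" using rin by (auto simp: ys_def simp del: upt_Suc)
  show "\<pi> \<subseteq> set ys"
  proof
   fix e assume e: "e \<in> \<pi>"
   then have "fst e \<in> set [1..<Suc n]" using rg(1)[OF e] by (simp del: upt_Suc)
   then show "e \<in> set ys" unfolding ys_def set_map by (rule rev_image_eqI) (simp add: rw[OF e])
  qed
 qed
 have dx: "distinct xs" and dy: "distinct ys"
  unfolding xs_def ys_def by (auto simp: distinct_map inj_on_def colum_def row_def simp del: upt_Suc)
 have ne: "xs ~= []" using n(1) by (simp add: xs_def)
 have finp: "finite \<pi>" using sx finite_set[of xs] by simp
 have psx: "Suc (pos xs e) = snd e" and psy: "Suc (pos ys e) = fst e" if "e \<in> \<pi>" for e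
 proof -
  have xn: "xs ! i = colum \<pi> (Suc i)" "ys ! i = row \<pi> (Suc i)" "i < length xs" "i < length ys" if "i < n" for i
   using that by (simp_all add: xs_def ys_def del: upt_Suc)
  have "snd e - 1 < n" "fst e - 1 < n" "Suc (snd e - 1) = snd e" "Suc (fst e - 1) = fst e" using rg[OF that] by auto
  then have "xs ! (snd e - 1) = e" "ys ! (fst e - 1) = e" "snd e - 1 < length xs" "fst e - 1 < length ys"
   using col[OF that] rw[OF that] xn by simp_all
  then show "Suc (pos xs e) = snd e" "Suc (pos ys e) = fst e"
   using pos_nth[OF dx, of "snd e - 1"] pos_nth[OF dy, of "fst e - 1"] rg[OF that] by auto
 qed
 define pick where "pick d e = (THE f. dr xs ys d e f)" for d e
 have fn: "f = g" if "dr xs ys d e f" "dr xs ys d e g" for d e f g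
 proof -
  have "d = 0 \<or> d = 1 \<or> d = 2 \<or> d = 3" using that(1) by (auto simp: dr_def split: if_splits)
  then show ?thesis
   using that nxt_fun[OF dx, of e f g] nxt_fun[OF dy, of e f g] nxt_inj[OF dx, of f e g] nxt_inj[OF dy, of f e g]
   by (elim disjE) (simp_all add: dr_def)
 qed
 have pick: "pick d e = f" if "dr xs ys d e f" for d e f
  unfolding pick_def using that fn by blast
 have rv: "\<exists>d'<4. dr xs ys d' f e" if "dr xs ys d e f" for d e f
 proof -
  have "d = 0 \<or> d = 1 \<or> d = 2 \<or> d = 3" using that(1) by (auto simp: dr_def split: if_splits)
  then show ?thesis using that unfolding less4 by (elim disjE) (simp_all add: dr_def)
 qed
 have dlt: "d < 4" if "dr xs ys d e f" for d e f using that by (simp add: dr_def split: if_splits)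
 \<comment> \<open>Two elements conflict if they are neighbours of a common element. Going to one of
   4 neighbours and on to one of its 4 neighbours gives at most 16 conflicts, hence 17
   colours.\<close>
 define C where "C f g \<longleftrightarrow> f ~= g & (\<exists>e d d'. dr xs ys d e f & dr xs ys d' e g)" for f g
 have deg: "card {g \<in> \<pi>. C f g} \<le> 16" for f
 proof -
  have "{g \<in> \<pi>. C f g} \<subseteq> (%(d, d'). pick d' (pick d f)) ` ({..<4} \<times> {..<4})"
  proof
   fix g assume "g \<in> {g \<in> \<pi>. C f g}"
   then obtain e d d' where d: "dr xs ys d e f" "dr xs ys d' e g" unfolding C_def by blast
   obtain d'' where "d'' < 4" "dr xs ys d'' f e" using rv[OF d(1)] by blast
   then have "g = (%(d, d'). pick d' (pick d f)) (d'', d')" using pick d(2) by simp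
   moreover have "(d'', d') \<in> {..<4} \<times> {..<4}" using \<open>d'' < 4\<close> dlt[OF d(2)] by simp
   ultimately show "g \<in> (%(d, d'). pick d' (pick d f)) ` ({..<4} \<times> {..<4})" by (rule image_eqI)
  qed
  then have "card {g \<in> \<pi>. C f g} \<le> card ((%(d, d'). pick d' (pick d f)) ` ({..<4} \<times> {..<4::nat}))" by (intro card_mono) auto
  also have "\<dots> \<le> card ({..<4::nat} \<times> {..<4::nat})" by (rule card_image_le) simp
  finally show ?thesis by (simp add: card_cartesian_product)
 qed
 have Cs: "C g f" if Cfg: "C f g" for f g
 proof -
  obtain e d d' where "f ~= g" "dr xs ys d e f" "dr xs ys d' e g" using Cfg unfolding C_def by blast
  then show ?thesis unfolding C_def by blast
 qed
 have Ci: "\<not> C f f" for f by (simp add: C_def)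
 have "\<exists>cl :: position => nat. \<forall>f\<in>\<pi>. cl f \<le> 16 & (\<forall>g\<in>\<pi>. C f g --> cl f ~= cl g)"
  by (rule colouring[of \<pi> C 16]) (simp add: finp, rule deg, erule Cs, rule Ci)
 then obtain cl :: "position => nat" where cl: "\<forall>f\<in>\<pi>. cl f \<le> 16 & (\<forall>g\<in>\<pi>. C f g --> cl f ~= cl g)" ..
 have din: "e \<in> \<pi> & f \<in> \<pi>" if "dr xs ys d e f" for d e f
  using that nxt_set[of xs e f] nxt_set[of ys e f] nxt_set[of xs f e] nxt_set[of ys f e] sx sy
  by (simp add: dr_def split: if_splits)
 define lab where "lab e = Cn (un (cl e)) (tol (filter (tr \<pi> \<sigma> \<phi> e) (keyl \<phi> Nl)))" for e
 have op: "order_pair xs ys lab"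
 proof
  show "f = g" if d: "dr xs ys d e f" "dr xs ys d' e g" and "lab f = lab g" for d d' e f g
  proof (rule ccontr)
   assume "f ~= g"
   then have "C f g" using d unfolding C_def by blast
   moreover have "f \<in> \<pi>" "g \<in> \<pi>"
    using din[OF d(1)] din[OF d(2)] by simp_all
   ultimately have "cl f ~= cl g" using cl by blast
   then show False using \<open>lab f = lab g\<close> un_inj by (auto simp: lab_def)
  qed
 qed (use dx dy sx sy ne in \<open>auto simp: lab_def\<close>)
 have ps: "order_pair.ps xs ys e = e" if "e \<in> \<pi>" for e
  unfolding order_pair.ps_def[OF op] psx[OF that] psy[OF that] by simp
 have img: "order_pair.ps xs ys ` set xs = \<pi>" unfolding sx using ps by force
 have Uk: "U k (lab e) \<longleftrightarrow> tr \<pi> \<sigma> \<phi> e k" if "k \<in> set (keyl \<phi> Nl)" for k e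
  using that by (simp add: U_def lab_def)
 have ag: "order_pair.agrees xs ys lab \<sigma> \<phi> Nl"
  unfolding order_pair.agrees_def[OF op] img
 proof (intro ballI conjI)
  fix e assume "e \<in> set xs"
  then have e: "e \<in> \<pi>" using sx by simp
  show "U (Cn Nl (dg p)) (lab e) \<longleftrightarrow> p \<in> \<sigma> (order_pair.ps xs ys e)" if "p \<in> lets \<phi>" for p
   unfolding Uk[OF keyl_let[OF that]] ps[OF e] by (rule tr_let)
  fix q assume q: "q \<in> occ \<phi> Nl"
  obtain b a \<psi> r' where [simp]: "q = (b, a, \<psi>, r')" by (cases q)
  show "case q of (b, a, \<psi>, r') => U (tk (Qf b a \<psi>) r') (lab e) \<longleftrightarrow> sat \<pi> \<sigma> (%_. order_pair.ps xs ys e) (Qf b a \<psi>)"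
   using Uk[OF keyl_occ, of b a \<psi> r' e] q tr_occ[of \<pi> \<sigma> \<phi> e b a \<psi> r'] ps[OF e] by simp
 qed
 have "lab ` set xs \<subseteq> LB \<phi>"
 proof (rule image_subsetI)
  fix e assume "e \<in> set xs"
  then have e: "e \<in> \<pi>" using sx by simp
  let ?S = "{k \<in> set (keyl \<phi> Nl). tr \<pi> \<sigma> \<phi> e k}"
  have "filter (tr \<pi> \<sigma> \<phi> e) (keyl \<phi> Nl) = filter (%k. k \<in> ?S) (keyl \<phi> Nl)" by (rule filter_cong) auto
  then have "lab e = (%(c, S). Cn (un c) (tol (filter (%k. k \<in> S) (keyl \<phi> Nl)))) (cl e, ?S)" by (simp add: lab_def)
  moreover have "(cl e, ?S) \<in> {..16} \<times> Pow (set (keyl \<phi> Nl))" using cl e by auto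
  ultimately show "lab e \<in> LB \<phi>" unfolding LB_def by (rule image_eqI)
 qed
 moreover have "\<exists>e\<in>set xs. evf \<phi> Nl (Cn (lab e) (Cn (lab e) r0))"
 proof -
  define e where "e = hd xs"
  have e: "e \<in> set xs" using ne by (simp add: e_def)
  have "sat \<pi> \<sigma> (%_. e) \<phi>" using assms(2) e sx by (simp add: models_def)
  then have "evf \<phi> Nl (order_pair.zz xs ys lab (%_. e))"
   using order_pair.evf_sat[OF op ag, of "%_. e"] e ps[of e] img sx by simp
  moreover have "order_pair.rel xs ys e e = r0"
   by (rule order_pair.rel_r0[OF op]) (simp add: dr_def nxt_pos[OF dx] nxt_pos[OF dy])
  ultimately show ?thesis using e by (auto simp: order_pair.zz_def[OF op] intro!: bexI[of _ e])
 qed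
 ultimately show ?thesis using op ag by blast
qed

section \<open>Checking the formula\<close>

fun rft :: "(tree => tree => tree => tree) => tree => tree => tree" where
 "rft F e Nl = Nl"
| "rft F e (Cn a L) = F e (Cn a L) (rft F e L)"

text \<open>\<open>foldt\<close> consumes a list from the left. Folding over the reversed list while
  rebuilding it in the accumulator presents the tails from the shortest to the longest, which is the
  order of a right fold.\<close>

lemma rft_foldt:
 "foldt (%v. Cn (th (tt v)) (Cn (Cn (th (th v)) (th (tt (tt v))))
   (F (th (tt v)) (Cn (th (th v)) (th (tt (tt v)))) (tt (tt (tt v)))))) (rva L M) (Cn e (Cn Nl Nl)) =
  foldt (%v. Cn (th (tt v)) (Cn (Cn (th (th v)) (th (tt (tt v))))
   (F (th (tt v)) (Cn (th (th v)) (th (tt (tt v)))) (tt (tt (tt v)))))) M (Cn e (Cn L (rft F e L)))"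
 by (induction L arbitrary: M) auto

text \<open>The condition \<open>J\<close> on intermediate values is an invariant.\<close>

lemma FP_rft:
 assumes F: "FP (%z. F (th z) (th (tt z)) (tt (tt z)))" and e: "FP e" and L: "FP L" and r: "pb r"
  and J: "J Nl" "\<And>x a s S. J S ==> sz a \<le> sz (L x) ==> J (F (e x) (Cn a s) S) & sz (F (e x) (Cn a s) S) \<le> sz S + r x"
 shows "FP (%x. rft F (e x) (L x))"
proof -
 let ?h = "%v. Cn (th (tt v)) (Cn (Cn (th (th v)) (th (tt (tt v))))
   (F (th (tt v)) (Cn (th (th v)) (th (tt (tt v)))) (tt (tt (tt v)))))"
 let ?I = "%x S'. \<exists>s v. S' = Cn (e x) (Cn s v) & J v"
 have Fv: "FP (%v. F (th (tt v)) (Cn (th (th v)) (th (tt (tt v)))) (tt (tt (tt v))))"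
  using FP_comp[OF F, of "%v. Cn (th (tt v)) (Cn (Cn (th (th v)) (th (tt (tt v)))) (tt (tt (tt v))))"]
  by (simp add: FP_Cn FP_th FP_tt FP_id)
 have "FP (%x. foldt ?h (rva (L x) Nl) (Cn (e x) (Cn Nl Nl)))"
 proof (rule FP_fold[where I = ?I and r = "%x. sz (L x) + 1 + r x"])
  show "FP ?h" by (intro FP_Cn FP_th FP_tt FP_id Fv)
  show "FP (%x. rva (L x) Nl)" by (intro FP_rva L FP_const)
  show "FP (%x. Cn (e x) (Cn Nl Nl))" by (intro FP_Cn e FP_const)
  show "pb (%x. sz (L x) + 1 + r x)" by (intro pb_add pb_const r FP_size L)
  show "?I x (Cn (e x) (Cn Nl Nl))" for x using J(1) by blast
  fix x L' S' assume I: "?I x S'" and len: "sz L' \<le> sz (rva (L x) Nl)"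
  then obtain s v where S': "S' = Cn (e x) (Cn s v)" "J v" by blast
  have "sz (rva (L x) Nl) = sz (L x)" using sz_rva[of "L x" Nl] by simp
  then have a: "sz (th L') \<le> sz (L x)" using len sz_th[of L'] by simp
  note j = J(2)[OF S'(2) a, of s]
  show "?I x (?h (Cn L' S')) & sz (?h (Cn L' S')) \<le> sz S' + (sz (L x) + 1 + r x)"
   using j a by (simp add: S'(1))
 qed
 then have "FP (%x. tt (tt (foldt ?h (rva (L x) Nl) (Cn (e x) (Cn Nl Nl)))))" by (intro FP_tt)
 then show ?thesis unfolding rft_foldt by simp
qed

abbreviation "one \<equiv> Cn Nl Nl"
abbreviation "kL \<equiv> bt [False, False, False]"
abbreviation "kR \<equiv> bt [False, False, True]"
abbreviation "kD \<equiv> bt [False, True, False]"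
abbreviation "kN \<equiv> bt [False, True, True]"
abbreviation "kC \<equiv> bt [True, False, False]"
abbreviation "kO \<equiv> bt [True, False, True]"
abbreviation "kE \<equiv> bt [True, True, False]"
abbreviation "kA \<equiv> bt [True, True, True]"

lemma FPp_comp: "FPp P ==> FP f ==> FPp (%x. P (f x))"
 unfolding FPp_def by (rule FP_comp)

lemma FP_b2t: "FPp P ==> FP (%x. b2t (P x))"
 unfolding FPp_def .

lemmas FPs = FP_Cn FP_th FP_tt FP_const FP_b2t FP_if FPp_not FPp_conj FPp_disj FPp_imp FPp_iff FPp_const FPp_ex
 FPp_all FPp_ex_tails FPp_all_tails FP_eq FP_app FP_ctl FP_rva FP_id

lemma FPp_U: "FP f ==> FP g ==> FPp (%x. U (f x) (g x))"
proof -
 assume "FP f" "FP g"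
 have "U k l \<longleftrightarrow> (\<exists>a\<in>els (tt l). a = k)" for k l by (auto simp: U_def)
 moreover have "FPp (%x. (\<exists>a\<in>els (tt (g x)). a = f x))"
  by (intro FPs FP_comp[OF \<open>FP f\<close>] \<open>FP g\<close>)
 ultimately show ?thesis by simp
qed

text \<open>\<open>z\<close> holds the labels of both elements and their relative position,
  \<open>y\<close> the list of tokens from the current one on, \<open>S\<close> the values of the
  formulas to the right. A quantified formula is looked up in a label under the key
  \<open>y\<close>, and the value of its body is discarded.\<close>

definition smf :: "tree => tree => tree => tree" where
 "smf z y S = (let k = th (th y); p = tt (th y) in
   if k = kL then Cn (b2t (U (Cn Nl (tt p)) (if th p = Nl then th z else th (tt z)))) S
   else if k = kR then Cn (b2t (\<not> th p = tt p & (if th p = Nl then th (tt (tt z)) else th (tt (tt (tt z)))) ~= Nl)) S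
   else if k = kD then Cn (b2t (\<not> th p = tt p & (if th p = Nl then th (tt (tt (tt (tt z)))) else tt (tt (tt (tt (tt z))))) ~= Nl)) S
   else if k = kN then Cn (b2t (th S = Nl)) (tt S)
   else if k = kC then Cn (b2t (th S ~= Nl & th (tt S) ~= Nl)) (tt (tt S))
   else if k = kO then Cn (b2t (th S ~= Nl \<or> th (tt S) ~= Nl)) (tt (tt S))
   else Cn (b2t (U y (if p = Nl then th (tt z) else th z))) (tt S))"

text \<open>The list of tokens is evaluated from the right, with a stack of truth values.\<close>

definition sm :: "tree => tree => tree" where
 "sm z L = rft smf z L"

lemma sz_th_tt: "sz (th S) + sz (tt S) \<le> sz S + 1"
 by (cases S) auto

lemma sz_b2t: "sz (b2t b) \<le> 3"
 by (simp add: b2t_def)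

lemma FP_sm: "FP f ==> FP g ==> FP (%x. sm (f x) (g x))"
 unfolding sm_def
proof (rule FP_rft[where J = "%_. True" and r = "%_. 4"])
 show "FP (%z. smf (th z) (th (tt z)) (tt (tt z)))"
  unfolding smf_def Let_def by (intro FPs FPp_U)
 show "True & sz (smf (f x) (Cn a s) S) \<le> sz S + 4" for x a s S
  using sz_b2t sz_tt[of S] sz_tt[of "tt S"]
  by (auto simp: smf_def Let_def intro!: add_mono order_trans[OF sz_tt] simp del: bt.simps)
qed (auto intro: pb_const)

lemma sm_tk: "sm z (tk \<phi> r) = Cn (b2t (evf \<phi> r z)) (sm z r)"
proof (induction \<phi> arbitrary: r)
 case (Letter p a)
 show ?case by (cases a) (simp_all add: sm_def smf_def lv_def)
next
 case (Rightarrow a b)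
 show ?case by (cases a; cases b) (simp_all add: sm_def smf_def)
next
 case (Downarrow a b)
 show ?case by (cases a; cases b) (simp_all add: sm_def smf_def)
next
 case (Exists a \<phi>)
 have "sm z (tk (Exists a \<phi>) r) = smf z (tk (Exists a \<phi>) r) (sm z (tk \<phi> r))" by (simp add: sm_def)
 then show ?case using Exists by (cases a) (simp_all add: smf_def lv_def Let_def)
next
 case (Forall a \<phi>)
 have "sm z (tk (Forall a \<phi>) r) = smf z (tk (Forall a \<phi>) r) (sm z (tk \<phi> r))" by (simp add: sm_def)
 then show ?case using Forall by (cases a) (simp_all add: smf_def lv_def Let_def)
qed (simp_all add: sm_def smf_def)

section \<open>Free variables and well-formed token lists\<close>

definition uni :: "tree => tree => tree" where
 "uni u v = Cn (b2t (th u ~= Nl \<or> th v ~= Nl)) (b2t (tt u ~= Nl \<or> tt v ~= Nl))"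

definition fv1 :: "tree => tree" where
 "fv1 a = Cn (b2t (a = Nl)) (b2t (a ~= Nl))"

text \<open>The same evaluation with sets of free variables in place of truth values, each set being
  a pair of bits. The stack also shows how many complete formulas lie to the right, which
  \<open>arok\<close> uses to check the arity of connectives.\<close>

definition fsf :: "tree => tree => tree => tree" where
 "fsf z y S = (let k = th (th y); p = tt (th y) in
   if k = kL then Cn (fv1 (th p)) S
   else if k = kR \<or> k = kD then Cn (uni (fv1 (th p)) (fv1 (tt p))) S
   else if k = kN then S
   else if k = kC \<or> k = kO then Cn (uni (th S) (th (tt S))) (tt (tt S))
   else Cn (Cn (b2t (p ~= Nl & th (th S) ~= Nl)) (b2t (p = Nl & tt (th S) ~= Nl))) (tt S))"

definition fs :: "tree => tree" where
 "fs L = rft fsf Nl L"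

lemma FP_fs: "FP g ==> FP (%x. fs (g x))"
 unfolding fs_def
proof (rule FP_rft[where J = "%_. True" and r = "%_. 8"])
 show "FP (%z. fsf (th z) (th (tt z)) (tt (tt z)))"
  unfolding fsf_def Let_def uni_def fv1_def by (intro FPs)
 show "True & sz (fsf Nl (Cn a s) S) \<le> sz S + 8" for a s S
  using sz_tt[of S] sz_tt[of "tt S"]
  by (auto simp: fsf_def Let_def uni_def fv1_def b2t_def simp del: bt.simps)
qed (auto intro: pb_const FP_const)

definition fvp :: "fm => tree" where
 "fvp \<phi> = Cn (b2t (X \<in> free_vars \<phi>)) (b2t (Y \<in> free_vars \<phi>))"

lemma var_cases: "(a = X) \<or> (a = Y)"
 by (cases a) auto

lemma fs_Cn: "fs (Cn a L) = fsf Nl (Cn a L) (fs L)"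
 by (simp add: fs_def)

lemma fs_tk: "fs (tk \<phi> r) = Cn (fvp \<phi>) (fs r)"
proof (induction \<phi> arbitrary: r)
 case (Letter p a)
 show ?case by (cases a) (simp_all add: fs_Cn fsf_def fvp_def fv1_def)
next
 case (Rightarrow a b)
 show ?case by (cases a; cases b) (simp_all add: fs_Cn fsf_def fvp_def fv1_def uni_def)
next
 case (Downarrow a b)
 show ?case by (cases a; cases b) (simp_all add: fs_Cn fsf_def fvp_def fv1_def uni_def)
next
 case (Exists a \<phi>)
 then show ?case by (cases a) (simp_all add: fs_Cn fsf_def fvp_def)
next
 case (Forall a \<phi>)
 then show ?case by (cases a) (simp_all add: fs_Cn fsf_def fvp_def)
qed (simp_all add: fs_Cn fsf_def fvp_def uni_def)

definition isv :: "tree => bool" where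
 "isv a \<longleftrightarrow> a = Nl \<or> a = one"

text \<open>Digits are \<open>Nl\<close> or \<open>one\<close> and the top digit is
  \<open>one\<close>, so that the accepted numerals are exactly the values of
  \<open>dg\<close>.\<close>

definition digok :: "tree => bool" where
 "digok bs \<longleftrightarrow> (\<forall>y\<in>tails bs. isv (th y) & (tt y = Nl --> th y = one))"

definition tokok :: "tree => bool" where
 "tokok t \<longleftrightarrow> t = Cn (th t) (tt t) &
   (th t = kL & tt t = Cn (th (tt t)) (tt (tt t)) & isv (th (tt t)) & digok (tt (tt t)) \<or>
   (th t = kR \<or> th t = kD) & tt t = Cn (th (tt t)) (tt (tt t)) & isv (th (tt t)) & isv (tt (tt t)) \<or>
   (th t = kN \<or> th t = kC \<or> th t = kO) & tt t = Nl \<or>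
   (th t = kE \<or> th t = kA) & isv (tt t))"

definition arok :: "tree => tree => bool" where
 "arok t S \<longleftrightarrow> (th t = kN \<or> th t = kE \<or> th t = kA --> S ~= Nl) &
   (th t = kC \<or> th t = kO --> S ~= Nl & tt S ~= Nl)"

definition toksok :: "tree => bool" where
 "toksok L \<longleftrightarrow> (\<forall>y\<in>tails L. tokok (th y) & arok (th y) (fs (tt y)))"

lemma FPp_toksok: "FP f ==> FPp (%x. toksok (f x))"
 unfolding toksok_def tokok_def arok_def digok_def isv_def
 by (intro FPs FP_fs)

lemma isv_vt: "isv (vt a)" "isv b ==> \<exists>v. b = vt v"
proof -
 show "isv (vt a)" by (cases a) (simp_all add: isv_def)
 assume "isv b"
 then have "b = vt X \<or> b = vt Y" by (simp add: isv_def)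
 then show "\<exists>v. b = vt v" by blast
qed

lemma dg_Nl: "dg p = Nl \<longleftrightarrow> p = 0"
 by (subst dg.simps) simp

lemma digok_dg: "digok (dg p)"
proof (induction p rule: less_induct)
 case (less p)
 show ?case
 proof (cases "p = 0")
  case True
  then show ?thesis by (simp add: digok_def dg.simps[of 0])
 next
  case False
  have "dg (p div 2) = Nl --> b2t (odd p) = one"
  proof
   assume "dg (p div 2) = Nl"
   then have "p div 2 = 0" by (simp add: dg_Nl)
   then have "p = 1" using False by linarith
   then show "b2t (odd p) = one" by (simp add: b2t_def)
  qed
  moreover have "isv (b2t (odd p))" by (simp add: isv_def b2t_def)
  moreover have "dg p = Cn (b2t (odd p)) (dg (p div 2))" using False by (subst dg.simps) simp
  ultimately show ?thesis using less[of "p div 2"] False by (simp add: digok_def)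
 qed
qed

lemma digok_D: "digok bs ==> \<exists>p. bs = dg p"
proof (induction bs)
 case Nl
 show ?case by (intro exI[of _ 0]) (simp add: dg.simps[of 0])
next
 case (Cn a b)
 have ab: "isv a" "b = Nl --> a = one" "digok b" using Cn.prems by (auto simp: digok_def)
 then obtain q where q: "b = dg q" using Cn.IH by blast
 let ?p = "2 * q + (if a = one then 1 else 0)"
 have p: "?p ~= 0" using ab(2) q by (auto simp: dg_Nl)
 have "a = b2t (odd ?p)" using ab(1) by (auto simp: isv_def b2t_def)
 moreover have "?p div 2 = q" by simp
 moreover have "dg ?p = Cn (b2t (odd ?p)) (dg (?p div 2))" using p by (subst dg.simps) simp
 ultimately have "Cn a b = dg ?p" using q by metis
 then show ?case ..
qed

lemma toksok_tk: "toksok r ==> toksok (tk \<phi> r)"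
proof (induction \<phi> arbitrary: r)
 case (Conj \<phi> \<psi>)
 then have "toksok (tk \<phi> (tk \<psi> r))" by blast
 then show ?case by (simp add: toksok_def tokok_def arok_def fs_tk)
next
 case (Disj \<phi> \<psi>)
 then have "toksok (tk \<phi> (tk \<psi> r))" by blast
 then show ?case by (simp add: toksok_def tokok_def arok_def fs_tk)
next
 case (Neg \<phi>)
 then have "toksok (tk \<phi> r)" by blast
 then show ?case by (simp add: toksok_def tokok_def arok_def fs_tk)
next
 case (Exists a \<phi>)
 then have "toksok (tk \<phi> r)" by blast
 then show ?case by (simp add: toksok_def tokok_def arok_def fs_tk isv_vt)
next
 case (Forall a \<phi>)
 then have "toksok (tk \<phi> r)" by blast
 then show ?case by (simp add: toksok_def tokok_def arok_def fs_tk isv_vt)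
qed (simp_all add: toksok_def tokok_def arok_def isv_vt digok_dg)

text \<open>Read from the right, a list with correct tokens and arities is a sequence of formulas,
  one for each entry of the stack; each new token takes its arguments from the front of that
  sequence.\<close>

lemma parse: "toksok L ==> \<exists>\<phi>s. L = foldr tk \<phi>s Nl & fs L = tol (map fvp \<phi>s)"
proof (induction L)
 case Nl
 show ?case by (intro exI[of _ "[]"]) (simp add: fs_def)
next
 case (Cn t L)
 have t: "tokok t" "arok t (fs L)" "toksok L" using Cn.prems by (auto simp: toksok_def)
 then obtain \<phi>s where f: "L = foldr tk \<phi>s Nl" "fs L = tol (map fvp \<phi>s)" using Cn.IH by blast
 have gen: "\<exists>\<phi>s'. Cn t L = foldr tk \<phi>s' Nl"
 proof -
  have tt: "t = Cn (th t) (tt t)" using t(1) by (simp only: tokok_def)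
  from t(1) consider (L) a bs where "th t = kL" "tt t = Cn a bs" "isv a" "digok bs"
   | (R) a b where "th t = kR" "tt t = Cn a b" "isv a" "isv b" | (D) a b where "th t = kD" "tt t = Cn a b" "isv a" "isv b"
   | (N) "th t = kN" "tt t = Nl" | (C) "th t = kC" "tt t = Nl" | (O) "th t = kO" "tt t = Nl"
   | (Ex) "th t = kE" "isv (tt t)" | (A) "th t = kA" "isv (tt t)"
   unfolding tokok_def by metis
  then show ?thesis
  proof cases
   case L
   obtain v p where "a = vt v" "bs = dg p" using isv_vt(2)[OF L(3)] digok_D[OF L(4)] by blast
   then have "t = tok (Letter p v)" using tt L by simp
   then show ?thesis using f(1) by (intro exI[of _ "Letter p v # \<phi>s"]) simp
  next
   case R
   obtain v u where "a = vt v" "b = vt u" using isv_vt(2)[OF R(3)] isv_vt(2)[OF R(4)] by blast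
   then have "t = tok (Rightarrow v u)" using tt R by simp
   then show ?thesis using f(1) by (intro exI[of _ "Rightarrow v u # \<phi>s"]) simp
  next
   case D
   obtain v u where "a = vt v" "b = vt u" using isv_vt(2)[OF D(3)] isv_vt(2)[OF D(4)] by blast
   then have "t = tok (Downarrow v u)" using tt D by simp
   then show ?thesis using f(1) by (intro exI[of _ "Downarrow v u # \<phi>s"]) simp
  next
   case N
   then obtain \<phi> \<phi>s' where p: "\<phi>s = \<phi> # \<phi>s'" using t(2) f(2) by (cases \<phi>s) (auto simp: arok_def)
   have "t = tok (Neg \<phi>)" using tt N by simp
   then show ?thesis using f(1) p by (intro exI[of _ "Neg \<phi> # \<phi>s'"]) simp
  next
   case C
   then obtain \<phi> \<psi> \<phi>s' where p: "\<phi>s = \<phi> # \<psi> # \<phi>s'" using t(2) f(2) by (cases \<phi>s; cases "tl \<phi>s") (auto simp: arok_def)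
   have "t = tok (Conj \<phi> \<psi>)" using tt C by simp
   then show ?thesis using f(1) p by (intro exI[of _ "Conj \<phi> \<psi> # \<phi>s'"]) simp
  next
   case O
   then obtain \<phi> \<psi> \<phi>s' where p: "\<phi>s = \<phi> # \<psi> # \<phi>s'" using t(2) f(2) by (cases \<phi>s; cases "tl \<phi>s") (auto simp: arok_def)
   have "t = tok (Disj \<phi> \<psi>)" using tt O by simp
   then show ?thesis using f(1) p by (intro exI[of _ "Disj \<phi> \<psi> # \<phi>s'"]) simp
  next
   case Ex
   then obtain \<phi> \<phi>s' where p: "\<phi>s = \<phi> # \<phi>s'" using t(2) f(2) by (cases \<phi>s) (auto simp: arok_def)
   obtain v where "tt t = vt v" using isv_vt(2)[OF Ex(2)] by blast
   then have "t = tok (Exists v \<phi>)" using tt Ex by simp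
   then show ?thesis using f(1) p by (intro exI[of _ "Exists v \<phi> # \<phi>s'"]) simp
  next
   case A
   then obtain \<phi> \<phi>s' where p: "\<phi>s = \<phi> # \<phi>s'" using t(2) f(2) by (cases \<phi>s) (auto simp: arok_def)
   obtain v where "tt t = vt v" using isv_vt(2)[OF A(2)] by blast
   then have "t = tok (Forall v \<phi>)" using tt A by simp
   then show ?thesis using f(1) p by (intro exI[of _ "Forall v \<phi> # \<phi>s'"]) simp
  qed
 qed
 then obtain \<phi>s' where p: "Cn t L = foldr tk \<phi>s' Nl" ..
 have "fs (foldr tk ps Nl) = tol (map fvp ps)" for ps
  by (induction ps) (simp_all add: fs_tk, simp add: fs_def)
 then show ?case using p by metis
qed

section \<open>From token lists to words\<close>

definition tb :: "tree => tree" where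
 "tb t = app (th t) (if th t = kL then app (ctl (%_ y. Cn one (Cn (th y) Nl)) Nl (tt (tt t))) (Cn Nl (Cn (th (tt t)) Nl))
   else if th t = kR \<or> th t = kD then Cn (th (tt t)) (Cn (tt (tt t)) Nl)
   else if th t = kE \<or> th t = kA then Cn (tt t) Nl else Nl)"

definition bits :: "tree => tree" where
 "bits L = ctl (%_ y. tb (th y)) Nl L"

lemma FP_bits: "FP f ==> FP (%x. bits (f x))"
 unfolding bits_def tb_def by (intro FPs)

lemma bt_nat: "app (ctl (%_ y. Cn one (Cn (th y) Nl)) Nl (dg p)) (Cn Nl r) = app (bt (encode_nat p)) r"
proof (induction p rule: less_induct)
 case (less p)
 show ?case
 proof (cases "p = 0")
  case True
  then show ?thesis by (simp add: dg.simps[of 0] encode_nat.simps[of 0])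
 next
  case False
  have "dg p = Cn (b2t (odd p)) (dg (p div 2))" using False by (subst dg.simps) simp
  moreover have "encode_nat p = True # odd p # encode_nat (p div 2)" using False by (subst encode_nat.simps) simp
  ultimately show ?thesis using less[of "p div 2"] False by (simp add: b2t_def)
 qed
qed

lemma bt_var: "Cn (vt a) Nl = bt (encode_var a)"
 by (cases a) auto

lemma bits_tk: "bits (tk \<phi> r) = app (bt (encode \<phi>)) (bits r)"
proof (induction \<phi> arbitrary: r)
 case (Letter p a)
 show ?case by (simp add: bits_def tb_def bt_nat bt_append app_assoc bt_var del: encode_var.simps)
next
 case (Rightarrow a b)
 show ?case by (cases a; cases b) (simp_all add: bits_def tb_def)
next
 case (Downarrow a b)
 show ?case by (cases a; cases b) (simp_all add: bits_def tb_def)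
next
 case (Exists a \<phi>)
 then show ?case by (cases a) (simp_all add: bits_def tb_def app_assoc)
next
 case (Forall a \<phi>)
 then show ?case by (cases a) (simp_all add: bits_def tb_def app_assoc)
qed (simp_all add: bits_def tb_def bt_append app_assoc)

lemma bt_inj: "bt u = bt v ==> u = v"
proof (induction u arbitrary: v)
 case Nil
 then show ?case by (cases v) auto
next
 case (Cons a u)
 then show ?case by (cases v) (auto split: if_splits)
qed

text \<open>Words need not be parsed: the list of tokens is part of the certificate, and its
  encoding is compared with the input. A stack with the single entry \<open>Cn Nl Nl\<close> says
  that there is one formula and that it is closed.\<close>

lemma parse_formula:
 assumes "toksok L" "fs L = Cn (Cn Nl Nl) Nl" "bits L = bt w"
 shows "\<exists>\<phi>. L = tk \<phi> Nl & closed_fm \<phi> & w = encode \<phi>"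
proof -
 obtain \<phi>s where f: "L = foldr tk \<phi>s Nl" "fs L = tol (map fvp \<phi>s)" using parse[OF assms(1)] by blast
 obtain \<phi> where p: "\<phi>s = [\<phi>]"
 proof (cases \<phi>s)
  case Nil
  then show ?thesis using f(2) assms(2) by simp
 next
  case (Cons \<phi> \<psi>s)
  then have "\<psi>s = []" using f(2) assms(2) by (cases \<psi>s) simp_all
  then show ?thesis using Cons that by simp
 qed
 have L: "L = tk \<phi> Nl" using f p by simp
 have "fvp \<phi> = Cn Nl Nl" using f(2) p assms(2) by simp
 then have "X \<notin> free_vars \<phi>" "Y \<notin> free_vars \<phi>" unfolding fvp_def tree.inject b2t_Nl by simp_all
 note nf = this
 have "free_vars \<phi> = {}"
 proof (rule equals0I)
  fix a assume "a \<in> free_vars \<phi>"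
  then show False using nf by (cases a) simp_all
 qed
 moreover have "bits L = bt (encode \<phi>)" unfolding L bits_tk by (simp add: bits_def)
 then have "w = encode \<phi>" using assms(3) by (intro bt_inj) simp
 ultimately show ?thesis using L by (intro exI[of _ \<phi>]) (simp add: closed_fm_def)
qed

lemma formula_ok:
 assumes "closed_fm \<phi>"
 shows "toksok (tk \<phi> Nl) & fs (tk \<phi> Nl) = Cn (Cn Nl Nl) Nl & bits (tk \<phi> Nl) = bt (encode \<phi>)"
 using assms toksok_tk[of Nl \<phi>]
 unfolding fs_tk bits_tk closed_fm_def fvp_def by (simp add: fs_def bits_def b2t_def toksok_def)

definition qt :: "tree => tree set" where
 "qt L = {y \<in> tails L. th (th y) = kE \<or> th (th y) = kA}"

lemma qt_Cn: "qt (Cn t L) = (if th t = kE \<or> th t = kA then {Cn t L} else {}) \<union> qt L"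
 by (auto simp: qt_def)

lemma qt_tk: "qt (tk \<phi> r) = (%(b, a, \<psi>, r'). tk (Qf b a \<psi>) r') ` occ \<phi> r \<union> qt r"
 by (induction \<phi> arbitrary: r) (simp_all add: qt_Cn image_Un Un_assoc Qf_def)

section \<open>Binary numbers\<close>

fun nv :: "tree => nat" where
 "nv Nl = 0"
| "nv (Cn a b) = (if th a ~= Nl then 1 else 0) + 2 * nv b"

text \<open>Both digits have the same size, so that the size of a sum grows additively.\<close>

definition dgt :: "bool => tree" where
 "dgt b = (if b then Cn one Nl else Cn Nl one)"

text \<open>One column of addition. The accumulator holds the carry, the rests of both summands and
  the digits produced, lowest last;
  \<open>p \<longleftrightarrow> (q \<longleftrightarrow> c)\<close> is the parity of the three
  bits.\<close>

definition addh :: "tree => tree" where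
 "addh v = (let S = tt v; c = th S ~= Nl; p = th (th (th (tt S))) ~= Nl; q = th (th (th (tt (tt S)))) ~= Nl in
   Cn (b2t (p & q \<or> p & c \<or> q & c)) (Cn (tt (th (tt S))) (Cn (tt (th (tt (tt S))))
    (Cn (if p \<longleftrightarrow> (q \<longleftrightarrow> c) then Cn one Nl else Cn Nl one) (tt (tt (tt S)))))))"

definition nadd :: "tree => tree => tree" where
 "nadd x y = rva (tt (tt (tt (foldt addh (Cn Nl (app x y)) (Cn Nl (Cn x (Cn y Nl))))))) Nl"

text \<open>\<open>rvv a r\<close> is the value of a number whose higher part has the value
  \<open>r\<close> and whose lower digits are \<open>a\<close>, the lowest last.\<close>

fun rvv :: "tree => nat => nat" where
 "rvv Nl r = r"
| "rvv (Cn a b) r = rvv b ((if th a ~= Nl then 1 else 0) + 2 * r)"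

lemma nv_rva: "nv (rva a t) = rvv a (nv t)"
 by (induction a arbitrary: t) auto

lemma len_app: "len (app x y) = len x + len y"
 by (induction x) auto

lemma len_rva: "len (rva x y) = len x + len y"
 by (induction x arbitrary: y) auto

abbreviation "cv c \<equiv> (if c ~= Nl then 1 else 0) :: nat"

lemma addh_step:
 "\<exists>c' d. addh (Cn M (Cn c (Cn x (Cn y a)))) = Cn c' (Cn (tt x) (Cn (tt y) (Cn (dgt d) a))) &
  cv c + nv x + nv y = (if d then 1 else 0) + 2 * (cv c' + nv (tt x) + nv (tt y))"
proof -
 have nvx: "nv t = (if th (th t) ~= Nl then 1 else 0) + 2 * nv (tt t)" for t by (cases t) auto
 show ?thesis
  unfolding addh_def Let_def by (subst nvx[of x], subst nvx[of y]) (auto simp: dgt_def b2t_def)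
qed

lemma add_loop:
 "\<exists>c' x' y' a'. foldt addh M (Cn c (Cn x (Cn y a))) = Cn c' (Cn x' (Cn y' a')) &
  rvv a' (cv c' + nv x' + nv y') = rvv a (cv c + nv x + nv y) &
  cv c' + nv x' + nv y' = (cv c + nv x + nv y) div 2 ^ len M & sz a' = sz a + 6 * len M & len a' = len a + len M"
proof (induction M arbitrary: c x y a)
 case Nl
 show ?case by (intro exI[of _ c] exI[of _ x] exI[of _ y] exI[of _ a]) simp
next
 case (Cn m M)
 obtain c1 d where s: "addh (Cn (Cn m M) (Cn c (Cn x (Cn y a)))) = Cn c1 (Cn (tt x) (Cn (tt y) (Cn (dgt d) a)))"
  "cv c + nv x + nv y = (if d then 1 else 0) + 2 * (cv c1 + nv (tt x) + nv (tt y))"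
  using addh_step[of "Cn m M" c x y a] by blast
 obtain c' x' y' a' where r: "foldt addh M (Cn c1 (Cn (tt x) (Cn (tt y) (Cn (dgt d) a)))) = Cn c' (Cn x' (Cn y' a'))"
  "rvv a' (cv c' + nv x' + nv y') = rvv (Cn (dgt d) a) (cv c1 + nv (tt x) + nv (tt y))"
  "cv c' + nv x' + nv y' = (cv c1 + nv (tt x) + nv (tt y)) div 2 ^ len M" "sz a' = sz (Cn (dgt d) a) + 6 * len M"
  "len a' = len (Cn (dgt d) a) + len M"
  using Cn.IH(2)[of c1 "tt x" "tt y" "Cn (dgt d) a"] by blast
 have "rvv (Cn (dgt d) a) (cv c1 + nv (tt x) + nv (tt y)) = rvv a (cv c + nv x + nv y)"
  unfolding s(2) by (simp add: dgt_def)
 moreover have "(cv c1 + nv (tt x) + nv (tt y)) div 2 ^ len M = (cv c + nv x + nv y) div 2 ^ len (Cn m M)"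
 proof -
  have "(cv c + nv x + nv y) div 2 = cv c1 + nv (tt x) + nv (tt y)" unfolding s(2) by (cases d) simp_all
  then show ?thesis by (simp add: div_mult2_eq)
 qed
 moreover have "sz (Cn (dgt d) a) + 6 * len M = sz a + 6 * len (Cn m M)" by (simp add: dgt_def)
 ultimately show ?case using s(1) r
  by (intro exI[of _ c'] exI[of _ x'] exI[of _ y'] exI[of _ a']) (simp only: foldt.simps len.simps add_Suc_right add_Suc)
qed

lemma nv_less: "nv x < 2 ^ len x"
 by (induction x) auto

lemma nadd: "nv (nadd x y) = nv x + nv y" "sz (nadd x y) = 1 + 6 * (len x + len y + 1)" "len (nadd x y) = len x + len y + 1"
proof -
 let ?M = "Cn Nl (app x y)"
 obtain c' x' y' a' where r: "foldt addh ?M (Cn Nl (Cn x (Cn y Nl))) = Cn c' (Cn x' (Cn y' a'))"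
  "rvv a' (cv c' + nv x' + nv y') = rvv Nl (cv Nl + nv x + nv y)"
  "cv c' + nv x' + nv y' = (cv Nl + nv x + nv y) div 2 ^ len ?M" "sz a' = sz Nl + 6 * len ?M" "len a' = len Nl + len ?M"
  using add_loop[of ?M Nl x y Nl] by blast
 have "nv x + nv y < 2 ^ len ?M"
 proof -
  have "(2::nat) ^ len x \<le> 2 ^ (len x + len y)" "(2::nat) ^ len y \<le> 2 ^ (len x + len y)" by (intro power_increasing; simp)+
  then have "nv x + nv y < 2 * 2 ^ (len x + len y)" using nv_less[of x] nv_less[of y] by linarith
  then show ?thesis by (simp add: len_app)
 qed
 then have "cv c' + nv x' + nv y' = 0" using r(3) by simp
 then have "rvv a' 0 = nv x + nv y" using r(2) by simp
 then show "nv (nadd x y) = nv x + nv y" by (simp only: nadd_def r(1) tt.simps nv_rva nv.simps)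
 show "sz (nadd x y) = 1 + 6 * (len x + len y + 1)" using r(4) sz_rva[of a' Nl]
  by (simp only: nadd_def r(1) tt.simps) (simp add: len_app)
 show "len (nadd x y) = len x + len y + 1" using r(5)
  by (simp only: nadd_def r(1) tt.simps) (simp add: len_rva len_app)
qed

lemma FP_nadd:
 assumes "FP f" "FP g"
 shows "FP (%x. nadd (f x) (g x))"
proof -
 let ?I = "%S'. \<exists>c x y a. S' = Cn c (Cn x (Cn y a))"
 have "FP (%x. foldt addh (Cn Nl (app (f x) (g x))) (Cn Nl (Cn (f x) (Cn (g x) Nl))))"
 proof (rule FP_fold[where I = "%_. ?I" and r = "%_. 20"])
  show "FP addh" unfolding addh_def Let_def by (intro FPs)
  show "FP (%x. Cn Nl (app (f x) (g x)))" "FP (%x. Cn Nl (Cn (f x) (Cn (g x) Nl)))" by (intro FPs assms)+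
  show "?I (addh (Cn L' S')) & sz (addh (Cn L' S')) \<le> sz S' + 20" if I: "?I S'" for L' S'
  proof -
   obtain c x y a where S': "S' = Cn c (Cn x (Cn y a))" using I by blast
   obtain c' d where "addh (Cn L' S') = Cn c' (Cn (tt x) (Cn (tt y) (Cn (dgt d) a)))"
    using addh_step[of L' c x y a] unfolding S' by blast
   moreover have "sz (th (addh (Cn L' S'))) \<le> 3" unfolding addh_def Let_def by (simp add: sz_b2t)
   ultimately show ?thesis unfolding S' using sz_tt[of x] sz_tt[of y] by (simp add: dgt_def)
  qed
 qed (auto intro: pb_const)
 then show ?thesis unfolding nadd_def by (intro FPs)
qed

fun elsl :: "tree => tree list" where
 "elsl Nl = []"
| "elsl (Cn a b) = a # elsl b"

lemma els_elsl: "els t = set (elsl t)"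
 by (induction t) auto

lemma elsl_lt [simp]: "elsl (tol l) = l"
 by (induction l) auto

definition nsum :: "(tree => tree => bool) => tree => tree => tree" where
 "nsum Q e L = rft (%e y S. nadd (if Q e (th y) then th (th y) else Nl) S) e L"

lemma len_sz: "len t \<le> sz t"
 by (induction t) auto

text \<open>A sum gets one digit more than both summands together. This is wasteful, but makes the
  growth along the list additive, as \<open>FP_rft\<close> demands; the invariant says that every
  digit occupies 6 symbols.\<close>

lemma FP_nsum:
 assumes "FPp (%z. Q (th z) (th (tt z)))" "FP e" "FP L"
 shows "FP (%x. nsum Q (e x) (L x))"
 unfolding nsum_def
proof (rule FP_rft[where J = "%S. sz S = 1 + 6 * len S" and r = "%x. 6 * sz (L x) + 6"])
 show "FP (%z. nadd (if Q (th z) (th (th (tt z))) then th (th (th (tt z))) else Nl) (tt (tt z)))"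
 proof (intro FP_nadd FP_if FPs)
  have "FPp (%z. Q (th (Cn (th z) (Cn (th (th (tt z))) Nl))) (th (tt (Cn (th z) (Cn (th (th (tt z))) Nl)))))"
   by (rule FPp_comp[OF assms(1)]) (intro FPs)
  then show "FPp (%z. Q (th z) (th (th (tt z))))" by simp
 qed
 show "pb (%x. 6 * sz (L x) + 6)" by (intro pb_add pb_mult pb_const FP_size assms)
 fix x a s S assume J: "sz S = 1 + 6 * len S" and a: "sz a \<le> sz (L x)"
 have "len (if Q (e x) a then th a else Nl) \<le> sz (L x)"
  using len_sz[of "th a"] sz_th[of a] a by auto
 then have "len (if Q (e x) (th (Cn a s)) then th a else Nl) \<le> sz (L x)" by simp
 then show "sz (nadd (if Q (e x) (th (Cn a s)) then th (th (Cn a s)) else Nl) S) = 1 + 6 * len (nadd (if Q (e x) (th (Cn a s)) then th (th (Cn a s)) else Nl) S) &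
   sz (nadd (if Q (e x) (th (Cn a s)) then th (th (Cn a s)) else Nl) S) \<le> sz S + (6 * sz (L x) + 6)"
  unfolding nadd th.simps using J by simp
qed (use assms in auto)

lemma nv_nsum: "nv (nsum Q e L) = (\<Sum>a\<leftarrow>elsl L. if Q e a then nv (th a) else 0)"
 unfolding nsum_def by (induction L) (auto simp: nadd)

definition eqh :: "tree => tree" where
 "eqh v = (let S = tt v in Cn (tt (th S)) (Cn (tt (th (tt S)))
   (if th (th (th S)) ~= Nl \<longleftrightarrow> th (th (th (tt S))) ~= Nl then tt (tt S) else one)))"

text \<open>Sums carry leading zeros, so equality of values is not equality of trees.\<close>

definition neq :: "tree => tree => bool" where
 "neq x y \<longleftrightarrow> tt (tt (foldt eqh (app x y) (Cn x (Cn y Nl)))) = Nl"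

lemma eq_loop:
 "len x \<le> len M ==> len y \<le> len M ==> tt (tt (foldt eqh M (Cn x (Cn y b)))) = Nl \<longleftrightarrow> b = Nl & nv x = nv y"
proof (induction M arbitrary: x y b)
 case Nl
 then show ?case by (cases x; cases y) auto
next
 case (Cn m M)
 have l: "len (tt x) \<le> len M" "len (tt y) \<le> len M" using Cn.prems by (cases x; simp)  (use Cn.prems in \<open>cases y; simp\<close>)
 have nvx: "nv t = (if th (th t) ~= Nl then 1 else 0) + 2 * nv (tt t)" for t by (cases t) auto
 have "nv x = nv y \<longleftrightarrow> (th (th x) ~= Nl \<longleftrightarrow> th (th y) ~= Nl) & nv (tt x) = nv (tt y)"
  unfolding nvx[of x] nvx[of y] by (simp add: Suc_double_not_eq_double double_not_eq_Suc_double)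
 then show ?case using Cn.IH(2)[OF l] by (simp add: eqh_def Let_def)
qed

lemma neq: "neq x y \<longleftrightarrow> nv x = nv y"
 unfolding neq_def by (subst eq_loop) (simp_all add: len_app)

lemma FPp_neq:
 assumes "FP f" "FP g"
 shows "FPp (%x. neq (f x) (g x))"
proof -
 let ?I = "%S'. \<exists>x y b. S' = Cn x (Cn y b)"
 have "FP (%x. foldt eqh (app (f x) (g x)) (Cn (f x) (Cn (g x) Nl)))"
 proof (rule FP_fold[where I = "%_. ?I" and r = "%_. 5"])
  show "FP eqh" unfolding eqh_def Let_def by (intro FPs)
  show "FP (%x. app (f x) (g x))" "FP (%x. Cn (f x) (Cn (g x) Nl))" by (intro FPs assms)+
  show "?I (eqh (Cn L' S')) & sz (eqh (Cn L' S')) \<le> sz S' + 5" if I: "?I S'" for L' S'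
  proof -
   obtain x y b where "S' = Cn x (Cn y b)" using I by blast
   then show ?thesis using sz_tt[of x] sz_tt[of y] by (auto simp: eqh_def Let_def)
  qed
 qed (auto intro: pb_const)
 then show ?thesis unfolding neq_def by (intro FPs)
qed

section \<open>Canonical numerals for multiplicities\<close>

fun mb :: "nat => tree" where
 "mb n = (if n = 0 then Nl else Cn (dgt (odd n)) (mb (n div 2)))"

declare mb.simps [simp del]

text \<open>Nonempty with top digit 1. Such a numeral has value 1 exactly if it has one digit
  (\<open>mok_nv\<close>), so multiplicity 1 is recognised without arithmetic.\<close>

definition mok :: "tree => bool" where
 "mok m \<longleftrightarrow> m ~= Nl & (\<forall>y\<in>tails m. tt y = Nl --> th (th y) ~= Nl)"

lemma mok_nv: "mok m ==> nv m \<ge> 1 & (tt m = Nl \<longleftrightarrow> nv m = 1)"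
proof (induction m)
 case (Cn a b)
 show ?case
 proof (cases "b = Nl")
  case True
  then show ?thesis using Cn.prems by (simp add: mok_def)
 next
  case False
  then have "mok b" using Cn.prems by (simp add: mok_def)
  then show ?thesis using Cn.IH(2) False by auto
 qed
qed (simp add: mok_def)

lemma nv_mb: "nv (mb n) = n"
proof (induction n rule: less_induct)
 case (less n)
 show ?case
 proof (cases "n = 0")
  case False
  have "mb n = Cn (dgt (odd n)) (mb (n div 2))" using False by (subst mb.simps) simp
  moreover have "nv (mb (n div 2)) = n div 2" using less False by simp
  ultimately have "nv (mb n) = (if odd n then 1 else 0) + 2 * (n div 2)" by (simp add: dgt_def)
  then show ?thesis by (cases "odd n") simp_all
 qed (simp add: mb.simps[of 0])
qed

lemma mb_Nl: "mb n = Nl \<longleftrightarrow> n = 0"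
 by (subst mb.simps) simp

lemma mok_mb: "n \<ge> 1 ==> mok (mb n)"
proof (induction n rule: less_induct)
 case (less n)
 have n: "mb n = Cn (dgt (odd n)) (mb (n div 2))" using less.prems by (subst mb.simps) simp
 show ?case
 proof (cases "n div 2 = 0")
  case True
  then have "n = 1" using less.prems by linarith
  then show ?thesis unfolding mok_def n by (simp add: mb_Nl dgt_def mb.simps[of 0])
 next
  case False
  then have "mok (mb (n div 2))" using less by simp
  then show ?thesis unfolding mok_def n by (simp add: mb_Nl False)
 qed
qed

lemma sz_mb: "n < 2 ^ k ==> sz (mb n) \<le> 1 + 6 * k"
proof (induction k arbitrary: n)
 case 0
 then show ?case by (simp add: mb.simps[of 0])
next
 case (Suc k)
 show ?case
 proof (cases "n = 0")
  case False
  have "mb n = Cn (dgt (odd n)) (mb (n div 2))" using False by (subst mb.simps) simp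
  moreover have "n div 2 < 2 ^ k" using Suc.prems by simp
  ultimately show ?thesis using Suc.IH[of "n div 2"] by (simp add: dgt_def)
 qed (simp add: mb.simps[of 0])
qed

lemma un_app: "app (un a) (un b) = un (a + b)"
 unfolding un_def by (induction a) auto

lemma ctl_un: "ctl (%e y. un (g e (th y))) e L = un (\<Sum>a\<leftarrow>elsl L. g e a)"
proof (induction L)
 case Nl
 show ?case by (simp add: un_def)
qed (simp add: un_app)

text \<open>Whether a total equals 1 does not change when multiplicities are truncated at 2. Hence
  \<open>startt\<close> and \<open>king\<close> can count in unary, although the multiplicities are
  huge.\<close>

lemma sum_one_cong:
 "(\<And>p. p \<in> set P ==> f p = g p \<or> (f p \<ge> 2 & g p \<ge> (2::nat))) ==> (\<Sum>p\<leftarrow>P. f p) = 1 \<longleftrightarrow> (\<Sum>p\<leftarrow>P. g p) = (1::nat)"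
proof -
 have "(\<forall>p\<in>set P. f p = g p \<or> (f p \<ge> 2 & g p \<ge> (2::nat))) ==> min 2 (\<Sum>p\<leftarrow>P. f p) = min 2 (\<Sum>p\<leftarrow>P. g p)"
 proof (induction P)
  case (Cons p P)
  then have "min 2 (\<Sum>p\<leftarrow>P. f p) = min 2 (\<Sum>p\<leftarrow>P. g p)" "f p = g p \<or> (f p \<ge> 2 & g p \<ge> 2)" by simp_all
  then show ?case by (auto simp: min_def split: if_splits)
 qed simp
 then show "(\<And>p. p \<in> set P ==> f p = g p \<or> (f p \<ge> 2 & g p \<ge> (2::nat))) ==> ?thesis"
  by (auto simp: min_def split: if_splits)
qed

section \<open>Checking a certificate\<close>

definition lastt :: "tree => tree" where
 "lastt w = th (rva w Nl)"

definition dec :: "tree => bool \<times> tree list" where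
 "dec q = (th q ~= Nl, elsl (tt q))"

definition dp :: "tree => nat \<times> bool \<times> tree list" where
 "dp p = (nv (th p), dec (tt p))"

definition invt :: "bool => tree => tree" where
 "invt d q = ins d (if d \<or> th q ~= Nl then th (tt q) else lastt (tt q))"

definition outt :: "bool => tree => tree" where
 "outt d q = outs d (if d \<or> th q ~= Nl then lastt (tt q) else th (tt q))"

lemma th_hd: "w ~= Nl ==> th w = hd (elsl w) & elsl w ~= []"
 by (cases w) auto

lemma lastt_last: "w ~= Nl ==> lastt w = last (elsl w)"
proof -
 have "th (rva w t) = (if w = Nl then th t else last (elsl w))" for t
 proof (induction w arbitrary: t)
  case (Cn a b)
  then show ?case using th_hd[of b] by (cases b) auto
 qed simp
 then show "w ~= Nl ==> ?thesis" by (simp add: lastt_def)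
qed

lemma inv_dec: "tt q ~= Nl ==> inv d (dec q) = invt d q & outv d (dec q) = outt d q"
 using th_hd[of "tt q"] lastt_last[of "tt q"]
 by (auto simp: inv_def outv_def dec_def invt_def outt_def ori_def hd_rev last_rev)

definition wordt :: "tree => bool" where
 "wordt q \<longleftrightarrow> tt q ~= Nl & (\<forall>y\<in>tails (tt q). tt y ~= Nl --> nx (th q ~= Nl) (th y) (th (tt y))) &
   (\<forall>s\<in>els (tt q). star_ok (th q ~= Nl) s) & last_ok (lastt (tt q)) & first_ok (th (tt q))"

lemma succ_tails: "successively R (elsl w) \<longleftrightarrow> (\<forall>y\<in>tails w. tt y ~= Nl --> R (th y) (th (tt y)))"
proof (induction w)
 case (Cn a b)
 then show ?case by (cases b) auto
qed simp

lemma wordt: "wordt q \<longleftrightarrow> tt q ~= Nl & word_ok (fst (dec q)) (snd (dec q))"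
proof (cases "tt q = Nl")
 case False
 then show ?thesis
  using th_hd[OF False] lastt_last[OF False]
  by (simp add: wordt_def word_ok_def dec_def succ_tails els_elsl)
qed (simp add: wordt_def)

definition goodt :: "bool => tree => bool" where
 "goodt d L \<longleftrightarrow> (\<forall>y\<in>tails L. invt d (th y) = Nl \<or> (\<exists>q\<in>els (tt y). outt d q = invt d (th y)))"

lemma goodt: "(\<And>q. q \<in> els L ==> tt q ~= Nl) ==> goodt d L \<longleftrightarrow> rooted d (map dec (elsl L))"
proof (induction L)
 case (Cn q L)
 have "(\<exists>r\<in>set (map dec (elsl L)). outv d r = inv d (dec q)) \<longleftrightarrow> (\<exists>r\<in>els L. outt d r = invt d q)"
  using inv_dec Cn.prems by (simp add: els_elsl)
 then show ?case using Cn inv_dec[of q d] by (simp add: goodt_def)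
qed (simp add: goodt_def)

definition tls :: "tree => tree" where
 "tls L = ctl (%_ y. Cn (tt (th y)) Nl) Nl L"

lemma elsl_tls: "elsl (tls L) = map tt (elsl L)"
 unfolding tls_def by (induction L) auto

definition startt :: "bool => tree => tree" where
 "startt d P = ctl (%_ y. if invt d (tt (th y)) = Nl then (if tt (th (th y)) = Nl then un 1 else un 2) else un 0) Nl P"

definition king :: "tree => tree => bool" where
 "king t P \<longleftrightarrow> ctl (%t y. ctl (%e y'. if th (th y') = th e then (if tt e = Nl then un 1 else un 2) else un 0)
   (Cn t (tt (th (th y)))) (tt (tt (th y)))) t P = un 1"

definition labt :: "tree => tree" where
 "labt P = ctl (%_ y. ctl (%_ y'. Cn (th (th y')) Nl) Nl (tt (tt (th y)))) Nl P"

text \<open>Balance is tested at the vertices where some piece starts or ends; at all others both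
  flows are 0.\<close>

definition flowt :: "bool => tree => bool" where
 "flowt d P \<longleftrightarrow> (\<forall>p\<in>els P. \<forall>v\<in>els (Cn (invt d (tt p)) (Cn (outt d (tt p)) Nl)).
   neq (nsum (%e a. invt d (tt a) = e) v P) (nsum (%e a. outt d (tt a) = e) v P)) & startt d P = un 1"

definition piecest :: "tree => bool" where
 "piecest P \<longleftrightarrow> (\<forall>p\<in>els P. mok (th p) & wordt (tt p))"

lemma piecest: "piecest P ==> pieces_ok (map dp (elsl P))"
 unfolding piecest_def pieces_ok_def using mok_nv by (auto simp: dp_def wordt els_elsl)

lemma un1: "un 1 = un n \<longleftrightarrow> n = 1" "un n = un 1 \<longleftrightarrow> n = 1"
 using un_inj by auto

lemma mok_two: "mok m ==> (if tt m = Nl then 1 else 2) = nv m \<or> (2 \<le> nv m & tt m ~= Nl)"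
 using mok_nv[of m] by (cases "tt m = Nl") auto

lemma startt:
 assumes "piecest P"
 shows "startt d P = un 1 \<longleftrightarrow> flow (%p. inv d p = Nl) (map dp (elsl P)) = 1"
proof -
 have "startt d P = ctl (%_ y. un ((%_ p. if invt d (tt p) = Nl then (if tt (th p) = Nl then 1 else 2) else 0) Nl (th y))) Nl P"
  unfolding startt_def by (simp add: if_distrib[of un] cong: if_cong)
 also have "\<dots> = un (\<Sum>p\<leftarrow>elsl P. if invt d (tt p) = Nl then (if tt (th p) = Nl then 1 else 2) else 0)"
  by (rule ctl_un)
 finally have "startt d P = un 1 \<longleftrightarrow> (\<Sum>p\<leftarrow>elsl P. if invt d (tt p) = Nl then (if tt (th p) = Nl then 1 else 2) else 0) = (1::nat)"
  by (simp only: un1)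
 also have "\<dots> \<longleftrightarrow> (\<Sum>p\<leftarrow>elsl P. if inv d (dec (tt p)) = Nl then nv (th p) else 0) = 1"
 proof (rule sum_one_cong)
  fix p assume "p \<in> set (elsl P)"
  then have "mok (th p)" "tt (tt p) ~= Nl" using assms by (auto simp: piecest_def els_elsl wordt)
  then show "(if invt d (tt p) = Nl then if tt (th p) = Nl then 1 else 2 else 0) = (if inv d (dec (tt p)) = Nl then nv (th p) else 0) \<or>
   2 \<le> (if invt d (tt p) = Nl then if tt (th p) = Nl then 1 else 2 else (0::nat)) & 2 \<le> (if inv d (dec (tt p)) = Nl then nv (th p) else 0)"
   using mok_two[of "th p"] inv_dec[of "tt p" d] by auto
 qed
 also have "(\<Sum>p\<leftarrow>elsl P. if inv d (dec (tt p)) = Nl then nv (th p) else 0) = flow (%p. inv d p = Nl) (map dp (elsl P))"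
  by (simp add: flow_def dp_def comp_def)
 finally show ?thesis .
qed

lemma king:
 assumes "piecest P"
 shows "king t P \<longleftrightarrow> tot (map dp (elsl P)) t = 1"
proof -
 have inner: "ctl (%e y'. if th (th y') = th e then (if tt e = Nl then un 1 else un 2) else un 0) (Cn t m) w =
   un ((if m = Nl then 1 else 2) * count_list (map th (elsl w)) t)" for m w
 proof (induction w)
  case Nl
  show ?case by (simp add: un_def)
 next
  case (Cn a b)
  then show ?case by (auto simp: un_app)
 qed
 have "king t P \<longleftrightarrow> ctl (%t y. un ((%t p. (if tt (th p) = Nl then 1 else 2) * count_list (map th (elsl (tt (tt p)))) t) t (th y))) t P = un 1"
 proof -
  have "ctl (%t y. ctl (%e y'. if th (th y') = th e then (if tt e = Nl then un 1 else un 2) else un 0)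
    (Cn t (tt (th (th y)))) (tt (tt (th y)))) t P =
   ctl (%t y. un ((%t p. (if tt (th p) = Nl then 1 else 2) * count_list (map th (elsl (tt (tt p)))) t) t (th y))) t P"
   by (induction P) (simp_all add: inner)
  then show ?thesis unfolding king_def by simp
 qed
 also have "\<dots> \<longleftrightarrow> (\<Sum>p\<leftarrow>elsl P. (if tt (th p) = Nl then 1 else 2) * count_list (map th (elsl (tt (tt p)))) t) = 1"
  unfolding ctl_un[of "%t p. (if tt (th p) = Nl then 1 else 2) * count_list (map th (elsl (tt (tt p)))) t"]
  by (rule un1(2))
 also have "\<dots> \<longleftrightarrow> (\<Sum>p\<leftarrow>elsl P. nv (th p) * count_list (map th (elsl (tt (tt p)))) t) = 1"
 proof (rule sum_one_cong)
  fix p assume "p \<in> set (elsl P)"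
  then have m: "mok (th p)" using assms by (auto simp: piecest_def els_elsl)
  let ?c = "count_list (map th (elsl (tt (tt p)))) t"
  show "(if tt (th p) = Nl then 1 else 2) * ?c = nv (th p) * ?c \<or> 2 \<le> (if tt (th p) = Nl then 1 else 2) * ?c & 2 \<le> nv (th p) * ?c"
  proof (cases "tt (th p) = Nl \<or> ?c = 0")
   case True
   then show ?thesis using mok_nv[OF m] by auto
  next
   case False
   then have "2 \<le> nv (th p)" "1 \<le> ?c" using mok_nv[OF m] by auto
   then have "2 * 1 \<le> nv (th p) * ?c" by (intro mult_le_mono)
   then show ?thesis using False by simp
  qed
 qed
 also have "(\<Sum>p\<leftarrow>elsl P. nv (th p) * count_list (map th (elsl (tt (tt p)))) t) = tot (map dp (elsl P)) t"
  by (simp add: tot_def dp_def dec_def comp_def)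
 finally show ?thesis .
qed

lemma elsl_app: "elsl (app a b) = elsl a @ elsl b"
 by (induction a) auto

lemma labt: "els (labt P) = labels (map dp (elsl P))"
proof -
 have inner: "elsl (ctl (%_ y'. Cn (th (th y')) Nl) e w) = map th (elsl w)" for e w
  by (induction w) auto
 have "elsl (labt P) = concat (map (%p. map th (elsl (tt (tt p)))) (elsl P))"
  unfolding labt_def by (induction P) (simp_all add: elsl_app inner)
 then have "els (labt P) = (\<Union>p\<in>set (elsl P). th ` set (elsl (tt (tt p))))" by (simp add: els_elsl)
 also have "\<dots> = labels (map dp (elsl P))"
 proof (intro set_eqI iffI)
  fix t assume "t \<in> (\<Union>p\<in>set (elsl P). th ` set (elsl (tt (tt p))))"
  then obtain p s where p: "p \<in> set (elsl P)" "s \<in> set (elsl (tt (tt p)))" "t = th s" by blast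
  have "dp p \<in> set (map dp (elsl P))" using p(1) by simp
  then have "(nv (th p), th (tt p) ~= Nl, elsl (tt (tt p))) \<in> set (map dp (elsl P))" by (simp only: dp_def dec_def)
  then show "t \<in> labels (map dp (elsl P))" unfolding labels_def using p(2,3) by blast
 next
  fix t assume "t \<in> labels (map dp (elsl P))"
  then obtain s m k w where s: "t = th s" "(m, k, w) \<in> set (map dp (elsl P))" "s \<in> set w" unfolding labels_def by blast
  then obtain p where "p \<in> set (elsl P)" "w = elsl (tt (tt p))" by (auto simp: dp_def dec_def)
  then show "t \<in> (\<Union>p\<in>set (elsl P). th ` set (elsl (tt (tt p))))" using s by blast
 qed
 finally show ?thesis .
qed

lemma flowt:
 assumes "piecest P"
 shows "flowt d P \<longleftrightarrow> flow_ok d (map dp (elsl P))"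
proof -
 let ?P = "map dp (elsl P)"
 have ne: "tt (tt p) ~= Nl" if "p \<in> set (elsl P)" for p using assms that by (auto simp: piecest_def els_elsl wordt)
 have nin: "nv (nsum (%e a. invt d (tt a) = e) v P) = flow (%p. inv d p = v) ?P" for v
  unfolding nv_nsum flow_def map_map comp_def dp_def prod.case
  by (rule arg_cong[of _ _ sum_list], rule map_cong[OF refl]) (use inv_dec[OF ne] in simp)
 have nout: "nv (nsum (%e a. outt d (tt a) = e) v P) = flow (%p. outv d p = v) ?P" for v
  unfolding nv_nsum flow_def map_map comp_def dp_def prod.case
  by (rule arg_cong[of _ _ sum_list], rule map_cong[OF refl]) (use inv_dec[OF ne] in simp)
 have zero: "flow Q ?P = 0" if "\<forall>p\<in>set (elsl P). \<not> Q (dec (tt p))" for Q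
 proof -
  have "(\<Sum>p\<leftarrow>elsl P. if Q (dec (tt p)) then nv (th p) else 0) = (\<Sum>p\<leftarrow>elsl P. 0)"
   using that by (intro arg_cong[of _ _ sum_list] map_cong refl) simp
  then show ?thesis by (simp add: flow_def dp_def comp_def)
 qed
 have "(\<forall>p\<in>els P. \<forall>v\<in>els (Cn (invt d (tt p)) (Cn (outt d (tt p)) Nl)).
   neq (nsum (%e a. invt d (tt a) = e) v P) (nsum (%e a. outt d (tt a) = e) v P)) \<longleftrightarrow>
   (\<forall>v. flow (%p. inv d p = v) ?P = flow (%p. outv d p = v) ?P)" (is "?L \<longleftrightarrow> ?R")
 proof
  assume L: ?L
  show ?R
  proof
   fix v
   show "flow (%p. inv d p = v) ?P = flow (%p. outv d p = v) ?P"
   proof (cases "\<exists>p\<in>set (elsl P). v = invt d (tt p) \<or> v = outt d (tt p)")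
    case True
    then obtain p where "p \<in> els P" "v \<in> els (Cn (invt d (tt p)) (Cn (outt d (tt p)) Nl))" by (auto simp: els_elsl)
    then have "neq (nsum (%e a. invt d (tt a) = e) v P) (nsum (%e a. outt d (tt a) = e) v P)" using L by blast
    then show ?thesis unfolding neq nin nout .
   next
    case False
    then have "\<forall>p\<in>set (elsl P). inv d (dec (tt p)) ~= v & outv d (dec (tt p)) ~= v" using inv_dec[OF ne] by metis
    then show ?thesis using zero[of "%p. inv d p = v"] zero[of "%p. outv d p = v"] by simp
   qed
  qed
 next
  assume ?R
  then show ?L unfolding neq nin nout by blast
 qed
 then show ?thesis unfolding flowt_def flow_ok_def startt[OF assms] by blast
qed

definition nbs :: "tree => tree" where
 "nbs s = Cn (nb 0 s) (Cn (nb 1 s) (Cn (nb 2 s) (Cn (nb 3 s) Nl)))"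

lemma els_nbs: "t \<in> els (nbs s) \<longleftrightarrow> (\<exists>d<4. nb d s = t)"
 unfolding less4 nbs_def by auto

definition body :: "tree => tree => tree => tree => bool" where
 "body y s t r \<longleftrightarrow> th (sm (if tt (th y) ~= Nl then Cn (th s) (Cn t r) else Cn t (Cn (th s) (flip r))) (tt y)) ~= Nl"

text \<open>\<open>qval\<close> over \<open>view\<close> spelled out for a quantified subformula
  \<open>y\<close>: the neighbours, with \<open>Nl\<close> for a missing one skipped, and the labels
  that can be met at a non-neighbour.\<close>

definition qt_ok :: "tree => tree => tree => bool" where
 "qt_ok P s y \<longleftrightarrow> (U y (th s) \<longleftrightarrow>
   (if th (th y) = kE then
    (\<exists>t\<in>els (nbs s). t ~= Nl & body y s t (rho s t)) \<or>
    (\<exists>t\<in>els (labt P). (\<not> (\<exists>a\<in>els (nbs s). a = t) \<or> \<not> king t P) & body y s t r0)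
   else
    (\<forall>t\<in>els (nbs s). t ~= Nl --> body y s t (rho s t)) &
    (\<forall>t\<in>els (labt P). \<not> (\<exists>a\<in>els (nbs s). a = t) \<or> \<not> king t P --> body y s t r0)))"

lemma body: "body (tk (Qf b a \<psi>) r') s t r \<longleftrightarrow> evf \<psi> r' (env a (th s) t r)"
 unfolding body_def by (cases a; cases b) (simp_all add: Qf_def env_def sm_tk)

lemma qt_ok:
 assumes "piecest P"
 shows "qt_ok P s (tk (Qf b a \<psi>) r') \<longleftrightarrow> (U (tk (Qf b a \<psi>) r') (th s) \<longleftrightarrow>
  qval b (view (labels (map dp (elsl P))) {t. tot (map dp (elsl P)) t = 1} s) (%t r. evf \<psi> r' (env a (th s) t r)))"
proof -
 have kd: "th (th (tk (Qf b a \<psi>) r')) = kE \<longleftrightarrow> b" by (simp add: Qf_def)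
 have nn: "(\<not> (\<exists>a\<in>els (nbs s). a = t)) \<longleftrightarrow> (\<forall>d<4. nb d s ~= t)" for t using els_nbs[of t s] by blast
 have ex: "(\<exists>t\<in>els (nbs s). Q t) \<longleftrightarrow> (\<exists>t. (\<exists>d<4. nb d s = t) & Q t)"
  "(\<forall>t\<in>els (nbs s). Q t) \<longleftrightarrow> (\<forall>t. (\<exists>d<4. nb d s = t) --> Q t)" for Q using els_nbs by blast+
 show ?thesis
  unfolding qt_ok_def kd body nn ex labt king[OF assms] qval_def view_def by (cases b) (simp, blast)+
qed

text \<open>The certificate consists of the tokens \<open>L\<close> of the formula, the pieces
  \<open>P\<close> with multiplicities, and \<open>R\<close>, the same pieces without multiplicities
  in a second arrangement. Reachability for \<open>xs\<close> is witnessed by the arrangement of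
  \<open>P\<close>, that for \<open>ys\<close> by \<open>R\<close>.\<close>

definition CK :: "tree => bool" where
 "CK z \<longleftrightarrow> (let w = th z; L = th (tt z); P = th (tt (tt z)); R = tt (tt (tt z)) in
   bits L = w & toksok L & fs L = Cn (Cn Nl Nl) Nl & piecest P & flowt True P & flowt False P &
   goodt True (tls P) & goodt False R & (\<forall>q\<in>els R. \<exists>a\<in>els (tls P). a = q) & (\<forall>q\<in>els (tls P). \<exists>a\<in>els R. a = q) &
   (\<forall>p\<in>els P. \<forall>s\<in>els (tt (tt p)). \<forall>y\<in>tails L. th (th y) = kE \<or> th (th y) = kA --> qt_ok P s y) &
   (\<exists>l\<in>els (labt P). th (sm (Cn l (Cn l r0)) L) ~= Nl))"

section \<open>The check is a polynomial-time predicate\<close>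

lemmas nb_fs = nb_def ins_def outs_def fwd_def bwd_def lastt_def

lemma FP_inout: "FP f ==> FP (%x. invt d (f x))" "FP f ==> FP (%x. outt d (f x))"
 unfolding invt_def outt_def nb_fs by (intro FPs; assumption)+

lemma FPp_wordt: "FP f ==> FPp (%x. wordt (f x))"
 by (rule FPp_comp[where P = wordt])
  (unfold wordt_def nx_def star_ok_def last_ok_def first_ok_def same_def nb_def lastt_def if_bool_eq_conj, intro FPs)

lemma FPp_goodt: "FP f ==> FPp (%x. goodt d (f x))"
 by (rule FPp_comp[where P = "goodt d"]) (unfold goodt_def, intro FPs FP_inout)

lemma FP_tls: "FP f ==> FP (%x. tls (f x))"
 unfolding tls_def by (intro FPs)

lemma FP_labt: "FP f ==> FP (%x. labt (f x))"
 unfolding labt_def by (intro FPs)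

lemma FPp_king: "FP f ==> FP g ==> FPp (%x. king (f x) (g x))"
 unfolding king_def by (intro FPs)

lemma FPp_flowt: "FP f ==> FPp (%x. flowt d (f x))"
 by (rule FPp_comp[where P = "flowt d"]) (unfold flowt_def startt_def, intro FPs FPp_neq FP_nsum FP_inout)

lemma FPp_piecest: "FP f ==> FPp (%x. piecest (f x))"
 by (rule FPp_comp[where P = piecest]) (unfold piecest_def mok_def, intro FPs FPp_wordt)

lemma FPp_body: "FP f ==> FP g ==> FP h ==> FP k ==> FPp (%x. body (f x) (g x) (h x) (k x))"
 unfolding body_def flip_def by (intro FPs FP_sm)

lemma FPp_qt_ok: "FP f ==> FP g ==> FP h ==> FPp (%x. qt_ok (f x) (g x) (h x))"
proof -
 assume f: "FP f" "FP g" "FP h"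
 have "FPp (%z. qt_ok (th z) (th (tt z)) (tt (tt z)))"
  unfolding qt_ok_def nbs_def rho_def nb_def if_bool_eq_conj
  by (intro FPs FPp_U FPp_body FPp_king FP_labt)
 from FPp_comp[OF this, of "%x. Cn (f x) (Cn (g x) (h x))"] f show ?thesis by (simp add: FP_Cn)
qed

lemma FPp_CK: "FPp CK"
 unfolding CK_def Let_def
 by (intro FPs FP_bits FPp_toksok FP_fs FPp_piecest FPp_flowt FPp_goodt FP_tls FPp_qt_ok FP_labt FP_sm)

lemma CK_sound:
 assumes "CK (Cn (bt w) u)"
 shows "w \<in> {encode \<phi> |\<phi>. closed_fm \<phi> & satisfiable \<phi>}"
proof -
 define L P R where "L = th u" and "P = th (tt u)" and "R = tt (tt u)"
 have c: "bits L = bt w" "toksok L" "fs L = Cn (Cn Nl Nl) Nl" "piecest P" "flowt True P" "flowt False P"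
  "goodt True (tls P)" "goodt False R" "\<forall>q\<in>els R. \<exists>a\<in>els (tls P). a = q" "\<forall>q\<in>els (tls P). \<exists>a\<in>els R. a = q"
  "\<forall>p\<in>els P. \<forall>s\<in>els (tt (tt p)). \<forall>y\<in>tails L. th (th y) = kE \<or> th (th y) = kA --> qt_ok P s y"
  "\<exists>l\<in>els (labt P). th (sm (Cn l (Cn l r0)) L) ~= Nl"
  using assms unfolding CK_def Let_def L_def[symmetric] P_def[symmetric] R_def[symmetric] th.simps tt.simps
  by - (elim conjE, assumption)+
 obtain \<phi> where p: "L = tk \<phi> Nl" "closed_fm \<phi>" "w = encode \<phi>" using parse_formula[OF c(2,3,1)] by blast
 let ?P = "map dp (elsl P)"
 have elsR: "els R = els (tls P)" using c(9,10) by blast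
 have nonempty: "tt q ~= Nl" if "q \<in> els (tls P)" for q
  using that c(4) by (auto simp: els_elsl elsl_tls piecest_def wordt)
 have sndP: "map snd ?P = map dec (elsl (tls P))" by (simp add: elsl_tls dp_def)
 have setR: "set (map dec (elsl R)) = snd ` set ?P"
 proof -
  have "snd ` set ?P = set (map snd ?P)" by (simp add: image_image)
  also have "\<dots> = dec ` els (tls P)" unfolding sndP by (simp add: els_elsl)
  finally show ?thesis using elsR by (simp add: els_elsl)
 qed
 have eu: "euler_ok d ?P" for d
 proof (cases d)
  case True
  have "rooted True (map dec (elsl (tls P)))" using goodt[of "tls P" True] nonempty c(7) by blast
  moreover have "set (map dec (elsl (tls P))) = snd ` set ?P" unfolding sndP[symmetric] by (simp add: image_image)
  moreover have "flow_ok True ?P" using flowt[OF c(4)] c(5) by blast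
  ultimately have "euler_ok True ?P" by (intro euler_ok_I)
  then show ?thesis using True by simp
 next
  case False
  have "rooted False (map dec (elsl R))" using goodt[of R False] nonempty elsR c(8) by blast
  moreover have "flow_ok False ?P" using flowt[OF c(4)] c(6) by blast
  ultimately have "euler_ok False ?P" using setR by (intro euler_ok_I)
  then show ?thesis using False by simp
 qed
 obtain l where l: "l \<in> els (labt P)" "th (sm (Cn l (Cn l r0)) L) ~= Nl" using c(12) by blast
 have "satisfiable \<phi>"
 proof (rule certificate_sound[OF piecest[OF c(4)] eu _ p(2)])
  show "l \<in> labels ?P" using l(1) labt by simp
  show "evf \<phi> Nl (Cn l (Cn l r0))" using l(2) by (simp add: p(1) sm_tk)
  fix m k w s b a \<psi> r assume a: "(m, k, w) \<in> set ?P" "s \<in> set w" "(b, a, \<psi>, r) \<in> occ \<phi> Nl"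
  then obtain q where q: "q \<in> els P" "s \<in> els (tt (tt q))" by (auto simp: dp_def dec_def els_elsl)
  have "tk (Qf b a \<psi>) r \<in> qt L" unfolding p(1) qt_tk using a(3) by force
  then have "qt_ok P s (tk (Qf b a \<psi>) r)" using c(11) q unfolding qt_def by blast
  then show "U (tk (Qf b a \<psi>) r) (th s) \<longleftrightarrow>
    qval b (view (labels ?P) {t. tot ?P t = 1} s) (%t r'. evf \<psi> r (env a (th s) t r'))"
   unfolding qt_ok[OF c(4)] .
 qed
 then show ?thesis using p by blast
qed

section \<open>Size of the certificate\<close>

lemma sz_lt: "\<forall>x\<in>set l. sz x \<le> b ==> sz (tol l) \<le> 1 + length l * (1 + b)"
 by (induction l) auto

lemma sz_vt: "sz (vt a) \<le> 3"
 by (cases a) auto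

lemma sz_dg: "sz (dg p) \<le> 2 * length (encode_nat p)"
proof (induction p rule: less_induct)
 case (less p)
 show ?case
 proof (cases "p = 0")
  case True
  then show ?thesis by (simp add: dg.simps[of 0] encode_nat.simps[of 0])
 next
  case False
  have "dg p = Cn (b2t (odd p)) (dg (p div 2))" using False by (subst dg.simps) simp
  moreover have "encode_nat p = True # odd p # encode_nat (p div 2)" using False by (subst encode_nat.simps) simp
  ultimately show ?thesis using less[of "p div 2"] False sz_b2t[of "odd p"] by simp
 qed
qed

lemma length_var: "length (encode_var a) = 1"
 by (cases a) auto

lemma sz_tk: "sz (tk \<phi> r) \<le> 10 * length (encode \<phi>) + sz r"
proof (induction \<phi> arbitrary: r)
 case (Letter p a)
 then show ?case using sz_dg[of p] sz_vt[of a] by (simp add: length_var)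
next
 case (Rightarrow a b)
 then show ?case using sz_vt[of a] sz_vt[of b] by (simp add: length_var)
next
 case (Downarrow a b)
 then show ?case using sz_vt[of a] sz_vt[of b] by (simp add: length_var)
next
 case (Neg \<phi>)
 show ?case using Neg[of r] by simp
next
 case (Conj \<phi> \<psi>)
 show ?case using Conj(1)[of "tk \<psi> r"] Conj(2)[of r] by simp
next
 case (Disj \<phi> \<psi>)
 show ?case using Disj(1)[of "tk \<psi> r"] Disj(2)[of r] by simp
next
 case (Exists a \<phi>)
 show ?case using Exists[of r] sz_vt[of a] by (simp add: length_var)
next
 case (Forall a \<phi>)
 show ?case using Forall[of r] sz_vt[of a] by (simp add: length_var)
qed

lemma length_keyl: "length (keyl \<phi> r) \<le> length (encode \<phi>)"
proof (induction \<phi> arbitrary: r)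
 case (Conj \<phi> \<psi>)
 show ?case using Conj(1)[of "tk \<psi> r"] Conj(2)[of r] by simp
next
 case (Disj \<phi> \<psi>)
 show ?case using Disj(1)[of "tk \<psi> r"] Disj(2)[of r] by simp
next
 case (Exists a \<phi>)
 show ?case using Exists[of r] by simp
next
 case (Forall a \<phi>)
 show ?case using Forall[of r] by simp
next
 case (Neg \<phi>)
 show ?case using Neg[of r] by simp
qed simp_all

lemma sz_tk_ge: "sz r \<le> sz (tk \<phi> r)"
proof (induction \<phi> arbitrary: r)
 case (Conj \<phi> \<psi>)
 show ?case using Conj(1)[of "tk \<psi> r"] Conj(2)[of r] by simp
next
 case (Disj \<phi> \<psi>)
 show ?case using Disj(1)[of "tk \<psi> r"] Disj(2)[of r] by simp
next
 case (Exists a \<phi>)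
 show ?case using Exists[of r] by simp
next
 case (Forall a \<phi>)
 show ?case using Forall[of r] by simp
next
 case (Neg \<phi>)
 show ?case using Neg[of r] by simp
qed simp_all

lemma sz_keyl: "k \<in> set (keyl \<phi> r) ==> sz k \<le> sz (tk \<phi> r)"
proof (induction \<phi> arbitrary: r)
 case (Conj \<phi> \<psi>)
 then consider "k \<in> set (keyl \<phi> (tk \<psi> r))" | "k \<in> set (keyl \<psi> r)" by auto
 then show ?case
 proof cases
  case 1
  then show ?thesis using Conj.IH(1)[of "tk \<psi> r"] by simp
 next
  case 2
  then show ?thesis using Conj.IH(2)[of r] sz_tk_ge[of "tk \<psi> r" \<phi>] by simp
 qed
next
 case (Disj \<phi> \<psi>)
 then consider "k \<in> set (keyl \<phi> (tk \<psi> r))" | "k \<in> set (keyl \<psi> r)" by auto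
 then show ?case
 proof cases
  case 1
  then show ?thesis using Disj.IH(1)[of "tk \<psi> r"] by simp
 next
  case 2
  then show ?thesis using Disj.IH(2)[of r] sz_tk_ge[of "tk \<psi> r" \<phi>] by simp
 qed
next
 case (Exists a \<phi>)
 then consider "k = tk (Exists a \<phi>) r" | "k \<in> set (keyl \<phi> r)" by auto
 then show ?case using Exists.IH[of r] by cases simp_all
next
 case (Forall a \<phi>)
 then consider "k = tk (Forall a \<phi>) r" | "k \<in> set (keyl \<phi> r)" by auto
 then show ?case using Forall.IH[of r] by cases simp_all
next
 case (Neg \<phi>)
 then have "sz k \<le> sz (tk \<phi> r)" by simp
 then show ?case by simp
qed auto

lemma finite_LB: "finite (LB \<phi>)"
 unfolding LB_def by simp

lemma card_LB: "card (LB \<phi>) \<le> 17 * 2 ^ length (encode \<phi>)"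
proof -
 have "card (LB \<phi>) \<le> card ({..16::nat} \<times> Pow (set (keyl \<phi> Nl)))" unfolding LB_def by (rule card_image_le) simp
 also have "\<dots> = 17 * 2 ^ card (set (keyl \<phi> Nl))" by (simp add: card_cartesian_product card_Pow)
 also have "\<dots> \<le> 17 * 2 ^ length (encode \<phi>)"
  using card_length[of "keyl \<phi> Nl"] length_keyl[of \<phi> Nl] by (intro mult_le_mono power_increasing) auto
 finally show ?thesis .
qed

text \<open>With n the length of the encoding there are at most n keys, each no larger than the list
  of all tokens and so of size linear in n; the colour adds a constant.\<close>

lemma sz_LB:
 assumes "l \<in> LB \<phi>"
 shows "sz l \<le> 50 * (length (encode \<phi>) + 1) ^ 2"
proof -
 let ?n = "length (encode \<phi>)"
 obtain c S where l: "l = Cn (un c) (tol (filter (%k. k \<in> S) (keyl \<phi> Nl)))" "c \<le> 16"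
  using assms unfolding LB_def by auto
 have "sz (un c) \<le> 1 + c * 2" unfolding un_def using sz_lt[of "replicate c Nl" 1] by simp
 moreover have "sz (tol (filter (%k. k \<in> S) (keyl \<phi> Nl))) \<le> 1 + ?n * (1 + (10 * ?n + 1))"
 proof -
  have "\<forall>x\<in>set (filter (%k. k \<in> S) (keyl \<phi> Nl)). sz x \<le> 10 * ?n + 1"
   using sz_keyl[of _ \<phi> Nl] sz_tk[of \<phi> Nl] by fastforce
  from sz_lt[OF this] have "sz (tol (filter (%k. k \<in> S) (keyl \<phi> Nl))) \<le>
    1 + length (filter (%k. k \<in> S) (keyl \<phi> Nl)) * (1 + (10 * ?n + 1))" .
  also have "\<dots> \<le> 1 + ?n * (1 + (10 * ?n + 1))"
   using order_trans[OF length_filter_le length_keyl, of "%k. k \<in> S" \<phi> Nl]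
   by (intro add_mono mult_le_mono) auto
  finally show ?thesis .
 qed
 ultimately show ?thesis using l by (simp add: power2_eq_square algebra_simps)
qed

lemma Suc_le_pow: "n + 1 \<le> (2::nat) ^ n"
 by (induction n) auto

context order_pair
begin

lemma star_parts: "e \<in> set xs ==> lab ` set xs \<subseteq> B ==> lab e \<in> B & nbl d e \<in> insert Nl B"
proof
 assume e: "e \<in> set xs" and B: "lab ` set xs \<subseteq> B"
 then show "lab e \<in> B" by auto
 show "nbl d e \<in> insert Nl B"
 proof (cases "nbl d e = Nl")
  case False
  then obtain f where "dr xs ys d e f" "lab f = nbl d e" using nbl_D[of d e "nbl d e"] by blast
  then show ?thesis using dr_set[of d e f] B by (metis image_subset_iff insertCI)
 qed simp
qed

text \<open>A star is a label and four entries that are labels or \<open>Nl\<close>, which explains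
  the exponent 5.\<close>

lemma nst_le:
 assumes "lab ` set xs \<subseteq> B" "finite B"
 shows "nst \<le> (card B + 1) ^ 5"
proof -
 let ?B = "insert Nl B"
 let ?f = "%(a, b, c, d, e). Cn a (Cn b (Cn c (Cn d e)))"
 have "star ` set xs \<subseteq> ?f ` (?B \<times> ?B \<times> ?B \<times> ?B \<times> ?B)"
 proof (rule image_subsetI)
  fix e assume e: "e \<in> set xs"
  have "star e = ?f (lab e, nbl 0 e, nbl 1 e, nbl 2 e, nbl 3 e)" by (simp add: star_def)
  moreover have "(lab e, nbl 0 e, nbl 1 e, nbl 2 e, nbl 3 e) \<in> ?B \<times> ?B \<times> ?B \<times> ?B \<times> ?B"
   using star_parts[OF e assms(1)] by blast
  ultimately show "star e \<in> ?f ` (?B \<times> ?B \<times> ?B \<times> ?B \<times> ?B)" by (rule image_eqI)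
 qed
 then have "nst \<le> card (?f ` (?B \<times> ?B \<times> ?B \<times> ?B \<times> ?B))" unfolding nst_def using assms(2) by (intro card_mono) auto
 also have "\<dots> \<le> card (?B \<times> ?B \<times> ?B \<times> ?B \<times> ?B)" using assms(2) by (intro card_image_le) auto
 also have "\<dots> = card ?B ^ 5"
 proof -
  have "x * (x * (x * (x * x))) = x ^ 5" for x :: nat by (simp add: eval_nat_numeral)
  then show ?thesis unfolding card_cartesian_product .
 qed
 also have "\<dots> \<le> (card B + 1) ^ 5" using assms(2) by (intro power_mono) (auto simp: card_insert_if)
 finally show ?thesis .
qed

lemma sz_star:
 assumes "e \<in> set xs" "lab ` set xs \<subseteq> B" "\<And>l. l \<in> B ==> sz l \<le> b" "1 \<le> b"
 shows "sz (star e) \<le> 5 * b + 4"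
proof -
 have "sz (lab e) \<le> b" "sz (nbl d e) \<le> b" for d
  using star_parts[OF assms(1,2), of d] assms(3)[of "lab e"] assms(3)[of "nbl d e"] assms(4) by auto
 from this(1) this(2)[of 0] this(2)[of 1] this(2)[of 2] this(2)[of 3] show ?thesis by (simp add: star_def)
qed

end

section \<open>Encoding of the certificate and its size\<close>

definition enq :: "bool \<times> tree list => tree" where
 "enq q = Cn (b2t (fst q)) (tol (snd q))"

definition enp :: "nat \<times> bool \<times> tree list => tree" where
 "enp p = Cn (mb (fst p)) (enq (snd p))"

lemma dec_enq: "dec (enq q) = q"
 by (simp add: dec_def enq_def)

lemma dp_enp: "dp (enp p) = p"
 by (simp add: dp_def enp_def dec_enq nv_mb)

lemma lt_Nl: "tol l = Nl \<longleftrightarrow> l = []"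
 by (cases l) auto

lemma size_arith:
 fixes T :: nat
 assumes "T \<ge> 100" "szp \<le> 6 + (13 + 6 * (T * (T + 1))) + (1 + T * T)"
 shows "2 + T + (1 + T * (1 + szp)) + (1 + T * (1 + szp)) \<le> 32 * (T * T * T)"
proof -
 have T: "100 * T \<le> T * T" using assms(1) by (rule mult_le_mono1)
 have "1 + szp \<le> 21 + 7 * (T * T) + 6 * T" using assms(2) by (simp add: algebra_simps)
 also have "\<dots> \<le> 8 * (T * T)" using T assms(1) by linarith
 finally have "T * (1 + szp) \<le> T * (8 * (T * T))" by (rule mult_le_mono2)
 then have "T * (1 + szp) \<le> 8 * (T * T * T)" by (simp add: ac_simps)
 moreover have "4 + T \<le> T * T * T"
 proof -
  have "4 + T \<le> T * T" using T assms(1) by linarith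
  also have "\<dots> \<le> T * T * T" using assms(1) by simp
  finally show ?thesis .
 qed
 ultimately show ?thesis by linarith
qed

text \<open>With \<open>lp\<close> exponential in the length of the formula the bound on a
  multiplicity is doubly exponential; its binary length is still exponential.\<close>

lemma mult_bound:
 assumes "m \<le> 3 * lp * lp ^ lp" "lp \<le> 2 ^ K"
 shows "m < 2 ^ (2 + K * (lp + 1))"
proof -
 have "m \<le> 3 * lp ^ (lp + 1)" using assms(1) by simp
 also have "\<dots> \<le> 3 * (2 ^ K) ^ (lp + 1)" using assms(2) by (intro mult_le_mono2 power_mono) auto
 also have "\<dots> = 3 * 2 ^ (K * (lp + 1))" by (simp only: power_mult)
 also have "\<dots> < 4 * 2 ^ (K * (lp + 1))" by simp
 also have "\<dots> = 2 ^ (2 + K * (lp + 1))" by (simp add: power_add)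
 finally show ?thesis .
qed

lemma CK_complete:
 assumes "closed_fm \<phi>" "satisfiable \<phi>"
 shows "\<exists>u. sz u \<le> 2 ^ ((length (encode \<phi>) + 2) ^ 9) & CK (Cn (bt (encode \<phi>)) u)"
proof -
 let ?n = "length (encode \<phi>)"
 obtain \<pi> \<sigma> where "valued_permutation \<pi> \<sigma>" "models \<pi> \<sigma> \<phi>" using assms(2) unfolding satisfiable_def by blast
 from model_labels[OF this assms(1)] obtain xs ys :: "position list" and lab where
  op: "order_pair xs ys lab" and ag: "order_pair.agrees xs ys lab \<sigma> \<phi> Nl" and LBs: "lab ` set xs \<subseteq> LB \<phi>"
  and root: "\<exists>e\<in>set xs. evf \<phi> Nl (Cn (lab e) (Cn (lab e) r0))" by blast
 interpret order_pair xs ys lab by (rule op)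
 obtain P R where c: "pieces_ok P" "\<forall>d. flow_ok d P" "rooted True (map snd P)" "rooted False R" "set R = snd ` set P"
  "length R = length P" "labels P = Tl" "{t. tot P t = 1} = Kl" "length P \<le> 4 * card Tl + 2 * nst * nst"
  "\<forall>(m, k, w)\<in>set P. set w \<subseteq> star ` set xs & length w \<le> nst * (2 * card Tl + 1) & m \<le> 3 * length P * length P ^ length P"
  using certificate_complete by (elim exE conjE)
 define L where "L = tk \<phi> Nl"
 define Pt where "Pt = tol (map enp P)"
 define Rt where "Rt = tol (map enq R)"
 have dpP: "map dp (elsl Pt) = P" by (simp add: Pt_def comp_def dp_enp)
 have elsP: "els Pt = enp ` set P" and elsR: "els Rt = enq ` set R" by (simp_all add: Pt_def Rt_def)
 have ok: "fst p \<ge> 1 & word_ok (fst (snd p)) (snd (snd p))" if "p \<in> set P" for p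
  using c(1) that unfolding pieces_ok_def by auto
 have tne: "tt (enq (snd p)) ~= Nl" if "p \<in> set P" for p
  using ok[OF that] by (simp add: enq_def lt_Nl word_ok_def)
 have pt: "piecest Pt"
  unfolding piecest_def elsP
 proof (rule ballI, elim imageE)
  fix q p assume q: "q = enp p" "p \<in> set P"
  have "wordt (enq (snd p))" unfolding wordt dec_enq using ok[OF q(2)] tne[OF q(2)] by simp
  then show "mok (th q) & wordt (tt q)" using ok[OF q(2)] mok_mb q(1) by (simp add: enp_def)
 qed
 have tls: "els (tls Pt) = enq ` snd ` set P"
  by (simp add: els_elsl elsl_tls Pt_def image_image enp_def)
 have tne': "tt q ~= Nl" if q: "q \<in> els (tls Pt)" for q
 proof -
  obtain p where "p \<in> set P" "q = enq (snd p)" using q unfolding tls by blast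
  then show ?thesis using tne by simp
 qed
 have RP: "els Rt = els (tls Pt)" unfolding elsR tls c(5) ..
 have CK: "CK (Cn (bt (encode \<phi>)) (Cn L (Cn Pt Rt)))"
  unfolding CK_def Let_def th.simps tt.simps
 proof (intro conjI)
  show "bits L = bt (encode \<phi>)" "toksok L" "fs L = Cn (Cn Nl Nl) Nl" using formula_ok[OF assms(1)] unfolding L_def by simp_all
  show "piecest Pt" by (rule pt)
  show "flowt True Pt" "flowt False Pt" unfolding flowt[OF pt] dpP using c(2) by simp_all
  have "map dec (elsl (tls Pt)) = map snd P" by (simp add: elsl_tls Pt_def comp_def enp_def dec_enq)
  then show "goodt True (tls Pt)" using goodt[OF tne'] c(3) by simp
  have "map dec (elsl Rt) = R" by (simp add: Rt_def comp_def dec_enq)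
  then show "goodt False Rt" using goodt[of Rt False] tne' c(4) RP by simp
  show "\<forall>q\<in>els Rt. \<exists>a\<in>els (tls Pt). a = q" "\<forall>q\<in>els (tls Pt). \<exists>a\<in>els Rt. a = q" unfolding RP by blast+
  show "\<exists>l\<in>els (labt Pt). th (sm (Cn l (Cn l r0)) L) ~= Nl"
   unfolding labt dpP c(7) L_def sm_tk using root by simp
  show "\<forall>p\<in>els Pt. \<forall>s\<in>els (tt (tt p)). \<forall>y\<in>tails L. th (th y) = kE \<or> th (th y) = kA --> qt_ok Pt s y"
  proof (intro ballI impI)
   fix p s y assume a: "p \<in> els Pt" "s \<in> els (tt (tt p))" "y \<in> tails L" "th (th y) = kE \<or> th (th y) = kA"
   obtain p0 where p0: "p0 \<in> set P" "p = enp p0" using a(1) unfolding elsP by blast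
   have "s \<in> set (snd (snd p0))" using a(2) p0 by (simp add: enp_def enq_def)
   moreover have "set (snd (snd p0)) \<subseteq> star ` set xs" using bspec[OF c(10) p0(1)] by (simp add: case_prod_unfold)
   ultimately obtain e where e: "e \<in> set xs" "s = star e" by blast
   have "y \<in> qt (tk \<phi> Nl)" using a(3,4) unfolding qt_def L_def by blast
   then have "y \<in> (%(b, a, \<psi>, r'). tk (Qf b a \<psi>) r') ` occ \<phi> Nl" unfolding qt_tk by (simp add: qt_def)
   then obtain b v \<psi> r' where o: "(b, v, \<psi>, r') \<in> occ \<phi> Nl" "y = tk (Qf b v \<psi>) r'" by auto
   have "U (tk (Qf b v \<psi>) r') (lab e) \<longleftrightarrow> qval b (view Tl Kl (star e)) (%t r. evf \<psi> r' (env v (lab e) t r))"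
    using bspec[OF bspec[OF agrees_qc[OF ag, unfolded qc_def] e(1)] o(1)] by simp
   then show "qt_ok Pt s y" unfolding o(2) e(2) qt_ok[OF pt] dpP c(7,8) th_star .
  qed
 qed
 \<comment> \<open>The largest contribution is \<open>2 * nst * nst\<close> with
   \<open>nst \<le> 2 ^ (5 * n + 25)\<close>; \<open>T = 2 ^ (10 * n + 60)\<close> bounds the number
   of pieces, their lengths and the sizes of stars alike.\<close>
 define K where "K = 10 * ?n + 60"
 define T where "T = (2::nat) ^ K"
 have T100: "T \<ge> 2 ^ 60" unfolding T_def K_def by (intro power_increasing) auto
 have KT: "K \<le> T" unfolding T_def using Suc_le_pow[of K] by simp
 have cT: "card Tl + 1 \<le> 2 ^ (?n + 5)" "card (LB \<phi>) + 1 \<le> 2 ^ (?n + 5)"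
 proof -
  have "card Tl \<le> card (LB \<phi>)" by (rule card_mono[OF finite_LB LBs])
  moreover have "card (LB \<phi>) + 1 \<le> 2 ^ (?n + 5)"
  proof -
   have "17 * 2 ^ ?n + 1 \<le> (32::nat) * 2 ^ ?n" using one_le_power[of "2::nat" ?n] by simp
   moreover have "(2::nat) ^ (?n + 5) = 32 * 2 ^ ?n" by (simp add: power_add)
   ultimately show ?thesis using card_LB[of \<phi>] by linarith
  qed
  ultimately show "card Tl + 1 \<le> 2 ^ (?n + 5)" "card (LB \<phi>) + 1 \<le> 2 ^ (?n + 5)" by simp_all
 qed
 have nst: "nst \<le> 2 ^ (5 * ?n + 25)"
 proof -
  have "nst \<le> (card (LB \<phi>) + 1) ^ 5" by (rule nst_le[OF LBs finite_LB])
  also have "\<dots> \<le> (2 ^ (?n + 5)) ^ 5" using cT(2) by (intro power_mono) auto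
  also have "\<dots> = 2 ^ (5 * ?n + 25)" unfolding power_mult[symmetric] by (simp add: algebra_simps)
  finally show ?thesis .
 qed
 have lp: "length P \<le> T"
 proof -
  have "nst * nst \<le> 2 ^ (5 * ?n + 25) * 2 ^ (5 * ?n + 25)" by (intro mult_le_mono nst)
  also have "\<dots> = 2 ^ (10 * ?n + 50)" unfolding power_add[symmetric] by simp
  finally have "2 * nst * nst \<le> 2 * 2 ^ (10 * ?n + 50)" by simp
  moreover have "4 * card Tl \<le> 4 * 2 ^ (10 * ?n + 50)"
  proof -
   have "(2::nat) ^ (?n + 5) \<le> 2 ^ (10 * ?n + 50)" by (intro power_increasing) auto
   then show ?thesis using cT(1) by linarith
  qed
  ultimately have "length P \<le> 6 * 2 ^ (10 * ?n + 50)" using c(9) by linarith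
  also have "\<dots> \<le> 2 ^ 10 * 2 ^ (10 * ?n + 50)" by simp
  also have "\<dots> = T" unfolding T_def K_def power_add[symmetric] by simp
  finally show ?thesis .
 qed
 have wl: "nst * (2 * card Tl + 1) \<le> T"
 proof -
  have "nst * (2 * card Tl + 1) \<le> 2 ^ (5 * ?n + 25) * (2 * 2 ^ (?n + 5))" using cT(1) by (intro mult_le_mono nst) simp
  also have "\<dots> = 2 ^ (6 * ?n + 31)" unfolding power_Suc[symmetric] power_add[symmetric] by simp
  also have "\<dots> \<le> T" unfolding T_def K_def by (intro power_increasing) auto
  finally show ?thesis .
 qed
 have st: "sz (star e) + 1 \<le> T" if e: "e \<in> set xs" for e
 proof -
  have "sz (star e) \<le> 5 * (50 * (?n + 1) ^ 2) + 4"
   by (rule sz_star[OF e LBs sz_LB]) (auto simp: power2_eq_square)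
  also have "\<dots> + 1 \<le> 255 * (?n + 1) ^ 2" by (simp add: power2_eq_square)
  also have "\<dots> \<le> 256 * (2 ^ ?n) ^ 2" using Suc_le_pow[of ?n] by (intro mult_le_mono power_mono) auto
  also have "\<dots> = 2 ^ (2 * ?n + 8)" by (simp add: power_add mult.commute flip: power_mult)
  also have "\<dots> \<le> T" unfolding T_def K_def by (intro power_increasing) auto
  finally show ?thesis by simp
 qed
 let ?szp = "6 + (13 + 6 * (T * (T + 1))) + (1 + T * T)"
 have piece: "sz (enp p) \<le> ?szp & sz (enq (snd p)) \<le> ?szp" if p: "p \<in> set P" for p
 proof -
  obtain m k w where [simp]: "p = (m, k, w)" by (cases p)
  have b: "set w \<subseteq> star ` set xs" "length w \<le> nst * (2 * card Tl + 1)" "m \<le> 3 * length P * length P ^ length P"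
   using bspec[OF c(10) p] by simp_all
  have "\<forall>x\<in>set w. sz x \<le> T - 1" using b(1) st by fastforce
  from sz_lt[OF this] have "sz (tol w) \<le> 1 + length w * (1 + (T - 1))" .
  also have "\<dots> = 1 + length w * T" using T100 by simp
  also have "\<dots> \<le> 1 + T * T" using b(2) wl by simp
  finally have w: "sz (tol w) \<le> 1 + T * T" .
  have "sz (mb m) \<le> 1 + 6 * (2 + K * (length P + 1))" by (rule sz_mb[OF mult_bound[OF b(3) lp[unfolded T_def]]])
  also have "\<dots> \<le> 1 + 6 * (2 + T * (T + 1))" using KT lp by (intro add_mono mult_le_mono) auto
  finally show ?thesis using w sz_b2t[of k] by (simp add: enp_def enq_def)
 qed
 have "sz Pt \<le> 1 + length P * (1 + ?szp)" unfolding Pt_def using sz_lt[of "map enp P" ?szp] piece by simp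
 also have "\<dots> \<le> 1 + T * (1 + ?szp)" using lp by (intro add_mono mult_le_mono) auto
 finally have Ps: "sz Pt \<le> 1 + T * (1 + ?szp)" .
 have "\<forall>x\<in>set (map enq R). sz x \<le> ?szp"
 proof
  fix x assume "x \<in> set (map enq R)"
  then have "x \<in> enq ` snd ` set P" using c(5) by simp
  then obtain p where "p \<in> set P" "x = enq (snd p)" by blast
  then show "sz x \<le> ?szp" using piece by simp
 qed
 from sz_lt[OF this] have "sz Rt \<le> 1 + length P * (1 + ?szp)" using c(6) by (simp add: Rt_def)
 also have "\<dots> \<le> 1 + T * (1 + ?szp)" using lp by (intro add_mono mult_le_mono) auto
 finally have Rs: "sz Rt \<le> 1 + T * (1 + ?szp)" .
 have Ls: "sz L \<le> T"
 proof -
  have "sz L \<le> K" unfolding L_def K_def using sz_tk[of \<phi> Nl] by simp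
  then show ?thesis using KT by simp
 qed
 have "sz (Cn L (Cn Pt Rt)) = 2 + sz L + sz Pt + sz Rt" by simp
 also have "\<dots> \<le> 2 + T + (1 + T * (1 + ?szp)) + (1 + T * (1 + ?szp))" by (intro add_mono order_refl Ls Ps Rs)
 also have "\<dots> \<le> 32 * (T * T * T)" by (rule size_arith) (use T100 in simp_all)
 also have "\<dots> = 2 ^ (3 * K + 5)"   proof -
  have "3 * K + 5 = K + K + K + 5" by simp
  then show ?thesis unfolding T_def by (simp only: power_add) simp
 qed
 \<comment> \<open>\<open>3 * K + 5 \<le> 2 ^ 8 * (n + 2)\<close> and \<open>2 \<le> n + 2\<close>
   give the exponent 9.\<close>
 also have "\<dots> \<le> 2 ^ ((?n + 2) ^ 9)"
 proof (rule power_increasing)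
  have "(2::nat) ^ 8 * (?n + 2) \<le> (?n + 2) ^ 8 * (?n + 2)" by (intro mult_le_mono1 power_mono) auto
  also have "(?n + 2) ^ 8 * (?n + 2) = (?n + 2) ^ 9"
  proof -
   have "x ^ 8 * x = x ^ 9" for x :: nat using power_add[of x 8 1] by simp
   then show ?thesis .
  qed
  finally have "2 ^ 8 * (?n + 2) \<le> (?n + 2) ^ 9" .
  moreover have "3 * K + 5 \<le> 2 ^ 8 * (?n + 2)" unfolding K_def by simp
  ultimately show "3 * K + 5 \<le> (?n + 2) ^ 9" by (rule order_trans[rotated])
 qed simp
 finally show ?thesis using CK by blast
qed

theorem sat_NEXPTIME: "{encode \<phi> | \<phi>. closed_fm \<phi> & satisfiable \<phi>} \<in> NEXPTIME"
proof (rule NEXPTIME_FP[where chk = "%z. b2t (CK z)" and k = 9])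
 show "FP (%z. b2t (CK z))" using FPp_CK unfolding FPp_def .
 show ex: "\<exists>u. sz u \<le> 2 ^ ((length w + 2) ^ 9) & b2t (CK (Cn (bt w) u)) ~= Nl"
  if "w \<in> {encode \<phi> | \<phi>. closed_fm \<phi> & satisfiable \<phi>}" for w
  using that CK_complete by auto
 show "w \<in> {encode \<phi> | \<phi>. closed_fm \<phi> & satisfiable \<phi>} \<longleftrightarrow> (\<exists>u. b2t (CK (Cn (bt w) u)) ~= Nl)" for w
  using ex[of w] CK_sound[of w] by auto
qed

theorem theorem1:
  shows "NEXPTIME_complete {encode \<phi> | \<phi>. closed_fm \<phi> \<and> satisfiable \<phi>}"
  unfolding NEXPTIME_complete_def using sat_NEXPTIME sat_NEXPTIME_hard by blast

end
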